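(* Let $\Bbbk$ be a commutative ring, $\mathcal O$ an operad in differential graded $\Bbbk$-modules, and $A=F(\mathcal O,V)$ an almost free $\mathcal O$-algebra. Then the restriction of the natural chain equivalence $\mathrm{Tot}(\underline A)\to N_*(\underline A)=C^{\mathfrak H}_*(\mathcal O,A)$ to the total complex $\mathrm{Tot}(\underline A^+)$ is an isomorphism of differential graded modules $$\mathrm{Tot}(\underline A^+)\longrightarrow C^{\mathfrak H}_*(\mathcal O,A).$$ Moreover, this homomorphism is an isomorphism of $\mathcal O$-algebras.
   Context: Free algebras: for a graded module $V$, $F(\mathcal O,V)=\bigoplus_{k\ge0}\mathcal O(k)\otimes_{\Sigma_k}V^{\otimes k}$. An $\mathcal O$-algebra $A$ is almost free if, forgetting differentials, $A_\#=F(\mathcal O_\#,V)$ for some graded module $V$ (the differential of $A$ need not be induced from one on $V$). Operadic Hochschild chain complex: let $\coprod$ be the coproduct of $\mathcal O$-algebras, $l:A\to A\coprod A$ the left inclusion and $\nabla:A\coprod A\to A$ the folding map. Let $\underline A$ be the simplicial $\mathcal O$-algebra with $\underline A_n=A^{\coprod (n+1)}$; for $0\le i\le n-1$, $d_i:\underline A_n\to\underline A_{n-1}$ is $\mathrm{id}^{\coprod i}\coprod\nabla\coprod \mathrm{id}^{\coprod (n-1-i)}$; $d_n=(\nabla\coprod\mathrm{id}^{\coprod (n-1)})\circ\tau_n$, where $\tau_n$ cyclically permutes the factors by moving the last factor to the front; and $s_i:\underline A_n\to\underline A_{n+1}$, $0\le i\le n$, is $\mathrm{id}^{\coprod i}\coprod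 l\coprod\mathrm{id}^{\coprod(n-i)}$. $\mathrm{Tot}(\underline A)$ is the complex $\mathrm{Tot}_n(\underline A)=\bigoplus_{p+q=n}\underline A_{p,q}$ ($p$ simplicial degree, $q$ internal degree) with differential $x\mapsto\sum_i(-1)^id_ix+(-1)^pd_Ax$; $N_*(\underline A)$ is its quotient by the subcomplex generated by degenerate elements, and $C^{\mathfrak H}_*(\mathcal O,A):=N_*(\underline A)$. Both $\mathrm{Tot}(\underline A)$ and $N_*(\underline A)$ are $\mathcal O$-algebras: the evaluation product is the iterated Eilenberg–Mac Lane shuffle product $\mathrm{Tot}(\underline A)^{\otimes k}\to \mathrm{Tot}(\underline A^{\otimes k})$ (levelwise tensor power; similarly for $N_*$) followed by the levelwise evaluation products $\mathcal O(k)\otimes\underline A_n^{\otimes k}\to\underline A_n$. The quotient map $\mathrm{Tot}(\underline A)\to N_*(\underline A)$ is the natural chain equivalence. The submodule $\underline A^+$: for $A=F(\mathcal O,V)$ almost free, as graded modules $\underline A_n=F(\mathcal O,V^{\oplus(n+1)})$, and every element of $\underline A_n$ is a finite sum of elements $$x\otimes v_1\cdots v_{k_0}\otimes v_{k_0+1}\cdots v_{k_0+k_1}\otimes\cdots\otimes v_{k_0+\dots+k_{n-1}+1}\cdots v_k,\qquad k=k_0+\dots+k_n,$$ with $x\in\mathcal O(k)$ and the $i$-th block in $V^{\otimes k_i}$, the tensor power of the $i$-th copy of $V$ ($0\le i\le n$, $V^{\otimes0}=\Bbbk$). $\underline A^+_n\subset\underline A_n$ is the submodule generated by such elements with each $k_i>0$.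 $\mathrm{Tot}(\underline A^+)$ is $\bigoplus_{p+q=n}\underline A^+_{p,q}$ with the differential and evaluation products restricted from $\mathrm{Tot}(\underline A)$.
   Formalization: In the definition of A^+_n, k_i>0 is required only for 1≤i≤n (k_0 may be 0), since the claim fails otherwise; stability of Tot(A^+) under the differential is claimed only when dv has no O(0)-component for all v in V (automatic if O(0)=0). *)

theory Defs
  imports "HOL-Combinatorics.Permutations" "HOL-Algebra.Module" "HOL-Algebra.AbelCoset"
begin

section \<open>Modules\<close>

abbreviation sgn_mod :: "('r, 'a) module \<Rightarrow> int \<Rightarrow> 'a \<Rightarrow> 'a"
  where "sgn_mod M e x \<equiv> (if even e then x else \<ominus>\<^bsub>M\<^esub> x)"

definition lin :: "'r ring \<Rightarrow> ('r, 'a) module \<Rightarrow> ('r, 'b) module \<Rightarrow> ('a \<Rightarrow> 'b) set"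
  where "lin R M N = {f \<in> carrier M \<rightarrow> carrier N.
    (\<forall>x\<in>carrier M. \<forall>y\<in>carrier M. f (x \<oplus>\<^bsub>M\<^esub> y) = f x \<oplus>\<^bsub>N\<^esub> f y) \<and>
    (\<forall>r\<in>carrier R. \<forall>x\<in>carrier M. f (r \<odot>\<^bsub>M\<^esub> x) = r \<odot>\<^bsub>N\<^esub> f x)}"

definition gen_sub :: "'r ring \<Rightarrow> ('r, 'a) module \<Rightarrow> 'a set \<Rightarrow> 'a set"
  where "gen_sub R M G = \<Inter>{H. submodule H R M \<and> G \<subseteq> H}"

definition quot_mod :: "('r, 'a) module \<Rightarrow> 'a set \<Rightarrow> ('r, 'a set) module"
  where "quot_mod M H = \<lparr>carrier = a_rcosets\<^bsub>M\<^esub> H, mult = (\<lambda>_ _. undefined), one = undefined,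
    zero = H, add = set_add M, smult = (\<lambda>r X. H <+>\<^bsub>M\<^esub> (\<lambda>x. r \<odot>\<^bsub>M\<^esub> x) ` X)\<rparr>"

text \<open>The map induced on a quotient by a map that is constant on cosets.\<close>

definition induced :: "('a \<Rightarrow> 'b) \<Rightarrow> 'a set \<Rightarrow> 'b"
  where "induced f X = the_elem (f ` X)"

definition direct_sum :: "'i set \<Rightarrow> ('i \<Rightarrow> ('r, 'a) module) \<Rightarrow> ('r, 'i \<Rightarrow> 'a) module"
  where "direct_sum I M = \<lparr>
    carrier = {f \<in> (\<Pi>\<^sub>E i\<in>I. carrier (M i)). finite {i \<in> I. f i \<noteq> \<zero>\<^bsub>M i\<^esub>}},
    mult = (\<lambda>_ _. undefined), one = undefined,
    zero = (\<lambda>i\<in>I. \<zero>\<^bsub>M i\<^esub>), add = (\<lambda>f g. \<lambda>i\<in>I. f i \<oplus>\<^bsub>M i\<^esub> g i),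
    smult = (\<lambda>r f. \<lambda>i\<in>I. r \<odot>\<^bsub>M i\<^esub> f i)\<rparr>"

definition single :: "'i set \<Rightarrow> ('i \<Rightarrow> ('r, 'a) module) \<Rightarrow> 'i \<Rightarrow> 'a \<Rightarrow> 'i \<Rightarrow> 'a"
  where "single I M i x = (\<lambda>j\<in>I. if j = i then x else \<zero>\<^bsub>M j\<^esub>)"

definition self_mod :: "'r ring \<Rightarrow> ('r, 'r) module"
  where "self_mod R = \<lparr>carrier = carrier R, mult = mult R, one = one R, zero = zero R,
    add = add R, smult = mult R\<rparr>"

definition free_mod :: "'r ring \<Rightarrow> 's set \<Rightarrow> ('r, 's \<Rightarrow> 'r) module"
  where "free_mod R S = direct_sum S (\<lambda>_. self_mod R)"

definition basis_el :: "'r ring \<Rightarrow> 's set \<Rightarrow> 's \<Rightarrow> 's \<Rightarrow> 'r"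
  where "basis_el R S s = single S (\<lambda>_. self_mod R) s \<one>\<^bsub>R\<^esub>"

definition lin_ext :: "'r ring \<Rightarrow> 's set \<Rightarrow> ('r, 'a) module \<Rightarrow> ('s \<Rightarrow> 'a) \<Rightarrow> ('s \<Rightarrow> 'r) \<Rightarrow> 'a"
  where "lin_ext R S M \<phi> f = (\<Oplus>\<^bsub>M\<^esub>s\<in>{s \<in> S. f s \<noteq> \<zero>\<^bsub>R\<^esub>}. f s \<odot>\<^bsub>M\<^esub> \<phi> s)"


section \<open>Graded and differential graded modules\<close>

text \<open>A graded module is a family of modules indexed by the integers. Homogeneous elements carry
  their degree, so that the zero elements of different degrees are distinguished.\<close>

type_synonym ('r, 'a) grmod = "int \<Rightarrow> ('r, 'a) module"
type_synonym 'a gel = "int \<times> 'a"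

record ('r, 'a) dgmod =
  gpart :: "('r, 'a) grmod"
  dif :: "int \<Rightarrow> 'a \<Rightarrow> 'a"

definition El :: "('r, 'a) grmod \<Rightarrow> 'a gel set"
  where "El M = (SIGMA q:UNIV. carrier (M q))"

definition gr_module :: "'r ring \<Rightarrow> ('r, 'a) grmod \<Rightarrow> bool"
  where "gr_module R M \<longleftrightarrow> (\<forall>q. module R (M q))"

definition dg_module :: "'r ring \<Rightarrow> ('r, 'a, 'm) dgmod_scheme \<Rightarrow> bool"
  where "dg_module R M \<longleftrightarrow> gr_module R (gpart M) \<and>
    (\<forall>q. dif M q \<in> lin R (gpart M q) (gpart M (q - 1))) \<and>
    (\<forall>q. \<forall>x\<in>carrier (gpart M q). dif M (q - 1) (dif M q x) = \<zero>\<^bsub>gpart M (q - 2)\<^esub>)"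

definition dl :: "('r, 'a, 'm) dgmod_scheme \<Rightarrow> 'a gel \<Rightarrow> 'a gel"
  where "dl M a = (fst a - 1, dif M (fst a) (snd a))"

definition sg :: "('r, 'a) grmod \<Rightarrow> int \<Rightarrow> 'a gel \<Rightarrow> 'a gel"
  where "sg M e a = (fst a, sgn_mod (M (fst a)) e (snd a))"

abbreviation degs :: "'a gel list \<Rightarrow> int list"
  where "degs as \<equiv> map fst as"

text \<open>Morphisms of degree 0 are families indexed by the degree.\<close>

abbreviation gmap :: "(int \<Rightarrow> 'a \<Rightarrow> 'b) \<Rightarrow> 'a gel \<Rightarrow> 'b gel"
  where "gmap \<phi> a \<equiv> (fst a, \<phi> (fst a) (snd a))"

definition gr_iso :: "'r ring \<Rightarrow> ('r, 'a, 'm) dgmod_scheme \<Rightarrow> ('r, 'b, 'n) dgmod_scheme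
    \<Rightarrow> (int \<Rightarrow> 'a \<Rightarrow> 'b) set"
  where "gr_iso R M N = {\<phi>. \<forall>q. \<phi> q \<in> lin R (gpart M q) (gpart N q) \<and>
    bij_betw (\<phi> q) (carrier (gpart M q)) (carrier (gpart N q))}"

definition dg_iso :: "'r ring \<Rightarrow> ('r, 'a, 'm) dgmod_scheme \<Rightarrow> ('r, 'b, 'n) dgmod_scheme
    \<Rightarrow> (int \<Rightarrow> 'a \<Rightarrow> 'b) set"
  where "dg_iso R M N = {\<phi> \<in> gr_iso R M N.
    \<forall>q. \<forall>x\<in>carrier (gpart M q). \<phi> (q - 1) (dif M q x) = dif N q (\<phi> q x)}"

definition gr_sub :: "'r ring \<Rightarrow> ('r, 'a, 'm) dgmod_scheme \<Rightarrow> (int \<Rightarrow> 'a set) \<Rightarrow> bool"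
  where "gr_sub R M S \<longleftrightarrow> (\<forall>q. submodule (S q) R (gpart M q))"

definition subcomplex :: "'r ring \<Rightarrow> ('r, 'a, 'm) dgmod_scheme \<Rightarrow> (int \<Rightarrow> 'a set) \<Rightarrow> bool"
  where "subcomplex R M S \<longleftrightarrow> gr_sub R M S \<and> (\<forall>q. dif M q ` S q \<subseteq> S (q - 1))"

definition restrict_part :: "('r, 'a, 'm) dgmod_scheme \<Rightarrow> (int \<Rightarrow> 'a set) \<Rightarrow> ('r, 'a, 'm) dgmod_scheme"
  where "restrict_part M S = M\<lparr>gpart := \<lambda>q. (gpart M q)\<lparr>carrier := S q\<rparr>\<rparr>"

text \<open>\<open>chain_op R X [Y\<^sub>1, \<dots>, Y\<^sub>k] Z \<mu>\<close>: the operation \<open>\<mu>\<close> is a morphism of differential graded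
  modules \<open>X \<otimes> Y\<^sub>1 \<otimes> \<dots> \<otimes> Y\<^sub>k \<rightarrow> Z\<close>, given as a multilinear map on homogeneous elements.\<close>

definition chain_op :: "'r ring \<Rightarrow> ('r, 'x, 'm) dgmod_scheme \<Rightarrow> ('r, 'y, 'n) dgmod_scheme list
    \<Rightarrow> ('r, 'z, 'l) dgmod_scheme \<Rightarrow> ('x gel \<Rightarrow> 'y gel list \<Rightarrow> 'z gel) \<Rightarrow> bool"
  where "chain_op R X Ys Z \<mu> \<longleftrightarrow>
    (\<forall>x ys. x \<in> El (gpart X) \<and> list_all2 (\<lambda>y Y. y \<in> El (gpart Y)) ys Ys \<longrightarrow>
      (let n = fst x + sum_list (degs ys) in
        \<mu> x ys \<in> El (gpart Z) \<and> fst (\<mu> x ys) = n \<and>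
        (\<lambda>u. snd (\<mu> (fst x, u) ys)) \<in> lin R (gpart X (fst x)) (gpart Z n) \<and>
        (\<forall>i<length ys. (\<lambda>u. snd (\<mu> x (ys[i := (fst (ys ! i), u)])))
            \<in> lin R (gpart (Ys ! i) (fst (ys ! i))) (gpart Z n)) \<and>
        dif Z n (snd (\<mu> x ys)) = snd (\<mu> (dl X x) ys) \<oplus>\<^bsub>gpart Z (n - 1)\<^esub>
          (\<Oplus>\<^bsub>gpart Z (n - 1)\<^esub>i\<in>{..<length ys}.
            snd (sg (gpart Z) (fst x + sum_list (degs (take i ys)))
              (\<mu> x (ys[i := dl (Ys ! i) (ys ! i)]))))))"


section \<open>Koszul signs and block permutations\<close>

text \<open>Sign exponent for
  \<open>y\<^sub>1 \<dots> y\<^sub>k z\<^sub>1 \<dots> z\<^sub>k \<mapsto> y\<^sub>1 z\<^sub>1 \<dots> y\<^sub>k z\<^sub>k\<close>, with \<open>ps\<close>, \<open>qs\<close> the degrees of the \<open>y\<^sub>i\<close>, \<open>z\<^sub>i\<close>.\<close>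

definition interleave_exp :: "int list \<Rightarrow> int list \<Rightarrow> int"
  where "interleave_exp ps qs = (\<Sum>j<length ps. \<Sum>i<j. ps ! j * qs ! i)"

text \<open>Sign exponent for moving the factor in position \<open>i\<close> to position \<open>\<sigma> i\<close>, for all \<open>i\<close>.\<close>

definition koszul_exp :: "(nat \<Rightarrow> nat) \<Rightarrow> int list \<Rightarrow> int"
  where "koszul_exp \<sigma> qs =
    (\<Sum>j<length qs. \<Sum>i\<in>{i. i < j \<and> \<sigma> j < \<sigma> i}. qs ! i * qs ! j)"

definition offset :: "nat list \<Rightarrow> nat \<Rightarrow> nat"
  where "offset js i = sum_list (take i js)"

text \<open>The index of the block containing position \<open>m\<close>, for consecutive blocks of lengths \<open>js\<close>.\<close>

definition block_of :: "nat list \<Rightarrow> nat \<Rightarrow> nat"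
  where "block_of js m = (THE i. i < length js \<and> offset js i \<le> m \<and> m < offset js (Suc i))"

definition block_perm :: "(nat \<Rightarrow> nat) \<Rightarrow> nat list \<Rightarrow> nat \<Rightarrow> nat"
  where "block_perm \<sigma> js m = (if m < sum_list js then
      (let i = block_of js m in
        (\<Sum>l\<in>{l. l < length js \<and> \<sigma> l < \<sigma> i}. js ! l) + (m - offset js i))
    else m)"

definition sum_perm :: "(nat \<Rightarrow> nat) list \<Rightarrow> nat list \<Rightarrow> nat \<Rightarrow> nat"
  where "sum_perm \<tau>s js m = (if m < sum_list js then
      (let i = block_of js m in offset js i + (\<tau>s ! i) (m - offset js i))
    else m)"


section \<open>Operads and their algebras\<close>

text \<open>Symmetric operads in differential graded modules, with the composition
  \<open>ocomp [j\<^sub>1, \<dots>, j\<^sub>k] : \<O>(k) \<otimes> \<O>(j\<^sub>1) \<otimes> \<dots> \<otimes> \<O>(j\<^sub>k) \<rightarrow> \<O>(j\<^sub>1 + \<dots> + j\<^sub>k)\<close>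
  and the right action \<open>oact k \<sigma>\<close> of the permutations of \<open>{..<k}\<close> on \<open>\<O>(k)\<close>.
  All arities \<open>k \<ge> 0\<close> are allowed.\<close>

record ('r, 'o) operad =
  ops :: "nat \<Rightarrow> ('r, 'o) dgmod"
  ocomp :: "nat list \<Rightarrow> 'o gel \<Rightarrow> 'o gel list \<Rightarrow> 'o gel"
  ounit :: 'o
  oact :: "nat \<Rightarrow> (nat \<Rightarrow> nat) \<Rightarrow> int \<Rightarrow> 'o \<Rightarrow> 'o"

abbreviation OEl :: "('r, 'o) operad \<Rightarrow> nat \<Rightarrow> 'o gel set"
  where "OEl P k \<equiv> El (gpart (ops P k))"

abbreviation oid :: "('r, 'o) operad \<Rightarrow> 'o gel"
  where "oid P \<equiv> (0, ounit P)"

definition dg_operad :: "'r ring \<Rightarrow> ('r, 'o) operad \<Rightarrow> bool"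
  where "dg_operad R P \<longleftrightarrow>
    (\<forall>k. dg_module R (ops P k)) \<and>
    (\<forall>js. chain_op R (ops P (length js)) (map (ops P) js) (ops P (sum_list js)) (ocomp P js)) \<and>
    oid P \<in> OEl P 1 \<and> dif (ops P 1) 0 (ounit P) = \<zero>\<^bsub>gpart (ops P 1) (-1)\<^esub> \<and>
    (\<forall>k. \<forall>x\<in>OEl P k. ocomp P [k] (oid P) [x] = x \<and>
      ocomp P (replicate k 1) x (replicate k (oid P)) = x) \<and>
    (\<forall>js x ys kss zss.
      x \<in> OEl P (length js) \<and> list_all2 (\<lambda>y j. y \<in> OEl P j) ys js \<and>
      list_all2 (\<lambda>ks j. length ks = j) kss js \<and>
      list_all2 (list_all2 (\<lambda>z k. z \<in> OEl P k)) zss kss \<longrightarrow>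
      ocomp P (concat kss) (ocomp P js x ys) (concat zss) =
        sg (gpart (ops P (sum_list (concat kss))))
          (interleave_exp (degs ys) (map (sum_list \<circ> degs) zss))
          (ocomp P (map sum_list kss) x
            (map (\<lambda>i. ocomp P (kss ! i) (ys ! i) (zss ! i)) [0..<length js]))) \<and>
    (\<forall>k \<sigma> q. \<sigma> permutes {..<k} \<longrightarrow>
      oact P k \<sigma> q \<in> lin R (gpart (ops P k) q) (gpart (ops P k) q)) \<and>
    (\<forall>k \<sigma>. \<forall>x\<in>OEl P k. \<sigma> permutes {..<k} \<longrightarrow>
      dl (ops P k) (gmap (oact P k \<sigma>) x) = gmap (oact P k \<sigma>) (dl (ops P k) x)) \<and>
    (\<forall>k. \<forall>x\<in>OEl P k. gmap (oact P k id) x = x) \<and>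
    (\<forall>k \<sigma> \<tau>. \<forall>x\<in>OEl P k. \<sigma> permutes {..<k} \<and> \<tau> permutes {..<k} \<longrightarrow>
      gmap (oact P k (\<sigma> \<circ> \<tau>)) x = gmap (oact P k \<tau>) (gmap (oact P k \<sigma>) x)) \<and>
    (\<forall>js x ys \<sigma>.
      x \<in> OEl P (length js) \<and> list_all2 (\<lambda>y j. y \<in> OEl P j) ys js \<and>
      \<sigma> permutes {..<length js} \<longrightarrow>
      ocomp P js (gmap (oact P (length js) \<sigma>) x) ys =
        sg (gpart (ops P (sum_list js))) (koszul_exp \<sigma> (degs ys))
          (gmap (oact P (sum_list js) (block_perm \<sigma> js))
            (ocomp P (permute_list (inv_into UNIV \<sigma>) js) x (permute_list (inv_into UNIV \<sigma>) ys)))) \<and>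
    (\<forall>js x ys \<tau>s.
      x \<in> OEl P (length js) \<and> list_all2 (\<lambda>y j. y \<in> OEl P j) ys js \<and>
      list_all2 (\<lambda>\<tau> j. \<tau> permutes {..<j}) \<tau>s js \<longrightarrow>
      ocomp P js x (map (\<lambda>i. gmap (oact P (js ! i) (\<tau>s ! i)) (ys ! i)) [0..<length js]) =
        gmap (oact P (sum_list js) (sum_perm \<tau>s js)) (ocomp P js x ys))"

record ('r, 'o, 'a) dgalg = "('r, 'a) dgmod" +
  ev :: "'o gel \<Rightarrow> 'a gel list \<Rightarrow> 'a gel"

definition operad_algebra :: "'r ring \<Rightarrow> ('r, 'o) operad \<Rightarrow> ('r, 'o, 'a) dgalg \<Rightarrow> bool"
  where "operad_algebra R P A \<longleftrightarrow>
    dg_module R A \<and>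
    (\<forall>k. chain_op R (ops P k) (replicate k A) A (ev A)) \<and>
    (\<forall>a\<in>El (gpart A). ev A (oid P) [a] = a) \<and>
    (\<forall>js x ys ass.
      x \<in> OEl P (length js) \<and> list_all2 (\<lambda>y j. y \<in> OEl P j) ys js \<and>
      list_all2 (\<lambda>as j. length as = j \<and> set as \<subseteq> El (gpart A)) ass js \<longrightarrow>
      ev A (ocomp P js x ys) (concat ass) =
        sg (gpart A) (interleave_exp (degs ys) (map (sum_list \<circ> degs) ass))
          (ev A x (map2 (ev A) ys ass))) \<and>
    (\<forall>x as \<sigma>.
      x \<in> OEl P (length as) \<and> set as \<subseteq> El (gpart A) \<and> \<sigma> permutes {..<length as} \<longrightarrow>
      ev A (gmap (oact P (length as) \<sigma>) x) as =
        sg (gpart A) (koszul_exp \<sigma> (degs as)) (ev A x (permute_list (inv_into UNIV \<sigma>) as)))"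

definition preserves_ev :: "('r, 'o) operad \<Rightarrow> ('r, 'o, 'a) dgalg \<Rightarrow> ('r, 'o, 'b) dgalg
    \<Rightarrow> (int \<Rightarrow> 'a \<Rightarrow> 'b) \<Rightarrow> bool"
  where "preserves_ev P A B \<phi> \<longleftrightarrow>
    (\<forall>x as. x \<in> OEl P (length as) \<and> set as \<subseteq> El (gpart A) \<longrightarrow>
      gmap \<phi> (ev A x as) = ev B x (map (gmap \<phi>) as))"

text \<open>Isomorphisms of algebras, and of the underlying algebras over \<open>\<O>\<^sub>#\<close>
  (all differentials forgotten).\<close>

definition alg_iso :: "'r ring \<Rightarrow> ('r, 'o) operad \<Rightarrow> ('r, 'o, 'a) dgalg \<Rightarrow> ('r, 'o, 'b) dgalg
    \<Rightarrow> (int \<Rightarrow> 'a \<Rightarrow> 'b) set"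
  where "alg_iso R P A B = {\<phi> \<in> dg_iso R A B. preserves_ev P A B \<phi>}"

definition gr_alg_iso :: "'r ring \<Rightarrow> ('r, 'o) operad \<Rightarrow> ('r, 'o, 'a) dgalg \<Rightarrow> ('r, 'o, 'b) dgalg
    \<Rightarrow> (int \<Rightarrow> 'a \<Rightarrow> 'b) set"
  where "gr_alg_iso R P A B = {\<phi> \<in> gr_iso R A B. preserves_ev P A B \<phi>}"

definition ev_closed :: "('r, 'o) operad \<Rightarrow> ('r, 'o, 'a) dgalg \<Rightarrow> (int \<Rightarrow> 'a set) \<Rightarrow> bool"
  where "ev_closed P A S \<longleftrightarrow>
    (\<forall>x as. x \<in> OEl P (length as) \<and> (\<forall>a\<in>set as. snd a \<in> S (fst a)) \<longrightarrow>
      snd (ev A x as) \<in> S (fst (ev A x as)))"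


section \<open>Ideals and quotient algebras\<close>

definition alg_ideal :: "'r ring \<Rightarrow> ('r, 'o) operad \<Rightarrow> ('r, 'o, 'a) dgalg \<Rightarrow> (int \<Rightarrow> 'a set) \<Rightarrow> bool"
  where "alg_ideal R P A I \<longleftrightarrow> subcomplex R A I \<and>
    (\<forall>x as. x \<in> OEl P (length as) \<and> set as \<subseteq> El (gpart A) \<and> (\<exists>a\<in>set as. snd a \<in> I (fst a)) \<longrightarrow>
      snd (ev A x as) \<in> I (fst (ev A x as)))"

definition ideal_gen :: "'r ring \<Rightarrow> ('r, 'o) operad \<Rightarrow> ('r, 'o, 'a) dgalg \<Rightarrow> (int \<Rightarrow> 'a set)
    \<Rightarrow> int \<Rightarrow> 'a set"
  where "ideal_gen R P A G q = \<Inter>{I q | I. alg_ideal R P A I \<and> (\<forall>n. G n \<subseteq> I n)}"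

definition proj :: "('r, 'a, 'm) dgmod_scheme \<Rightarrow> (int \<Rightarrow> 'a set) \<Rightarrow> int \<Rightarrow> 'a \<Rightarrow> 'a set"
  where "proj M I q a = I q +>\<^bsub>gpart M q\<^esub> a"

definition quot_alg :: "('r, 'o, 'a) dgalg \<Rightarrow> (int \<Rightarrow> 'a set) \<Rightarrow> ('r, 'o, 'a set) dgalg"
  where "quot_alg A I = \<lparr>gpart = (\<lambda>q. quot_mod (gpart A q) (I q)),
    dif = (\<lambda>q. induced (proj A I (q - 1) \<circ> dif A q)),
    ev = (\<lambda>x Xs. the_elem {gmap (proj A I) (ev A x as) | as.
      list_all2 (\<lambda>a X. fst a = fst X \<and> snd a \<in> snd X) as Xs})\<rparr>"


section \<open>Free algebras\<close>

text \<open>\<open>F(\<O>, V) = \<Oplus>\<^sub>k \<O>(k) \<otimes>\<^bsub>\<Sigma>\<^sub>k\<^esub> V\<^sup>\<otimes>\<^sup>k\<close>: in degree \<open>n\<close> this is the free module on the symbols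
  \<open>(x, [v\<^sub>1, \<dots>, v\<^sub>k])\<close> with \<open>x \<in> \<O>(k)\<close> and \<open>v\<^sub>i \<in> V\<close> homogeneous of total degree \<open>n\<close>, modulo
  multilinearity and \<open>x\<sigma> \<otimes> v\<^sub>1 \<dots> v\<^sub>k = \<plusminus> x \<otimes> \<sigma>(v\<^sub>1 \<dots> v\<^sub>k)\<close>.\<close>

type_synonym ('o, 'v) sym = "'o gel \<times> 'v gel list"
type_synonym ('r, 'o, 'v) free_el = "(('o, 'v) sym \<Rightarrow> 'r) set"

definition syms :: "('r, 'o) operad \<Rightarrow> ('r, 'v) grmod \<Rightarrow> int \<Rightarrow> ('o, 'v) sym set"
  where "syms P V n = {(x, vs). x \<in> OEl P (length vs) \<and> set vs \<subseteq> El V \<and>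
    fst x + sum_list (degs vs) = n}"

definition free_rels :: "'r ring \<Rightarrow> ('r, 'o) operad \<Rightarrow> ('r, 'v) grmod \<Rightarrow> int
    \<Rightarrow> (('o, 'v) sym \<Rightarrow> 'r) set"
  where "free_rels R P V n = (let
      M = free_mod R (syms P V n); \<delta> = basis_el R (syms P V n)
    in
      {\<delta> ((p, x \<oplus>\<^bsub>gpart (ops P (length vs)) p\<^esub> y), vs) \<ominus>\<^bsub>M\<^esub> (\<delta> ((p, x), vs) \<oplus>\<^bsub>M\<^esub> \<delta> ((p, y), vs)) | p x y vs.
        ((p, x), vs) \<in> syms P V n \<and> ((p, y), vs) \<in> syms P V n} \<union>
      {\<delta> ((p, r \<odot>\<^bsub>gpart (ops P (length vs)) p\<^esub> x), vs) \<ominus>\<^bsub>M\<^esub> r \<odot>\<^bsub>M\<^esub> \<delta> ((p, x), vs) | p x vs r.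
        ((p, x), vs) \<in> syms P V n \<and> r \<in> carrier R} \<union>
      {\<delta> (x, vs[i := (q, v \<oplus>\<^bsub>V q\<^esub> w)]) \<ominus>\<^bsub>M\<^esub>
          (\<delta> (x, vs[i := (q, v)]) \<oplus>\<^bsub>M\<^esub> \<delta> (x, vs[i := (q, w)])) | x vs i q v w.
        i < length vs \<and> (x, vs[i := (q, v)]) \<in> syms P V n \<and> (x, vs[i := (q, w)]) \<in> syms P V n} \<union>
      {\<delta> (x, vs[i := (q, r \<odot>\<^bsub>V q\<^esub> v)]) \<ominus>\<^bsub>M\<^esub> r \<odot>\<^bsub>M\<^esub> \<delta> (x, vs[i := (q, v)]) | x vs i q v r.
        i < length vs \<and> (x, vs[i := (q, v)]) \<in> syms P V n \<and> r \<in> carrier R} \<union>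
      {\<delta> (gmap (oact P (length vs) \<sigma>) x, vs) \<ominus>\<^bsub>M\<^esub>
          sgn_mod M (koszul_exp \<sigma> (degs vs)) (\<delta> (x, permute_list (inv_into UNIV \<sigma>) vs)) | x vs \<sigma>.
        (x, vs) \<in> syms P V n \<and> \<sigma> permutes {..<length vs}})"

definition free_sub :: "'r ring \<Rightarrow> ('r, 'o) operad \<Rightarrow> ('r, 'v) grmod \<Rightarrow> int
    \<Rightarrow> (('o, 'v) sym \<Rightarrow> 'r) set"
  where "free_sub R P V n = gen_sub R (free_mod R (syms P V n)) (free_rels R P V n)"

definition free_part :: "'r ring \<Rightarrow> ('r, 'o) operad \<Rightarrow> ('r, 'v) grmod
    \<Rightarrow> ('r, ('r, 'o, 'v) free_el) grmod"
  where "free_part R P V n = quot_mod (free_mod R (syms P V n)) (free_sub R P V n)"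

definition tens :: "'r ring \<Rightarrow> ('r, 'o) operad \<Rightarrow> ('r, 'v) grmod \<Rightarrow> 'o gel \<Rightarrow> 'v gel list
    \<Rightarrow> ('r, 'o, 'v) free_el gel"
  where "tens R P V x vs = (let n = fst x + sum_list (degs vs) in
    (n, free_sub R P V n +>\<^bsub>free_mod R (syms P V n)\<^esub> basis_el R (syms P V n) (x, vs)))"

text \<open>The evaluation product
  \<open>y \<otimes> (x\<^sub>1 \<otimes> w\<^sub>1) \<otimes> \<dots> \<otimes> (x\<^sub>k \<otimes> w\<^sub>k) \<mapsto> \<plusminus> y(x\<^sub>1, \<dots>, x\<^sub>k) \<otimes> w\<^sub>1 \<dots> w\<^sub>k\<close> on symbols (the \<open>w\<^sub>i\<close> being words
  in \<open>V\<close>), extended multilinearly.\<close>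

definition sym_ev :: "'r ring \<Rightarrow> ('r, 'o) operad \<Rightarrow> ('r, 'v) grmod \<Rightarrow> 'o gel \<Rightarrow> ('o, 'v) sym list
    \<Rightarrow> ('r, 'o, 'v) free_el gel"
  where "sym_ev R P V y ss = sg (free_part R P V)
    (interleave_exp (map (fst \<circ> fst) ss) (map (sum_list \<circ> degs \<circ> snd) ss))
    (tens R P V (ocomp P (map (length \<circ> snd) ss) y (map fst ss)) (concat (map snd ss)))"

definition free_ev :: "'r ring \<Rightarrow> ('r, 'o) operad \<Rightarrow> ('r, 'v) grmod \<Rightarrow> 'o gel
    \<Rightarrow> ('r, 'o, 'v) free_el gel list \<Rightarrow> ('r, 'o, 'v) free_el gel"
  where "free_ev R P V y Xs = (let n = fst y + sum_list (degs Xs) in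
    (n, the_elem {\<Oplus>\<^bsub>free_part R P V n\<^esub>ss\<in>{ss. list_all2 (\<lambda>s f. s \<in> syms P V (fst f) \<and> snd f s \<noteq> \<zero>\<^bsub>R\<^esub>) ss fs}.
          foldr (\<otimes>\<^bsub>R\<^esub>) (map2 (\<lambda>f s. snd f s) fs ss) \<one>\<^bsub>R\<^esub> \<odot>\<^bsub>free_part R P V n\<^esub> snd (sym_ev R P V y ss) | fs.
        list_all2 (\<lambda>f X. fst f = fst X \<and> snd f \<in> snd X) fs Xs}))"

definition sym_dif :: "'r ring \<Rightarrow> ('r, 'o) operad \<Rightarrow> ('r, 'v) dgmod \<Rightarrow> int \<Rightarrow> ('o, 'v) sym
    \<Rightarrow> ('r, 'o, 'v) free_el"
  where "sym_dif R P W n s = (let x = fst s; ws = snd s; F = free_part R P (gpart W) in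
    snd (tens R P (gpart W) (dl (ops P (length ws)) x) ws) \<oplus>\<^bsub>F (n - 1)\<^esub>
      (\<Oplus>\<^bsub>F (n - 1)\<^esub>i\<in>{..<length ws}. snd (sg F (fst x + sum_list (degs (take i ws)))
        (tens R P (gpart W) x (ws[i := dl W (ws ! i)])))))"

definition free_alg :: "'r ring \<Rightarrow> ('r, 'o) operad \<Rightarrow> ('r, 'v) dgmod
    \<Rightarrow> ('r, 'o, ('r, 'o, 'v) free_el) dgalg"
  where "free_alg R P W = \<lparr>gpart = free_part R P (gpart W),
    dif = (\<lambda>n. induced (lin_ext R (syms P (gpart W) n) (free_part R P (gpart W) (n - 1))
      (sym_dif R P W n))),
    ev = free_ev R P (gpart W)\<rparr>"

text \<open>\<open>\<phi>\<close> exhibits \<open>A\<close> as almost free on \<open>V\<close>, i.e.\ \<open>\<phi> : F(\<O>\<^sub>#, V) \<cong> A\<^sub>#\<close>. The zero differential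
  on \<open>V\<close> plays no role here since \<^const>\<open>gr_alg_iso\<close> ignores differentials.\<close>

definition almost_free :: "'r ring \<Rightarrow> ('r, 'o) operad \<Rightarrow> ('r, 'o, 'a) dgalg \<Rightarrow> ('r, 'v) grmod
    \<Rightarrow> (int \<Rightarrow> ('r, 'o, 'v) free_el \<Rightarrow> 'a) \<Rightarrow> bool"
  where "almost_free R P A V \<phi> \<longleftrightarrow> gr_module R V \<and>
    \<phi> \<in> gr_alg_iso R P (free_alg R P \<lparr>gpart = V, dif = (\<lambda>q _. \<zero>\<^bsub>V (q - 1)\<^esub>)\<rparr>) A"

definition gen :: "'r ring \<Rightarrow> ('r, 'o) operad \<Rightarrow> ('r, 'v) grmod
    \<Rightarrow> (int \<Rightarrow> ('r, 'o, 'v) free_el \<Rightarrow> 'a) \<Rightarrow> 'v gel \<Rightarrow> 'a gel"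
  where "gen R P V \<phi> v = gmap \<phi> (tens R P V (oid P) [v])"

text \<open>The differential of every generator \<open>v \<in> V\<close> has vanishing component in \<open>\<O>(0)\<close>. This is
  automatic if \<open>\<O>(0) = 0\<close>.\<close>

definition no_constant_terms :: "'r ring \<Rightarrow> ('r, 'o) operad \<Rightarrow> ('r, 'o, 'a) dgalg
    \<Rightarrow> ('r, 'v) grmod \<Rightarrow> (int \<Rightarrow> ('r, 'o, 'v) free_el \<Rightarrow> 'a) \<Rightarrow> bool"
  where "no_constant_terms R P A V \<phi> \<longleftrightarrow> (\<forall>v\<in>El V.
    snd (dl A (gen R P V \<phi> v)) \<in> gen_sub R (gpart A (fst v - 1))
      {snd (ev A x (map (gen R P V \<phi>) vs)) | x vs.
        vs \<noteq> [] \<and> (x, vs) \<in> syms P V (fst v - 1)})"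


section \<open>Coproducts of copies of an algebra\<close>

text \<open>The \<open>m\<close>-fold coproduct of \<open>A\<close> is \<open>F(\<O>, A\<^sup>\<oplus>\<^sup>m)\<close> modulo the ideal generated by the elements
  \<open>y \<otimes> \<iota>\<^sub>i a\<^sub>1 \<dots> \<iota>\<^sub>i a\<^sub>k - 1 \<otimes> \<iota>\<^sub>i (y(a\<^sub>1, \<dots>, a\<^sub>k))\<close>, i.e.\ the coproduct inclusions are forced to be
  morphisms of algebras.\<close>

type_synonym ('r, 'o, 'a) cop_el = "('r, 'o, nat \<Rightarrow> 'a) free_el set"

definition copies :: "('r, 'o, 'a) dgalg \<Rightarrow> nat \<Rightarrow> ('r, nat \<Rightarrow> 'a) dgmod"
  where "copies A m = \<lparr>gpart = (\<lambda>q. direct_sum {..<m} (\<lambda>_. gpart A q)),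
    dif = (\<lambda>q w. \<lambda>j\<in>{..<m}. dif A q (w j))\<rparr>"

definition copy_in :: "('r, 'o, 'a) dgalg \<Rightarrow> nat \<Rightarrow> nat \<Rightarrow> 'a gel \<Rightarrow> (nat \<Rightarrow> 'a) gel"
  where "copy_in A m i a = (fst a, single {..<m} (\<lambda>_. gpart A (fst a)) i (snd a))"

abbreviation free_on_copies :: "'r ring \<Rightarrow> ('r, 'o) operad \<Rightarrow> ('r, 'o, 'a) dgalg \<Rightarrow> nat
    \<Rightarrow> ('r, 'o, ('r, 'o, nat \<Rightarrow> 'a) free_el) dgalg"
  where "free_on_copies R P A m \<equiv> free_alg R P (copies A m)"

definition cop_rels :: "'r ring \<Rightarrow> ('r, 'o) operad \<Rightarrow> ('r, 'o, 'a) dgalg \<Rightarrow> nat \<Rightarrow> int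
    \<Rightarrow> ('r, 'o, nat \<Rightarrow> 'a) free_el set"
  where "cop_rels R P A m q =
    {snd (tens R P (gpart (copies A m)) y (map (copy_in A m i) as))
        \<ominus>\<^bsub>gpart (free_on_copies R P A m) q\<^esub>
      snd (tens R P (gpart (copies A m)) (oid P) [copy_in A m i (ev A y as)]) | i y as.
      i < m \<and> (y, as) \<in> syms P (gpart A) q}"

definition cop_ideal :: "'r ring \<Rightarrow> ('r, 'o) operad \<Rightarrow> ('r, 'o, 'a) dgalg \<Rightarrow> nat \<Rightarrow> int
    \<Rightarrow> ('r, 'o, nat \<Rightarrow> 'a) free_el set"
  where "cop_ideal R P A m = ideal_gen R P (free_on_copies R P A m) (cop_rels R P A m)"

definition copower :: "'r ring \<Rightarrow> ('r, 'o) operad \<Rightarrow> ('r, 'o, 'a) dgalg \<Rightarrow> nat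
    \<Rightarrow> ('r, 'o, ('r, 'o, 'a) cop_el) dgalg"
  where "copower R P A m = quot_alg (free_on_copies R P A m) (cop_ideal R P A m)"

definition coinj :: "'r ring \<Rightarrow> ('r, 'o) operad \<Rightarrow> ('r, 'o, 'a) dgalg \<Rightarrow> nat \<Rightarrow> nat \<Rightarrow> 'a gel
    \<Rightarrow> ('r, 'o, 'a) cop_el gel"
  where "coinj R P A m i a = gmap (proj (free_on_copies R P A m) (cop_ideal R P A m))
    (tens R P (gpart (copies A m)) (oid P) [copy_in A m i a])"

text \<open>The morphism from the \<open>m\<close>-fold coproduct to \<open>B\<close> whose restriction to the \<open>j\<close>-th copy of \<open>A\<close>
  is \<open>f j\<close>:  \<open>x \<otimes> w\<^sub>1 \<dots> w\<^sub>k \<mapsto> x(\<Sum>\<^sub>j f\<^sub>j(w\<^sub>1 j), \<dots>, \<Sum>\<^sub>j f\<^sub>j(w\<^sub>k j))\<close>.\<close>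

definition copair :: "'r ring \<Rightarrow> ('r, 'o) operad \<Rightarrow> ('r, 'o, 'a) dgalg \<Rightarrow> ('r, 'o, 'b) dgalg \<Rightarrow> nat
    \<Rightarrow> (nat \<Rightarrow> 'a gel \<Rightarrow> 'b gel) \<Rightarrow> int \<Rightarrow> ('r, 'o, 'a) cop_el \<Rightarrow> 'b"
  where "copair R P A B m f q = induced (induced
    (lin_ext R (syms P (gpart (copies A m)) q) (gpart B q)
      (\<lambda>(x, ws). snd (ev B x
        (map (\<lambda>w. (fst w, \<Oplus>\<^bsub>gpart B (fst w)\<^esub>j\<in>{..<m}. snd (f j (fst w, snd w j)))) ws)))))"


section \<open>The simplicial algebra\<close>

definition cyc :: "'r ring \<Rightarrow> ('r, 'o) operad \<Rightarrow> ('r, 'o, 'a) dgalg \<Rightarrow> nat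
    \<Rightarrow> ('r, 'o, ('r, 'o, 'a) cop_el) dgalg"
  where "cyc R P A n = copower R P A (Suc n)"

text \<open>The morphism from the \<open>(m+1)\<close>-fold to the \<open>(n+1)\<close>-fold coproduct that identifies the \<open>j\<close>-th
  copy of \<open>A\<close> with the \<open>\<theta> j\<close>-th copy.\<close>

definition reindex :: "'r ring \<Rightarrow> ('r, 'o) operad \<Rightarrow> ('r, 'o, 'a) dgalg \<Rightarrow> nat \<Rightarrow> nat
    \<Rightarrow> (nat \<Rightarrow> nat) \<Rightarrow> int \<Rightarrow> ('r, 'o, 'a) cop_el \<Rightarrow> ('r, 'o, 'a) cop_el"
  where "reindex R P A m n \<theta> =
    copair R P A (cyc R P A n) (Suc m) (\<lambda>j. coinj R P A (Suc n) (\<theta> j))"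

text \<open>In terms of copies of \<open>A\<close>, the map \<open>id\<^sup>\<amalg>\<^sup>i \<amalg> \<nabla> \<amalg> id\<^sup>\<amalg>\<^sup>(\<^sup>n\<^sup>-\<^sup>1\<^sup>-\<^sup>i\<^sup>)\<close> identifies the copies \<open>i\<close> and \<open>i+1\<close>,
  and \<open>id\<^sup>\<amalg>\<^sup>i \<amalg> l \<amalg> id\<^sup>\<amalg>\<^sup>(\<^sup>n\<^sup>-\<^sup>i\<^sup>)\<close> leaves out the copy \<open>i+1\<close> of its target.\<close>

definition merge :: "'r ring \<Rightarrow> ('r, 'o) operad \<Rightarrow> ('r, 'o, 'a) dgalg \<Rightarrow> nat \<Rightarrow> nat
    \<Rightarrow> int \<Rightarrow> ('r, 'o, 'a) cop_el \<Rightarrow> ('r, 'o, 'a) cop_el"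
  where "merge R P A n i = reindex R P A n (n - 1) (\<lambda>j. if j \<le> i then j else j - 1)"

definition rot :: "'r ring \<Rightarrow> ('r, 'o) operad \<Rightarrow> ('r, 'o, 'a) dgalg \<Rightarrow> nat
    \<Rightarrow> int \<Rightarrow> ('r, 'o, 'a) cop_el \<Rightarrow> ('r, 'o, 'a) cop_el"
  where "rot R P A n = reindex R P A n n (\<lambda>j. if j = n then 0 else j + 1)"

definition face :: "'r ring \<Rightarrow> ('r, 'o) operad \<Rightarrow> ('r, 'o, 'a) dgalg \<Rightarrow> nat \<Rightarrow> nat
    \<Rightarrow> int \<Rightarrow> ('r, 'o, 'a) cop_el \<Rightarrow> ('r, 'o, 'a) cop_el"
  where "face R P A n i q X =
    (if i < n then merge R P A n i q X else merge R P A n 0 q (rot R P A n q X))"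

definition degen :: "'r ring \<Rightarrow> ('r, 'o) operad \<Rightarrow> ('r, 'o, 'a) dgalg \<Rightarrow> nat \<Rightarrow> nat
    \<Rightarrow> int \<Rightarrow> ('r, 'o, 'a) cop_el \<Rightarrow> ('r, 'o, 'a) cop_el"
  where "degen R P A n i = reindex R P A n (Suc n) (\<lambda>j. if j \<le> i then j else j + 1)"


section \<open>The total complex and the operadic Hochschild chain complex\<close>

type_synonym ('r, 'o, 'a) tot_el = "nat \<Rightarrow> ('r, 'o, 'a) cop_el"

definition bidegree :: "'r ring \<Rightarrow> ('r, 'o) operad \<Rightarrow> ('r, 'o, 'a) dgalg \<Rightarrow> int \<Rightarrow> nat
    \<Rightarrow> ('r, ('r, 'o, 'a) cop_el) module"
  where "bidegree R P A n p = gpart (cyc R P A p) (n - int p)"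

definition tot_part :: "'r ring \<Rightarrow> ('r, 'o) operad \<Rightarrow> ('r, 'o, 'a) dgalg
    \<Rightarrow> ('r, ('r, 'o, 'a) tot_el) grmod"
  where "tot_part R P A n = direct_sum UNIV (bidegree R P A n)"

definition tot_dif :: "'r ring \<Rightarrow> ('r, 'o) operad \<Rightarrow> ('r, 'o, 'a) dgalg \<Rightarrow> int
    \<Rightarrow> ('r, 'o, 'a) tot_el \<Rightarrow> ('r, 'o, 'a) tot_el"
  where "tot_dif R P A n f = (\<lambda>p.
    (\<Oplus>\<^bsub>bidegree R P A (n - 1) p\<^esub>i\<in>{..Suc p}.
      sgn_mod (bidegree R P A (n - 1) p) (int i) (face R P A (Suc p) i (n - int (Suc p)) (f (Suc p))))
    \<oplus>\<^bsub>bidegree R P A (n - 1) p\<^esub>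
      sgn_mod (bidegree R P A (n - 1) p) (int p) (dif (cyc R P A p) (n - int p) (f p)))"

text \<open>A shuffle of type \<open>(p\<^sub>0, \<dots>, p\<^bsub>k-1\<^esub>)\<close> is encoded as a word \<open>c\<close> of length \<open>N = p\<^sub>0 + \<dots> + p\<^bsub>k-1\<^esub>\<close> in
  \<open>{..<k}\<close> in which \<open>i\<close> occurs \<open>p\<^sub>i\<close> times: the positions of \<open>i\<close> in \<open>c\<close> are the values of the shuffle
  on its \<open>i\<close>-th block. In the corresponding term of the iterated shuffle product the \<open>i\<close>-th factor
  is degenerated along the remaining positions \<open>\<nu>\<^sub>1 < \<dots> < \<nu>\<^sub>r\<close>, as \<open>s\<^bsub>\<nu>\<^sub>r\<^esub> \<dots> s\<^bsub>\<nu>\<^sub>1\<^esub>\<close>, and the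
  signature of the shuffle is given by the inversions of \<open>c\<close>.\<close>

definition inversions :: "nat list \<Rightarrow> nat"
  where "inversions c = card {(m, n). m < n \<and> n < length c \<and> c ! n < c ! m}"

definition shuffle_degen :: "'r ring \<Rightarrow> ('r, 'o) operad \<Rightarrow> ('r, 'o, 'a) dgalg \<Rightarrow> nat list \<Rightarrow> nat
    \<Rightarrow> int \<Rightarrow> ('r, 'o, 'a) cop_el \<Rightarrow> ('r, 'o, 'a) cop_el"
  where "shuffle_degen R P A c i q X =
    snd (fold (\<lambda>\<nu> (n, Y). (Suc n, degen R P A n \<nu> q Y)) (filter (\<lambda>m. c ! m \<noteq> i) [0..<length c])
      (count_list c i, X))"

text \<open>Besides the signature, the usual Koszul signs occur: internal degrees are moved past
  simplicial degrees. The internal degree of the \<open>i\<close>-th component is its total degree minus \<open>p\<^sub>i\<close>.\<close>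

definition shuffle_exp :: "int \<Rightarrow> int list \<Rightarrow> nat list \<Rightarrow> int"
  where "shuffle_exp r ns c = int (inversions c) + r * int (length c) +
    (\<Sum>j<length ns. \<Sum>i<j. (ns ! i - int (count_list c i)) * int (count_list c j))"

definition tot_ev :: "'r ring \<Rightarrow> ('r, 'o) operad \<Rightarrow> ('r, 'o, 'a) dgalg \<Rightarrow> 'o gel
    \<Rightarrow> ('r, 'o, 'a) tot_el gel list \<Rightarrow> ('r, 'o, 'a) tot_el gel"
  where "tot_ev R P A x ts = (let n = fst x + sum_list (degs ts) in
    (n, \<lambda>N. \<Oplus>\<^bsub>bidegree R P A n N\<^esub>c\<in>{c. length c = N \<and> set c \<subseteq> {..<length ts}}.
      sgn_mod (bidegree R P A n N) (shuffle_exp (fst x) (degs ts) c)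
        (snd (ev (cyc R P A N) x
          (map (\<lambda>i. let p = count_list c i; q = fst (ts ! i) - int p in
            (q, shuffle_degen R P A c i q (snd (ts ! i) p))) [0..<length ts])))))"

definition Tot :: "'r ring \<Rightarrow> ('r, 'o) operad \<Rightarrow> ('r, 'o, 'a) dgalg
    \<Rightarrow> ('r, 'o, ('r, 'o, 'a) tot_el) dgalg"
  where "Tot R P A = \<lparr>gpart = tot_part R P A, dif = tot_dif R P A, ev = tot_ev R P A\<rparr>"

definition degenerate_sub :: "'r ring \<Rightarrow> ('r, 'o) operad \<Rightarrow> ('r, 'o, 'a) dgalg
    \<Rightarrow> int \<Rightarrow> ('r, 'o, 'a) tot_el set"
  where "degenerate_sub R P A n = \<Inter>{S n | S. subcomplex R (Tot R P A) S \<and>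
    (\<forall>p q i. \<forall>X\<in>carrier (gpart (cyc R P A p) q). i \<le> p \<longrightarrow>
      single UNIV (bidegree R P A (q + int (Suc p))) (Suc p) (degen R P A p i q X)
        \<in> S (q + int (Suc p)))}"

definition hochschild :: "'r ring \<Rightarrow> ('r, 'o) operad \<Rightarrow> ('r, 'o, 'a) dgalg
    \<Rightarrow> ('r, 'o, ('r, 'o, 'a) tot_el set) dgalg"
  where "hochschild R P A = quot_alg (Tot R P A) (degenerate_sub R P A)"

definition normalization_map :: "'r ring \<Rightarrow> ('r, 'o) operad \<Rightarrow> ('r, 'o, 'a) dgalg
    \<Rightarrow> int \<Rightarrow> ('r, 'o, 'a) tot_el \<Rightarrow> ('r, 'o, 'a) tot_el set"
  where "normalization_map R P A = proj (Tot R P A) (degenerate_sub R P A)"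


section \<open>The submodule of elements with nonempty blocks\<close>

text \<open>\<open>vss = [w\<^sub>0, \<dots>, w\<^sub>p]\<close> is the list of blocks, \<open>w\<^sub>i\<close> being a word in the \<open>i\<close>-th copy of \<open>V\<close>.
  The blocks \<open>w\<^sub>1, \<dots>, w\<^sub>p\<close> are required to be nonempty, but not \<open>w\<^sub>0\<close>: a degenerate element
  \<open>s\<^sub>i y\<close> has an empty block in position \<open>i + 1 \<ge> 1\<close>, so that elements in which only \<open>w\<^sub>0\<close> is empty
  are not killed by normalization.\<close>

definition plus_sub :: "'r ring \<Rightarrow> ('r, 'o) operad \<Rightarrow> ('r, 'o, 'a) dgalg \<Rightarrow> ('r, 'v) grmod
    \<Rightarrow> (int \<Rightarrow> ('r, 'o, 'v) free_el \<Rightarrow> 'a) \<Rightarrow> nat \<Rightarrow> int \<Rightarrow> ('r, 'o, 'a) cop_el set"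
  where "plus_sub R P A V \<phi> p q = gen_sub R (gpart (cyc R P A p) q)
    {snd (ev (cyc R P A p) x
        (concat (map (\<lambda>i. map (coinj R P A (Suc p) i \<circ> gen R P V \<phi>) (vss ! i)) [0..<Suc p]))) | x vss.
      length vss = Suc p \<and> (\<forall>i\<in>{1..p}. vss ! i \<noteq> []) \<and> (x, concat vss) \<in> syms P V q}"

definition tot_plus :: "'r ring \<Rightarrow> ('r, 'o) operad \<Rightarrow> ('r, 'o, 'a) dgalg \<Rightarrow> ('r, 'v) grmod
    \<Rightarrow> (int \<Rightarrow> ('r, 'o, 'v) free_el \<Rightarrow> 'a) \<Rightarrow> int \<Rightarrow> ('r, 'o, 'a) tot_el set"
  where "tot_plus R P A V \<phi> n = {f \<in> carrier (gpart (Tot R P A) n).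
    \<forall>p. f p \<in> plus_sub R P A V \<phi> p (n - int p)}"

definition Tot_plus :: "'r ring \<Rightarrow> ('r, 'o) operad \<Rightarrow> ('r, 'o, 'a) dgalg \<Rightarrow> ('r, 'v) grmod
    \<Rightarrow> (int \<Rightarrow> ('r, 'o, 'v) free_el \<Rightarrow> 'a) \<Rightarrow> ('r, 'o, ('r, 'o, 'a) tot_el) dgalg"
  where "Tot_plus R P A V \<phi> = restrict_part (Tot R P A) (tot_plus R P A V \<phi>)"

end

theory Submission
  imports Defs
begin

text \<open>The ideal defining the coproduct of copies of \<open>A\<close> is, by the Leibniz rule, already generated
  by its relations as a graded ideal. Hence endomorphisms of the underlying graded algebra of \<open>A\<close>,
  even those that do not commute with the differential, act on a single copy of \<open>A\<close> in the
  coproduct. For the endomorphism of \<open>F(\<O>, V)\<close> that kills \<open>V\<close> and the \<open>i\<close>-th copy this gives an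
  operator \<open>\<kappa>\<^sub>i\<close> which annihilates the monomials in \<open>V\<close> that involve the \<open>i\<close>-th copy and fixes all
  others. The product of the operators \<open>1 - \<kappa>\<^sub>i\<close>, \<open>1 \<le> i \<le> n\<close>, is therefore a projection of the
  \<open>(n+1)\<close>-fold coproduct onto the span \<open>N\<^sub>n\<close> of the monomials involving all the copies \<open>1, \<dots>, n\<close>,
  and its kernel is the span \<open>D\<^sub>n\<close> of the monomials in which one of these copies is missing.

  Since \<open>s\<^sub>i\<close> leaves out the copy \<open>i + 1\<close>, the elements of \<open>D\<^sub>n\<close> are sums of degenerate elements.
  On a monomial in which the copy \<open>b\<close> is missing, the faces \<open>d\<^bsub>b-1\<^esub>\<close> and \<open>d\<^sub>b\<close> agree, so they cancel,
  and the other faces still miss a copy. Thus \<open>D\<close> is the degenerate subcomplex, and \<open>N\<close> maps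
  isomorphically to the quotient.

  In the term of the shuffle product given by a word \<open>c\<close>, the degeneracies applied to the \<open>i\<close>-th factor
  send its copies \<open>1, \<dots>, p\<^sub>i\<close> to the positions of \<open>i\<close> in \<open>c\<close>. These positions partition
  \<open>{1, \<dots>, N}\<close>, so that a product of monomials involves all copies if and only if each of its
  factors does: \<open>N\<close> is closed under products and \<open>D\<close> is an ideal.\<close>

section \<open>Linear algebra\<close>

text \<open>Since \<open>V\<close> is an arbitrary graded module over a commutative ring, there is
  no basis in which monomials could be called independent; moreover the coproduct is given only as a
  quotient of a free algebra on copies of \<open>A\<close>. An identification of the coproduct with
  the free algebra on \<open>n + 1\<close> copies of \<open>V\<close> is therefore never
  constructed. It suffices that the monomials in generators span and that each
  \<open>\<kappa>\<^sub>i\<close> multiplies every monomial by 0 or 1: this separates monomials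
  according to the set of copies that occur in them, and N and D depend on nothing else. Claims
  about faces, degeneracies, differentials and products then become claims about such sets of
  indices.

  The internal differential is arbitrary on generators and may produce a component in
  \<open>O(0)\<close>. Such a constant erases a letter, so the set of copies of a monomial can
  shrink but never grow. This keeps D stable, whereas stability of N is tied to
  \<open>no_constant_terms\<close>. For this reason the compatibility of normalization with
  differentials is established on the whole total complex and only then restricted.\<close>

lemma linI:
  assumes "\<And>x. x \<in> carrier M \<Longrightarrow> f x \<in> carrier N"
    and "\<And>x y. x \<in> carrier M \<Longrightarrow> y \<in> carrier M \<Longrightarrow> f (x \<oplus>\<^bsub>M\<^esub> y) = f x \<oplus>\<^bsub>N\<^esub> f y"
    and "\<And>r x. r \<in> carrier R \<Longrightarrow> x \<in> carrier M \<Longrightarrow> f (r \<odot>\<^bsub>M\<^esub> x) = r \<odot>\<^bsub>N\<^esub> f x"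
  shows "f \<in> lin R M N"
  using assms by (auto simp: lin_def)

lemma lin_closed: "f \<in> lin R M N \<Longrightarrow> x \<in> carrier M \<Longrightarrow> f x \<in> carrier N"
  by (auto simp: lin_def)

lemma lin_add: "f \<in> lin R M N \<Longrightarrow> x \<in> carrier M \<Longrightarrow> y \<in> carrier M \<Longrightarrow> f (x \<oplus>\<^bsub>M\<^esub> y) = f x \<oplus>\<^bsub>N\<^esub> f y"
  by (auto simp: lin_def)

lemma lin_smult: "f \<in> lin R M N \<Longrightarrow> r \<in> carrier R \<Longrightarrow> x \<in> carrier M \<Longrightarrow> f (r \<odot>\<^bsub>M\<^esub> x) = r \<odot>\<^bsub>N\<^esub> f x"
  by (auto simp: lin_def)

lemma lin_hom:
  assumes "f \<in> lin R M N" "module R M" "module R N"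
  shows "abelian_group_hom M N f"
proof -
  interpret M: module R M by fact
  interpret N: module R N by fact
  show ?thesis
    using assms(1) by (intro abelian_group_homI group_hom.intro group_hom_axioms.intro
        M.abelian_group_axioms N.abelian_group_axioms M.a_group N.a_group)
      (auto simp: hom_def lin_def)
qed

lemma lin_zero: "f \<in> lin R M N \<Longrightarrow> module R M \<Longrightarrow> module R N \<Longrightarrow> f \<zero>\<^bsub>M\<^esub> = \<zero>\<^bsub>N\<^esub>"
  using abelian_group_hom.hom_zero[OF lin_hom] by blast

lemma lin_neg: "f \<in> lin R M N \<Longrightarrow> module R M \<Longrightarrow> module R N \<Longrightarrow> x \<in> carrier M \<Longrightarrow> f (\<ominus>\<^bsub>M\<^esub> x) = \<ominus>\<^bsub>N\<^esub> f x"
  by (rule abelian_group_hom.hom_a_inv[OF lin_hom])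

lemma module_neg_closed: "module R M \<Longrightarrow> x \<in> carrier M \<Longrightarrow> \<ominus>\<^bsub>M\<^esub> x \<in> carrier M"
  using abelian_group.a_inv_closed[OF module.axioms(2)] .

lemma module_zero_closed: "module R M \<Longrightarrow> \<zero>\<^bsub>M\<^esub> \<in> carrier M"
  using abelian_monoid.zero_closed[OF abelian_group.axioms(1)[OF module.axioms(2)]] .

lemma module_add_closed: "module R M \<Longrightarrow> x \<in> carrier M \<Longrightarrow> y \<in> carrier M \<Longrightarrow> x \<oplus>\<^bsub>M\<^esub> y \<in> carrier M"
  using abelian_monoid.a_closed[OF abelian_group.axioms(1)[OF module.axioms(2)]] .

lemma module_minus_closed: "module R M \<Longrightarrow> x \<in> carrier M \<Longrightarrow> y \<in> carrier M \<Longrightarrow> x \<ominus>\<^bsub>M\<^esub> y \<in> carrier M"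
  by (simp add: a_minus_def module_neg_closed module_add_closed)

lemma module_neg_zero: "module R M \<Longrightarrow> \<ominus>\<^bsub>M\<^esub> \<zero>\<^bsub>M\<^esub> = \<zero>\<^bsub>M\<^esub>"
proof -
  assume "module R M"
  then interpret M: module R M .
  show ?thesis using M.l_neg[of "\<zero>\<^bsub>M\<^esub>"] by simp
qed

lemma module_diff_eq_zero:
  assumes "module R M" "x \<in> carrier M" "y \<in> carrier M"
  shows "x \<ominus>\<^bsub>M\<^esub> y = \<zero>\<^bsub>M\<^esub> \<longleftrightarrow> x = y"
proof -
  interpret M: module R M by fact
  have "x = (x \<ominus>\<^bsub>M\<^esub> y) \<oplus>\<^bsub>M\<^esub> y" using assms by (simp add: M.minus_eq M.a_assoc M.l_neg)
  then show ?thesis using assms by (auto simp: M.minus_eq M.r_neg)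
qed

lemma module_add_zero:
  assumes "module R M" "x \<in> carrier M"
  shows "x \<oplus>\<^bsub>M\<^esub> \<zero>\<^bsub>M\<^esub> = x" "\<zero>\<^bsub>M\<^esub> \<oplus>\<^bsub>M\<^esub> x = x"
proof -
  interpret M: module R M by fact
  show "x \<oplus>\<^bsub>M\<^esub> \<zero>\<^bsub>M\<^esub> = x" "\<zero>\<^bsub>M\<^esub> \<oplus>\<^bsub>M\<^esub> x = x" using assms by auto
qed

lemma lin_minus: "f \<in> lin R M N \<Longrightarrow> module R M \<Longrightarrow> module R N \<Longrightarrow> x \<in> carrier M \<Longrightarrow> y \<in> carrier M \<Longrightarrow>
    f (x \<ominus>\<^bsub>M\<^esub> y) = f x \<ominus>\<^bsub>N\<^esub> f y"
  by (simp add: a_minus_def lin_add lin_neg module_neg_closed)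

lemma lin_sgn: "f \<in> lin R M N \<Longrightarrow> module R M \<Longrightarrow> module R N \<Longrightarrow> x \<in> carrier M \<Longrightarrow>
    f (sgn_mod M e x) = sgn_mod N e (f x)"
  by (simp add: lin_neg)

lemma module_sgn_closed: "module R M \<Longrightarrow> x \<in> carrier M \<Longrightarrow> sgn_mod M e x \<in> carrier M"
  by (simp add: module_neg_closed)

lemma module_finsum_closed:
  "module R M \<Longrightarrow> (\<And>i. i \<in> I \<Longrightarrow> f i \<in> carrier M) \<Longrightarrow> finsum M f I \<in> carrier M"
  using abelian_monoid.finsum_closed[OF abelian_group.axioms(1)[OF module.axioms(2)], of R M f I]
  by auto

lemma module_finsum_cong:
  "module R M \<Longrightarrow> (\<And>i. i \<in> I \<Longrightarrow> f i = g i) \<Longrightarrow> (\<And>i. i \<in> I \<Longrightarrow> g i \<in> carrier M) \<Longrightarrow> finsum M f I = finsum M g I"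
  using abelian_monoid.finsum_cong'[OF abelian_group.axioms(1)[OF module.axioms(2)], of R M I I g f]
  by auto

lemma lin_finsum:
  assumes f: "f \<in> lin R M N" and M: "module R M" and N: "module R N"
    and I: "finite I" "\<And>i. i \<in> I \<Longrightarrow> g i \<in> carrier M"
  shows "f (finsum M g I) = finsum N (\<lambda>i. f (g i)) I"
proof -
  interpret M: module R M by fact
  interpret N: module R N by fact
  show ?thesis using I
  proof (induction I rule: finite_induct)
    case empty
    then show ?case using lin_zero[OF f M N] by simp
  next
    case (insert i I)
    then show ?case using lin_add[OF f] lin_closed[OF f] by (simp add: Pi_def)
  qed
qed

lemma lin_cong: "f \<in> lin R M N \<Longrightarrow> module R M \<Longrightarrow> (\<And>x. x \<in> carrier M \<Longrightarrow> g x = f x) \<Longrightarrow> g \<in> lin R M N"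
  by (rule linI) (auto simp: module.smult_closed lin_closed lin_add lin_smult module_add_closed)

lemma lin_comp: "f \<in> lin R M N \<Longrightarrow> g \<in> lin R N K \<Longrightarrow> (\<lambda>x. g (f x)) \<in> lin R M K"
  by (auto simp: lin_def Pi_def)

lemma lin_id: "(\<lambda>x. x) \<in> lin R M M"
  by (auto simp: lin_def)

lemma lin_const_zero: "module R N \<Longrightarrow> (\<lambda>x. \<zero>\<^bsub>N\<^esub>) \<in> lin R M N"
proof -
  assume N: "module R N"
  interpret N: module R N by fact
  show ?thesis by (rule linI) auto
qed

lemma lin_plus:
  assumes "f \<in> lin R M N" "g \<in> lin R M N" "module R N"
  shows "(\<lambda>x. f x \<oplus>\<^bsub>N\<^esub> g x) \<in> lin R M N"
proof -
  interpret N: module R N by fact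
  show ?thesis
    using assms(1,2) by (intro linI) (auto simp: lin_closed lin_add lin_smult N.a_ac N.smult_r_distr)
qed

lemma lin_uminus:
  assumes "f \<in> lin R M N" "module R N"
  shows "(\<lambda>x. \<ominus>\<^bsub>N\<^esub> f x) \<in> lin R M N"
proof -
  interpret N: module R N by fact
  show ?thesis
    using assms(1) by (intro linI) (auto simp: lin_closed lin_add lin_smult N.minus_add N.smult_r_minus N.a_comm)
qed

lemma lin_sgn_mod: "f \<in> lin R M N \<Longrightarrow> module R N \<Longrightarrow> (\<lambda>x. sgn_mod N e (f x)) \<in> lin R M N"
  using lin_uminus[of f R M N] by (cases "even e") auto

lemma lin_diff: "f \<in> lin R M N \<Longrightarrow> g \<in> lin R M N \<Longrightarrow> module R N \<Longrightarrow> (\<lambda>x. f x \<ominus>\<^bsub>N\<^esub> g x) \<in> lin R M N"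
  unfolding a_minus_def by (intro lin_plus lin_uminus)

lemma lin_scale:
  assumes "f \<in> lin R M N" "module R N" "r \<in> carrier R"
  shows "(\<lambda>x. r \<odot>\<^bsub>N\<^esub> f x) \<in> lin R M N"
proof -
  interpret N: module R N by fact
  show ?thesis
    using assms by (intro linI) (auto simp: lin_closed lin_add lin_smult N.smult_r_distr
        N.smult_assoc1[symmetric] N.R.m_comm)
qed

lemma lin_sum:
  assumes M: "module R M" and N: "module R N" and I: "finite I" "\<And>i. i \<in> I \<Longrightarrow> f i \<in> lin R M N"
  shows "(\<lambda>x. finsum N (\<lambda>i. f i x) I) \<in> lin R M N"
  using I
proof (induction I rule: finite_induct)
  case empty
  interpret N: module R N by fact
  show ?case by (rule linI) auto
next
  case (insert i I)
  interpret N: module R N by fact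
  have "(\<lambda>x. f i x \<oplus>\<^bsub>N\<^esub> finsum N (\<lambda>i. f i x) I) \<in> lin R M N"
    using insert N by (intro lin_plus) auto
  moreover have "finsum N (\<lambda>i. f i x) (insert i I) = f i x \<oplus>\<^bsub>N\<^esub> finsum N (\<lambda>i. f i x) I"
    if "x \<in> carrier M" for x
    using insert that by (subst N.finsum_insert) (auto intro: lin_closed)
  ultimately show ?case
    by (rule lin_cong[OF _ M])
qed

lemma sgn_mod_sgn_mod: "module R M \<Longrightarrow> x \<in> carrier M \<Longrightarrow> sgn_mod M e (sgn_mod M e' x) = sgn_mod M (e + e') x"
  using abelian_group.minus_minus[OF module.axioms(2)] by auto

subsection \<open>Submodules\<close>

lemma submoduleD:
  assumes "module R M" "submodule H R M"
  shows submodule_subset: "H \<subseteq> carrier M"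
    and submodule_zero: "\<zero>\<^bsub>M\<^esub> \<in> H"
    and submodule_neg: "a \<in> H \<Longrightarrow> \<ominus>\<^bsub>M\<^esub> a \<in> H"
    and submodule_add: "a \<in> H \<Longrightarrow> b \<in> H \<Longrightarrow> a \<oplus>\<^bsub>M\<^esub> b \<in> H"
    and submodule_minus: "a \<in> H \<Longrightarrow> b \<in> H \<Longrightarrow> a \<ominus>\<^bsub>M\<^esub> b \<in> H"
    and submodule_smult: "r \<in> carrier R \<Longrightarrow> a \<in> H \<Longrightarrow> r \<odot>\<^bsub>M\<^esub> a \<in> H"
    and submodule_sgn: "a \<in> H \<Longrightarrow> sgn_mod M e a \<in> H"
  using module.submoduleE[OF assms] subgroup.one_closed[OF submodule.axioms(1)[OF assms(2)]]
  by (auto simp: a_minus_def)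

lemma submodule_finsum:
  fixes M :: "('r, 'a) module"
  assumes M: "module R M" and H: "submodule H R M" and "\<And>i. i \<in> I \<Longrightarrow> f i \<in> H"
  shows "finsum M f I \<in> H"
proof (cases "finite I")
  case True
  interpret M: module R M by fact
  show ?thesis using True assms(3)
  proof (induction I rule: finite_induct)
    case (insert i I)
    then show ?case using submoduleD[OF M H] by (subst M.finsum_insert) auto
  qed (use submodule_zero[OF M H] in simp)
next
  case False
  interpret M: module R M by fact
  show ?thesis using False submodule_zero[OF M H] by simp
qed

lemma submodule_sgn_iff:
  assumes "module R M" "submodule H R M" "a \<in> carrier M"
  shows "sgn_mod M e a \<in> H \<longleftrightarrow> a \<in> H"
  using submodule_neg[OF assms(1,2)] abelian_group.minus_minus[OF module.axioms(2)[OF assms(1)] assms(3)]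
  by auto metis

lemma submodule_Inter:
  fixes M :: "('r, 'a) module"
  assumes M: "module R M" and "\<S> \<noteq> {}" "\<And>H. H \<in> \<S> \<Longrightarrow> submodule H R M"
  shows "submodule (\<Inter>\<S>) R M"
proof (rule module.submoduleI[OF M])
  show "\<Inter>\<S> \<subseteq> carrier M" using assms(2) submodule_subset[OF M assms(3)] by blast
qed (auto simp: submodule_zero[OF M] submodule_neg[OF M] submodule_add[OF M] submodule_smult[OF M] assms(3))

lemma submodule_preimage:
  assumes "f \<in> lin R M N" "module R M" "module R N" "submodule H R N"
  shows "submodule {x \<in> carrier M. f x \<in> H} R M"
  using assms submoduleD[OF assms(3,4)]
  by (intro module.submoduleI)
    (auto simp: lin_add lin_smult lin_zero lin_neg module_add_closed module_neg_closed module_zero_closed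
        module.smult_closed)

lemma submodule_Int:
  fixes M :: "('r, 'a) module"
  assumes "module R M" "submodule H R M" "submodule K R M"
  shows "submodule (H \<inter> K) R M"
  using submodule_Inter[OF assms(1), of "{H, K}"] assms by auto

lemma submodule_zero_sub: "module R M \<Longrightarrow> submodule {\<zero>\<^bsub>M\<^esub>} R M"
proof -
  assume M: "module R M"
  interpret M: module R M by fact
  show ?thesis by (rule M.submoduleI) auto
qed

lemma gen_sub_submodule: "module R M \<Longrightarrow> G \<subseteq> carrier M \<Longrightarrow> submodule (gen_sub R M G) R M"
  unfolding gen_sub_def using module.carrier_is_submodule[of R M]
  by (intro submodule_Inter) auto

lemma gen_sub_incl: "G \<subseteq> gen_sub R M G"
  by (auto simp: gen_sub_def)

lemma gen_sub_least: "submodule H R M \<Longrightarrow> G \<subseteq> H \<Longrightarrow> gen_sub R M G \<subseteq> H"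
  by (auto simp: gen_sub_def)

lemma gen_sub_carrier: "module R M \<Longrightarrow> G \<subseteq> carrier M \<Longrightarrow> gen_sub R M G \<subseteq> carrier M"
  by (rule submodule_subset[OF _ gen_sub_submodule])

lemma gen_sub_mono: "G \<subseteq> G' \<Longrightarrow> gen_sub R M G \<subseteq> gen_sub R M G'"
  by (auto simp: gen_sub_def)

text \<open>The preimage of a submodule under a linear map is a submodule, so it contains a span as
  soon as it contains the generators. This takes the place of arguments with bases: most submodules
  below are known only through spanning sets.\<close>

lemma gen_sub_lin:
  assumes "f \<in> lin R M N" "module R M" "module R N" "submodule H R N"
    and "\<And>x. x \<in> G \<Longrightarrow> x \<in> carrier M" "\<And>x. x \<in> G \<Longrightarrow> f x \<in> H" and "x \<in> gen_sub R M G"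
  shows "f x \<in> H"
  using gen_sub_least[OF submodule_preimage[OF assms(1-4)], of G] assms(5-) by blast

lemma gen_sub_lin_eq:
  assumes "f \<in> lin R M N" "g \<in> lin R M N" "module R M" "module R N"
    and "G \<subseteq> carrier M" "\<And>x. x \<in> G \<Longrightarrow> f x = g x" and "x \<in> gen_sub R M G"
  shows "f x = g x"
proof -
  interpret N: module R N by fact
  have "f x \<ominus>\<^bsub>N\<^esub> g x \<in> {\<zero>\<^bsub>N\<^esub>}"
  proof (rule gen_sub_lin[OF lin_diff[OF assms(1,2,4)] assms(3,4) submodule_zero_sub[OF assms(4)] _ _ assms(7)])
    fix x assume "x \<in> G"
    then show "x \<in> carrier M" "f x \<ominus>\<^bsub>N\<^esub> g x \<in> {\<zero>\<^bsub>N\<^esub>}"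
      using assms(5,6) lin_closed[OF assms(1)] lin_closed[OF assms(2)] module_diff_eq_zero[OF assms(4)] by auto
  qed
  moreover have "x \<in> carrier M" using assms gen_sub_carrier by blast
  ultimately show ?thesis
    using assms lin_closed[OF assms(1)] lin_closed[OF assms(2)] module_diff_eq_zero[OF assms(4)] by simp
qed

subsection \<open>Quotient modules\<close>

context
  fixes R :: "'r ring" and M :: "('r, 'a) module" and H :: "'a set"
  assumes M: "module R M" and H: "submodule H R M"
begin

interpretation M: module R M by (rule M)

text \<open>Elements of quotients are sets, and \<open>free_ev\<close> and \<open>quot_alg\<close>
  range over all their members. This turns being a member into a congruence, to which linear
  arguments apply.\<close>

lemma coset_mem_iff: "a \<in> carrier M \<Longrightarrow> b \<in> H +>\<^bsub>M\<^esub> a \<longleftrightarrow> b \<in> carrier M \<and> b \<ominus>\<^bsub>M\<^esub> a \<in> H"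
proof -
  assume a: "a \<in> carrier M"
  have "b \<in> H +>\<^bsub>M\<^esub> a \<longleftrightarrow> (\<exists>h\<in>H. b = h \<oplus>\<^bsub>M\<^esub> a)" by (auto simp: a_r_coset_def')
  also have "\<dots> \<longleftrightarrow> b \<in> carrier M \<and> b \<ominus>\<^bsub>M\<^esub> a \<in> H"
  proof safe
    fix h assume h: "h \<in> H"
    then have hc: "h \<in> carrier M" using submodule_subset[OF M H] by auto
    show "h \<oplus>\<^bsub>M\<^esub> a \<in> carrier M" using hc a by simp
    show "h \<oplus>\<^bsub>M\<^esub> a \<ominus>\<^bsub>M\<^esub> a \<in> H"
      using hc a h by (simp add: M.minus_eq M.a_assoc M.r_neg)
  next
    assume b: "b \<in> carrier M" "b \<ominus>\<^bsub>M\<^esub> a \<in> H"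
    then show "\<exists>h\<in>H. b = h \<oplus>\<^bsub>M\<^esub> a"
      using a by (intro bexI[of _ "b \<ominus>\<^bsub>M\<^esub> a"]) (auto simp: M.minus_eq M.a_assoc M.l_neg)
  qed
  finally show ?thesis .
qed

lemma coset_self: "a \<in> carrier M \<Longrightarrow> a \<in> H +>\<^bsub>M\<^esub> a"
  by (simp add: coset_mem_iff M.minus_eq M.r_neg submodule_zero[OF M H])

lemma coset_eq_iff:
  assumes "a \<in> carrier M" "b \<in> carrier M"
  shows "H +>\<^bsub>M\<^esub> a = H +>\<^bsub>M\<^esub> b \<longleftrightarrow> a \<ominus>\<^bsub>M\<^esub> b \<in> H"
proof
  assume "H +>\<^bsub>M\<^esub> a = H +>\<^bsub>M\<^esub> b"
  then show "a \<ominus>\<^bsub>M\<^esub> b \<in> H" using coset_self[of a] coset_mem_iff[of b a] assms by auto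
next
  assume ab: "a \<ominus>\<^bsub>M\<^esub> b \<in> H"
  have eq: "c \<ominus>\<^bsub>M\<^esub> b = (c \<ominus>\<^bsub>M\<^esub> a) \<oplus>\<^bsub>M\<^esub> (a \<ominus>\<^bsub>M\<^esub> b)" "c \<ominus>\<^bsub>M\<^esub> a = (c \<ominus>\<^bsub>M\<^esub> b) \<ominus>\<^bsub>M\<^esub> (a \<ominus>\<^bsub>M\<^esub> b)"
    if "c \<in> carrier M" for c
  proof -
    show "c \<ominus>\<^bsub>M\<^esub> b = (c \<ominus>\<^bsub>M\<^esub> a) \<oplus>\<^bsub>M\<^esub> (a \<ominus>\<^bsub>M\<^esub> b)"
      using assms that by (simp add: M.minus_eq M.a_assoc M.r_neg2 M.r_neg1)
    show "c \<ominus>\<^bsub>M\<^esub> a = (c \<ominus>\<^bsub>M\<^esub> b) \<ominus>\<^bsub>M\<^esub> (a \<ominus>\<^bsub>M\<^esub> b)"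
      using assms that by (simp add: M.minus_eq M.minus_add M.a_lcomm[of "\<ominus>\<^bsub>M\<^esub> b"] M.a_assoc M.r_neg1 M.l_neg)
  qed
  show "H +>\<^bsub>M\<^esub> a = H +>\<^bsub>M\<^esub> b"
  proof (intro Set.set_eqI)
    fix c
    show "c \<in> H +>\<^bsub>M\<^esub> a \<longleftrightarrow> c \<in> H +>\<^bsub>M\<^esub> b"
      unfolding coset_mem_iff[OF assms(1)] coset_mem_iff[OF assms(2)]
      using eq[of c] submodule_add[OF M H _ ab] submodule_minus[OF M H _ ab] by metis
  qed
qed

lemma coset_zero: "H +>\<^bsub>M\<^esub> \<zero>\<^bsub>M\<^esub> = H"
proof (intro Set.set_eqI)
  fix c show "c \<in> H +>\<^bsub>M\<^esub> \<zero>\<^bsub>M\<^esub> \<longleftrightarrow> c \<in> H"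
    using coset_mem_iff[of "\<zero>\<^bsub>M\<^esub>" c] submodule_subset[OF M H] by (auto simp: M.minus_eq module_neg_zero[OF M])
qed

lemma coset_add:
  assumes "a \<in> carrier M" "b \<in> carrier M"
  shows "(H +>\<^bsub>M\<^esub> a) <+>\<^bsub>M\<^esub> (H +>\<^bsub>M\<^esub> b) = H +>\<^bsub>M\<^esub> (a \<oplus>\<^bsub>M\<^esub> b)"
proof -
  interpret abelian_subgroup H M
    using H by (intro abelian_subgroupI3 additive_subgroupI M.abelian_group_axioms) (auto simp: submodule_def)
  show ?thesis using a_rcos_sum assms by simp
qed

lemma coset_smult:
  assumes r: "r \<in> carrier R" and a: "a \<in> carrier M"
  shows "H <+>\<^bsub>M\<^esub> (\<lambda>x. r \<odot>\<^bsub>M\<^esub> x) ` (H +>\<^bsub>M\<^esub> a) = H +>\<^bsub>M\<^esub> (r \<odot>\<^bsub>M\<^esub> a)"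
proof (intro Set.set_eqI iffI)
  fix c assume "c \<in> H <+>\<^bsub>M\<^esub> (\<lambda>x. r \<odot>\<^bsub>M\<^esub> x) ` (H +>\<^bsub>M\<^esub> a)"
  then obtain h k where hk: "h \<in> H" "k \<in> H" "c = h \<oplus>\<^bsub>M\<^esub> r \<odot>\<^bsub>M\<^esub> (k \<oplus>\<^bsub>M\<^esub> a)"
    by (auto simp: set_add_def' a_r_coset_def')
  then have hkc: "h \<in> carrier M" "k \<in> carrier M" using submodule_subset[OF M H] by auto
  have "c = (h \<oplus>\<^bsub>M\<^esub> r \<odot>\<^bsub>M\<^esub> k) \<oplus>\<^bsub>M\<^esub> r \<odot>\<^bsub>M\<^esub> a"
    using hkc hk r a by (simp add: M.smult_r_distr M.a_assoc)
  moreover have "h \<oplus>\<^bsub>M\<^esub> r \<odot>\<^bsub>M\<^esub> k \<in> H"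
    using hk r submodule_add[OF M H] submodule_smult[OF M H] by auto
  ultimately show "c \<in> H +>\<^bsub>M\<^esub> (r \<odot>\<^bsub>M\<^esub> a)" by (auto simp: a_r_coset_def')
next
  fix c assume "c \<in> H +>\<^bsub>M\<^esub> (r \<odot>\<^bsub>M\<^esub> a)"
  then obtain h where "h \<in> H" "c = h \<oplus>\<^bsub>M\<^esub> r \<odot>\<^bsub>M\<^esub> a" by (auto simp: a_r_coset_def')
  then show "c \<in> H <+>\<^bsub>M\<^esub> (\<lambda>x. r \<odot>\<^bsub>M\<^esub> x) ` (H +>\<^bsub>M\<^esub> a)"
    using coset_self[OF a] by (auto simp: set_add_def')
qed

lemma quot_carrier: "carrier (quot_mod M H) = (\<lambda>a. H +>\<^bsub>M\<^esub> a) ` carrier M"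
  by (auto simp: quot_mod_def A_RCOSETS_def')

lemma quot_add: "a \<in> carrier M \<Longrightarrow> b \<in> carrier M \<Longrightarrow>
    (H +>\<^bsub>M\<^esub> a) \<oplus>\<^bsub>quot_mod M H\<^esub> (H +>\<^bsub>M\<^esub> b) = H +>\<^bsub>M\<^esub> (a \<oplus>\<^bsub>M\<^esub> b)"
  by (simp add: quot_mod_def coset_add)

lemma quot_smult: "r \<in> carrier R \<Longrightarrow> a \<in> carrier M \<Longrightarrow>
    r \<odot>\<^bsub>quot_mod M H\<^esub> (H +>\<^bsub>M\<^esub> a) = H +>\<^bsub>M\<^esub> (r \<odot>\<^bsub>M\<^esub> a)"
  by (simp add: quot_mod_def coset_smult)

lemma quot_zero: "\<zero>\<^bsub>quot_mod M H\<^esub> = H +>\<^bsub>M\<^esub> \<zero>\<^bsub>M\<^esub>"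
  by (simp add: coset_zero) (simp add: quot_mod_def)

lemma quot_module: "module R (quot_mod M H)"
proof (rule moduleI)
  show "cring R" by (rule M.R.is_cring)
  show "abelian_group (quot_mod M H)"
  proof (rule abelian_groupI)
    fix x assume "x \<in> carrier (quot_mod M H)"
    then obtain a where a: "a \<in> carrier M" "x = H +>\<^bsub>M\<^esub> a" by (auto simp: quot_carrier)
    then show "\<exists>y\<in>carrier (quot_mod M H). y \<oplus>\<^bsub>quot_mod M H\<^esub> x = \<zero>\<^bsub>quot_mod M H\<^esub>"
      by (intro bexI[of _ "H +>\<^bsub>M\<^esub> (\<ominus>\<^bsub>M\<^esub> a)"]) (auto simp: quot_carrier quot_add quot_zero M.l_neg)
  qed (auto simp: quot_carrier quot_add quot_zero M.a_ac)
qed (auto simp: quot_carrier quot_add quot_smult M.smult_l_distr M.smult_r_distr M.smult_assoc1)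

lemma coset_lin: "(\<lambda>a. H +>\<^bsub>M\<^esub> a) \<in> lin R M (quot_mod M H)"
  by (rule linI) (auto simp: quot_carrier quot_add quot_smult)

lemma coset_eq_zero_iff: "a \<in> carrier M \<Longrightarrow> H +>\<^bsub>M\<^esub> a = \<zero>\<^bsub>quot_mod M H\<^esub> \<longleftrightarrow> a \<in> H"
  by (simp add: quot_zero coset_eq_iff M.minus_eq module_neg_zero[OF M])

text \<open>\<open>induced\<close> returns the common value on a coset and is meaningful only if
  there is one. Vanishing on \<open>H\<close> provides it, because two members of a coset differ by
  an element of \<open>H\<close>.\<close>

lemma induced_coset:
  assumes "f \<in> lin R M N" "module R N" "\<And>h. h \<in> H \<Longrightarrow> f h = \<zero>\<^bsub>N\<^esub>" "a \<in> carrier M"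
  shows "induced f (H +>\<^bsub>M\<^esub> a) = f a"
proof -
  interpret N: module R N by fact
  have "f b = f a" if "b \<in> H +>\<^bsub>M\<^esub> a" for b
  proof -
    have "f (b \<ominus>\<^bsub>M\<^esub> a) = \<zero>\<^bsub>N\<^esub>" "b \<in> carrier M" using coset_mem_iff[OF assms(4)] that assms(3) by blast+
    then show ?thesis using lin_minus[OF assms(1) M assms(2), of b a] assms(4)
        lin_closed[OF assms(1)] module_diff_eq_zero[OF assms(2), of "f b" "f a"] by simp
  qed
  then show ?thesis
    unfolding induced_def using coset_self[OF assms(4)] by (intro the_elem_image_unique) blast+
qed

lemma induced_lin:
  assumes "f \<in> lin R M N" "module R N" "\<And>h. h \<in> H \<Longrightarrow> f h = \<zero>\<^bsub>N\<^esub>"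
  shows "induced f \<in> lin R (quot_mod M H) N"
  by (rule linI)
    (auto simp: quot_carrier quot_add quot_smult induced_coset[OF assms] lin_closed[OF assms(1)]
      lin_add[OF assms(1)] lin_smult[OF assms(1)])

lemma quot_gen_sub:
  assumes "G \<subseteq> carrier M" "carrier M \<subseteq> gen_sub R M G"
  shows "carrier (quot_mod M H) \<subseteq> gen_sub R (quot_mod M H) ((\<lambda>a. H +>\<^bsub>M\<^esub> a) ` G)"
proof
  fix X assume "X \<in> carrier (quot_mod M H)"
  then obtain a where a: "a \<in> carrier M" "X = H +>\<^bsub>M\<^esub> a" by (auto simp: quot_carrier)
  have "(\<lambda>a. H +>\<^bsub>M\<^esub> a) a \<in> gen_sub R (quot_mod M H) ((\<lambda>a. H +>\<^bsub>M\<^esub> a) ` G)"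
  proof (rule gen_sub_lin[OF coset_lin M quot_module gen_sub_submodule[OF quot_module]])
    show "(\<lambda>a. H +>\<^bsub>M\<^esub> a) ` G \<subseteq> carrier (quot_mod M H)" using assms by (auto simp: quot_carrier)
    show "a \<in> gen_sub R M G" using a assms by auto
  qed (use assms gen_sub_incl[of "(\<lambda>a. H +>\<^bsub>M\<^esub> a) ` G" R "quot_mod M H"] in auto)
  then show "X \<in> gen_sub R (quot_mod M H) ((\<lambda>a. H +>\<^bsub>M\<^esub> a) ` G)" using a by simp
qed

end

subsection \<open>Direct sums and free modules\<close>

lemma direct_sum_module:
  assumes "cring R" and M: "\<And>i. i \<in> I \<Longrightarrow> module R (M i)"
  shows "module R (direct_sum I M)"
proof -
  have ag: "abelian_group (M i)" if "i \<in> I" for i using M[OF that] module.axioms by blast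
  note am = abelian_group.axioms(1)[OF ag]
  have fin2: "finite {i \<in> I. f i \<oplus>\<^bsub>M i\<^esub> g i \<noteq> \<zero>\<^bsub>M i\<^esub>}"
    if "finite {i \<in> I. f i \<noteq> \<zero>\<^bsub>M i\<^esub>}" "finite {i \<in> I. g i \<noteq> \<zero>\<^bsub>M i\<^esub>}" for f g
    by (rule finite_subset[OF _ finite_UnI[OF that]])
      (use am in \<open>auto simp: abelian_monoid.l_zero abelian_monoid.zero_closed\<close>)
  have fin1: "finite {i \<in> I. r \<odot>\<^bsub>M i\<^esub> f i \<noteq> \<zero>\<^bsub>M i\<^esub>}"
    if "finite {i \<in> I. f i \<noteq> \<zero>\<^bsub>M i\<^esub>}" "r \<in> carrier R" for f r
    by (rule finite_subset[OF _ that(1)]) (use M that module.smult_r_null in fastforce)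
  have finn: "finite {i \<in> I. \<ominus>\<^bsub>M i\<^esub> f i \<noteq> \<zero>\<^bsub>M i\<^esub>}"
    if "finite {i \<in> I. f i \<noteq> \<zero>\<^bsub>M i\<^esub>}" for f
    by (rule finite_subset[OF _ that(1)]) (use M module_neg_zero in fastforce)
  show ?thesis
  proof (rule moduleI)
    show "abelian_group (direct_sum I M)"
    proof (rule abelian_groupI)
      fix f assume "f \<in> carrier (direct_sum I M)"
      then show "\<exists>g\<in>carrier (direct_sum I M). g \<oplus>\<^bsub>direct_sum I M\<^esub> f = \<zero>\<^bsub>direct_sum I M\<^esub>"
        using ag by (intro bexI[of _ "\<lambda>i\<in>I. \<ominus>\<^bsub>M i\<^esub> f i"])
          (auto simp: direct_sum_def PiE_def Pi_def abelian_group.l_neg abelian_group.a_inv_closed finn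
            intro!: restrict_ext cong: conj_cong)
    qed (auto simp: direct_sum_def fin2 fun_eq_iff abelian_monoid.r_zero restrict_def PiE_def Pi_def extensional_def am
        abelian_monoid.a_closed abelian_monoid.zero_closed abelian_monoid.l_zero abelian_monoid.a_assoc
        abelian_monoid.a_comm abelian_monoid.a_lcomm cong: conj_cong)
  qed (use assms in \<open>auto simp: direct_sum_def fin1 fun_eq_iff restrict_def PiE_def Pi_def extensional_def
        module.smult_closed[OF M] module.smult_l_distr[OF M] module.smult_r_distr[OF M]
        module.smult_assoc1[OF M] module.smult_one[OF M] cong: conj_cong\<close>)
qed

lemma direct_sum_carrier:
  "f \<in> carrier (direct_sum I M) \<longleftrightarrow> f \<in> (\<Pi>\<^sub>E i\<in>I. carrier (M i)) \<and> finite {i \<in> I. f i \<noteq> \<zero>\<^bsub>M i\<^esub>}"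
  by (simp add: direct_sum_def)

lemma direct_sum_add: "i \<in> I \<Longrightarrow> (f \<oplus>\<^bsub>direct_sum I M\<^esub> g) i = f i \<oplus>\<^bsub>M i\<^esub> g i"
  by (simp add: direct_sum_def)

lemma direct_sum_smult: "i \<in> I \<Longrightarrow> (r \<odot>\<^bsub>direct_sum I M\<^esub> f) i = r \<odot>\<^bsub>M i\<^esub> f i"
  by (simp add: direct_sum_def)

lemma direct_sum_eval_lin: "i \<in> I \<Longrightarrow> (\<lambda>f. f i) \<in> lin R (direct_sum I M) (M i)"
  by (rule linI) (auto simp: direct_sum_add direct_sum_smult direct_sum_carrier)

lemma direct_sum_ext: "f \<in> carrier (direct_sum I M) \<Longrightarrow> g \<in> carrier (direct_sum I M) \<Longrightarrow>
    (\<And>i. i \<in> I \<Longrightarrow> f i = g i) \<Longrightarrow> f = g"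
  by (auto simp: direct_sum_carrier PiE_def extensional_def fun_eq_iff) metis

lemma single_apply: "j \<in> I \<Longrightarrow> single I M i x j = (if j = i then x else \<zero>\<^bsub>M j\<^esub>)"
  by (simp add: single_def)

lemma single_lin:
  assumes M: "\<And>i. i \<in> I \<Longrightarrow> module R (M i)" and i: "i \<in> I"
  shows "single I M i \<in> lin R (M i) (direct_sum I M)"
proof (rule linI)
  note am = abelian_group.axioms(1)[OF module.axioms(2)[OF M]]
  fix x assume x: "x \<in> carrier (M i)"
  have "finite {j \<in> I. single I M i x j \<noteq> \<zero>\<^bsub>M j\<^esub>}"
    by (rule finite_subset[of _ "{i}"]) (auto simp: single_def)
  then show "single I M i x \<in> carrier (direct_sum I M)"
    using x am by (auto simp: direct_sum_carrier single_def abelian_monoid.zero_closed)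
qed (use M in \<open>auto simp: single_def direct_sum_def fun_eq_iff restrict_def
    module_add_zero[OF M] module_zero_closed[OF M] module.smult_r_null[OF M]\<close>)

text \<open>An element is the finite sum of its components. The induction enlarges a truncation of
  \<open>f\<close> by one index of the support at a time, which avoids a \<open>finsum\<close> taken
  inside the direct sum.\<close>

lemma direct_sum_single_mem:
  assumes R: "cring R" and M: "\<And>i. i \<in> I \<Longrightarrow> module R (M i)"
    and H: "submodule H R (direct_sum I M)" and f: "f \<in> carrier (direct_sum I M)"
    and single: "\<And>i. i \<in> I \<Longrightarrow> single I M i (f i) \<in> H"
  shows "f \<in> H"
proof -
  have D: "module R (direct_sum I M)" by (rule direct_sum_module[OF R M])
  note am = abelian_group.axioms(1)[OF module.axioms(2)[OF M]]
  have fI: "f i \<in> carrier (M i)" if "i \<in> I" for i using f that by (auto simp: direct_sum_carrier)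
  have part: "(\<lambda>i\<in>I. if i \<in> F then f i else \<zero>\<^bsub>M i\<^esub>) \<in> H" if "finite F" "F \<subseteq> I" for F
    using that
  proof (induction F rule: finite_induct)
    case empty
    have "(\<lambda>i\<in>I. \<zero>\<^bsub>M i\<^esub>) = \<zero>\<^bsub>direct_sum I M\<^esub>" by (simp add: direct_sum_def)
    then show ?case using submodule_zero[OF D H] by simp
  next
    case (insert j F)
    have eq: "(\<lambda>i\<in>I. if i \<in> insert j F then f i else \<zero>\<^bsub>M i\<^esub>) =
        single I M j (f j) \<oplus>\<^bsub>direct_sum I M\<^esub> (\<lambda>i\<in>I. if i \<in> F then f i else \<zero>\<^bsub>M i\<^esub>)"
      using insert fI am by (auto simp: direct_sum_def single_def fun_eq_iff restrict_def
          abelian_monoid.l_zero abelian_monoid.r_zero abelian_monoid.zero_closed subset_iff)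
    have "single I M j (f j) \<in> H" using insert single by auto
    moreover have "(\<lambda>i\<in>I. if i \<in> F then f i else \<zero>\<^bsub>M i\<^esub>) \<in> H" using insert.IH insert.prems by blast
    ultimately show ?case unfolding eq by (rule submodule_add[OF D H])
  qed
  have "f = (\<lambda>i\<in>I. if i \<in> {i \<in> I. f i \<noteq> \<zero>\<^bsub>M i\<^esub>} then f i else \<zero>\<^bsub>M i\<^esub>)"
    using f by (auto simp: direct_sum_carrier fun_eq_iff restrict_def PiE_def extensional_def)
  then show ?thesis using part[of "{i \<in> I. f i \<noteq> \<zero>\<^bsub>M i\<^esub>}"] f by (auto simp: direct_sum_carrier)
qed

lemma self_module: "cring R \<Longrightarrow> module R (self_mod R)"
proof -
  assume "cring R"
  then interpret R: cring R .
  have "\<exists>y\<in>carrier R. y \<oplus>\<^bsub>R\<^esub> x = \<zero>\<^bsub>R\<^esub>" if "x \<in> carrier R" for x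
    using that R.l_neg by blast
  then show ?thesis
    by (intro moduleI abelian_groupI \<open>cring R\<close>)
      (auto simp: self_mod_def R.l_distr R.r_distr R.m_assoc R.a_ac)
qed

lemma free_module: "cring R \<Longrightarrow> module R (free_mod R S)"
  unfolding free_mod_def by (intro direct_sum_module self_module)

lemma free_mod_carrier: "f \<in> carrier (free_mod R S) \<longleftrightarrow> f \<in> (\<Pi>\<^sub>E s\<in>S. carrier R) \<and> finite {s \<in> S. f s \<noteq> \<zero>\<^bsub>R\<^esub>}"
  by (simp add: free_mod_def direct_sum_carrier self_mod_def)

lemma basis_el_carrier: "cring R \<Longrightarrow> s \<in> S \<Longrightarrow> basis_el R S s \<in> carrier (free_mod R S)"
  unfolding basis_el_def free_mod_def
  by (rule lin_closed[OF single_lin[OF self_module]]) (auto simp: self_mod_def cring_def ring_def monoid.one_closed)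

lemma free_mod_gen:
  assumes R: "cring R"
  shows "carrier (free_mod R S) \<subseteq> gen_sub R (free_mod R S) (basis_el R S ` S)"
proof
  interpret cring R by fact
  fix f assume f: "f \<in> carrier (free_mod R S)"
  have H: "submodule (gen_sub R (free_mod R S) (basis_el R S ` S)) R (free_mod R S)"
    by (rule gen_sub_submodule[OF free_module[OF R]]) (use basis_el_carrier[OF R] in auto)
  show "f \<in> gen_sub R (free_mod R S) (basis_el R S ` S)"
    unfolding free_mod_def
  proof (rule direct_sum_single_mem[OF R self_module[OF R] H[unfolded free_mod_def] f[unfolded free_mod_def]])
    fix s assume s: "s \<in> S"
    have fs: "f s \<in> carrier R" using f s by (auto simp: free_mod_carrier)
    have "single S (\<lambda>_. self_mod R) s (f s \<odot>\<^bsub>self_mod R\<^esub> \<one>\<^bsub>R\<^esub>) = f s \<odot>\<^bsub>free_mod R S\<^esub> basis_el R S s"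
      unfolding basis_el_def free_mod_def using fs s
      by (intro lin_smult[OF single_lin[OF self_module[OF R]]]) (auto simp: self_mod_def)
    then have "single S (\<lambda>_. self_mod R) s (f s) = f s \<odot>\<^bsub>free_mod R S\<^esub> basis_el R S s"
      using fs by (simp add: self_mod_def)
    then show "single S (\<lambda>_. self_mod R) s (f s) \<in> gen_sub R (direct_sum S (\<lambda>_. self_mod R)) (basis_el R S ` S)"
      using submodule_smult[OF free_module[OF R] H fs] gen_sub_incl[of "basis_el R S ` S" R "free_mod R S"] s
      by (auto simp: free_mod_def)
  qed
qed

text \<open>\<open>lin_ext\<close> sums over the exact support, which changes under addition and
  scaling. Terms with coefficient zero may be added, so that several functions can be summed over
  one common finite set.\<close>

lemma lin_ext_superset:
  assumes M: "module R M" and \<phi>: "\<And>s. s \<in> S \<Longrightarrow> \<phi> s \<in> carrier M" and f: "f \<in> carrier (free_mod R S)"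
    and T: "finite T" "T \<subseteq> S" "{s \<in> S. f s \<noteq> \<zero>\<^bsub>R\<^esub>} \<subseteq> T"
  shows "lin_ext R S M \<phi> f = (\<Oplus>\<^bsub>M\<^esub>s\<in>T. f s \<odot>\<^bsub>M\<^esub> \<phi> s)"
proof -
  interpret M: module R M by fact
  have "(\<lambda>s. f s \<odot>\<^bsub>M\<^esub> \<phi> s) \<in> T \<rightarrow> carrier M"
    using T f \<phi> by (auto simp: free_mod_carrier PiE_def Pi_def subset_iff)
  then show ?thesis unfolding lin_ext_def
    by (intro M.add.finprod_mono_neutral_cong_left) (use T \<phi> in \<open>auto\<close>)
qed

lemma lin_ext_lin:
  assumes M: "module R M" and \<phi>: "\<And>s. s \<in> S \<Longrightarrow> \<phi> s \<in> carrier M"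
  shows "lin_ext R S M \<phi> \<in> lin R (free_mod R S) M"
proof (rule linI)
  interpret M: module R M by fact
  note F = free_module[OF M.R.is_cring, of S]
  note supp = lin_ext_superset[OF M \<phi>]
  fix f assume f: "f \<in> carrier (free_mod R S)"
  have fc: "f s \<in> carrier R" if "s \<in> S" for s using f that by (auto simp: free_mod_carrier)
  show "lin_ext R S M \<phi> f \<in> carrier M"
    unfolding lin_ext_def by (rule M.finsum_closed) (use \<phi> fc in auto)
  {
    fix g assume g: "g \<in> carrier (free_mod R S)"
    have gc: "g s \<in> carrier R" if "s \<in> S" for s using g that by (auto simp: free_mod_carrier)
    let ?T = "{s \<in> S. f s \<noteq> \<zero>\<^bsub>R\<^esub>} \<union> {s \<in> S. g s \<noteq> \<zero>\<^bsub>R\<^esub>}"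
    have T: "finite ?T" "?T \<subseteq> S" using f g by (auto simp: free_mod_carrier)
    have fg: "(f \<oplus>\<^bsub>free_mod R S\<^esub> g) s = f s \<oplus>\<^bsub>R\<^esub> g s" if "s \<in> S" for s
      using that by (simp add: free_mod_def direct_sum_add) (simp add: self_mod_def)
    have "lin_ext R S M \<phi> (f \<oplus>\<^bsub>free_mod R S\<^esub> g) = (\<Oplus>\<^bsub>M\<^esub>s\<in>?T. (f \<oplus>\<^bsub>free_mod R S\<^esub> g) s \<odot>\<^bsub>M\<^esub> \<phi> s)"
      by (rule supp) (use T f g F in \<open>auto simp: fg intro: module_add_closed\<close>)
    also have "\<dots> = (\<Oplus>\<^bsub>M\<^esub>s\<in>?T. f s \<odot>\<^bsub>M\<^esub> \<phi> s \<oplus>\<^bsub>M\<^esub> g s \<odot>\<^bsub>M\<^esub> \<phi> s)"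
      by (rule M.finsum_cong') (use fc gc \<phi> in \<open>auto simp: fg M.smult_l_distr\<close>)
    also have "\<dots> = (\<Oplus>\<^bsub>M\<^esub>s\<in>?T. f s \<odot>\<^bsub>M\<^esub> \<phi> s) \<oplus>\<^bsub>M\<^esub> (\<Oplus>\<^bsub>M\<^esub>s\<in>?T. g s \<odot>\<^bsub>M\<^esub> \<phi> s)"
      by (rule M.finsum_addf) (use fc gc \<phi> in auto)
    also have "(\<Oplus>\<^bsub>M\<^esub>s\<in>?T. f s \<odot>\<^bsub>M\<^esub> \<phi> s) = lin_ext R S M \<phi> f"
      by (rule supp[symmetric]) (use T f in auto)
    also have "(\<Oplus>\<^bsub>M\<^esub>s\<in>?T. g s \<odot>\<^bsub>M\<^esub> \<phi> s) = lin_ext R S M \<phi> g"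
      by (rule supp[symmetric]) (use T g in auto)
    finally show "lin_ext R S M \<phi> (f \<oplus>\<^bsub>free_mod R S\<^esub> g) = lin_ext R S M \<phi> f \<oplus>\<^bsub>M\<^esub> lin_ext R S M \<phi> g" .
  }
  fix r assume r: "r \<in> carrier R"
  have rf: "(r \<odot>\<^bsub>free_mod R S\<^esub> f) s = r \<otimes>\<^bsub>R\<^esub> f s" if "s \<in> S" for s
    using that by (simp add: free_mod_def direct_sum_smult) (simp add: self_mod_def)
  have T: "finite {s \<in> S. f s \<noteq> \<zero>\<^bsub>R\<^esub>}" using f by (auto simp: free_mod_carrier)
  have "lin_ext R S M \<phi> (r \<odot>\<^bsub>free_mod R S\<^esub> f) =
      (\<Oplus>\<^bsub>M\<^esub>s\<in>{s \<in> S. f s \<noteq> \<zero>\<^bsub>R\<^esub>}. (r \<odot>\<^bsub>free_mod R S\<^esub> f) s \<odot>\<^bsub>M\<^esub> \<phi> s)"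
    by (rule supp) (use T f r F in \<open>auto simp: rf intro: module.smult_closed\<close>)
  also have "\<dots> = (\<Oplus>\<^bsub>M\<^esub>s\<in>{s \<in> S. f s \<noteq> \<zero>\<^bsub>R\<^esub>}. r \<odot>\<^bsub>M\<^esub> (f s \<odot>\<^bsub>M\<^esub> \<phi> s))"
    by (rule M.finsum_cong') (use fc r \<phi> in \<open>auto simp: rf M.smult_assoc1\<close>)
  also have "\<dots> = r \<odot>\<^bsub>M\<^esub> lin_ext R S M \<phi> f"
    unfolding lin_ext_def by (rule M.finsum_smult_ldistr[symmetric]) (use T r fc \<phi> in auto)
  finally show "lin_ext R S M \<phi> (r \<odot>\<^bsub>free_mod R S\<^esub> f) = r \<odot>\<^bsub>M\<^esub> lin_ext R S M \<phi> f" .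
qed

lemma lin_ext_basis:
  assumes M: "module R M" and \<phi>: "\<And>s. s \<in> S \<Longrightarrow> \<phi> s \<in> carrier M" and s: "s \<in> S"
  shows "lin_ext R S M \<phi> (basis_el R S s) = \<phi> s"
proof -
  interpret M: module R M by fact
  have "lin_ext R S M \<phi> (basis_el R S s) = (\<Oplus>\<^bsub>M\<^esub>t\<in>{s}. basis_el R S s t \<odot>\<^bsub>M\<^esub> \<phi> t)"
    by (rule lin_ext_superset[OF M \<phi>])
      (use s basis_el_carrier[OF M.R.is_cring s] in \<open>auto simp: basis_el_def single_def self_mod_def split: if_splits\<close>)
  also have "\<dots> = \<phi> s" using s \<phi> by (simp add: basis_el_def single_def)
  finally show ?thesis .
qed

text \<open>Here the coefficients are fixed and the values on the basis elements depend linearly on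
  a parameter. This serves the later slots of an iterated linear extension, as in
  \<open>msum_multilin\<close>.\<close>

lemma lin_ext_lin_param:
  assumes M: "module R M" and N: "module R N" and f: "f \<in> carrier (free_mod R S)"
    and h: "\<And>s. s \<in> S \<Longrightarrow> h s \<in> lin R N M"
  shows "(\<lambda>u. lin_ext R S M (\<lambda>s. h s u) f) \<in> lin R N M"
proof -
  interpret M: module R M by fact
  show ?thesis unfolding lin_ext_def
    by (rule lin_sum[OF N M]) (use f h M in \<open>auto simp: free_mod_carrier intro!: lin_scale\<close>)
qed

section \<open>Multilinear maps on lists of homogeneous elements\<close>

lemma El_iff: "a \<in> El M \<longleftrightarrow> snd a \<in> carrier (M (fst a))"
  by (cases a) (auto simp: El_def)

lemma El_nth: "set as \<subseteq> El M \<Longrightarrow> i < length as \<Longrightarrow> snd (as ! i) \<in> carrier (M (fst (as ! i)))"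
  using El_iff[of "as ! i" M] nth_mem[of i as] by blast

lemma degs_nth: "degs as = qs \<Longrightarrow> i < length as \<Longrightarrow> fst (as ! i) = qs ! i"
  by auto

lemma degs_length: "degs as = qs \<Longrightarrow> length as = length qs"
  by auto

text \<open>The degrees of the arguments are prescribed by \<open>qs\<close>: the module in which a
  graded operation takes its value depends on them, and additivity makes sense only within one
  degree.\<close>

definition multilin :: "'r ring \<Rightarrow> ('r, 'a) grmod \<Rightarrow> ('r, 'b) module \<Rightarrow> int list
    \<Rightarrow> ('a gel list \<Rightarrow> 'b) \<Rightarrow> bool"
  where "multilin R M N qs g \<longleftrightarrow> (\<forall>as. set as \<subseteq> El M \<and> degs as = qs \<longrightarrow> g as \<in> carrier N \<and>
    (\<forall>i<length as. (\<lambda>u. g (as[i := (fst (as ! i), u)])) \<in> lin R (M (fst (as ! i))) N))"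

lemma multilinI:
  assumes "\<And>as. set as \<subseteq> El M \<Longrightarrow> degs as = qs \<Longrightarrow> g as \<in> carrier N"
    and "\<And>as i. set as \<subseteq> El M \<Longrightarrow> degs as = qs \<Longrightarrow> i < length as \<Longrightarrow>
      (\<lambda>u. g (as[i := (fst (as ! i), u)])) \<in> lin R (M (fst (as ! i))) N"
  shows "multilin R M N qs g"
  using assms by (auto simp: multilin_def)

lemma multilin_closed: "multilin R M N qs g \<Longrightarrow> set as \<subseteq> El M \<Longrightarrow> degs as = qs \<Longrightarrow> g as \<in> carrier N"
  by (auto simp: multilin_def)

lemma multilin_lin: "multilin R M N qs g \<Longrightarrow> set as \<subseteq> El M \<Longrightarrow> degs as = qs \<Longrightarrow> i < length as \<Longrightarrow>
    (\<lambda>u. g (as[i := (fst (as ! i), u)])) \<in> lin R (M (fst (as ! i))) N"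
  by (auto simp: multilin_def)

lemma degs_update: "degs (as[i := (fst (as ! i), u)]) = degs as"
  by (simp add: map_update list_update_same_conv nth_equalityI) (metis list_update_id map_update)

lemma El_update: "set as \<subseteq> El M \<Longrightarrow> snd a \<in> carrier (M (fst a)) \<Longrightarrow> set (as[i := a]) \<subseteq> El M"
  using set_update_subset_insert[of as i a] by (auto simp: El_iff)

lemma multilin_zero:
  assumes g: "multilin R M N qs g" and M: "\<And>q. module R (M q)" and N: "module R N"
    and as: "set as \<subseteq> El M" "degs as = qs" "i < length as" "snd (as ! i) = \<zero>\<^bsub>M (fst (as ! i))\<^esub>"
  shows "g as = \<zero>\<^bsub>N\<^esub>"
proof -
  have "g (as[i := (fst (as ! i), \<zero>\<^bsub>M (fst (as ! i))\<^esub>)]) = \<zero>\<^bsub>N\<^esub>"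
    by (rule lin_zero[OF multilin_lin[OF g as(1-3)] M N])
  then show ?thesis using as(4) by (metis list_update_id prod.collapse)
qed

text \<open>Generators are replaced by arbitrary elements of their spans one slot at a time, each
  replacement being an instance of \<open>gen_sub_lin\<close>. The sets \<open>G i\<close> may
  differ from slot to slot; a singleton freezes its slot at a given element.\<close>

lemma multilin_gen_sub:
  assumes g: "multilin R M N qs g" and M: "\<And>q. module R (M q)" and N: "module R N"
    and H: "submodule H R N"
    and G: "\<And>i. i < length qs \<Longrightarrow> G i \<subseteq> carrier (M (qs ! i))"
    and gens: "\<And>as. set as \<subseteq> El M \<Longrightarrow> degs as = qs \<Longrightarrow> (\<And>i. i < length qs \<Longrightarrow> snd (as ! i) \<in> G i) \<Longrightarrow> g as \<in> H"
    and as: "degs as = qs" "\<And>i. i < length qs \<Longrightarrow> snd (as ! i) \<in> gen_sub R (M (qs ! i)) (G i)"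
  shows "g as \<in> H"
proof -
  have El: "set bs \<subseteq> El M"
    if b: "degs bs = qs" and bG: "\<And>i. i < length qs \<Longrightarrow> snd (bs ! i) \<in> gen_sub R (M (qs ! i)) (G i)" for bs
  proof
    fix b assume "b \<in> set bs"
    then obtain i where i: "i < length bs" "b = bs ! i" by (auto simp: in_set_conv_nth)
    then have iq: "i < length qs" "fst b = qs ! i" using b by auto
    then show "b \<in> El M"
      using bG[OF iq(1)] gen_sub_carrier[OF M G[OF iq(1)]] i by (auto simp: El_iff)
  qed
  have incl: "u \<in> gen_sub R (M (qs ! i)) (G i)" if "u \<in> G i" for u i
    by (rule subsetD[OF gen_sub_incl that])
  \<comment> \<open>Hybrid statement for the induction: slots before \<open>j\<close> range over the
    spans, the remaining ones over generators only.\<close>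
  have "\<forall>bs. degs bs = qs \<and> (\<forall>i<length qs. snd (bs ! i) \<in> (if i < j then gen_sub R (M (qs ! i)) (G i) else G i))
      \<longrightarrow> g bs \<in> H" for j
  proof (induction j)
    case 0
    show ?case
    proof (intro allI impI, elim conjE)
      fix bs assume bs: "degs bs = qs"
        "\<forall>i<length qs. snd (bs ! i) \<in> (if i < 0 then gen_sub R (M (qs ! i)) (G i) else G i)"
      then have "set bs \<subseteq> El M" using El[OF bs(1)] incl by auto
      then show "g bs \<in> H" using bs by (intro gens) auto
    qed
  next
    case (Suc j)
    show ?case
    proof (intro allI impI, elim conjE)
      fix bs assume bs: "degs bs = qs"
        "\<forall>i<length qs. snd (bs ! i) \<in> (if i < Suc j then gen_sub R (M (qs ! i)) (G i) else G i)"
      show "g bs \<in> H"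
      proof (cases "j < length qs")
        case False
        then show ?thesis using Suc bs by (auto simp: less_Suc_eq)
      next
        case j: True
        have bsE: "set bs \<subseteq> El M"
          using El[OF bs(1)] bs(2) incl by metis
        have jb: "j < length bs" "fst (bs ! j) = qs ! j" using j bs by auto
        let ?f = "\<lambda>u. g (bs[j := (fst (bs ! j), u)])"
        have "?f (snd (bs ! j)) \<in> H"
        proof (rule gen_sub_lin[OF multilin_lin[OF g bsE bs(1) jb(1)] M N H])
          show "snd (bs ! j) \<in> gen_sub R (M (fst (bs ! j))) (G j)" using bs(2) j jb by auto
          fix u assume u: "u \<in> G j"
          show "u \<in> carrier (M (fst (bs ! j)))" using G[OF j] u jb by auto
          have "snd (bs[j := (fst (bs ! j), u)] ! i) \<in> (if i < j then gen_sub R (M (qs ! i)) (G i) else G i)"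
            if "i < length qs" for i
            using bs(2)[rule_format, OF that] u jb that by (cases "i = j") (auto split: if_splits)
          then show "?f u \<in> H"
            using Suc.IH degs_update[of bs j u] bs(1) by blast
        qed
        then show ?thesis by simp
      qed
    qed
  qed
  from this[of "length qs"] show ?thesis using as by auto
qed

lemma multilin_diff:
  "multilin R M N qs f \<Longrightarrow> multilin R M N qs g \<Longrightarrow> module R N \<Longrightarrow> multilin R M N qs (\<lambda>as. f as \<ominus>\<^bsub>N\<^esub> g as)"
  by (intro multilinI lin_diff module_minus_closed) (auto intro: multilin_closed multilin_lin)

lemma multilin_eq:
  assumes f: "multilin R M N qs f" and g: "multilin R M N qs g"
    and M: "\<And>q. module R (M q)" and N: "module R N"
    and G: "\<And>i. i < length qs \<Longrightarrow> G i \<subseteq> carrier (M (qs ! i))"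
    and gens: "\<And>as. set as \<subseteq> El M \<Longrightarrow> degs as = qs \<Longrightarrow> (\<And>i. i < length qs \<Longrightarrow> snd (as ! i) \<in> G i) \<Longrightarrow> f as = g as"
    and as: "set as \<subseteq> El M" "degs as = qs" "\<And>i. i < length qs \<Longrightarrow> snd (as ! i) \<in> gen_sub R (M (qs ! i)) (G i)"
  shows "f as = g as"
proof -
  have "f as \<ominus>\<^bsub>N\<^esub> g as \<in> {\<zero>\<^bsub>N\<^esub>}"
    by (rule multilin_gen_sub[OF multilin_diff[OF f g N] M N submodule_zero_sub[OF N] G _ as(2,3)])
      (simp_all add: gens module_diff_eq_zero[OF N] multilin_closed[OF g])
  then show ?thesis
    using module_diff_eq_zero[OF N multilin_closed[OF f as(1,2)] multilin_closed[OF g as(1,2)]] by simp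
qed

text \<open>Passing from \<open>as\<close> to \<open>bs\<close> slot by slot changes
  \<open>g\<close> by its value on a list that has the difference in the current slot, and these
  values lie in \<open>H\<close>. With \<open>H\<close> zero this is independence of representatives
  for products of cosets; with \<open>H\<close> an ideal it is the same modulo the ideal.\<close>

lemma multilin_cong:
  assumes g: "multilin R M N qs g" and M: "\<And>q. module R (M q)" and N: "module R N"
    and H: "submodule H R N"
    and K: "\<And>cs i. set cs \<subseteq> El M \<Longrightarrow> degs cs = qs \<Longrightarrow> i < length qs \<Longrightarrow> snd (cs ! i) \<in> K i \<Longrightarrow> g cs \<in> H"
    and as: "set as \<subseteq> El M" "degs as = qs" and bs: "set bs \<subseteq> El M" "degs bs = qs"
    and ab: "\<And>i. i < length qs \<Longrightarrow> snd (as ! i) \<ominus>\<^bsub>M (qs ! i)\<^esub> snd (bs ! i) \<in> K i"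
  shows "g as \<ominus>\<^bsub>N\<^esub> g bs \<in> H"
proof -
  interpret N: module R N by (rule N)
  have len: "length as = length qs" "length bs = length qs" using degs_length as bs by blast+
  define c where "c j = take j bs @ drop j as" for j
  have cE: "set (c j) \<subseteq> El M" for j
    using as bs set_take_subset[of j bs] set_drop_subset[of j as] by (auto simp: c_def)
  have cd: "degs (c j) = qs" for j
    by (simp add: c_def take_map[symmetric] drop_map[symmetric] as(2) bs(2))
  have gc: "g (c j) \<in> carrier N" for j by (rule multilin_closed[OF g cE cd])
  have "j \<le> length qs \<Longrightarrow> g as \<ominus>\<^bsub>N\<^esub> g (c j) \<in> H" for j
  proof (induction j)
    case 0
    then show ?case using submodule_zero[OF N H] multilin_closed[OF g as] by (simp add: c_def N.r_neg N.minus_eq)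
  next
    case (Suc j)
    then have j: "j < length qs" by simp
    have jc: "j < length (c j)" using j len by (simp add: c_def)
    have upd: "c j = (c j)[j := (qs ! j, snd (as ! j))]" "c (Suc j) = (c j)[j := (qs ! j, snd (bs ! j))]"
    proof -
      have e: "(qs ! j, snd (as ! j)) = as ! j" "(qs ! j, snd (bs ! j)) = bs ! j"
        using degs_nth[OF as(2)] degs_nth[OF bs(2)] j len by (auto simp: prod_eq_iff)
      have d: "drop j as = as ! j # drop (Suc j) as" using j len by (simp add: Cons_nth_drop_Suc)
      show "c j = (c j)[j := (qs ! j, snd (as ! j))]" "c (Suc j) = (c j)[j := (qs ! j, snd (bs ! j))]"
        unfolding e using j len by (simp_all add: c_def list_update_append take_Suc_conv_app_nth d)
    qed
    have q: "fst (c j ! j) = qs ! j" using cd[of j] jc by auto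
    let ?f = "\<lambda>u. g ((c j)[j := (fst (c j ! j), u)])"
    have f: "?f \<in> lin R (M (qs ! j)) N" using multilin_lin[OF g cE cd jc] q by simp
    have carr: "snd (as ! j) \<in> carrier (M (qs ! j))" "snd (bs ! j) \<in> carrier (M (qs ! j))"
      using El_nth[OF as(1), of j] El_nth[OF bs(1), of j] degs_nth[OF as(2)] degs_nth[OF bs(2)] j len by auto
    have "?f (snd (as ! j)) \<ominus>\<^bsub>N\<^esub> ?f (snd (bs ! j)) = ?f (snd (as ! j) \<ominus>\<^bsub>M (qs ! j)\<^esub> snd (bs ! j))"
      by (rule lin_minus[OF f M N carr, symmetric])
    also have "\<dots> \<in> H"
    proof (rule K[OF El_update[OF cE] _ j])
      show "degs ((c j)[j := (fst (c j ! j), snd (as ! j) \<ominus>\<^bsub>M (qs ! j)\<^esub> snd (bs ! j))]) = qs"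
        by (simp only: degs_update cd)
      show "snd ((c j)[j := (fst (c j ! j), snd (as ! j) \<ominus>\<^bsub>M (qs ! j)\<^esub> snd (bs ! j))] ! j) \<in> K j"
        using ab[OF j] jc by simp
    qed (use carr q in \<open>auto intro: module_minus_closed[OF M]\<close>)
    finally have step: "g (c j) \<ominus>\<^bsub>N\<^esub> g (c (Suc j)) \<in> H" using upd q by simp
    have "g as \<ominus>\<^bsub>N\<^esub> g (c (Suc j)) = (g as \<ominus>\<^bsub>N\<^esub> g (c j)) \<oplus>\<^bsub>N\<^esub> (g (c j) \<ominus>\<^bsub>N\<^esub> g (c (Suc j)))"
      using gc multilin_closed[OF g as] by (simp add: N.minus_eq N.a_assoc N.r_neg1)
    then show ?case using submodule_add[OF N H] Suc step by simp
  qed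
  from this[of "length qs"] show ?thesis using len by (simp add: c_def)
qed

lemma multilin_comp: "multilin R M N qs g \<Longrightarrow> f \<in> lin R N N' \<Longrightarrow> multilin R M N' qs (\<lambda>as. f (g as))"
  by (rule multilinI) (auto intro: lin_closed multilin_closed lin_comp[OF multilin_lin])

lemma multilin_sgn: "multilin R M N qs g \<Longrightarrow> module R N \<Longrightarrow> multilin R M N qs (\<lambda>as. sgn_mod N e (g as))"
  using multilin_comp[of R M N qs g "\<lambda>x. sgn_mod N e x"] lin_sgn_mod[OF lin_id] by blast

lemma multilin_add:
  "multilin R M N qs f \<Longrightarrow> multilin R M N qs g \<Longrightarrow> module R N \<Longrightarrow> multilin R M N qs (\<lambda>as. f as \<oplus>\<^bsub>N\<^esub> g as)"
  by (rule multilinI lin_plus module_add_closed; auto intro: multilin_closed multilin_lin lin_plus module_add_closed)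

lemma multilin_sum:
  assumes M: "\<And>q. module R (M q)" and N: "module R N" and I: "finite I"
    and f: "\<And>i. i \<in> I \<Longrightarrow> multilin R M N qs (f i)"
  shows "multilin R M N qs (\<lambda>as. finsum N (\<lambda>i. f i as) I)"
  by (rule multilinI) (auto intro!: module_finsum_closed[OF N] lin_sum[OF M N I] intro: multilin_closed[OF f] multilin_lin[OF f])

text \<open>The maps \<open>h i\<close> may change the degree of their slot, from
  \<open>qs' ! i\<close> to \<open>qs ! i\<close>. This covers inclusions of a copy of
  \<open>A\<close> as well as projections from the total complex to one bidegree.\<close>

lemma multilin_precomp:
  assumes g: "multilin R M N qs g" and len: "length qs' = length qs"
    and h: "\<And>i. i < length qs \<Longrightarrow> h i \<in> lin R (M' (qs' ! i)) (M (qs ! i))"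
  shows "multilin R M' N qs' (\<lambda>as. g (map (\<lambda>i. (qs ! i, h i (snd (as ! i)))) [0..<length qs]))"
proof (rule multilinI)
  fix as assume as: "set as \<subseteq> El M'" "degs as = qs'"
  have len': "length as = length qs" using as len by auto
  let ?bs = "map (\<lambda>i. (qs ! i, h i (snd (as ! i)))) [0..<length qs]"
  have carr: "snd (as ! i) \<in> carrier (M' (qs' ! i))" if "i < length qs" for i
    using El_nth[OF as(1), of i] as(2) that len' by auto
  have bs: "set ?bs \<subseteq> El M" "degs ?bs = qs"
    using lin_closed[OF h carr] by (auto simp: El_iff intro!: nth_equalityI)
  show "g ?bs \<in> carrier N" by (rule multilin_closed[OF g bs])
  fix i assume i: "i < length as"
  then have i': "i < length qs" "fst (as ! i) = qs' ! i" using len' as by auto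
  have "(\<lambda>u. g (?bs[i := (fst (?bs ! i), u)])) \<in> lin R (M (qs ! i)) N"
    using multilin_lin[OF g bs, of i] i' by simp
  from lin_comp[OF h[OF i'(1)] this]
  have "(\<lambda>u. g (?bs[i := (qs ! i, h i u)])) \<in> lin R (M' (fst (as ! i))) N"
    using i' by simp
  moreover have "?bs[i := (qs ! i, h i u)] =
      map (\<lambda>j. (qs ! j, h j (snd (as[i := (fst (as ! i), u)] ! j)))) [0..<length qs]" for u
  proof (rule nth_equalityI)
    fix k assume "k < length (?bs[i := (qs ! i, h i u)])"
    then show "?bs[i := (qs ! i, h i u)] ! k =
        map (\<lambda>j. (qs ! j, h j (snd (as[i := (fst (as ! i), u)] ! j)))) [0..<length qs] ! k"
      using len' by (cases "k = i") auto
  qed simp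
  ultimately show "(\<lambda>u. g (map (\<lambda>j. (qs ! j, h j (snd (as[i := (fst (as ! i), u)] ! j)))) [0..<length qs]))
      \<in> lin R (M' (fst (as ! i))) N"
    by simp
qed

lemma multilin_map:
  assumes g: "multilin R M N qs g" and h: "\<And>q. h q \<in> lin R (M' q) (M q)"
  shows "multilin R M' N qs (\<lambda>as. g (map (gmap h) as))"
proof (rule multilinI)
  fix as assume as: "set as \<subseteq> El M'" "degs as = qs"
  have bs: "set (map (gmap h) as) \<subseteq> El M" "degs (map (gmap h) as) = qs"
    using as lin_closed[OF h] by (auto simp: El_iff subset_iff)
  show "g (map (gmap h) as) \<in> carrier N" by (rule multilin_closed[OF g bs])
  fix i assume i: "i < length as"
  have "(\<lambda>u. g ((map (gmap h) as)[i := (fst (as ! i), h (fst (as ! i)) u)])) \<in> lin R (M' (fst (as ! i))) N"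
    using lin_comp[OF h multilin_lin[OF g bs, of i]] i by simp
  then show "(\<lambda>u. g (map (gmap h) (as[i := (fst (as ! i), u)]))) \<in> lin R (M' (fst (as ! i))) N"
    by (simp add: map_update)
qed

section \<open>Signs and block permutations\<close>

lemma offset_0: "offset js 0 = 0"
  by (simp add: offset_def)

lemma offset_length: "offset js (length js) = sum_list js"
  by (simp add: offset_def)

lemma offset_mono: "i \<le> j \<Longrightarrow> offset js i \<le> offset js j"
proof -
  assume "i \<le> j"
  then have "take j js = take i js @ drop i (take j js)"
    by (metis append_take_drop_id min.absorb1 take_take)
  then show ?thesis unfolding offset_def by (metis sum_list_append le_add1)
qed

lemma block_exists: "m < offset js k \<Longrightarrow> k \<le> length js \<Longrightarrow> \<exists>i<k. offset js i \<le> m \<and> m < offset js (Suc i)"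
proof (induction k)
  case 0
  then show ?case by (simp add: offset_0)
next
  case (Suc k)
  then show ?case by (cases "m < offset js k") (auto simp: less_Suc_eq not_less)
qed

lemma block_unique: "offset js i \<le> m \<Longrightarrow> m < offset js (Suc i) \<Longrightarrow> offset js j \<le> m \<Longrightarrow> m < offset js (Suc j) \<Longrightarrow> i = j"
  using offset_mono[of "Suc i" j js] offset_mono[of "Suc j" i js]
  by linarith

lemma block_of_props:
  assumes "m < sum_list js"
  shows "block_of js m < length js" "offset js (block_of js m) \<le> m" "m < offset js (Suc (block_of js m))"
proof -
  have "\<exists>!i. i < length js \<and> offset js i \<le> m \<and> m < offset js (Suc i)"
    using block_exists[of m js "length js"] assms block_unique by (auto simp: offset_length)
  from theI'[OF this] show "block_of js m < length js" "offset js (block_of js m) \<le> m"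
    "m < offset js (Suc (block_of js m))"
    by (auto simp: block_of_def)
qed

text \<open>The block sum of \<open>\<sigma>\<close> with identities on the neighbouring blocks.
  Equivariance of the evaluation product is checked in one argument at a time, so only block sums of
  this shape occur.\<close>

definition shift_perm :: "nat \<Rightarrow> nat \<Rightarrow> (nat \<Rightarrow> nat) \<Rightarrow> nat \<Rightarrow> nat"
  where "shift_perm a k \<sigma> m = (if a \<le> m \<and> m < a + k then a + \<sigma> (m - a) else m)"

lemma sum_perm_block:
  assumes "k = length w"
  shows "sum_perm (map (\<lambda>_. id) js1 @ \<sigma> # map (\<lambda>_. id) js2) (js1 @ k # js2) = shift_perm (sum_list js1) k \<sigma>"
    (is "sum_perm ?\<tau>s ?js = _")
proof
  fix m
  have o1: "offset ?js (length js1) = sum_list js1" "offset ?js (Suc (length js1)) = sum_list js1 + k"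
    by (simp_all add: offset_def)
  show "sum_perm ?\<tau>s ?js m = shift_perm (sum_list js1) k \<sigma> m"
  proof (cases "m < sum_list ?js")
    case True
    let ?i = "block_of ?js m"
    note b = block_of_props[OF True]
    consider "?i < length js1" | "?i = length js1" | "?i > length js1" by linarith
    then show ?thesis
    proof cases
      case 1
      then have "m < sum_list js1" using offset_mono[of "Suc ?i" "length js1" ?js] b o1 by simp
      then show ?thesis using True 1 b by (simp add: sum_perm_def Let_def shift_perm_def nth_append)
    next
      case 2
      then have "sum_list js1 \<le> m" "m < sum_list js1 + k" using b o1 by auto
      then show ?thesis using True 2 b o1 by (simp add: sum_perm_def Let_def shift_perm_def nth_append)
    next
      case 3
      then have "sum_list js1 + k \<le> m" using offset_mono[of "Suc (length js1)" ?i ?js] b o1 by simp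
      then show ?thesis using True 3 b by (simp add: sum_perm_def Let_def shift_perm_def nth_append nth_Cons')
    qed
  qed (auto simp: sum_perm_def shift_perm_def)
qed

lemma shift_perm_lt: "\<sigma> permutes {..<k::nat} \<Longrightarrow> m < k \<Longrightarrow> \<sigma> m < k"
  using permutes_in_image[of \<sigma> "{..<k}" m] by auto

lemma shift_perm_lt': "\<sigma> permutes {..<k::nat} \<Longrightarrow> a \<le> m \<Longrightarrow> m < a + k \<Longrightarrow> \<sigma> (m - a) < k"
proof -
  assume "\<sigma> permutes {..<k}" "a \<le> m" "m < a + k"
  moreover from this have "m - a < k" by arith
  ultimately show ?thesis using shift_perm_lt by blast
qed

lemma shift_perm_comp:
  assumes "\<sigma> permutes {..<k}" "\<tau> permutes {..<k}"
  shows "shift_perm a k \<sigma> (shift_perm a k \<tau> m) = shift_perm a k (\<sigma> \<circ> \<tau>) m"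
  using shift_perm_lt'[OF assms(2), of a m] by (auto simp: shift_perm_def)

lemma shift_perm_id: "shift_perm a k id m = m" "shift_perm a k (\<lambda>x. x) m = m"
  by (auto simp: shift_perm_def)

lemma shift_perm_inverse:
  assumes "\<sigma> permutes {..<k}"
  shows "shift_perm a k (inv_into UNIV \<sigma>) (shift_perm a k \<sigma> m) = m"
    "shift_perm a k \<sigma> (shift_perm a k (inv_into UNIV \<sigma>) m) = m"
  using shift_perm_comp[OF assms permutes_inv[OF assms], of a m] shift_perm_comp[OF permutes_inv[OF assms] assms, of a m]
    permutes_inv_o[OF assms] shift_perm_id by simp_all

lemma shift_perm_permutes:
  assumes "\<sigma> permutes {..<k}" "a + k \<le> n"
  shows "shift_perm a k \<sigma> permutes {..<n}"
proof (rule bij_imp_permutes)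
  have lt: "shift_perm a k \<tau> m < n" if "m < n" "\<tau> permutes {..<k}" for m \<tau>
    using that assms shift_perm_lt'[OF that(2), of a m] by (auto simp: shift_perm_def)
  show "bij_betw (shift_perm a k \<sigma>) {..<n} {..<n}"
    by (rule bij_betwI[where g = "shift_perm a k (inv_into UNIV \<sigma>)"])
      (use lt assms permutes_inv[OF assms(1)] shift_perm_inverse[OF assms(1)] in auto)
  show "shift_perm a k \<sigma> m = m" if "m \<notin> {..<n}" for m
    using that assms by (auto simp: shift_perm_def)
qed

lemma inv_shift_perm:
  assumes "\<sigma> permutes {..<k}"
  shows "inv_into UNIV (shift_perm a k \<sigma>) = shift_perm a k (inv_into UNIV \<sigma>)"
  by (rule inv_unique_comp) (auto simp: fun_eq_iff shift_perm_inverse[OF assms])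

lemma permute_list_shift_perm:
  assumes "\<sigma> permutes {..<length w}"
  shows "permute_list (shift_perm (length c1) (length w) \<sigma>) (c1 @ w @ c2) = c1 @ permute_list \<sigma> w @ c2"
proof (rule nth_equalityI)
  fix m assume m: "m < length (permute_list (shift_perm (length c1) (length w) \<sigma>) (c1 @ w @ c2))"
  then have m': "m < length c1 + length w + length c2" by simp
  have "permute_list (shift_perm (length c1) (length w) \<sigma>) (c1 @ w @ c2) ! m =
      (c1 @ w @ c2) ! shift_perm (length c1) (length w) \<sigma> m"
    by (rule permute_list_nth[OF shift_perm_permutes[OF assms]]) (use m' in auto)
  also have "\<dots> = (c1 @ permute_list \<sigma> w @ c2) ! m"
    using m' shift_perm_lt'[OF assms, of "length c1" m] permute_list_nth[OF assms, of "m - length c1"]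
    by (auto simp: shift_perm_def nth_append)
  finally show "permute_list (shift_perm (length c1) (length w) \<sigma>) (c1 @ w @ c2) ! m =
    (c1 @ permute_list \<sigma> w @ c2) ! m" .
qed simp

text \<open>The exponent becomes a sum over a single finite set, the inversions of
  \<open>\<sigma>\<close>, which can be reindexed or split.\<close>

lemma koszul_exp_pairs:
  "koszul_exp \<sigma> qs = (\<Sum>(i, j)\<in>{(i, j). i < j \<and> j < length qs \<and> \<sigma> j < \<sigma> i}. qs ! i * qs ! j)"
proof -
  have "koszul_exp \<sigma> qs = (\<Sum>(j, i)\<in>(SIGMA j:{..<length qs}. {i. i < j \<and> \<sigma> j < \<sigma> i}). qs ! i * qs ! j)"
    unfolding koszul_exp_def by (subst sum.Sigma) auto
  also have "\<dots> = (\<Sum>(i, j)\<in>{(i, j). i < j \<and> j < length qs \<and> \<sigma> j < \<sigma> i}. qs ! i * qs ! j)"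
    by (rule sum.reindex_bij_witness[of _ prod.swap prod.swap]) auto
  finally show ?thesis .
qed

text \<open>All inversions of the shifted permutation lie inside the permuted block, and translation
  by \<open>length c1\<close> matches them with the inversions of \<open>\<sigma>\<close>.\<close>

lemma koszul_exp_shift_perm:
  assumes "\<sigma> permutes {..<length w}"
  shows "koszul_exp (shift_perm (length c1) (length w) \<sigma>) (c1 @ w @ c2) = koszul_exp \<sigma> w"
proof -
  let ?a = "length c1" let ?k = "length w"
  let ?\<rho> = "shift_perm ?a ?k \<sigma>"
  have inv: "?a \<le> i \<and> j < ?a + ?k \<and> \<sigma> (j - ?a) < \<sigma> (i - ?a)" if "i < j" "?\<rho> j < ?\<rho> i" for i j
    using that shift_perm_lt'[OF assms, of ?a i] shift_perm_lt'[OF assms, of ?a j]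
    by (auto simp: shift_perm_def split: if_splits)
  let ?S = "{(i, j). i < j \<and> j < length (c1 @ w @ c2) \<and> ?\<rho> j < ?\<rho> i}"
  let ?T = "{(i, j). i < j \<and> j < ?k \<and> \<sigma> j < \<sigma> i}"
  let ?f = "\<lambda>(i, j). (i + ?a, j + ?a)"
  have "?S = ?f ` ?T"
  proof (intro equalityI subsetI)
    fix ij assume "ij \<in> ?S"
    then obtain i j where ij: "ij = (i, j)" "i < j" "?\<rho> j < ?\<rho> i" by auto
    note inv[OF ij(2,3)]
    then show "ij \<in> ?f ` ?T" using ij(1,2) by (intro image_eqI[of _ _ "(i - ?a, j - ?a)"]) auto
  qed (auto simp: shift_perm_def)
  then have "koszul_exp ?\<rho> (c1 @ w @ c2) =
      (\<Sum>(i, j)\<in>?f ` ?T. (c1 @ w @ c2) ! i * (c1 @ w @ c2) ! j)"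
    unfolding koszul_exp_pairs by simp
  also have "\<dots> = (\<Sum>(i, j)\<in>?T. w ! i * w ! j)"
    by (subst sum.reindex) (auto simp: inj_on_def nth_append intro!: sum.cong)
  finally show ?thesis unfolding koszul_exp_pairs .
qed

text \<open>This is the sign comparison behind equivariance of the differential. Lowering the degree
  of factor \<open>i\<close> by one changes the Koszul exponent by the degrees of the factors that
  \<open>i\<close> crosses. The two other sums are the signs for moving a differential up to factor
  \<open>i\<close> before and after permuting; modulo 2 they differ by exactly the same
  crossings.\<close>

lemma koszul_exp_dec:
  assumes \<sigma>: "\<sigma> permutes {..<length qs}" and i: "i < length qs"
  shows "even (koszul_exp \<sigma> (qs[i := qs ! i - 1]) + sum_list (take i qs) +
    koszul_exp \<sigma> qs + sum_list (take (\<sigma> i) (permute_list (inv_into UNIV \<sigma>) qs)))"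
proof -
  let ?n = "length qs"
  let ?I = "{(a, b). a < b \<and> b < ?n \<and> \<sigma> b < \<sigma> a}"
  have inj: "\<sigma> a = \<sigma> b \<longleftrightarrow> a = b" for a b using permutes_inj[OF \<sigma>] by (simp add: inj_eq)
  have fin: "finite ?I" by (rule finite_subset[of _ "{..<?n} \<times> {..<?n}"]) auto
  have "koszul_exp \<sigma> (qs[i := qs ! i - 1]) =
      (\<Sum>(a, b)\<in>?I. qs ! a * qs ! b - ((if a = i then qs ! b else 0) + (if b = i then qs ! a else 0)))"
    unfolding koszul_exp_pairs by (rule sum.cong) (use i in \<open>auto simp: nth_list_update algebra_simps\<close>)
  also have "\<dots> = koszul_exp \<sigma> qs - ((\<Sum>(a, b)\<in>?I. if a = i then qs ! b else 0) + (\<Sum>(a, b)\<in>?I. if b = i then qs ! a else 0))"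
    unfolding koszul_exp_pairs by (simp add: sum_subtractf sum.distrib case_prod_unfold)
  also have "(\<Sum>(a, b)\<in>?I. if a = i then qs ! b else 0) = (\<Sum>b\<in>{b. i < b \<and> b < ?n \<and> \<sigma> b < \<sigma> i}. qs ! b)"
    using fin by (simp add: case_prod_unfold sum.inter_filter[symmetric])
      (rule sum.reindex_bij_witness[of _ "\<lambda>b. (i, b)" snd], auto)
  also have "(\<Sum>(a, b)\<in>?I. if b = i then qs ! a else 0) = (\<Sum>a\<in>{a. a < i \<and> \<sigma> i < \<sigma> a}. qs ! a)"
    using fin i by (simp add: case_prod_unfold sum.inter_filter[symmetric])
      (rule sum.reindex_bij_witness[of _ "\<lambda>a. (a, i)" fst], auto)
  finally have k: "koszul_exp \<sigma> (qs[i := qs ! i - 1]) = koszul_exp \<sigma> qs -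
      ((\<Sum>b\<in>{b. i < b \<and> b < ?n \<and> \<sigma> b < \<sigma> i}. qs ! b) + (\<Sum>a\<in>{a. a < i \<and> \<sigma> i < \<sigma> a}. qs ! a))" .
  have t: "sum_list (take i qs) = (\<Sum>a\<in>{a. a < i \<and> \<sigma> i < \<sigma> a}. qs ! a) + (\<Sum>a\<in>{a. a < i \<and> \<sigma> a < \<sigma> i}. qs ! a)"
  proof -
    have "sum_list (take i qs) = (\<Sum>a<i. qs ! a)"
      using i by (simp add: sum_list_sum_nth atLeast0LessThan)
    also have "\<dots> = (\<Sum>a\<in>{a. a < i \<and> \<sigma> i < \<sigma> a} \<union> {a. a < i \<and> \<sigma> a < \<sigma> i}. qs ! a)"
      by (rule sum.cong) (use inj in \<open>auto, metis less_irrefl linorder_neqE_nat\<close>)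
    also have "\<dots> = (\<Sum>a\<in>{a. a < i \<and> \<sigma> i < \<sigma> a}. qs ! a) + (\<Sum>a\<in>{a. a < i \<and> \<sigma> a < \<sigma> i}. qs ! a)"
      by (rule sum.union_disjoint) auto
    finally show ?thesis .
  qed
  \<comment> \<open>The entries before position \<open>\<sigma> i\<close> of the permuted list are
    the factors \<open>a\<close> with \<open>\<sigma> a < \<sigma> i\<close>; they split into those
    after \<open>i\<close>, which are crossed, and those before \<open>i\<close>, which are
    not.\<close>
  have p: "sum_list (take (\<sigma> i) (permute_list (inv_into UNIV \<sigma>) qs)) =
      (\<Sum>b\<in>{b. i < b \<and> b < ?n \<and> \<sigma> b < \<sigma> i}. qs ! b) + (\<Sum>a\<in>{a. a < i \<and> \<sigma> a < \<sigma> i}. qs ! a)"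
  proof -
    have si: "\<sigma> i < ?n" by (rule shift_perm_lt[OF \<sigma> i])
    have "sum_list (take (\<sigma> i) (permute_list (inv_into UNIV \<sigma>) qs)) = (\<Sum>c<\<sigma> i. qs ! inv_into UNIV \<sigma> c)"
      using si permute_list_nth[OF permutes_inv[OF \<sigma>]] by (simp add: sum_list_sum_nth atLeast0LessThan)
    also have "\<dots> = (\<Sum>a\<in>{a. a < ?n \<and> \<sigma> a < \<sigma> i}. qs ! a)"
      by (rule sum.reindex_bij_witness[of _ \<sigma> "inv_into UNIV \<sigma>"])
        (use si permutes_inverses[OF \<sigma>] shift_perm_lt[OF permutes_inv[OF \<sigma>]] in auto)
    also have "\<dots> = (\<Sum>a\<in>{b. i < b \<and> b < ?n \<and> \<sigma> b < \<sigma> i} \<union> {a. a < i \<and> \<sigma> a < \<sigma> i}. qs ! a)"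
      by (rule sum.cong) (use i in \<open>auto, metis less_irrefl linorder_neqE_nat\<close>)
    also have "\<dots> = (\<Sum>b\<in>{b. i < b \<and> b < ?n \<and> \<sigma> b < \<sigma> i}. qs ! b) + (\<Sum>a\<in>{a. a < i \<and> \<sigma> a < \<sigma> i}. qs ! a)"
      by (rule sum.union_disjoint) auto
    finally show ?thesis .
  qed
  show ?thesis unfolding k t p by simp
qed

lemma interleave_exp_zero: "(\<And>p. p \<in> set ps \<Longrightarrow> p = 0) \<Longrightarrow> interleave_exp ps qs = 0"
  by (auto simp: interleave_exp_def intro!: sum.neutral)

section \<open>Operads\<close>

locale dg_operad_ctx =
  fixes R :: "'r ring" and P :: "('r, 'o) operad"
  assumes R: "cring R" and P: "dg_operad R P"
begin

lemma op_dg: "dg_module R (ops P k)"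
  using P by (simp add: dg_operad_def)

lemma op_module: "module R (gpart (ops P k) q)"
  using op_dg[of k] by (simp add: dg_module_def gr_module_def)

lemma op_dif: "dif (ops P k) q \<in> lin R (gpart (ops P k) q) (gpart (ops P k) (q - 1))"
  using op_dg[of k] by (simp add: dg_module_def)

lemma oid_el: "oid P \<in> OEl P 1" "ounit P \<in> carrier (gpart (ops P 1) 0)"
    "dif (ops P 1) 0 (ounit P) = \<zero>\<^bsub>gpart (ops P 1) (-1)\<^esub>"
  using P by (simp_all add: dg_operad_def El_iff)

lemma ocomp_oids: "x \<in> OEl P k \<Longrightarrow> ocomp P (replicate k 1) x (replicate k (oid P)) = x"
  using P by (simp add: dg_operad_def)

lemma oact_lin: "\<sigma> permutes {..<k} \<Longrightarrow> oact P k \<sigma> q \<in> lin R (gpart (ops P k) q) (gpart (ops P k) q)"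
  using P by (simp add: dg_operad_def)

lemma oact_dif: "\<sigma> permutes {..<k} \<Longrightarrow> x \<in> OEl P k \<Longrightarrow>
    dl (ops P k) (gmap (oact P k \<sigma>) x) = gmap (oact P k \<sigma>) (dl (ops P k) x)"
  using P by (simp add: dg_operad_def)

lemma oact_id: "x \<in> OEl P k \<Longrightarrow> gmap (oact P k id) x = x"
  using P unfolding dg_operad_def by blast

lemma
  assumes x: "x \<in> OEl P (length js)" and ys: "list_all2 (\<lambda>y j. y \<in> OEl P j) ys js"
  shows ocomp_el: "ocomp P js x ys \<in> OEl P (sum_list js)"
    and ocomp_deg: "fst (ocomp P js x ys) = fst x + sum_list (degs ys)"
    and ocomp_lin_slot: "i < length ys \<Longrightarrow> (\<lambda>u. snd (ocomp P js x (ys[i := (fst (ys ! i), u)]))) \<in>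
      lin R (gpart (ops P (js ! i)) (fst (ys ! i))) (gpart (ops P (sum_list js)) (fst x + sum_list (degs ys)))"
    and ocomp_dif: "dif (ops P (sum_list js)) (fst x + sum_list (degs ys)) (snd (ocomp P js x ys)) =
      snd (ocomp P js (dl (ops P (length js)) x) ys)
      \<oplus>\<^bsub>gpart (ops P (sum_list js)) (fst x + sum_list (degs ys) - 1)\<^esub>
      (\<Oplus>\<^bsub>gpart (ops P (sum_list js)) (fst x + sum_list (degs ys) - 1)\<^esub>i\<in>{..<length ys}.
        snd (sg (gpart (ops P (sum_list js))) (fst x + sum_list (degs (take i ys)))
          (ocomp P js x (ys[i := dl (map (ops P) js ! i) (ys ! i)]))))"
proof -
  have c: "chain_op R (ops P (length js)) (map (ops P) js) (ops P (sum_list js)) (ocomp P js)"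
    using P by (simp add: dg_operad_def)
  have "list_all2 (\<lambda>y Y. y \<in> El (gpart Y)) ys (map (ops P) js)"
    using ys by (simp add: list_all2_map2)
  note * = c[unfolded chain_op_def Let_def, rule_format, OF conjI, OF x this]
  have len: "length ys = length js" using ys by (rule list_all2_lengthD)
  show "ocomp P js x ys \<in> OEl P (sum_list js)" "fst (ocomp P js x ys) = fst x + sum_list (degs ys)"
    using * by auto
  show "(\<lambda>u. snd (ocomp P js x (ys[i := (fst (ys ! i), u)]))) \<in>
      lin R (gpart (ops P (js ! i)) (fst (ys ! i))) (gpart (ops P (sum_list js)) (fst x + sum_list (degs ys)))"
    if "i < length ys" using * that len by auto
  show "dif (ops P (sum_list js)) (fst x + sum_list (degs ys)) (snd (ocomp P js x ys)) =
      snd (ocomp P js (dl (ops P (length js)) x) ys)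
      \<oplus>\<^bsub>gpart (ops P (sum_list js)) (fst x + sum_list (degs ys) - 1)\<^esub>
      (\<Oplus>\<^bsub>gpart (ops P (sum_list js)) (fst x + sum_list (degs ys) - 1)\<^esub>i\<in>{..<length ys}.
        snd (sg (gpart (ops P (sum_list js))) (fst x + sum_list (degs (take i ys)))
          (ocomp P js x (ys[i := dl (map (ops P) js ! i) (ys ! i)]))))"
    using * by auto
qed

text \<open>The operad axiom permutes the inputs of all inner operations simultaneously. Identities
  in the other slots isolate one block, and \<open>sum_perm\<close> becomes
  \<open>shift_perm\<close>.\<close>

lemma ocomp_block_act:
  assumes y: "y \<in> OEl P (length js1 + Suc (length js2))" and xs1: "list_all2 (\<lambda>y j. y \<in> OEl P j) xs1 js1"
    and x: "x \<in> OEl P k" and xs2: "list_all2 (\<lambda>y j. y \<in> OEl P j) xs2 js2" and \<sigma>: "\<sigma> permutes {..<k}"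
  shows "ocomp P (js1 @ k # js2) y (xs1 @ gmap (oact P k \<sigma>) x # xs2) =
    gmap (oact P (sum_list (js1 @ k # js2)) (shift_perm (sum_list js1) k \<sigma>)) (ocomp P (js1 @ k # js2) y (xs1 @ x # xs2))"
proof -
  let ?js = "js1 @ k # js2" let ?xs = "xs1 @ x # xs2"
  let ?\<tau>s = "map (\<lambda>_. id) js1 @ \<sigma> # map (\<lambda>_. id) js2"
  have len: "length xs1 = length js1" "length xs2 = length js2" using xs1 xs2 list_all2_lengthD by auto
  have "map (\<lambda>i. gmap (oact P (?js ! i) (?\<tau>s ! i)) (?xs ! i)) [0..<length ?js] = xs1 @ gmap (oact P k \<sigma>) x # xs2"
  proof (rule nth_equalityI)
    fix i assume "i < length (map (\<lambda>i. gmap (oact P (?js ! i) (?\<tau>s ! i)) (?xs ! i)) [0..<length ?js])"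
    then have i: "i < length ?js" by simp
    consider "i < length js1" | "i = length js1" | j where "i = Suc (length js1 + j)" "j < length js2"
      using i less_iff_Suc_add[of "length js1" i] by fastforce
    then show "map (\<lambda>i. gmap (oact P (?js ! i) (?\<tau>s ! i)) (?xs ! i)) [0..<length ?js] ! i =
        (xs1 @ gmap (oact P k \<sigma>) x # xs2) ! i"
    proof cases
      case 1
      then have "xs1 ! i \<in> OEl P (js1 ! i)" using xs1 by (simp add: list_all2_conv_all_nth)
      then show ?thesis using 1 i len oact_id by (simp add: nth_append del: upt_Suc)
    next
      case 2
      then show ?thesis using i len by (simp add: nth_append del: upt_Suc)
    next
      case 3
      then have "xs2 ! j \<in> OEl P (js2 ! j)" using xs2 by (simp add: list_all2_conv_all_nth)
      then show ?thesis using 3 i len oact_id by (simp add: nth_append del: upt_Suc)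
    qed
  qed (simp add: len)
  moreover have "ocomp P ?js y (map (\<lambda>i. gmap (oact P (?js ! i) (?\<tau>s ! i)) (?xs ! i)) [0..<length ?js]) =
      gmap (oact P (sum_list ?js) (sum_perm ?\<tau>s ?js)) (ocomp P ?js y ?xs)"
  proof -
    have "y \<in> OEl P (length ?js) \<and> list_all2 (\<lambda>y j. y \<in> OEl P j) ?xs ?js \<and>
        list_all2 (\<lambda>\<tau> j. \<tau> permutes {..<j}) ?\<tau>s ?js"
      using assms by (auto simp: list_all2_map1 permutes_id list.rel_refl intro!: list_all2_appendI)
    then show ?thesis using P unfolding dg_operad_def by blast
  qed
  moreover have "sum_perm ?\<tau>s ?js = shift_perm (sum_list js1) k \<sigma>"
    using sum_perm_block[of k "replicate k ()"] by simp
  ultimately show ?thesis by simp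
qed

end

section \<open>Free modules on operadic symbols\<close>

lemma (in -) sum_list_permute_list: "\<sigma> permutes {..<length qs} \<Longrightarrow> sum_list (permute_list \<sigma> qs) = sum_list (qs :: int list)"
  by (metis mset_permute_list sum_mset_sum_list)

lemma syms_iff: "(x, vs) \<in> syms P V n \<longleftrightarrow> x \<in> OEl P (length vs) \<and> set vs \<subseteq> El V \<and> fst x + sum_list (degs vs) = n"
  by (simp add: syms_def)

lemma syms_update_op: "(x, vs) \<in> syms P V n \<Longrightarrow> u \<in> carrier (gpart (ops P (length vs)) (fst x)) \<Longrightarrow> ((fst x, u), vs) \<in> syms P V n"
  by (auto simp: syms_iff El_iff)

lemma syms_update: "(x, vs) \<in> syms P V n \<Longrightarrow> u \<in> carrier (V (fst (vs ! i))) \<Longrightarrow> (x, vs[i := (fst (vs ! i), u)]) \<in> syms P V n"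
  unfolding syms_iff degs_update using El_update[of vs V "(fst (vs ! i), u)" i] by auto

text \<open>Balanced maps on symbols are those that induce linear maps on \<^const>\<open>free_part\<close>.\<close>

definition balanced :: "'r ring \<Rightarrow> ('r, 'o) operad \<Rightarrow> ('r, 'v) grmod \<Rightarrow> int \<Rightarrow> ('r, 'b) module
    \<Rightarrow> (('o, 'v) sym \<Rightarrow> 'b) \<Rightarrow> bool"
  where "balanced R P V n M h \<longleftrightarrow> (\<forall>x vs. (x, vs) \<in> syms P V n \<longrightarrow> h (x, vs) \<in> carrier M \<and>
    (\<lambda>u. h ((fst x, u), vs)) \<in> lin R (gpart (ops P (length vs)) (fst x)) M \<and>
    (\<forall>i<length vs. (\<lambda>u. h (x, vs[i := (fst (vs ! i), u)])) \<in> lin R (V (fst (vs ! i))) M) \<and>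
    (\<forall>\<sigma>. \<sigma> permutes {..<length vs} \<longrightarrow> h (gmap (oact P (length vs) \<sigma>) x, vs) =
      sgn_mod M (koszul_exp \<sigma> (degs vs)) (h (x, permute_list (inv_into UNIV \<sigma>) vs))))"

lemma balancedI:
  assumes "\<And>x vs. (x, vs) \<in> syms P V n \<Longrightarrow> h (x, vs) \<in> carrier M"
    and "\<And>x vs. (x, vs) \<in> syms P V n \<Longrightarrow> (\<lambda>u. h ((fst x, u), vs)) \<in> lin R (gpart (ops P (length vs)) (fst x)) M"
    and "\<And>x vs i. (x, vs) \<in> syms P V n \<Longrightarrow> i < length vs \<Longrightarrow>
      (\<lambda>u. h (x, vs[i := (fst (vs ! i), u)])) \<in> lin R (V (fst (vs ! i))) M"
    and "\<And>x vs \<sigma>. (x, vs) \<in> syms P V n \<Longrightarrow> \<sigma> permutes {..<length vs} \<Longrightarrow> h (gmap (oact P (length vs) \<sigma>) x, vs) =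
      sgn_mod M (koszul_exp \<sigma> (degs vs)) (h (x, permute_list (inv_into UNIV \<sigma>) vs))"
  shows "balanced R P V n M h"
  using assms unfolding balanced_def by blast

lemma balancedD:
  assumes "balanced R P V n M h" "(x, vs) \<in> syms P V n"
  shows balanced_closed: "h (x, vs) \<in> carrier M"
    and balanced_op: "(\<lambda>u. h ((fst x, u), vs)) \<in> lin R (gpart (ops P (length vs)) (fst x)) M"
    and balanced_slot: "i < length vs \<Longrightarrow> (\<lambda>u. h (x, vs[i := (fst (vs ! i), u)])) \<in> lin R (V (fst (vs ! i))) M"
    and balanced_perm: "\<sigma> permutes {..<length vs} \<Longrightarrow> h (gmap (oact P (length vs) \<sigma>) x, vs) =
      sgn_mod M (koszul_exp \<sigma> (degs vs)) (h (x, permute_list (inv_into UNIV \<sigma>) vs))"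
  using assms unfolding balanced_def by blast+

text \<open>\<open>tens\<close> recomputes the degree from the symbol. With the degree as a
  parameter, the ambient quotient stays fixed while an entry varies, as statements of linearity
  require.\<close>

definition sym_class :: "'r ring \<Rightarrow> ('r, 'o) operad \<Rightarrow> ('r, 'v) grmod \<Rightarrow> int \<Rightarrow> ('o, 'v) sym \<Rightarrow> ('r, 'o, 'v) free_el"
  where "sym_class R P V n s = free_sub R P V n +>\<^bsub>free_mod R (syms P V n)\<^esub> basis_el R (syms P V n) s"

lemma tens_eq: "(x, vs) \<in> syms P V n \<Longrightarrow> tens R P V x vs = (n, sym_class R P V n (x, vs))"
  by (auto simp: tens_def sym_class_def syms_iff Let_def)

context dg_operad_ctx
begin

abbreviation "Fr \<equiv> free_part R P"
abbreviation "Cl \<equiv> sym_class R P"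
abbreviation "Fev \<equiv> free_ev R P"
abbreviation "Sev \<equiv> sym_ev R P"
abbreviation "perminv \<sigma> \<equiv> permute_list (inv_into UNIV \<sigma>)"

lemma syms_act: "(x, vs) \<in> syms P V n \<Longrightarrow> \<sigma> permutes {..<length vs} \<Longrightarrow> (gmap (oact P (length vs) \<sigma>) x, vs) \<in> syms P V n"
  using lin_closed[OF oact_lin] by (auto simp: syms_iff El_iff)

lemma syms_permute: "(x, vs) \<in> syms P V n \<Longrightarrow> \<sigma> permutes {..<length vs} \<Longrightarrow>
    (x, perminv \<sigma> vs) \<in> syms P V n"
  using permutes_inv[of \<sigma> "{..<length vs}"] permute_list_map[of "inv_into UNIV \<sigma>" vs fst, symmetric]
    sum_list_permute_list[of "inv_into UNIV \<sigma>" "degs vs"]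
  by (auto simp: syms_iff)

abbreviation "FM V n \<equiv> free_mod R (syms P V n)"

lemma FM_module: "module R (FM V n)"
  by (rule free_module[OF R])

context
  fixes V :: "('r, 'v) grmod"
  assumes V: "gr_module R V"
begin

lemma V_module: "module R (V q)"
  using V by (simp add: gr_module_def)

lemma basis_closed: "s \<in> syms P V n \<Longrightarrow> basis_el R (syms P V n) s \<in> carrier (FM V n)"
  by (rule basis_el_carrier[OF R])

text \<open>Each relation is rewritten so that it starts from one symbol \<open>(x, vs)\<close> with
  an entry varying in its own degree, the shape in which \<open>balanced\<close> is
  formulated.\<close>

lemma free_rels_cases:
  assumes "z \<in> free_rels R P V n"
  obtains (op_add) x u v vs where "(x, vs) \<in> syms P V n" "u \<in> carrier (gpart (ops P (length vs)) (fst x))"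
      "v \<in> carrier (gpart (ops P (length vs)) (fst x))"
      "z = basis_el R (syms P V n) ((fst x, u \<oplus>\<^bsub>gpart (ops P (length vs)) (fst x)\<^esub> v), vs) \<ominus>\<^bsub>FM V n\<^esub>
        (basis_el R (syms P V n) ((fst x, u), vs) \<oplus>\<^bsub>FM V n\<^esub> basis_el R (syms P V n) ((fst x, v), vs))"
    | (op_smult) x u vs r where "(x, vs) \<in> syms P V n" "u \<in> carrier (gpart (ops P (length vs)) (fst x))" "r \<in> carrier R"
      "z = basis_el R (syms P V n) ((fst x, r \<odot>\<^bsub>gpart (ops P (length vs)) (fst x)\<^esub> u), vs) \<ominus>\<^bsub>FM V n\<^esub>
        r \<odot>\<^bsub>FM V n\<^esub> basis_el R (syms P V n) ((fst x, u), vs)"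
    | (slot_add) x u v vs i where "(x, vs) \<in> syms P V n" "i < length vs" "u \<in> carrier (V (fst (vs ! i)))"
      "v \<in> carrier (V (fst (vs ! i)))"
      "z = basis_el R (syms P V n) (x, vs[i := (fst (vs ! i), u \<oplus>\<^bsub>V (fst (vs ! i))\<^esub> v)]) \<ominus>\<^bsub>FM V n\<^esub>
        (basis_el R (syms P V n) (x, vs[i := (fst (vs ! i), u)]) \<oplus>\<^bsub>FM V n\<^esub>
         basis_el R (syms P V n) (x, vs[i := (fst (vs ! i), v)]))"
    | (slot_smult) x u vs i r where "(x, vs) \<in> syms P V n" "i < length vs" "u \<in> carrier (V (fst (vs ! i)))" "r \<in> carrier R"
      "z = basis_el R (syms P V n) (x, vs[i := (fst (vs ! i), r \<odot>\<^bsub>V (fst (vs ! i))\<^esub> u)]) \<ominus>\<^bsub>FM V n\<^esub>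
        r \<odot>\<^bsub>FM V n\<^esub> basis_el R (syms P V n) (x, vs[i := (fst (vs ! i), u)])"
    | (perm) x vs \<sigma> where "(x, vs) \<in> syms P V n" "\<sigma> permutes {..<length vs}"
      "z = basis_el R (syms P V n) (gmap (oact P (length vs) \<sigma>) x, vs) \<ominus>\<^bsub>FM V n\<^esub>
        sgn_mod (FM V n) (koszul_exp \<sigma> (degs vs)) (basis_el R (syms P V n) (x, perminv \<sigma> vs))"
proof -
  have slotc: "v \<in> carrier (V q)" if "(x, vs[i := (q, v)]) \<in> syms P V n" "i < length vs" for x vs i q v
    using that set_update_memI[of i vs "(q, v)"] by (auto simp: syms_iff El_iff)
  show thesis
    using assms unfolding free_rels_def Let_def
  proof (elim UnE CollectE exE conjE)
    fix p x y vs assume a: "((p, x), vs) \<in> syms P V n" "((p, y), vs) \<in> syms P V n"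
      and z: "z = basis_el R (syms P V n) ((p, x \<oplus>\<^bsub>gpart (ops P (length vs)) p\<^esub> y), vs) \<ominus>\<^bsub>FM V n\<^esub>
        (basis_el R (syms P V n) ((p, x), vs) \<oplus>\<^bsub>FM V n\<^esub> basis_el R (syms P V n) ((p, y), vs))"
    show thesis by (rule op_add[of "(p, x)" vs x y]) (use a z in \<open>auto simp: syms_iff El_iff\<close>)
  next
    fix p x vs r assume a: "((p, x), vs) \<in> syms P V n" "r \<in> carrier R"
      and z: "z = basis_el R (syms P V n) ((p, r \<odot>\<^bsub>gpart (ops P (length vs)) p\<^esub> x), vs) \<ominus>\<^bsub>FM V n\<^esub>
        r \<odot>\<^bsub>FM V n\<^esub> basis_el R (syms P V n) ((p, x), vs)"
    show thesis by (rule op_smult[of "(p, x)" vs x r]) (use a z in \<open>auto simp: syms_iff El_iff\<close>)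
  next
    fix x vs i q v w assume a: "i < length vs" "(x, vs[i := (q, v)]) \<in> syms P V n" "(x, vs[i := (q, w)]) \<in> syms P V n"
      and z: "z = basis_el R (syms P V n) (x, vs[i := (q, v \<oplus>\<^bsub>V q\<^esub> w)]) \<ominus>\<^bsub>FM V n\<^esub>
        (basis_el R (syms P V n) (x, vs[i := (q, v)]) \<oplus>\<^bsub>FM V n\<^esub> basis_el R (syms P V n) (x, vs[i := (q, w)]))"
    show thesis by (rule slot_add[of x "vs[i := (q, v)]" i v w]) (use a z slotc in auto)
  next
    fix x vs i q v r assume a: "i < length vs" "(x, vs[i := (q, v)]) \<in> syms P V n" "r \<in> carrier R"
      and z: "z = basis_el R (syms P V n) (x, vs[i := (q, r \<odot>\<^bsub>V q\<^esub> v)]) \<ominus>\<^bsub>FM V n\<^esub>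
        r \<odot>\<^bsub>FM V n\<^esub> basis_el R (syms P V n) (x, vs[i := (q, v)])"
    show thesis by (rule slot_smult[of x "vs[i := (q, v)]" i v r]) (use a z slotc in auto)
  qed (rule perm)
qed

lemma free_rels_carrier: "free_rels R P V n \<subseteq> carrier (FM V n)"
proof
  note [simp] = FM_module basis_closed module_minus_closed[OF FM_module] module_add_closed[OF FM_module]
    module.smult_closed[OF FM_module] module_neg_closed[OF FM_module] syms_update_op syms_update syms_act syms_permute
    module_add_closed[OF op_module] module_add_closed[OF V_module] module.smult_closed[OF op_module] module.smult_closed[OF V_module]
  fix z assume "z \<in> free_rels R P V n"
  then show "z \<in> carrier (FM V n)"
    by (cases rule: free_rels_cases) simp_all
qed

text \<open>Each kind of relation is annihilated by one clause of \<open>balanced\<close>. The map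
  \<open>L\<close> is an arbitrary linear map and not just a linear extension, because it is also
  taken to be \<open>msum\<close> with all arguments but one fixed.\<close>

lemma balanced_vanishes:
  assumes h: "balanced R P V n M (\<lambda>s. L (basis_el R (syms P V n) s))" and L: "L \<in> lin R (FM V n) M" and M: "module R M"
    and z: "z \<in> free_sub R P V n"
  shows "L z = \<zero>\<^bsub>M\<^esub>"
proof -
  note [simp] = FM_module basis_closed module_minus_closed[OF FM_module] module_add_closed[OF FM_module]
    module.smult_closed[OF FM_module] module_neg_closed[OF FM_module] syms_update_op syms_update syms_act syms_permute
    module_add_closed[OF op_module] module_add_closed[OF V_module] module.smult_closed[OF op_module] module.smult_closed[OF V_module]
  have "L z \<in> {\<zero>\<^bsub>M\<^esub>}"
  proof (rule gen_sub_lin[OF L FM_module M submodule_zero_sub[OF M] _ _ z[unfolded free_sub_def]])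
    fix w assume w: "w \<in> free_rels R P V n"
    show "w \<in> carrier (FM V n)" using w free_rels_carrier by auto
    have "L w = \<zero>\<^bsub>M\<^esub>" using w
    proof (cases rule: free_rels_cases)
      case (op_add x u v vs)
      then show ?thesis using lin_add[OF balanced_op[OF h op_add(1)]] lin_closed[OF L]
        by (simp add: lin_minus[OF L FM_module M] lin_add[OF L] module_diff_eq_zero[OF M] module_add_closed[OF M])
    next
      case (op_smult x u vs r)
      then show ?thesis using lin_smult[OF balanced_op[OF h op_smult(1)]] lin_closed[OF L]
        by (simp add: lin_minus[OF L FM_module M] lin_smult[OF L] module_diff_eq_zero[OF M] module.smult_closed[OF M])
    next
      case (slot_add x u v vs i)
      then show ?thesis using lin_add[OF balanced_slot[OF h slot_add(1,2)]] lin_closed[OF L]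
        by (simp add: lin_minus[OF L FM_module M] lin_add[OF L] module_diff_eq_zero[OF M] module_add_closed[OF M])
    next
      case (slot_smult x u vs i r)
      then show ?thesis using lin_smult[OF balanced_slot[OF h slot_smult(1,2)]] lin_closed[OF L]
        by (simp add: lin_minus[OF L FM_module M] lin_smult[OF L] module_diff_eq_zero[OF M] module.smult_closed[OF M])
    next
      case (perm x vs \<sigma>)
      let ?b = "basis_el R (syms P V n) (x, perminv \<sigma> vs)"
      have b: "?b \<in> carrier (FM V n)" using perm by simp
      have "L w = L (basis_el R (syms P V n) (gmap (oact P (length vs) \<sigma>) x, vs)) \<ominus>\<^bsub>M\<^esub>
          L (sgn_mod (FM V n) (koszul_exp \<sigma> (degs vs)) ?b)"
        unfolding perm(3) by (rule lin_minus[OF L FM_module M basis_closed[OF syms_act[OF perm(1,2)]] module_sgn_closed[OF FM_module b]])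
      also have "\<dots> = \<zero>\<^bsub>M\<^esub>"
        unfolding lin_sgn[OF L FM_module M b] balanced_perm[OF h perm(1,2)]
        using module_diff_eq_zero[OF M] module_sgn_closed[OF M lin_closed[OF L b]] by blast
      finally show ?thesis .
    qed
    then show "L w \<in> {\<zero>\<^bsub>M\<^esub>}" by simp
  qed
  then show ?thesis by simp
qed

lemma free_sub_submodule: "submodule (free_sub R P V n) R (FM V n)"
  unfolding free_sub_def by (rule gen_sub_submodule[OF FM_module free_rels_carrier])

lemma free_part_module: "module R (Fr V n)"
  unfolding free_part_def by (rule quot_module[OF FM_module free_sub_submodule])

lemma coset_free_lin: "(\<lambda>f. free_sub R P V n +>\<^bsub>FM V n\<^esub> f) \<in> lin R (FM V n) (Fr V n)"
  unfolding free_part_def by (rule coset_lin[OF FM_module free_sub_submodule])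

lemma sym_class_closed: "s \<in> syms P V n \<Longrightarrow> Cl V n s \<in> carrier (Fr V n)"
  unfolding sym_class_def by (rule lin_closed[OF coset_free_lin basis_closed])

lemma free_part_gen: "carrier (Fr V n) \<subseteq> gen_sub R (Fr V n) (Cl V n ` syms P V n)"
proof -
  have "basis_el R (syms P V n) ` syms P V n \<subseteq> carrier (FM V n)" using basis_closed by blast
  from quot_gen_sub[OF FM_module free_sub_submodule this free_mod_gen[OF R]]
  show ?thesis unfolding free_part_def sym_class_def[abs_def] image_image .
qed

lemma free_rel_eq:
  assumes "a \<ominus>\<^bsub>FM V n\<^esub> b \<in> free_rels R P V n" "a \<in> carrier (FM V n)" "b \<in> carrier (FM V n)"
  shows "free_sub R P V n +>\<^bsub>FM V n\<^esub> a = free_sub R P V n +>\<^bsub>FM V n\<^esub> b"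
  using coset_eq_iff[OF FM_module free_sub_submodule assms(2,3)] subsetD[OF gen_sub_incl assms(1)]
  by (simp add: free_sub_def)

lemma sym_class_balanced: "balanced R P V n (Fr V n) (Cl V n)"
proof (rule balancedI)
  note [simp] = FM_module basis_closed module_minus_closed[OF FM_module] module_add_closed[OF FM_module]
    module.smult_closed[OF FM_module] module_neg_closed[OF FM_module] syms_update_op syms_update syms_act syms_permute
    module_add_closed[OF op_module] module_add_closed[OF V_module] module.smult_closed[OF op_module] module.smult_closed[OF V_module]
  fix x vs assume s: "(x, vs) \<in> syms P V n"
  show "Cl V n (x, vs) \<in> carrier (Fr V n)" by (rule sym_class_closed[OF s])
  show "(\<lambda>u. Cl V n ((fst x, u), vs)) \<in> lin R (gpart (ops P (length vs)) (fst x)) (Fr V n)"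
  proof (rule linI)
    fix u assume u: "u \<in> carrier (gpart (ops P (length vs)) (fst x))"
    show "Cl V n ((fst x, u), vs) \<in> carrier (Fr V n)" using s u by (simp add: sym_class_closed)
    {
      fix v assume v: "v \<in> carrier (gpart (ops P (length vs)) (fst x))"
      show "Cl V n ((fst x, u \<oplus>\<^bsub>gpart (ops P (length vs)) (fst x)\<^esub> v), vs) =
          Cl V n ((fst x, u), vs) \<oplus>\<^bsub>Fr V n\<^esub> Cl V n ((fst x, v), vs)"
        unfolding sym_class_def using s u v
        by (subst lin_add[OF coset_free_lin, symmetric]; (simp; fail)?)
          (rule free_rel_eq; simp add: free_rels_def Let_def; metis syms_update_op)
    }
    fix r assume r: "r \<in> carrier R"
    show "Cl V n ((fst x, r \<odot>\<^bsub>gpart (ops P (length vs)) (fst x)\<^esub> u), vs) =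
          r \<odot>\<^bsub>Fr V n\<^esub> Cl V n ((fst x, u), vs)"
      unfolding sym_class_def using s u r
      by (subst lin_smult[OF coset_free_lin, symmetric]; (simp; fail)?)
        (rule free_rel_eq; simp add: free_rels_def Let_def; metis syms_update_op)
  qed
  {
    fix i assume i: "i < length vs"
    show "(\<lambda>u. Cl V n (x, vs[i := (fst (vs ! i), u)])) \<in> lin R (V (fst (vs ! i))) (Fr V n)"
    proof (rule linI)
      fix u assume u: "u \<in> carrier (V (fst (vs ! i)))"
      show "Cl V n (x, vs[i := (fst (vs ! i), u)]) \<in> carrier (Fr V n)"
        using s u by (simp add: sym_class_closed)
      {
        fix v assume v: "v \<in> carrier (V (fst (vs ! i)))"
        show "Cl V n (x, vs[i := (fst (vs ! i), u \<oplus>\<^bsub>V (fst (vs ! i))\<^esub> v)]) =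
            Cl V n (x, vs[i := (fst (vs ! i), u)]) \<oplus>\<^bsub>Fr V n\<^esub>
            Cl V n (x, vs[i := (fst (vs ! i), v)])"
          unfolding sym_class_def using s u v i
          by (subst lin_add[OF coset_free_lin, symmetric]; (simp; fail)?)
            (rule free_rel_eq, unfold free_rels_def Let_def, rule UnI1, rule UnI1, rule UnI2, rule CollectI,
              intro exI conjI, rule refl, simp_all)
      }
      fix r assume r: "r \<in> carrier R"
      show "Cl V n (x, vs[i := (fst (vs ! i), r \<odot>\<^bsub>V (fst (vs ! i))\<^esub> u)]) =
            r \<odot>\<^bsub>Fr V n\<^esub> Cl V n (x, vs[i := (fst (vs ! i), u)])"
        unfolding sym_class_def using s u r i
        by (subst lin_smult[OF coset_free_lin, symmetric]; (simp; fail)?)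
          (rule free_rel_eq, unfold free_rels_def Let_def, rule UnI1, rule UnI2, rule CollectI,
              intro exI conjI, rule refl, simp_all)
    qed
  }
  fix \<sigma> assume \<sigma>: "\<sigma> permutes {..<length vs}"
  let ?b = "basis_el R (syms P V n) (x, perminv \<sigma> vs)"
  have b: "?b \<in> carrier (FM V n)" using s \<sigma> by simp
  have "Cl V n (gmap (oact P (length vs) \<sigma>) x, vs) =
      free_sub R P V n +>\<^bsub>FM V n\<^esub> sgn_mod (FM V n) (koszul_exp \<sigma> (degs vs)) ?b"
    unfolding sym_class_def
    by (rule free_rel_eq[OF _ basis_closed[OF syms_act[OF s \<sigma>]] module_sgn_closed[OF FM_module b]])
      (use s \<sigma> in \<open>unfold free_rels_def Let_def, blast\<close>)
  then show "Cl V n (gmap (oact P (length vs) \<sigma>) x, vs) =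
      sgn_mod (Fr V n) (koszul_exp \<sigma> (degs vs)) (Cl V n (x, perminv \<sigma> vs))"
    unfolding lin_sgn[OF coset_free_lin FM_module free_part_module b] sym_class_def by simp
qed

section \<open>The universal property of the graded pieces of a free algebra\<close>

lemma lift_coset:
  assumes "balanced R P V n M h" "module R M" "f \<in> carrier (FM V n)"
  shows "induced (lin_ext R (syms P V n) M h) (free_sub R P V n +>\<^bsub>FM V n\<^esub> f) = lin_ext R (syms P V n) M h f"
    and "(\<And>z. z \<in> free_sub R P V n \<Longrightarrow> lin_ext R (syms P V n) M h z = \<zero>\<^bsub>M\<^esub>)"
proof -
  have hc: "\<And>s. s \<in> syms P V n \<Longrightarrow> h s \<in> carrier M" using balanced_closed[OF assms(1)] by auto
  note L = lin_ext_lin[OF assms(2) hc]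
  have "balanced R P V n M (\<lambda>s. lin_ext R (syms P V n) M h (basis_el R (syms P V n) s))"
  proof (rule balancedI)
    fix x vs assume s: "(x, vs) \<in> syms P V n"
    have b: "lin_ext R (syms P V n) M h (basis_el R (syms P V n) s) = h s" if "s \<in> syms P V n" for s
      by (rule lin_ext_basis[OF assms(2) hc that])
    show "lin_ext R (syms P V n) M h (basis_el R (syms P V n) (x, vs)) \<in> carrier M" by (simp add: b s hc)
    show "(\<lambda>u. lin_ext R (syms P V n) M h (basis_el R (syms P V n) ((fst x, u), vs))) \<in>
        lin R (gpart (ops P (length vs)) (fst x)) M"
      by (rule lin_cong[OF balanced_op[OF assms(1) s] op_module]) (simp add: b syms_update_op[OF s])
    show "(\<lambda>u. lin_ext R (syms P V n) M h (basis_el R (syms P V n) (x, vs[i := (fst (vs ! i), u)]))) \<in>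
        lin R (V (fst (vs ! i))) M" if "i < length vs" for i
      by (rule lin_cong[OF balanced_slot[OF assms(1) s that] V_module]) (simp add: b syms_update[OF s])
    show "lin_ext R (syms P V n) M h (basis_el R (syms P V n) (gmap (oact P (length vs) \<sigma>) x, vs)) =
        sgn_mod M (koszul_exp \<sigma> (degs vs)) (lin_ext R (syms P V n) M h
          (basis_el R (syms P V n) (x, perminv \<sigma> vs)))"
      if "\<sigma> permutes {..<length vs}" for \<sigma>
      by (simp only: b[OF syms_act[OF s that]] b[OF syms_permute[OF s that]] balanced_perm[OF assms(1) s that])
  qed
  from balanced_vanishes[OF this L assms(2)]
  show z: "\<And>z. z \<in> free_sub R P V n \<Longrightarrow> lin_ext R (syms P V n) M h z = \<zero>\<^bsub>M\<^esub>" .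
  show "induced (lin_ext R (syms P V n) M h) (free_sub R P V n +>\<^bsub>FM V n\<^esub> f) = lin_ext R (syms P V n) M h f"
    by (rule induced_coset[OF FM_module free_sub_submodule L assms(2) z assms(3)])
qed

lemma lift_lin:
  assumes "balanced R P V n M h" "module R M"
  shows "induced (lin_ext R (syms P V n) M h) \<in> lin R (Fr V n) M"
  unfolding free_part_def
  by (rule induced_lin[OF FM_module free_sub_submodule lin_ext_lin[OF assms(2)] assms(2) lift_coset(2)[OF assms]])
    (use balanced_closed[OF assms(1)] module_zero_closed[OF FM_module] in auto)

lemma lift_class:
  assumes "balanced R P V n M h" "module R M" "s \<in> syms P V n"
  shows "induced (lin_ext R (syms P V n) M h) (Cl V n s) = h s"
  unfolding sym_class_def lift_coset(1)[OF assms(1,2) basis_closed[OF assms(3)]]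
  by (rule lin_ext_basis[OF assms(2) _ assms(3)]) (use balanced_closed[OF assms(1)] in auto)

end

end

section \<open>The evaluation product of a free algebra\<close>

lemma El_listI: "(\<And>i. i < length as \<Longrightarrow> snd (as ! i) \<in> carrier (M (fst (as ! i)))) \<Longrightarrow> set as \<subseteq> El M"
  by (metis El_iff in_set_conv_nth subsetI)

lemma balanced_cong:
  assumes h: "balanced R P V n M h" and eq: "\<And>s. s \<in> syms P V n \<Longrightarrow> h' s = h s"
    and ctx: "dg_operad_ctx R P" "gr_module R V"
  shows "balanced R P V n M h'"
proof -
  interpret dg_operad_ctx R P by fact
  show ?thesis
  proof (rule balancedI)
    fix x vs assume s: "(x, vs) \<in> syms P V n"
    show "h' (x, vs) \<in> carrier M" using balanced_closed[OF h s] eq[OF s] by simp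
    show "(\<lambda>u. h' ((fst x, u), vs)) \<in> lin R (gpart (ops P (length vs)) (fst x)) M"
      by (rule lin_cong[OF balanced_op[OF h s] op_module]) (simp add: eq syms_update_op[OF s])
    show "(\<lambda>u. h' (x, vs[i := (fst (vs ! i), u)])) \<in> lin R (V (fst (vs ! i))) M" if "i < length vs" for i
      by (rule lin_cong[OF balanced_slot[OF h s that] V_module[OF ctx(2)]]) (simp add: eq syms_update[OF s])
    show "h' (gmap (oact P (length vs) \<sigma>) x, vs) =
        sgn_mod M (koszul_exp \<sigma> (degs vs)) (h' (x, permute_list (inv_into UNIV \<sigma>) vs))"
      if "\<sigma> permutes {..<length vs}" for \<sigma>
      by (simp only: eq[OF syms_act[OF s that]] eq[OF syms_permute[OF s that]] balanced_perm[OF h s that])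
  qed
qed

lemma finsum_Cons_product:
  assumes M: "module R M" and A: "finite A" and B: "finite B"
    and h: "\<And>s ss. s \<in> A \<Longrightarrow> ss \<in> B \<Longrightarrow> h (s # ss) \<in> carrier M"
  shows "finsum M h ((\<lambda>(s, ss). s # ss) ` (A \<times> B)) = finsum M (\<lambda>s. finsum M (\<lambda>ss. h (s # ss)) B) A"
  using A h
proof (induction A rule: finite_induct)
  case empty
  interpret M: module R M by fact
  show ?case by simp
next
  case (insert a A)
  interpret M: module R M by fact
  have eq: "(\<lambda>(s, ss). s # ss) ` (insert a A \<times> B) = (\<lambda>ss. a # ss) ` B \<union> (\<lambda>(s, ss). s # ss) ` (A \<times> B)"
    by auto
  have "finsum M h ((\<lambda>(s, ss). s # ss) ` (insert a A \<times> B)) =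
      finsum M h ((\<lambda>ss. a # ss) ` B) \<oplus>\<^bsub>M\<^esub> finsum M h ((\<lambda>(s, ss). s # ss) ` (A \<times> B))"
    unfolding eq by (rule M.finsum_Un_disjoint) (use insert B in auto)
  also have "finsum M h ((\<lambda>ss. a # ss) ` B) = finsum M (\<lambda>ss. h (a # ss)) B"
    by (rule M.finsum_reindex) (use insert in \<open>auto simp: inj_on_def\<close>)
  also have "finsum M h ((\<lambda>(s, ss). s # ss) ` (A \<times> B)) = finsum M (\<lambda>s. finsum M (\<lambda>ss. h (s # ss)) B) A"
    using insert by simp
  finally show ?case using insert by (simp add: Pi_def)
qed

text \<open>The multilinear extension of a function of symbols, in the form in which it occurs in \<^const>\<open>free_ev\<close>.\<close>

definition msum :: "'r ring \<Rightarrow> ('r, 'o) operad \<Rightarrow> ('r, 'v) grmod \<Rightarrow> ('r, 'b) module \<Rightarrow> (('o, 'v) sym list \<Rightarrow> 'b)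
    \<Rightarrow> (('o, 'v) sym \<Rightarrow> 'r) gel list \<Rightarrow> 'b"
  where "msum R P V M g fs = (\<Oplus>\<^bsub>M\<^esub>ss\<in>{ss. list_all2 (\<lambda>s f. s \<in> syms P V (fst f) \<and> snd f s \<noteq> \<zero>\<^bsub>R\<^esub>) ss fs}.
    foldr (\<otimes>\<^bsub>R\<^esub>) (map2 (\<lambda>f s. snd f s) fs ss) \<one>\<^bsub>R\<^esub> \<odot>\<^bsub>M\<^esub> g ss)"

abbreviation sym_lists :: "('r, 'o) operad \<Rightarrow> ('r, 'v) grmod \<Rightarrow> int list \<Rightarrow> ('o, 'v) sym list \<Rightarrow> bool"
  where "sym_lists P V qs ss \<equiv> list_all2 (\<lambda>s q. s \<in> syms P V q) ss qs"

section \<open>Multilinear extension of functions of symbols\<close>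

context dg_operad_ctx
begin

lemma coeffs_closed:
  assumes "set fs \<subseteq> El (FM V)" "list_all2 (\<lambda>s f. s \<in> syms P V (fst f) \<and> snd f s \<noteq> \<zero>\<^bsub>R\<^esub>) ss fs"
  shows "foldr (\<otimes>\<^bsub>R\<^esub>) (map2 (\<lambda>f s. snd f s) fs ss) \<one>\<^bsub>R\<^esub> \<in> carrier R"
proof -
  interpret cring R by (rule R)
  show ?thesis using assms(2,1)
    by (induction rule: list_all2_induct) (auto simp: El_iff free_mod_carrier)
qed

lemma supports_finite:
  assumes "set fs \<subseteq> El (FM V)"
  shows "finite {ss. list_all2 (\<lambda>s f. s \<in> syms P V (fst f) \<and> snd f s \<noteq> \<zero>\<^bsub>R\<^esub>) ss fs}"
  using assms
proof (induction fs)
  case (Cons f fs)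
  have "{ss. list_all2 (\<lambda>s f. s \<in> syms P V (fst f) \<and> snd f s \<noteq> \<zero>\<^bsub>R\<^esub>) ss (f # fs)} =
      (\<lambda>(s, ss). s # ss) ` ({s \<in> syms P V (fst f). snd f s \<noteq> \<zero>\<^bsub>R\<^esub>} \<times>
        {ss. list_all2 (\<lambda>s f. s \<in> syms P V (fst f) \<and> snd f s \<noteq> \<zero>\<^bsub>R\<^esub>) ss fs})"
    by (auto simp: list_all2_Cons2 image_iff)
  then show ?case using Cons by (auto simp: El_iff free_mod_carrier)
qed auto

text \<open>The sum over lists of symbols is a sum over the first symbol of sums over the others. As
  an iterated linear extension, \<open>msum\<close> becomes accessible to induction on the number of
  arguments.\<close>

lemma msum_Cons:
  assumes M: "module R M" and fs: "set (f # fs) \<subseteq> El (FM V)"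
    and g: "\<And>ss. sym_lists P V (degs (f # fs)) ss \<Longrightarrow> g ss \<in> carrier M"
  shows "msum R P V M g (f # fs) = lin_ext R (syms P V (fst f)) M (\<lambda>s. msum R P V M (\<lambda>ss. g (s # ss)) fs) (snd f)"
proof -
  interpret M: module R M by fact
  let ?A = "{s \<in> syms P V (fst f). snd f s \<noteq> \<zero>\<^bsub>R\<^esub>}"
  let ?B = "{ss. list_all2 (\<lambda>s f. s \<in> syms P V (fst f) \<and> snd f s \<noteq> \<zero>\<^bsub>R\<^esub>) ss fs}"
  let ?c = "\<lambda>fs ss. foldr (\<otimes>\<^bsub>R\<^esub>) (map2 (\<lambda>f s. snd f s) fs ss) \<one>\<^bsub>R\<^esub>"
  have eq: "{ss. list_all2 (\<lambda>s f. s \<in> syms P V (fst f) \<and> snd f s \<noteq> \<zero>\<^bsub>R\<^esub>) ss (f # fs)} =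
      (\<lambda>(s, ss). s # ss) ` (?A \<times> ?B)"
    by (auto simp: list_all2_Cons2 image_iff)
  have fin: "finite ?A" "finite ?B"
    using fs supports_finite[of fs V] by (auto simp: El_iff free_mod_carrier)
  have sl: "sym_lists P V (degs fs) ss" if "ss \<in> ?B" for ss
    using that by (auto simp: list_all2_map2 elim: list_all2_mono)
  have fc: "snd f s \<in> carrier R" if "s \<in> ?A" for s
    using that fs by (auto simp: El_iff free_mod_carrier)
  have cc: "?c fs ss \<in> carrier R" if "ss \<in> ?B" for ss
    using coeffs_closed[of fs V ss] fs that by auto
  have gc: "g (s # ss) \<in> carrier M" if "s \<in> ?A" "ss \<in> ?B" for s ss
    using g[of "s # ss"] sl that by auto
  have "msum R P V M g (f # fs) = finsum M (\<lambda>s. finsum M (\<lambda>ss. ?c (f # fs) (s # ss) \<odot>\<^bsub>M\<^esub> g (s # ss)) ?B) ?A"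
    unfolding msum_def eq by (rule finsum_Cons_product[OF M fin]) (use fc cc gc in auto)
  also have "\<dots> = finsum M (\<lambda>s. finsum M (\<lambda>ss. snd f s \<odot>\<^bsub>M\<^esub> (?c fs ss \<odot>\<^bsub>M\<^esub> g (s # ss))) ?B) ?A"
    by (intro module_finsum_cong[OF M] module_finsum_closed[OF M])
      (use fc cc gc in \<open>simp_all add: M.smult_assoc1\<close>)
  also have "\<dots> = finsum M (\<lambda>s. snd f s \<odot>\<^bsub>M\<^esub> msum R P V M (\<lambda>ss. g (s # ss)) fs) ?A"
    unfolding msum_def
    by (intro module_finsum_cong[OF M] M.finsum_smult_ldistr[symmetric] M.smult_closed module_finsum_closed[OF M])
      (use fin fc cc gc in \<open>auto\<close>)
  finally show ?thesis by (simp add: lin_ext_def)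
qed

text \<open>By induction on the slots: the first one is linear because \<open>lin_ext\<close> is
  linear in the coefficients, a later one because \<open>lin_ext\<close> is linear in the values
  that it extends.\<close>

lemma msum_multilin:
  assumes M: "module R M" and g: "\<And>ss. sym_lists P V qs ss \<Longrightarrow> g ss \<in> carrier M"
  shows "multilin R (FM V) M qs (msum R P V M g)"
  using g
proof (induction qs arbitrary: g)
  case Nil
  interpret M: module R M by fact
  show ?case using Nil by (auto simp: multilin_def msum_def)
next
  case (Cons q qs)
  have IH: "multilin R (FM V) M qs (msum R P V M (\<lambda>ss. g (s # ss)))" if "s \<in> syms P V q" for s
    by (rule Cons.IH) (use Cons.prems that in auto)
  have eq: "msum R P V M g ((q, u) # fs) = lin_ext R (syms P V q) M (\<lambda>s. msum R P V M (\<lambda>ss. g (s # ss)) fs) u"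
    if "u \<in> carrier (FM V q)" "set fs \<subseteq> El (FM V)" "degs fs = qs" for u fs
    using msum_Cons[OF M, of "(q, u)" fs V g] that Cons.prems by (simp add: El_iff)
  show ?case
  proof (rule multilinI)
    fix as assume as: "set as \<subseteq> El (FM V)" "degs as = q # qs"
    then obtain f fs where asd: "as = (q, f) # fs" "degs fs = qs" "set fs \<subseteq> El (FM V)" "f \<in> carrier (FM V q)"
      by (cases as) (auto simp: El_iff)
    have sc: "msum R P V M (\<lambda>ss. g (s # ss)) fs \<in> carrier M" if "s \<in> syms P V q" for s
      by (rule multilin_closed[OF IH[OF that] asd(3,2)])
    have L: "lin_ext R (syms P V q) M (\<lambda>s. msum R P V M (\<lambda>ss. g (s # ss)) fs) \<in> lin R (FM V q) M"
      by (rule lin_ext_lin[OF M sc])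
    show "msum R P V M g as \<in> carrier M"
      unfolding asd(1) eq[OF asd(4,3,2)] by (rule lin_closed[OF L asd(4)])
    fix i assume i: "i < length as"
    show "(\<lambda>u. msum R P V M g (as[i := (fst (as ! i), u)])) \<in> lin R (FM V (fst (as ! i))) M"
    proof (cases i)
      case 0
      show ?thesis unfolding asd(1) 0 using lin_cong[OF L FM_module, of "\<lambda>u. msum R P V M g ((q, u) # fs)"] eq asd by simp
    next
      case (Suc j)
      have j: "j < length fs" using i Suc asd by simp
      have a: "(\<lambda>u. lin_ext R (syms P V q) M (\<lambda>s. msum R P V M (\<lambda>ss. g (s # ss)) (fs[j := (fst (fs ! j), u)])) f)
          \<in> lin R (FM V (fst (fs ! j))) M"
        by (rule lin_ext_lin_param[OF M FM_module asd(4)]) (rule multilin_lin[OF IH asd(3,2) j])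
      have b: "msum R P V M g ((q, f) # fs[j := (fst (fs ! j), u)]) =
          lin_ext R (syms P V q) M (\<lambda>s. msum R P V M (\<lambda>ss. g (s # ss)) (fs[j := (fst (fs ! j), u)])) f"
        if "u \<in> carrier (FM V (fst (fs ! j)))" for u
        by (rule eq[OF asd(4) El_update[OF asd(3)]]) (use that asd degs_update in auto)
      show ?thesis unfolding asd(1) Suc using lin_cong[OF a FM_module b] by simp
    qed
  qed
qed

lemma msum_basis:
  assumes M: "module R M" and g: "\<And>ss. sym_lists P V qs ss \<Longrightarrow> g ss \<in> carrier M" and ss: "sym_lists P V qs ss"
  shows "msum R P V M g (map2 (\<lambda>q s. (q, basis_el R (syms P V q) s)) qs ss) = g ss"
  using ss g
proof (induction ss qs arbitrary: g rule: list_all2_induct)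
  case Nil
  interpret M: module R M by fact
  show ?case using Nil by (simp add: msum_def)
next
  case (Cons s ss q qs)
  let ?fs = "map2 (\<lambda>q s. (q, basis_el R (syms P V q) s)) qs ss"
  have "snd (?fs ! i) \<in> carrier (FM V (fst (?fs ! i)))" if "i < length ?fs" for i
  proof -
    have "ss ! i \<in> syms P V (qs ! i)" using that Cons.hyps(2) by (simp add: list_all2_conv_all_nth)
    from basis_el_carrier[OF R this] show ?thesis using that by simp
  qed
  then have fs: "set ?fs \<subseteq> El (FM V)" by (rule El_listI)
  have fd: "degs ?fs = qs" using Cons.hyps(2) by (auto simp: list_all2_conv_all_nth intro!: nth_equalityI)
  note fs = fs fd
  have c: "msum R P V M (\<lambda>ss. g (s # ss)) ?fs \<in> carrier M" if "s \<in> syms P V q" for s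
    by (rule multilin_closed[OF msum_multilin[OF M] fs]) (use Cons.prems that in auto)
  have "msum R P V M g ((q, basis_el R (syms P V q) s) # ?fs) =
      lin_ext R (syms P V q) M (\<lambda>s. msum R P V M (\<lambda>ss. g (s # ss)) ?fs) (basis_el R (syms P V q) s)"
    using msum_Cons[OF M, of "(q, basis_el R (syms P V q) s)" ?fs V g] fs
      basis_el_carrier[OF R Cons.hyps(1)] Cons.prems
    by (simp add: El_iff)
  also have "\<dots> = msum R P V M (\<lambda>ss. g (s # ss)) ?fs"
    by (rule lin_ext_basis[OF M c Cons.hyps(1)])
  also have "\<dots> = g (s # ss)"
    by (rule Cons.IH) (use Cons in auto)
  finally show ?case by simp
qed

section \<open>The product of symbols and its descent to the quotient\<close>

context
  fixes V :: "('r, 'v) grmod"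
  assumes V: "gr_module R V"
begin

lemma sym_lists_ops:
  assumes "sym_lists P V qs ss"
  shows "list_all2 (\<lambda>x j. x \<in> OEl P j) (map fst ss) (map (length \<circ> snd) ss)"
    and "set (concat (map snd ss)) \<subseteq> El V"
    and "sum_list (degs (map fst ss)) + sum_list (degs (concat (map snd ss))) = sum_list qs"
    and "length (concat (map snd ss)) = sum_list (map (length \<circ> snd) ss)"
  using assms by (induction rule: list_all2_induct) (auto simp: syms_def)

lemma sym_comp:
  assumes y: "y \<in> OEl P (length qs)" and ss: "sym_lists P V qs ss" and n: "n = fst y + sum_list qs"
  shows "(ocomp P (map (length \<circ> snd) ss) y (map fst ss), concat (map snd ss)) \<in> syms P V n"
    and "snd (Sev V y ss) = sgn_mod (Fr V n)
      (interleave_exp (map (fst \<circ> fst) ss) (map (sum_list \<circ> degs \<circ> snd) ss))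
      (Cl V n (ocomp P (map (length \<circ> snd) ss) y (map fst ss), concat (map snd ss)))"
    and "fst (Sev V y ss) = n"
proof -
  note o = sym_lists_ops[OF ss]
  have "length ss = length qs" using ss by (rule list_all2_lengthD)
  then have y': "y \<in> OEl P (length (map (length \<circ> snd) ss))" using y by simp
  show 1: "(ocomp P (map (length \<circ> snd) ss) y (map fst ss), concat (map snd ss)) \<in> syms P V n"
    using ocomp_el[OF y' o(1)] ocomp_deg[OF y' o(1)] o n by (simp add: syms_iff algebra_simps)
  show "snd (Sev V y ss) = sgn_mod (Fr V n)
      (interleave_exp (map (fst \<circ> fst) ss) (map (sum_list \<circ> degs \<circ> snd) ss))
      (Cl V n (ocomp P (map (length \<circ> snd) ss) y (map fst ss), concat (map snd ss)))"
    "fst (Sev V y ss) = n"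
    unfolding sym_ev_def sg_def tens_eq[OF 1] by simp_all
qed

lemma sym_ev_closed:
  "y \<in> OEl P (length qs) \<Longrightarrow> sym_lists P V qs ss \<Longrightarrow> n = fst y + sum_list qs \<Longrightarrow>
    snd (Sev V y ss) \<in> carrier (Fr V n)"
  unfolding sym_comp(2)
  by (rule module_sgn_closed[OF free_part_module[OF V] sym_class_closed[OF V sym_comp(1)]])

text \<open>This is why the product descends to \<open>free_part\<close>: with all other symbols
  fixed, it respects the relations in the remaining slot. Linearity comes from \<open>ocomp\<close>
  and from the symbol classes; a permutation of the letters of that slot acts on the concatenated
  word as the \<open>shift_perm\<close> of its block.\<close>

lemma sym_ev_balanced:
  assumes ss1: "sym_lists P V qs1 ss1" and ss2: "sym_lists P V qs2 ss2"
    and y: "y \<in> OEl P (length qs1 + Suc (length qs2))" and n: "n = fst y + sum_list (qs1 @ q # qs2)"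
  shows "balanced R P V q (Fr V n) (\<lambda>s. snd (Sev V y (ss1 @ s # ss2)))"
proof -
  let ?js1 = "map (length \<circ> snd) ss1" let ?js2 = "map (length \<circ> snd) ss2"
  let ?xs1 = "map fst ss1" let ?xs2 = "map fst ss2"
  let ?c1 = "concat (map snd ss1)" let ?c2 = "concat (map snd ss2)"
  let ?F = "Fr V n"
  define X where "X x k = ocomp P (?js1 @ k # ?js2) y (?xs1 @ x # ?xs2)" for x k
  \<comment> \<open>The interleaving sign sees only the degree \<open>p\<close> of the operation and
    the degree \<open>d\<close> of the word in the distinguished slot. Neither changes under the
    moves below, so the sign passes through them as a constant.\<close>
  define e where "e p d = interleave_exp (map (fst \<circ> fst) ss1 @ p # map (fst \<circ> fst) ss2)
    (map (sum_list \<circ> degs \<circ> snd) ss1 @ d # map (sum_list \<circ> degs \<circ> snd) ss2)" for p d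
  note o1 = sym_lists_ops[OF ss1] and o2 = sym_lists_ops[OF ss2]
  have len: "length ss1 = length qs1" "length ss2 = length qs2"
    using ss1 ss2 list_all2_lengthD by auto
  have sl: "sym_lists P V (qs1 @ q # qs2) (ss1 @ s # ss2)" if "s \<in> syms P V q" for s
    using ss1 ss2 that by (auto intro!: list_all2_appendI)
  have y': "y \<in> OEl P (length (qs1 @ q # qs2))" using y by simp
  have val: "snd (Sev V y (ss1 @ (x, w) # ss2)) =
      sgn_mod ?F (e (fst x) (sum_list (degs w))) (Cl V n (X x (length w), ?c1 @ w @ ?c2))"
    and memb: "(X x (length w), ?c1 @ w @ ?c2) \<in> syms P V n" if "(x, w) \<in> syms P V q" for x w
    using sym_comp(1,2)[OF y' sl[OF that] n] by (simp_all add: X_def e_def)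
  have ops: "list_all2 (\<lambda>x j. x \<in> OEl P j) (?xs1 @ x # ?xs2) (?js1 @ length w # ?js2)"
    if "(x, w) \<in> syms P V q" for x w
    using o1(1) o2(1) that by (auto simp: syms_iff intro!: list_all2_appendI)
  have yj: "y \<in> OEl P (length (?js1 @ k # ?js2))" for k using y len by simp
  have degX: "fst (X x (length w)) = fst y + sum_list (degs (?xs1 @ x # ?xs2))" if "(x, w) \<in> syms P V q" for x w
    unfolding X_def by (rule ocomp_deg[OF yj ops[OF that]])
  have sumj: "sum_list (?js1 @ length w # ?js2) = length (?c1 @ w @ ?c2)" for w :: "'v gel list"
    using o1(4) o2(4) by simp
  note B = sym_class_balanced[OF V, of n]
  show ?thesis
  proof (rule balancedI)
    fix x w assume s: "(x, w) \<in> syms P V q"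
    show "snd (Sev V y (ss1 @ (x, w) # ss2)) \<in> carrier ?F"
      by (rule sym_ev_closed[OF y' sl[OF s] n])
    show "(\<lambda>u. snd (Sev V y (ss1 @ ((fst x, u), w) # ss2))) \<in> lin R (gpart (ops P (length w)) (fst x)) ?F"
    proof (rule lin_cong[OF lin_sgn_mod[OF lin_comp free_part_module[OF V]] op_module])
      have "(\<lambda>u. snd (ocomp P (?js1 @ length w # ?js2) y ((?xs1 @ x # ?xs2)[length ?xs1 := (fst ((?xs1 @ x # ?xs2) ! length ?xs1), u)])))
        \<in> lin R (gpart (ops P ((?js1 @ length w # ?js2) ! length ?xs1)) (fst ((?xs1 @ x # ?xs2) ! length ?xs1)))
          (gpart (ops P (sum_list (?js1 @ length w # ?js2))) (fst y + sum_list (degs (?xs1 @ x # ?xs2))))"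
        by (rule ocomp_lin_slot[OF yj ops[OF s]]) simp
      then show "(\<lambda>u. snd (X (fst x, u) (length w))) \<in> lin R (gpart (ops P (length w)) (fst x))
          (gpart (ops P (length (?c1 @ w @ ?c2))) (fst (X x (length w))))"
        unfolding degX[OF s] unfolding sumj X_def by (simp add: nth_append list_update_append)
      show "(\<lambda>U. Cl V n ((fst (X x (length w)), U), ?c1 @ w @ ?c2)) \<in>
          lin R (gpart (ops P (length (?c1 @ w @ ?c2))) (fst (X x (length w)))) ?F"
        by (rule balanced_op[OF B memb[OF s]])
      fix u assume u: "u \<in> carrier (gpart (ops P (length w)) (fst x))"
      note su = syms_update_op[OF s u]
      have "X (fst x, u) (length w) = (fst (X x (length w)), snd (X (fst x, u) (length w)))"
        using degX[OF s] degX[OF su] by (simp add: prod_eq_iff)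
      then show "snd (Sev V y (ss1 @ ((fst x, u), w) # ss2)) =
          sgn_mod ?F (e (fst x) (sum_list (degs w)))
            (Cl V n ((fst (X x (length w)), snd (X (fst x, u) (length w))), ?c1 @ w @ ?c2))"
        using val[OF su] by simp
    qed
    show "(\<lambda>u. snd (Sev V y (ss1 @ (x, w[i := (fst (w ! i), u)]) # ss2))) \<in> lin R (V (fst (w ! i))) ?F"
      if i: "i < length w" for i
    proof (rule lin_cong[OF lin_sgn_mod[OF _ free_part_module[OF V]] V_module[OF V]])
      have "(\<lambda>u. Cl V n (X x (length w), (?c1 @ w @ ?c2)[length ?c1 + i := (fst ((?c1 @ w @ ?c2) ! (length ?c1 + i)), u)]))
          \<in> lin R (V (fst ((?c1 @ w @ ?c2) ! (length ?c1 + i)))) ?F"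
        by (rule balanced_slot[OF B memb[OF s]]) (use i in simp)
      then show "(\<lambda>u. Cl V n (X x (length w), ?c1 @ w[i := (fst (w ! i), u)] @ ?c2)) \<in> lin R (V (fst (w ! i))) ?F"
        using i by (simp add: nth_append list_update_append)
      fix u assume u: "u \<in> carrier (V (fst (w ! i)))"
      show "snd (Sev V y (ss1 @ (x, w[i := (fst (w ! i), u)]) # ss2)) =
          sgn_mod ?F (e (fst x) (sum_list (degs w))) (Cl V n (X x (length w), ?c1 @ w[i := (fst (w ! i), u)] @ ?c2))"
        using val[OF syms_update[OF s u]] degs_update[of w i u] by simp
    qed
    fix \<sigma> assume \<sigma>: "\<sigma> permutes {..<length w}"
    let ?\<rho> = "shift_perm (length ?c1) (length w) \<sigma>"
    have xl: "x \<in> OEl P (length w)" using s by (simp add: syms_iff)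
    have X\<sigma>: "X (gmap (oact P (length w) \<sigma>) x) (length w) = gmap (oact P (length (?c1 @ w @ ?c2)) ?\<rho>) (X x (length w))"
      unfolding X_def using ocomp_block_act[where y = y, OF _ o1(1) xl o2(1) \<sigma>] y len o1(4) sumj[of w]
      by simp
    have \<rho>: "?\<rho> permutes {..<length (?c1 @ w @ ?c2)}"
      by (rule shift_perm_permutes[OF \<sigma>]) simp
    have inv\<rho>: "permute_list (inv_into UNIV ?\<rho>) (?c1 @ w @ ?c2) = ?c1 @ perminv \<sigma> w @ ?c2"
      using inv_shift_perm[OF \<sigma>] permute_list_shift_perm[OF permutes_inv[OF \<sigma>]] by simp
    have kz: "koszul_exp ?\<rho> (degs (?c1 @ w @ ?c2)) = koszul_exp \<sigma> (degs w)"
      using koszul_exp_shift_perm[of \<sigma> "degs w" "degs ?c1" "degs ?c2"] \<sigma> by simp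
    have dsum: "sum_list (degs (perminv \<sigma> w)) = sum_list (degs w)"
      using permute_list_map[OF permutes_inv[OF \<sigma>], of fst] sum_list_permute_list[of "inv_into UNIV \<sigma>" "degs w"]
        permutes_inv[OF \<sigma>] by simp
    have c: "Cl V n (X x (length w), ?c1 @ perminv \<sigma> w @ ?c2) \<in> carrier ?F"
      using sym_class_closed[OF V memb[OF syms_permute[OF s \<sigma>]]] by simp
    have "snd (Sev V y (ss1 @ (gmap (oact P (length w) \<sigma>) x, w) # ss2)) =
        sgn_mod ?F (e (fst x) (sum_list (degs w))) (sgn_mod ?F (koszul_exp \<sigma> (degs w))
          (Cl V n (X x (length w), ?c1 @ perminv \<sigma> w @ ?c2)))"
      using val[OF syms_act[OF s \<sigma>]] balanced_perm[OF B memb[OF s] \<rho>] unfolding X\<sigma> inv\<rho> kz by simp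
    also have "\<dots> = sgn_mod ?F (koszul_exp \<sigma> (degs w)) (sgn_mod ?F (e (fst x) (sum_list (degs w)))
          (Cl V n (X x (length w), ?c1 @ perminv \<sigma> w @ ?c2)))"
      unfolding sgn_mod_sgn_mod[OF free_part_module[OF V] c] by (simp only: add.commute)
    also have "sgn_mod ?F (e (fst x) (sum_list (degs w)))
          (Cl V n (X x (length w), ?c1 @ perminv \<sigma> w @ ?c2)) =
        snd (Sev V y (ss1 @ (x, perminv \<sigma> w) # ss2))"
      using val[OF syms_permute[OF s \<sigma>]] dsum by simp
    finally show "snd (Sev V y (ss1 @ (gmap (oact P (length w) \<sigma>) x, w) # ss2)) =
        sgn_mod ?F (koszul_exp \<sigma> (degs w)) (snd (Sev V y (ss1 @ (x, perminv \<sigma> w) # ss2)))" .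
  qed
qed

lemma msum_closed_multilin:
  "y \<in> OEl P (length qs) \<Longrightarrow> n = fst y + sum_list qs \<Longrightarrow>
    multilin R (FM V) (Fr V n) qs (msum R P V (Fr V n) (\<lambda>ss. snd (Sev V y ss)))"
  by (rule msum_multilin[OF free_part_module[OF V] sym_ev_closed])

text \<open>Multilinearity reduces all slots except \<open>i\<close> to basis elements. What remains
  is a linear map in slot \<open>i\<close> that sends basis elements to the values of the function
  from \<open>sym_ev_balanced\<close>, hence kills \<open>free_sub\<close>.\<close>

lemma msum_vanishes:
  assumes y: "y \<in> OEl P (length qs)" and n: "n = fst y + sum_list qs"
    and fs: "set fs \<subseteq> El (FM V)" "degs fs = qs" and i: "i < length qs" "snd (fs ! i) \<in> free_sub R P V (qs ! i)"
  shows "msum R P V (Fr V n) (\<lambda>ss. snd (Sev V y ss)) fs = \<zero>\<^bsub>Fr V n\<^esub>"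
proof -
  let ?F = "Fr V n"
  let ?E = "msum R P V ?F (\<lambda>ss. snd (Sev V y ss))"
  let ?b = "\<lambda>q s. (q, basis_el R (syms P V q) s)"
  note F = free_part_module[OF V, of n]
  note E = msum_closed_multilin[OF y n]
  have len: "length fs = length qs" using fs(2) by auto
  \<comment> \<open>The singleton keeps the given element of \<open>free_sub\<close> in slot
    \<open>i\<close>, while every other slot is reduced to generators.\<close>
  define G where "G j = (if j = i then {snd (fs ! i)} else basis_el R (syms P V (qs ! j)) ` syms P V (qs ! j))" for j
  have "?E fs \<in> {\<zero>\<^bsub>?F\<^esub>}"
  proof (rule multilin_gen_sub[OF E FM_module F submodule_zero_sub[OF F] _ _ fs(2)])
    fix j assume j: "j < length qs"
    have jc: "snd (fs ! j) \<in> carrier (FM V (qs ! j))"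
      using El_nth[OF fs(1), of j] degs_nth[OF fs(2), of j] j len by simp
    show "G j \<subseteq> carrier (FM V (qs ! j))" using jc basis_closed[OF V] by (auto simp: G_def)
    have "snd (fs ! j) \<in> gen_sub R (FM V (qs ! j)) (basis_el R (syms P V (qs ! j)) ` syms P V (qs ! j))"
      using jc free_mod_gen[OF R] by blast
    moreover have "snd (fs ! i) \<in> gen_sub R (FM V (qs ! i)) {snd (fs ! i)}"
      using gen_sub_incl[of "{snd (fs ! i)}"] by auto
    ultimately show "snd (fs ! j) \<in> gen_sub R (FM V (qs ! j)) (G j)" by (auto simp: G_def)
  next
    fix as assume as: "set as \<subseteq> El (FM V)" "degs as = qs" and asG: "\<And>j. j < length qs \<Longrightarrow> snd (as ! j) \<in> G j"
    have la: "length as = length qs" using as by auto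
    have "\<forall>j. \<exists>s. j < length qs \<and> j \<noteq> i \<longrightarrow> s \<in> syms P V (qs ! j) \<and> snd (as ! j) = basis_el R (syms P V (qs ! j)) s"
    proof
      fix j
      show "\<exists>s. j < length qs \<and> j \<noteq> i \<longrightarrow> s \<in> syms P V (qs ! j) \<and> snd (as ! j) = basis_el R (syms P V (qs ! j)) s"
        using asG[of j] by (cases "j < length qs \<and> j \<noteq> i") (auto simp only: G_def if_False)
    qed
    then obtain t where t: "\<And>j. j < length qs \<Longrightarrow> j \<noteq> i \<Longrightarrow>
        t j \<in> syms P V (qs ! j) \<and> snd (as ! j) = basis_el R (syms P V (qs ! j)) (t j)"
      by metis
    define ss1 where "ss1 = map t [0..<i]"
    define ss2 where "ss2 = map (\<lambda>j. t (Suc i + j)) [0..<length qs - Suc i]"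
    have nth: "(ss1 @ s # ss2) ! j = (if j = i then s else t j)" if "j < length qs" for s j
      using that i by (auto simp: ss1_def ss2_def nth_append nth_Cons')
    have lss: "length (ss1 @ s # ss2) = length qs" for s using i by (simp add: ss1_def ss2_def)
    have sl: "sym_lists P V qs (ss1 @ s # ss2)" if "s \<in> syms P V (qs ! i)" for s
      using t that nth lss[of s] by (simp add: list_all2_conv_all_nth)
    have sl12: "sym_lists P V (take i qs) ss1" "sym_lists P V (drop (Suc i) qs) ss2"
      using t i by (auto simp: ss1_def ss2_def list_all2_conv_all_nth)
    let ?L = "\<lambda>u. ?E (as[i := (fst (as ! i), u)])"
    have ia: "i < length as" "fst (as ! i) = qs ! i" using i(1) la degs_nth[OF as(2)] by simp_all
    have L: "?L \<in> lin R (FM V (qs ! i)) ?F" using multilin_lin[OF E as ia(1)] ia(2) by simp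
    have Lb: "?L (basis_el R (syms P V (qs ! i)) s) = snd (Sev V y (ss1 @ s # ss2))"
      if s: "s \<in> syms P V (qs ! i)" for s
    proof -
      have "as[i := (fst (as ! i), basis_el R (syms P V (qs ! i)) s)] = map2 ?b qs (ss1 @ s # ss2)"
      proof (rule nth_equalityI)
        fix j assume "j < length (as[i := (fst (as ! i), basis_el R (syms P V (qs ! i)) s)])"
        then have j: "j < length qs" using la by simp
        show "as[i := (fst (as ! i), basis_el R (syms P V (qs ! i)) s)] ! j = map2 ?b qs (ss1 @ s # ss2) ! j"
        proof (cases "j = i")
          case True
          then show ?thesis using ia la nth[OF j, of s] lss[of s] j by simp
        next
          case False
          then have "as ! j = (qs ! j, basis_el R (syms P V (qs ! j)) (t j))"
            using t[OF j] degs_nth[OF as(2), of j] j la by (simp add: prod_eq_iff)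
          then show ?thesis using False la nth[OF j, of s] lss[of s] j by simp
        qed
      qed (use la lss[of s] in simp)
      then show ?thesis using msum_basis[OF F sym_ev_closed[OF y _ n] sl[OF s]] by simp
    qed
    have "balanced R P V (qs ! i) ?F (\<lambda>s. snd (Sev V y (ss1 @ s # ss2)))"
    proof (rule sym_ev_balanced[OF sl12])
      show "y \<in> OEl P (length (take i qs) + Suc (length (drop (Suc i) qs)))"
      proof -
        have "length (take i qs) + Suc (length (drop (Suc i) qs)) = length qs" using i(1) by simp
        then show ?thesis by (simp only: y)
      qed
      show "n = fst y + sum_list (take i qs @ qs ! i # drop (Suc i) qs)"
        using n id_take_nth_drop[OF i(1)] by simp
    qed
    then have "balanced R P V (qs ! i) ?F (\<lambda>s. ?L (basis_el R (syms P V (qs ! i)) s))"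
      by (rule balanced_cong) (use Lb V dg_operad_ctx_axioms in auto)
    from balanced_vanishes[OF V this L F i(2)] have "?L (snd (fs ! i)) = \<zero>\<^bsub>?F\<^esub>" .
    moreover have "snd (as ! i) = snd (fs ! i)" using asG[OF i(1)] by (simp add: G_def)
    ultimately show "?E as \<in> {\<zero>\<^bsub>?F\<^esub>}" by (simp, metis list_update_id prod.collapse)
  qed
  then show ?thesis by simp
qed

abbreviation "fcoset W n f \<equiv> free_sub R P W n +>\<^bsub>FM W n\<^esub> f"

lemma free_ev_deg: "fst (Fev V y Xs) = fst y + sum_list (degs Xs)"
  by (simp add: free_ev_def Let_def)

text \<open>The set under \<open>the_elem\<close> runs over all representatives of the cosets. By
  \<open>multilin_cong\<close> and \<open>msum_vanishes\<close> they share one value, so the product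
  can be computed from any chosen list \<open>fs\<close>.\<close>

lemma free_ev_coset:
  assumes y: "y \<in> OEl P (length fs)" and fs: "set fs \<subseteq> El (FM V)" and n: "n = fst y + sum_list (degs fs)"
  shows "snd (Fev V y (map (\<lambda>f. (fst f, fcoset V (fst f) (snd f))) fs)) =
    msum R P V (Fr V n) (\<lambda>ss. snd (Sev V y ss)) fs"
proof -
  let ?E = "msum R P V (Fr V n) (\<lambda>ss. snd (Sev V y ss))"
  let ?Xs = "map (\<lambda>f. (fst f, fcoset V (fst f) (snd f))) fs"
  note F = free_part_module[OF V, of n]
  have y': "y \<in> OEl P (length (degs fs))" using y by simp
  note E = msum_closed_multilin[OF y' n]
  have eq: "?E gs = ?E fs" if gs: "list_all2 (\<lambda>f X. fst f = fst X \<and> snd f \<in> snd X) gs ?Xs" for gs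
  proof -
    have gd: "degs gs = degs fs" using gs by (auto simp: list_all2_conv_all_nth intro!: nth_equalityI)
    have lg: "length gs = length fs" using gd by (metis length_map)
    have mem: "snd (gs ! i) \<in> carrier (FM V (fst (gs ! i))) \<and>
        snd (gs ! i) \<ominus>\<^bsub>FM V (degs fs ! i)\<^esub> snd (fs ! i) \<in> free_sub R P V (degs fs ! i)"
      if i: "i < length fs" for i
      using gs coset_mem_iff[OF FM_module free_sub_submodule[OF V] El_nth[OF fs i], of "snd (gs ! i)"] i
      by (auto simp: list_all2_conv_all_nth)
    have gE: "set gs \<subseteq> El (FM V)"
      by (rule El_listI) (use mem lg in auto)
    have "?E gs \<ominus>\<^bsub>Fr V n\<^esub> ?E fs \<in> {\<zero>\<^bsub>Fr V n\<^esub>}"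
    proof (rule multilin_cong[OF E FM_module F submodule_zero_sub[OF F] _ gE gd fs refl])
      show "snd (gs ! i) \<ominus>\<^bsub>FM V (degs fs ! i)\<^esub> snd (fs ! i) \<in> free_sub R P V (degs fs ! i)"
        if "i < length (degs fs)" for i using mem that by simp
    qed (use msum_vanishes[OF y' n] in simp)
    then show ?thesis
      using module_diff_eq_zero[OF F multilin_closed[OF E gE gd] multilin_closed[OF E fs refl]] by simp
  qed
  have self: "list_all2 (\<lambda>f X. fst f = fst X \<and> snd f \<in> snd X) fs ?Xs"
    using coset_self[OF FM_module free_sub_submodule[OF V]] fs
    by (auto simp: list_all2_conv_all_nth El_iff subset_iff)
  have "{?E gs | gs. list_all2 (\<lambda>f X. fst f = fst X \<and> snd f \<in> snd X) gs ?Xs} = {?E fs}"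
    using eq self by blast
  then show ?thesis
    unfolding free_ev_def msum_def Let_def by (simp add: n comp_def)
qed

lemma free_part_reps:
  assumes "set Xs \<subseteq> El (Fr V)"
  obtains fs where "set fs \<subseteq> El (FM V)" "Xs = map (\<lambda>f. (fst f, fcoset V (fst f) (snd f))) fs"
proof -
  have "\<exists>fs. set fs \<subseteq> El (FM V) \<and> Xs = map (\<lambda>f. (fst f, fcoset V (fst f) (snd f))) fs"
    using assms
  proof (induction Xs)
    case (Cons X Xs)
    then obtain fs where fs: "set fs \<subseteq> El (FM V)" "Xs = map (\<lambda>f. (fst f, fcoset V (fst f) (snd f))) fs" by auto
    obtain f where f: "f \<in> carrier (FM V (fst X))" "snd X = fcoset V (fst X) f"
      using Cons.prems by (auto simp: El_iff free_part_def quot_carrier[OF FM_module free_sub_submodule[OF V]])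
    show ?case
      by (rule exI[of _ "(fst X, f) # fs"]) (use f fs in \<open>auto simp: El_iff prod_eq_iff\<close>)
  qed auto
  then show ?thesis using that by blast
qed

lemma free_ev_multilin:
  assumes y: "y \<in> OEl P (length qs)" and n: "n = fst y + sum_list qs"
  shows "multilin R (Fr V) (Fr V n) qs (\<lambda>Xs. snd (Fev V y Xs))"
proof (rule multilinI)
  let ?c = "\<lambda>f. (fst f, fcoset V (fst f) (snd f))"
  note E = msum_closed_multilin[OF y n]
  fix Xs assume Xs: "set Xs \<subseteq> El (Fr V)" "degs Xs = qs"
  obtain fs where fs: "set fs \<subseteq> El (FM V)" "Xs = map ?c fs"
    using free_part_reps[OF Xs(1)] by blast
  have fd: "degs fs = qs" using fs Xs by (simp add: comp_def)
  have yl: "y \<in> OEl P (length fs)" using y fd by auto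
  show "snd (Fev V y Xs) \<in> carrier (Fr V n)"
    unfolding fs(2) free_ev_coset[OF yl fs(1), unfolded fd, OF n] by (rule multilin_closed[OF E fs(1) fd])
  fix i assume i: "i < length Xs"
  then have i': "i < length fs" using fs by simp
  let ?q = "fst (fs ! i)"
  let ?L = "\<lambda>u. msum R P V (Fr V n) (\<lambda>ss. snd (Sev V y ss)) (fs[i := (?q, u)])"
  have L: "?L \<in> lin R (FM V ?q) (Fr V n)" by (rule multilin_lin[OF E fs(1) fd i'])
  have eq: "snd (Fev V y (Xs[i := (?q, fcoset V ?q f)])) = ?L f" if f: "f \<in> carrier (FM V ?q)" for f
  proof -
    have "Xs[i := (?q, fcoset V ?q f)] = map ?c (fs[i := (?q, f)])" unfolding fs(2) by (simp add: map_update)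
    moreover have "snd (Fev V y (map ?c (fs[i := (?q, f)]))) = ?L f"
      by (rule free_ev_coset) (use yl El_update[OF fs(1)] f degs_update[of fs i f] fd n in auto)
    ultimately show ?thesis by simp
  qed
  have "(\<lambda>u. snd (Fev V y (Xs[i := (?q, u)]))) \<in> lin R (Fr V ?q) (Fr V n)"
  proof (rule linI)
    note qc = quot_carrier[OF FM_module free_sub_submodule[OF V]]
    note qa = lin_add[OF coset_free_lin[OF V], symmetric] and qs = lin_smult[OF coset_free_lin[OF V], symmetric]
    fix u assume "u \<in> carrier (Fr V ?q)"
    then obtain f where f: "f \<in> carrier (FM V ?q)" "u = fcoset V ?q f" by (auto simp: free_part_def qc)
    show "snd (Fev V y (Xs[i := (?q, u)])) \<in> carrier (Fr V n)"
      unfolding f(2) eq[OF f(1)] by (rule lin_closed[OF L f(1)])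
    {
      fix v assume "v \<in> carrier (Fr V ?q)"
      then obtain g where g: "g \<in> carrier (FM V ?q)" "v = fcoset V ?q g" by (auto simp: free_part_def qc)
      show "snd (Fev V y (Xs[i := (?q, u \<oplus>\<^bsub>Fr V ?q\<^esub> v)])) =
          snd (Fev V y (Xs[i := (?q, u)])) \<oplus>\<^bsub>Fr V n\<^esub> snd (Fev V y (Xs[i := (?q, v)]))"
        unfolding f(2) g(2) qa[OF f(1) g(1)] eq[OF f(1)] eq[OF g(1)] eq[OF module_add_closed[OF FM_module f(1) g(1)]]
        by (rule lin_add[OF L f(1) g(1)])
    }
    fix r assume r: "r \<in> carrier R"
    show "snd (Fev V y (Xs[i := (?q, r \<odot>\<^bsub>Fr V ?q\<^esub> u)])) =
        r \<odot>\<^bsub>Fr V n\<^esub> snd (Fev V y (Xs[i := (?q, u)]))"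
      unfolding f(2) qs[OF r f(1)] eq[OF f(1)] eq[OF module.smult_closed[OF FM_module r f(1)]]
      by (rule lin_smult[OF L r f(1)])
  qed
  then show "(\<lambda>u. snd (Fev V y (Xs[i := (fst (Xs ! i), u)]))) \<in> lin R (Fr V (fst (Xs ! i))) (Fr V n)"
    unfolding fs(2) using i' by simp
qed

lemma sym_lists_classes:
  assumes "sym_lists P V qs ss"
  shows "map (\<lambda>s. tens R P V (fst s) (snd s)) ss = map2 (\<lambda>q s. (q, Cl V q s)) qs ss"
    and "set (map (\<lambda>s. tens R P V (fst s) (snd s)) ss) \<subseteq> El (Fr V)"
    and "degs (map (\<lambda>s. tens R P V (fst s) (snd s)) ss) = qs"
  using assms by (induction rule: list_all2_induct) (auto simp: tens_eq El_iff sym_class_closed[OF V])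

text \<open>Basis elements represent symbol classes, and on basis elements the multilinear extension
  returns the function that it extends.\<close>

lemma free_ev_tens:
  assumes y: "y \<in> OEl P (length qs)" and ss: "sym_lists P V qs ss"
  shows "Fev V y (map (\<lambda>s. tens R P V (fst s) (snd s)) ss) = Sev V y ss"
proof -
  let ?n = "fst y + sum_list qs"
  let ?b = "\<lambda>q s. (q, basis_el R (syms P V q) s)"
  let ?fs = "map2 ?b qs ss"
  have len: "length ss = length qs" using ss by (rule list_all2_lengthD)
  have "snd (?fs ! i) \<in> carrier (FM V (fst (?fs ! i)))" if "i < length ?fs" for i
  proof -
    have "ss ! i \<in> syms P V (qs ! i)" using that ss by (simp add: list_all2_conv_all_nth)
    from basis_closed[OF V this] show ?thesis using that by simp
  qed
  then have fs: "set ?fs \<subseteq> El (FM V)" by (rule El_listI)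
  have fd: "degs ?fs = qs" using len by (auto intro!: nth_equalityI)
  have "map (\<lambda>s. tens R P V (fst s) (snd s)) ss = map (\<lambda>f. (fst f, fcoset V (fst f) (snd f))) ?fs"
    unfolding sym_lists_classes(1)[OF ss] by (auto simp: sym_class_def)
  moreover have "snd (Fev V y (map (\<lambda>f. (fst f, fcoset V (fst f) (snd f))) ?fs)) =
      msum R P V (Fr V ?n) (\<lambda>ss. snd (Sev V y ss)) ?fs"
    by (rule free_ev_coset) (use y fs fd len in auto)
  moreover have "\<dots> = snd (Sev V y ss)"
    by (rule msum_basis[OF free_part_module[OF V] sym_ev_closed[OF y _ refl] ss])
  moreover have "fst (Fev V y (map (\<lambda>s. tens R P V (fst s) (snd s)) ss)) = ?n"
    using free_ev_deg sym_lists_classes(3)[OF ss] by simp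
  ultimately show ?thesis using sym_comp(3)[OF y ss refl] by (simp add: prod_eq_iff)
qed

end

end

section \<open>The differential of a free algebra\<close>

lemma sgn_mod_cong: "even (e + e') \<Longrightarrow> sgn_mod M e x = sgn_mod M e' x"
  by (auto simp: even_add)

lemma sum_list_update_int: "i < length qs \<Longrightarrow> sum_list (qs[i := q]) = sum_list qs + q - (qs ! i :: int)"
  by (induction qs arbitrary: i) (auto split: nat.splits)

lemma sum_list_degs_concat: "sum_list (degs (concat wss)) = sum_list (map (sum_list \<circ> degs) wss)"
  by (induction wss) auto

text \<open>Differentiating operation \<open>i\<close> lowers its degree by one, and the exponent
  loses the degrees of the words which this operation is moved past. Dually, lowering the degree of
  a word, as in \<open>interleave_exp_dec_right\<close>, removes the degrees of the later
  operations.\<close>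

lemma interleave_exp_dec_left:
  assumes "i < length ps"
  shows "interleave_exp (ps[i := ps ! i - 1]) qs = interleave_exp ps qs - (\<Sum>l<i. qs ! l)"
proof -
  have "interleave_exp (ps[i := ps ! i - 1]) qs =
      (\<Sum>j<length ps. (\<Sum>l<j. ps ! j * qs ! l) - (if j = i then (\<Sum>l<i. qs ! l) else 0))"
    unfolding interleave_exp_def
    by (rule sum.cong) (use assms in \<open>auto simp: left_diff_distrib sum_subtractf\<close>)
  also have "\<dots> = interleave_exp ps qs - (\<Sum>l<i. qs ! l)"
    using assms by (simp add: sum_subtractf interleave_exp_def)
  finally show ?thesis .
qed

lemma interleave_exp_dec_right:
  assumes "i < length qs" "length ps = length qs"
  shows "interleave_exp ps (qs[i := qs ! i - 1]) = interleave_exp ps qs - (\<Sum>j\<in>{Suc i..<length ps}. ps ! j)"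
proof -
  have "interleave_exp ps (qs[i := qs ! i - 1]) =
      (\<Sum>j<length ps. (\<Sum>l<j. ps ! j * qs ! l - (if l = i then ps ! j else 0)))"
    unfolding interleave_exp_def
    by (intro sum.cong refl) (use assms in \<open>auto simp: right_diff_distrib nth_list_update\<close>)
  also have "\<dots> = (\<Sum>j<length ps. (\<Sum>l<j. ps ! j * qs ! l) - (if i < j then ps ! j else 0))"
    by (intro sum.cong refl) (simp add: sum_subtractf)
  also have "\<dots> = interleave_exp ps qs - (\<Sum>j<length ps. if i < j then ps ! j else 0)"
    by (simp add: sum_subtractf interleave_exp_def)
  also have "(\<Sum>j<length ps. if i < j then ps ! j else 0) = (\<Sum>j\<in>{Suc i..<length ps}. ps ! j)"
    by (simp add: sum.inter_filter[symmetric]) (rule sum.cong, auto)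
  finally show ?thesis .
qed

lemma offset_append: "i \<le> length js \<Longrightarrow> offset (js @ js') i = offset js i"
  by (simp add: offset_def)

text \<open>Groups the letters of a concatenated word by the factor they come from: the differential
  of a product runs over all letters of the long word, while the Leibniz rule runs over the
  factors.\<close>

lemma finsum_concat:
  assumes M: "module R M" and h: "\<And>m. h m \<in> carrier M"
  shows "finsum M h {..<length (concat wss)} =
    finsum M (\<lambda>i. finsum M (\<lambda>m. h (offset (map length wss) i + m)) {..<length (wss ! i)}) {..<length wss}"
proof (induction wss rule: rev_induct)
  case Nil
  interpret M: module R M by fact
  show ?case by simp
next
  case (snoc w wss)
  interpret M: module R M by fact
  let ?N = "length (concat wss)"
  have eq: "{..<length (concat (wss @ [w]))} = {..<?N} \<union> (\<lambda>m. ?N + m) ` {..<length w}"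
  proof (intro equalityI subsetI)
    fix x assume "x \<in> {..<length (concat (wss @ [w]))}"
    then show "x \<in> {..<?N} \<union> (\<lambda>m. ?N + m) ` {..<length w}"
      by (cases "x < ?N") (auto intro!: image_eqI[of _ _ "x - ?N"])
  qed auto
  have "finsum M h {..<length (concat (wss @ [w]))} = finsum M h {..<?N} \<oplus>\<^bsub>M\<^esub> finsum M h ((\<lambda>m. ?N + m) ` {..<length w})"
    unfolding eq by (rule M.finsum_Un_disjoint) (use h in auto)
  also have "finsum M h ((\<lambda>m. ?N + m) ` {..<length w}) = finsum M (\<lambda>m. h (?N + m)) {..<length w}"
    by (rule M.finsum_reindex) (use h in \<open>auto simp: inj_on_def\<close>)
  also have "finsum M h {..<?N} = finsum M (\<lambda>i. finsum M (\<lambda>m. h (offset (map length (wss @ [w])) i + m)) {..<length ((wss @ [w]) ! i)}) {..<length wss}"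
    unfolding snoc.IH
    by (rule module_finsum_cong[OF M]) (auto simp: nth_append offset_append intro!: module_finsum_closed[OF M] h)
  finally show ?case
    by (simp add: lessThan_Suc h M.a_comm offset_append length_concat offset_length[of "map length wss", simplified])
qed

lemma concat_split:
  assumes "i < length wss"
  shows "concat wss = concat (take i wss) @ wss ! i @ concat (drop (Suc i) wss)"
    and "offset (map length wss) i = length (concat (take i wss))"
    and "concat (wss[i := w]) = concat (take i wss) @ w @ concat (drop (Suc i) wss)"
proof -
  show "concat wss = concat (take i wss) @ wss ! i @ concat (drop (Suc i) wss)"
    by (subst id_take_nth_drop[OF assms]) simp
  show "offset (map length wss) i = length (concat (take i wss))"
    by (simp add: offset_def length_concat take_map)
  show "concat (wss[i := w]) = concat (take i wss) @ w @ concat (drop (Suc i) wss)"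
    by (simp add: upd_conv_take_nth_drop[OF assms])
qed

lemma multilin_transfer:
  assumes g: "multilin R M N qs g" and M: "\<And>q. module R (M q)"
    and eq: "\<And>as. set as \<subseteq> El M \<Longrightarrow> degs as = qs \<Longrightarrow> g' as = g as"
  shows "multilin R M N qs g'"
proof (rule multilinI)
  fix as assume as: "set as \<subseteq> El M" "degs as = qs"
  show "g' as \<in> carrier N" using multilin_closed[OF g as] eq[OF as] by simp
  fix i assume i: "i < length as"
  show "(\<lambda>u. g' (as[i := (fst (as ! i), u)])) \<in> lin R (M (fst (as ! i))) N"
    by (rule lin_cong[OF multilin_lin[OF g as i] M]) (rule eq, use as El_update[OF as(1)] degs_update in auto)
qed

text \<open>For the summands of a Leibniz rule: one argument passes through a map that changes its
  degree, and multilinearity for the new list of degrees gives multilinearity for the old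
  one.\<close>

lemma multilin_slot_map:
  assumes g: "multilin R M N (qs[i := q']) g" and M: "\<And>q. module R (M q)" and i: "i < length qs"
    and h: "h \<in> lin R (M (qs ! i)) (M q')"
  shows "multilin R M N qs (\<lambda>as. g (as[i := (q', h (snd (as ! i)))]))"
proof -
  have "multilin R M N qs (\<lambda>as. g (map (\<lambda>j. (qs[i := q'] ! j, (if j = i then h else (\<lambda>x. x)) (snd (as ! j)))) [0..<length (qs[i := q'])]))"
    by (rule multilin_precomp[OF g]) (use h i in \<open>auto simp: nth_list_update lin_id\<close>)
  then show ?thesis
  proof (rule multilin_transfer[OF _ M])
    fix as assume as: "set as \<subseteq> El M" "degs as = qs"
    have "as[i := (q', h (snd (as ! i)))] =
        map (\<lambda>j. (qs[i := q'] ! j, (if j = i then h else (\<lambda>x. x)) (snd (as ! j)))) [0..<length (qs[i := q'])]"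
    proof (rule nth_equalityI)
      fix j assume "j < length (as[i := (q', h (snd (as ! i)))])"
      then have j: "j < length qs" "j < length as" using degs_length[OF as(2)] by auto
      show "as[i := (q', h (snd (as ! i)))] ! j =
        map (\<lambda>j. (qs[i := q'] ! j, (if j = i then h else (\<lambda>x. x)) (snd (as ! j)))) [0..<length (qs[i := q'])] ! j"
        using j i degs_nth[OF as(2) j(2)] by (cases "j = i") (auto simp: prod_eq_iff)
    qed (use degs_length[OF as(2)] in simp)
    then show "g (as[i := (q', h (snd (as ! i)))]) =
        g (map (\<lambda>j. (qs[i := q'] ! j, (if j = i then h else (\<lambda>x. x)) (snd (as ! j)))) [0..<length (qs[i := q'])])"
      by simp
  qed
qed

context dg_operad_ctx
begin

context
  fixes W :: "('r, 'v) dgmod"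
  assumes W: "gr_module R (gpart W)"
    and dW: "\<And>q. dif W q \<in> lin R (gpart W q) (gpart W (q - 1))"
begin

abbreviation "dslot ws i \<equiv> ws[i := dl W (ws ! i)]"

lemma syms_dl_op: "(x, ws) \<in> syms P (gpart W) n \<Longrightarrow> (dl (ops P (length ws)) x, ws) \<in> syms P (gpart W) (n - 1)"
  using lin_closed[OF op_dif] by (auto simp: syms_iff El_iff dl_def)

lemma El_dl: "a \<in> El (gpart W) \<Longrightarrow> dl W a \<in> El (gpart W)"
  using lin_closed[OF dW] by (auto simp: El_iff dl_def)

lemma syms_dslot: "(x, ws) \<in> syms P (gpart W) n \<Longrightarrow> i < length ws \<Longrightarrow> (x, dslot ws i) \<in> syms P (gpart W) (n - 1)"
proof -
  assume s: "(x, ws) \<in> syms P (gpart W) n" and i: "i < length ws"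
  have "ws ! i \<in> El (gpart W)" using s i by (auto simp: syms_iff)
  then have "set (dslot ws i) \<subseteq> El (gpart W)"
    using El_update[of ws "gpart W" "dl W (ws ! i)" i] El_dl[of "ws ! i"] s by (auto simp: syms_iff El_iff)
  moreover have "sum_list (degs (dslot ws i)) = sum_list (degs ws) - 1"
    using i by (simp add: map_update sum_list_update_int) (simp add: dl_def)
  ultimately show ?thesis using s by (simp add: syms_iff)
qed

lemma sym_dif_eq:
  assumes "(x, ws) \<in> syms P (gpart W) n"
  shows "sym_dif R P W n (x, ws) = Cl (gpart W) (n - 1) (dl (ops P (length ws)) x, ws)
    \<oplus>\<^bsub>Fr (gpart W) (n - 1)\<^esub> (\<Oplus>\<^bsub>Fr (gpart W) (n - 1)\<^esub>i\<in>{..<length ws}.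
      sgn_mod (Fr (gpart W) (n - 1)) (fst x + sum_list (degs (take i ws)))
        (Cl (gpart W) (n - 1) (x, dslot ws i)))"
proof -
  have "(\<Oplus>\<^bsub>Fr (gpart W) (n - 1)\<^esub>i\<in>{..<length ws}.
      snd (sg (Fr (gpart W)) (fst x + sum_list (degs (take i ws))) (tens R P (gpart W) x (dslot ws i)))) =
    (\<Oplus>\<^bsub>Fr (gpart W) (n - 1)\<^esub>i\<in>{..<length ws}.
      sgn_mod (Fr (gpart W) (n - 1)) (fst x + sum_list (degs (take i ws)))
        (Cl (gpart W) (n - 1) (x, dslot ws i)))"
    by (rule module_finsum_cong[OF free_part_module[OF W]])
      (auto simp: sg_def tens_eq[OF syms_dslot[OF assms]] sym_class_closed[OF W syms_dslot[OF assms]]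
        intro: module_neg_closed[OF free_part_module[OF W]])
  then show ?thesis by (simp add: sym_dif_def Let_def tens_eq[OF syms_dl_op[OF assms]])
qed

text \<open>Only equivariance needs an idea: the summand that differentiates letter \<open>i\<close>
  on one side corresponds to the summand for letter \<open>\<sigma> i\<close> on the other, and
  \<open>koszul_exp_dec\<close> makes their signs agree.\<close>

lemma sym_dif_balanced: "balanced R P (gpart W) n (Fr (gpart W) (n - 1)) (sym_dif R P W n)"
proof (rule balancedI)
  let ?F = "Fr (gpart W) (n - 1)"
  let ?T = "Cl (gpart W) (n - 1)"
  note F = free_part_module[OF W, of "n - 1"]
  note B = sym_class_balanced[OF W, of "n - 1"]
  note Tc = sym_class_closed[OF W]
  fix x ws assume s: "(x, ws) \<in> syms P (gpart W) n"
  show "sym_dif R P W n (x, ws) \<in> carrier ?F"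
    unfolding sym_dif_eq[OF s]
    by (intro module_add_closed[OF F] module_finsum_closed[OF F] module_sgn_closed[OF F] Tc syms_dl_op[OF s] syms_dslot[OF s]) auto
  show "(\<lambda>u. sym_dif R P W n ((fst x, u), ws)) \<in> lin R (gpart (ops P (length ws)) (fst x)) ?F"
  proof (rule lin_cong[OF _ op_module])
    show "(\<lambda>u. ?T ((fst x - 1, dif (ops P (length ws)) (fst x) u), ws) \<oplus>\<^bsub>?F\<^esub>
        (\<Oplus>\<^bsub>?F\<^esub>i\<in>{..<length ws}. sgn_mod ?F (fst x + sum_list (degs (take i ws))) (?T ((fst x, u), dslot ws i))))
        \<in> lin R (gpart (ops P (length ws)) (fst x)) ?F"
    proof (rule lin_plus[OF lin_comp[OF op_dif] lin_sum[OF op_module F finite_lessThan] F])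
      show "(\<lambda>U. ?T ((fst x - 1, U), ws)) \<in> lin R (gpart (ops P (length ws)) (fst x - 1)) ?F"
        using balanced_op[OF B syms_dl_op[OF s]] by (simp add: dl_def)
      show "(\<lambda>u. sgn_mod ?F (fst x + sum_list (degs (take i ws))) (?T ((fst x, u), dslot ws i)))
          \<in> lin R (gpart (ops P (length ws)) (fst x)) ?F" if "i \<in> {..<length ws}" for i
      proof (rule lin_sgn_mod[OF _ F])
        show "(\<lambda>u. ?T ((fst x, u), dslot ws i)) \<in> lin R (gpart (ops P (length ws)) (fst x)) ?F"
          using balanced_op[OF B syms_dslot[OF s]] that by simp
      qed
    qed
    fix u assume u: "u \<in> carrier (gpart (ops P (length ws)) (fst x))"
    show "sym_dif R P W n ((fst x, u), ws) = ?T ((fst x - 1, dif (ops P (length ws)) (fst x) u), ws) \<oplus>\<^bsub>?F\<^esub>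
        (\<Oplus>\<^bsub>?F\<^esub>i\<in>{..<length ws}. sgn_mod ?F (fst x + sum_list (degs (take i ws))) (?T ((fst x, u), dslot ws i)))"
      using sym_dif_eq[OF syms_update_op[OF s u]] by (simp add: dl_def)
  qed
  show "(\<lambda>u. sym_dif R P W n (x, ws[j := (fst (ws ! j), u)])) \<in> lin R (gpart W (fst (ws ! j))) ?F"
    if j: "j < length ws" for j
  proof (rule lin_cong[OF _ V_module[OF W]])
    let ?q = "fst (ws ! j)"
    \<comment> \<open>In slot \<open>j\<close>, the summand \<open>i = j\<close> depends on the
      entry through the differential of \<open>W\<close> and a slot of lower degree; in all other
      summands the entry appears unchanged.\<close>
    let ?h = "\<lambda>i u. if i = j then ?T (x, ws[j := (?q - 1, dif W ?q u)]) else ?T (x, (dslot ws i)[j := (?q, u)])"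
    show "(\<lambda>u. ?T (dl (ops P (length ws)) x, ws[j := (?q, u)]) \<oplus>\<^bsub>?F\<^esub>
        (\<Oplus>\<^bsub>?F\<^esub>i\<in>{..<length ws}. sgn_mod ?F (fst x + sum_list (degs (take i ws))) (?h i u)))
        \<in> lin R (gpart W ?q) ?F"
    proof (rule lin_plus[OF _ lin_sum[OF V_module[OF W] F finite_lessThan lin_sgn_mod[OF _ F]] F])
      show "(\<lambda>u. ?T (dl (ops P (length ws)) x, ws[j := (?q, u)])) \<in> lin R (gpart W ?q) ?F"
        by (rule balanced_slot[OF B syms_dl_op[OF s] j])
      fix i assume "i \<in> {..<length ws}"
      then have i: "i < length ws" by simp
      show "(\<lambda>u. ?h i u) \<in> lin R (gpart W ?q) ?F"
      proof (cases "i = j")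
        case True
        have "(\<lambda>u. ?T (x, (dslot ws j)[j := (fst (dslot ws j ! j), u)])) \<in> lin R (gpart W (fst (dslot ws j ! j))) ?F"
          by (rule balanced_slot[OF B syms_dslot[OF s j]]) (use j in simp)
        then have "(\<lambda>u. ?T (x, ws[j := (?q - 1, u)])) \<in> lin R (gpart W (?q - 1)) ?F"
          using j by (simp add: dl_def)
        from lin_comp[OF dW this] show ?thesis using True by simp
      next
        case False
        have "(\<lambda>u. ?T (x, (dslot ws i)[j := (fst (dslot ws i ! j), u)])) \<in> lin R (gpart W (fst (dslot ws i ! j))) ?F"
          by (rule balanced_slot[OF B syms_dslot[OF s i]]) (use j in simp)
        then show ?thesis using False by simp
      qed
    qed
    fix u assume u: "u \<in> carrier (gpart W ?q)"
    have t: "degs (take i (ws[j := (?q, u)])) = degs (take i ws)" for i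
      using degs_update[of ws j u] by (simp add: take_map[symmetric])
    have "(\<Oplus>\<^bsub>?F\<^esub>i\<in>{..<length ws}. sgn_mod ?F (fst x + sum_list (degs (take i (ws[j := (?q, u)]))))
        (?T (x, dslot (ws[j := (?q, u)]) i))) =
      (\<Oplus>\<^bsub>?F\<^esub>i\<in>{..<length ws}. sgn_mod ?F (fst x + sum_list (degs (take i ws))) (?h i u))"
    proof (rule module_finsum_cong[OF F])
      fix i assume i: "i \<in> {..<length ws}"
      have e: "?T (x, dslot (ws[j := (?q, u)]) i) = ?h i u"
        using j by (auto simp: dl_def list_update_swap)
      show "sgn_mod ?F (fst x + sum_list (degs (take i (ws[j := (?q, u)])))) (?T (x, dslot (ws[j := (?q, u)]) i)) =
          sgn_mod ?F (fst x + sum_list (degs (take i ws))) (?h i u)"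
        unfolding e t ..
      have "?h i u \<in> carrier ?F"
        unfolding e[symmetric] by (rule Tc[OF syms_dslot[OF syms_update[OF s u]]]) (use i in simp)
      then show "sgn_mod ?F (fst x + sum_list (degs (take i ws))) (?h i u) \<in> carrier ?F"
        by (rule module_sgn_closed[OF F])
    qed
    then show "sym_dif R P W n (x, ws[j := (?q, u)]) = ?T (dl (ops P (length ws)) x, ws[j := (?q, u)]) \<oplus>\<^bsub>?F\<^esub>
        (\<Oplus>\<^bsub>?F\<^esub>i\<in>{..<length ws}. sgn_mod ?F (fst x + sum_list (degs (take i ws))) (?h i u))"
      using sym_dif_eq[OF syms_update[OF s u]] by simp
  qed
  fix \<sigma> assume \<sigma>: "\<sigma> permutes {..<length ws}"
  let ?\<kappa> = "koszul_exp \<sigma> (degs ws)" and ?ws = "perminv \<sigma> ws"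
  note s\<sigma> = syms_act[OF s \<sigma>] and sp = syms_permute[OF s \<sigma>]
  have lws: "length ?ws = length ws" by simp
  have dp: "perminv \<sigma> (dslot ws i) = dslot ?ws (\<sigma> i)" if i: "i < length ws" for i
  proof (rule nth_equalityI)
    fix m assume "m < length (perminv \<sigma> (dslot ws i))"
    then have m: "m < length ws" by simp
    have p: "perminv \<sigma> us ! m = us ! inv_into UNIV \<sigma> m" if "length us = length ws" for us :: "'v gel list"
      by (rule permute_list_nth) (use permutes_inv[OF \<sigma>] m that in auto)
    have "?ws ! \<sigma> i = ws ! i"
      using permute_list_nth[OF permutes_inv[OF \<sigma>], of "\<sigma> i"] shift_perm_lt[OF \<sigma> i] permutes_inverses[OF \<sigma>] by simp
    moreover have "inv_into UNIV \<sigma> m = i \<longleftrightarrow> m = \<sigma> i" using permutes_inverses[OF \<sigma>] by metis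
    ultimately show "perminv \<sigma> (dslot ws i) ! m = dslot ?ws (\<sigma> i) ! m"
      using p m i shift_perm_lt[OF \<sigma> i] shift_perm_lt[OF permutes_inv[OF \<sigma>] m]
      by (cases "m = \<sigma> i") (simp_all add: nth_list_update)
  qed simp
  have t1: "?T (dl (ops P (length ws)) (gmap (oact P (length ws) \<sigma>) x), ws) =
      sgn_mod ?F ?\<kappa> (?T (dl (ops P (length ws)) x, ?ws))"
    using oact_dif[OF \<sigma>, of x] s balanced_perm[OF B syms_dl_op[OF s] \<sigma>] by (simp add: syms_iff)
  let ?t = "\<lambda>i. sgn_mod ?F (fst x + sum_list (degs (take i ?ws))) (?T (x, dslot ?ws i))"
  have tc: "?t i \<in> carrier ?F" if "i < length ws" for i
    by (rule module_sgn_closed[OF F Tc[OF syms_dslot[OF sp]]]) (use that in simp)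
  have t2: "sgn_mod ?F (fst x + sum_list (degs (take i ws))) (?T (gmap (oact P (length ws) \<sigma>) x, dslot ws i)) =
      sgn_mod ?F ?\<kappa> (?t (\<sigma> i))" if i: "i < length ws" for i
  proof -
    have "?T (gmap (oact P (length ws) \<sigma>) x, dslot ws i) =
        sgn_mod ?F (koszul_exp \<sigma> (degs (dslot ws i))) (?T (x, dslot ?ws (\<sigma> i)))"
      using balanced_perm[OF B syms_dslot[OF s i], of \<sigma>] \<sigma> dp[OF i] by simp
    moreover have c: "?T (x, dslot ?ws (\<sigma> i)) \<in> carrier ?F"
      using Tc[OF syms_dslot[OF sp, of "\<sigma> i"]] shift_perm_lt[OF \<sigma> i] by simp
    moreover have "degs (dslot ws i) = (degs ws)[i := degs ws ! i - 1]"
      using i by (simp add: map_update dl_def)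
    moreover have "degs (take (\<sigma> i) ?ws) = take (\<sigma> i) (perminv \<sigma> (degs ws))"
      using permute_list_map[OF permutes_inv[OF \<sigma>], of fst] by (simp add: take_map)
    moreover have "even ((fst x + sum_list (degs (take i ws)) + koszul_exp \<sigma> ((degs ws)[i := degs ws ! i - 1])) +
        (?\<kappa> + (fst x + sum_list (take (\<sigma> i) (perminv \<sigma> (degs ws))))))"
    proof -
      have "even (koszul_exp \<sigma> ((degs ws)[i := degs ws ! i - 1]) + sum_list (degs (take i ws)) + ?\<kappa> +
          sum_list (take (\<sigma> i) (perminv \<sigma> (degs ws))))"
        using koszul_exp_dec[of \<sigma> "degs ws" i] \<sigma> i by (simp only: length_map take_map)
      then show ?thesis by presburger
    qed
    ultimately show ?thesis
      by (simp only: sgn_mod_sgn_mod[OF F c] sgn_mod_cong)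
  qed
  have sl: "(\<lambda>x. sgn_mod ?F ?\<kappa> x) \<in> lin R ?F ?F" by (rule lin_sgn_mod[OF lin_id F])
  interpret F: module R ?F by (rule F)
  have sc: "(\<Oplus>\<^bsub>?F\<^esub>i\<in>{..<length ws}. ?t i) \<in> carrier ?F"
    by (rule module_finsum_closed[OF F]) (use tc in auto)
  have "(\<Oplus>\<^bsub>?F\<^esub>i\<in>{..<length ws}. sgn_mod ?F (fst x + sum_list (degs (take i ws)))
        (?T (gmap (oact P (length ws) \<sigma>) x, dslot ws i))) =
      (\<Oplus>\<^bsub>?F\<^esub>i\<in>{..<length ws}. sgn_mod ?F ?\<kappa> (?t (\<sigma> i)))"
    by (rule module_finsum_cong[OF F]) (use t2 shift_perm_lt[OF \<sigma>] tc in \<open>auto intro: module_neg_closed[OF F]\<close>)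
  also have "\<dots> = sgn_mod ?F ?\<kappa> (\<Oplus>\<^bsub>?F\<^esub>i\<in>{..<length ws}. ?t (\<sigma> i))"
    by (rule lin_finsum[OF sl F F, symmetric]) (use tc shift_perm_lt[OF \<sigma>] in auto)
  also have "(\<Oplus>\<^bsub>?F\<^esub>i\<in>{..<length ws}. ?t (\<sigma> i)) = (\<Oplus>\<^bsub>?F\<^esub>i\<in>\<sigma> ` {..<length ws}. ?t i)"
    by (rule F.finsum_reindex[symmetric]) (use tc shift_perm_lt[OF \<sigma>] permutes_inj[OF \<sigma>] in \<open>auto simp: inj_on_def\<close>)
  also have "\<sigma> ` {..<length ws} = {..<length ws}" by (rule permutes_image[OF \<sigma>])
  finally show "sym_dif R P W n (gmap (oact P (length ws) \<sigma>) x, ws) = sgn_mod ?F ?\<kappa> (sym_dif R P W n (x, ?ws))"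
    unfolding sym_dif_eq[OF s\<sigma>] sym_dif_eq[OF sp] lws t1
      lin_add[OF sl Tc[OF syms_dl_op[OF sp], unfolded lws] sc]
    by (simp only: fst_conv)
qed

abbreviation "Fdif n \<equiv> dif (free_alg R P W) n"

lemma free_dif_lin: "Fdif n \<in> lin R (Fr (gpart W) n) (Fr (gpart W) (n - 1))"
  unfolding free_alg_def by (simp add: lift_lin[OF W sym_dif_balanced free_part_module[OF W]])

lemma free_dif_class: "s \<in> syms P (gpart W) n \<Longrightarrow> Fdif n (Cl (gpart W) n s) = sym_dif R P W n s"
  unfolding free_alg_def by (simp add: lift_class[OF W sym_dif_balanced free_part_module[OF W]])

text \<open>Both sides expand into terms in which \<open>y\<close>, one inner operation or one
  letter is differentiated. On the left the chain rule of \<open>ocomp\<close> yields the operation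
  terms and the letters run through the whole word; on the right everything is grouped by factors.
  After regrouping, the terms correspond one by one and only parities remain to be compared.\<close>

lemma free_leibniz_syms:
  assumes y: "y \<in> OEl P (length qs)" and ss: "sym_lists P (gpart W) qs ss" and n: "n = fst y + sum_list qs"
  shows "Fdif n (snd (Sev (gpart W) y ss)) = snd (Sev (gpart W) (dl (ops P (length qs)) y) ss)
    \<oplus>\<^bsub>Fr (gpart W) (n - 1)\<^esub> (\<Oplus>\<^bsub>Fr (gpart W) (n - 1)\<^esub>i\<in>{..<length qs}.
      sgn_mod (Fr (gpart W) (n - 1)) (fst y + sum_list (take i qs))
        (snd (Fev (gpart W) y ((map (\<lambda>s. tens R P (gpart W) (fst s) (snd s)) ss)
          [i := (qs ! i - 1, sym_dif R P W (qs ! i) (ss ! i))]))))"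
proof -
  let ?V = "gpart W"
  let ?F = "Fr ?V (n - 1)"
  let ?T = "Cl ?V (n - 1)"
  let ?k = "length qs"
  define xs where "xs = map fst ss"
  define J where "J = map (length \<circ> snd) ss"
  define C where "C = concat (map snd ss)"
  define ps where "ps = map (fst \<circ> fst) ss"
  define ds where "ds = map (sum_list \<circ> degs \<circ> snd) ss"
  define e where "e = interleave_exp ps ds"
  define Y where "Y = ocomp P J y xs"
  define Xs where "Xs = map (\<lambda>s. tens R P ?V (fst s) (snd s)) ss"
  let ?l = "\<lambda>i. length (snd (ss ! i))"
  let ?dx = "\<lambda>i. dl (ops P (J ! i)) (xs ! i)"
  let ?y = "ocomp P J (dl (ops P ?k) y) xs" and ?yx = "\<lambda>i. ocomp P J y (xs[i := ?dx i])"
  let ?sA = "\<lambda>i. ss[i := (dl (ops P (length (snd (ss ! i)))) (fst (ss ! i)), snd (ss ! i))]"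
    and ?sD = "\<lambda>i m. ss[i := (fst (ss ! i), dslot (snd (ss ! i)) m)]"
  let ?eA = "\<lambda>i. interleave_exp (ps[i := ps ! i - 1]) ds" and ?eD = "\<lambda>i. interleave_exp ps (ds[i := ds ! i - 1])"
  note F = free_part_module[OF W]
  interpret F: module R ?F by (rule F)
  note B = sym_class_balanced[OF W, of "n - 1"]
  note Tc = sym_class_closed[OF W, of _ "n - 1"]
  have len: "length ss = ?k" using ss by (rule list_all2_lengthD)
  then have lens: "length xs = ?k" "length J = ?k" "length ps = ?k" "length ds = ?k"
    by (simp_all add: xs_def J_def ps_def ds_def)
  note o = sym_lists_ops[OF W ss, folded xs_def J_def C_def]
  have YC: "(Y, C) \<in> syms P ?V n"
    unfolding Y_def J_def xs_def C_def by (rule sym_comp(1)[OF W y ss n])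
  have yJ: "y \<in> OEl P (length J)" using y lens by simp
  have CJ: "length C = sum_list J" by (rule o(4))
  have si: "ss ! i \<in> syms P ?V (qs ! i)" if "i < ?k" for i
    using ss that len by (simp add: list_all2_conv_all_nth)
  have si': "(xs ! i, snd (ss ! i)) \<in> syms P ?V (qs ! i)" if "i < ?k" for i
    using si[OF that] that len by (simp add: xs_def)
  have qi: "qs ! i = ps ! i + ds ! i" if "i < ?k" for i
    using si'[OF that, unfolded syms_iff] that len by (simp add: ps_def ds_def xs_def)
  have dy: "dl (ops P ?k) y \<in> OEl P ?k"
    using y lin_closed[OF op_dif] by (auto simp: El_iff dl_def)
  have slA: "sym_lists P ?V (qs[i := qs ! i - 1]) (ss[i := s])" if "s \<in> syms P ?V (qs ! i - 1)" "i < ?k" for s i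
    using ss that by (simp add: list_all2_update_cong)
  have yk: "y \<in> OEl P (length (qs[i := q]))" for i q using y by simp
  have nA: "n - 1 = fst y + sum_list (qs[i := qs ! i - 1])" if "i < ?k" for i
    using n that by (simp add: sum_list_update_int)
  \<comment> \<open>the three kinds of terms: differentiate \<open>y\<close>, one of the \<open>x\<^sub>i\<close>, or one letter\<close>
  define U where "U = ?T (?y, C)"
  define A where "A i = ?T (?yx i, C)" for i
  define D where "D m = ?T (Y, dslot C m)" for m
  let ?At = "\<lambda>i. sgn_mod ?F (?eA i) (A i)"
  define a where "a i = fst y + sum_list (degs (take i xs))" for i
  define c where "c m = fst Y + sum_list (degs (take m C))" for m
  let ?Dc = "\<lambda>i m. sgn_mod ?F (e + c (offset J i + m)) (D (offset J i + m))"
  have U: "snd (Sev ?V (dl (ops P ?k) y) ss) = sgn_mod ?F e U"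
    and UE: "(?y, C) \<in> syms P ?V (n - 1)"
    using sym_comp(1,2)[OF W dy ss, of "n - 1"] n
    by (simp_all add: U_def e_def ps_def ds_def xs_def J_def C_def dl_def)
  have sA: "(dl (ops P (length (snd (ss ! i)))) (fst (ss ! i)), snd (ss ! i)) \<in> syms P ?V (qs ! i - 1)" if i: "i < ?k" for i
    using syms_dl_op[of "fst (ss ! i)" "snd (ss ! i)"] si[OF i] by simp
  have A: "snd (Sev ?V y (?sA i)) =
      ?At i"
    and AE: "(?yx i, C) \<in> syms P ?V (n - 1)" if i: "i < ?k" for i
  proof -
    have u: "map (length \<circ> snd) (?sA i) = J"
      "map fst (?sA i) = xs[i := ?dx i]"
      "concat (map snd (?sA i)) = C"
      "map (fst \<circ> fst) (?sA i) = ps[i := ps ! i - 1]"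
      "map (sum_list \<circ> degs \<circ> snd) (?sA i) = ds"
      using i len by (simp_all add: map_update J_def xs_def C_def ps_def ds_def dl_def list_update_same_conv)
        (metis length_map list_update_id nth_map)+
    show "snd (Sev ?V y (?sA i)) =
      ?At i"
      "(?yx i, C) \<in> syms P ?V (n - 1)"
      using sym_comp(1,2)[OF W yk slA[OF sA[OF i] i] nA[OF i]] unfolding u A_def by simp_all
  qed
  have sD: "(fst (ss ! i), dslot (snd (ss ! i)) m) \<in> syms P ?V (qs ! i - 1)" if i: "i < ?k" "m < ?l i" for i m
    using syms_dslot[of "fst (ss ! i)" "snd (ss ! i)"] si[OF i(1)] i by simp
  have off: "concat (map snd ss) = concat (take i (map snd ss)) @ snd (ss ! i) @ concat (drop (Suc i) (map snd ss))"
    "offset J i = length (concat (take i (map snd ss)))"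
    "concat ((map snd ss)[i := w]) = concat (take i (map snd ss)) @ w @ concat (drop (Suc i) (map snd ss))" if "i < ?k" for i w
    using concat_split[of i "map snd ss"] that len by (simp_all add: J_def)
  have D: "snd (Sev ?V y (?sD i m)) =
      sgn_mod ?F (?eD i) (D (offset J i + m))"
    if i: "i < ?k" "m < ?l i" for i m
  proof -
    have "sum_list (degs (dslot (snd (ss ! i)) m)) = sum_list (degs (snd (ss ! i))) - 1"
      using i by (simp add: map_update sum_list_update_int) (simp add: dl_def)
    then have u: "map (length \<circ> snd) (?sD i m) = J"
      "map fst (?sD i m) = xs"
      "map (fst \<circ> fst) (?sD i m) = ps"
      "map (sum_list \<circ> degs \<circ> snd) (?sD i m) = ds[i := ds ! i - 1]"
      using i len by (simp_all add: map_update J_def xs_def ps_def ds_def)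
        (metis length_map list_update_id nth_map comp_def)+
    have "map snd (?sD i m) = (map snd ss)[i := dslot (snd (ss ! i)) m]"
      by (simp add: map_update)
    then have u5: "concat (map snd (?sD i m)) = dslot C (offset J i + m)"
      using off[OF i(1)] i by (simp add: C_def nth_append list_update_append)
    show ?thesis
      using sym_comp(2)[OF W yk slA[OF sD[OF i] i(1)] nA[OF i(1)]] unfolding u u5 D_def Y_def by simp
  qed
  have Uc: "U \<in> carrier ?F" unfolding U_def by (rule Tc[OF UE])
  have Ac: "A i \<in> carrier ?F" if "i < ?k" for i unfolding A_def by (rule Tc[OF AE[OF that]])
  have Dc: "D m \<in> carrier ?F" if "m < length C" for m unfolding D_def by (rule Tc[OF syms_dslot[OF YC that]])
  have sc: "sgn_mod ?F z v \<in> carrier ?F" if "v \<in> carrier ?F" for z v by (rule module_sgn_closed[OF F that])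
  have fc: "finsum ?F f I \<in> carrier ?F" if "\<And>i. i \<in> I \<Longrightarrow> f i \<in> carrier ?F" for f and I :: "nat set"
    by (rule module_finsum_closed[OF F that])
  have Ydeg: "fst Y = fst y + sum_list (degs xs)"
    unfolding Y_def by (rule ocomp_deg[OF yJ o(1)])
  \<comment> \<open>The chain rule holds in the operad; the linear map \<open>?L\<close>, which
    sends an operation to its class with the fixed word \<open>C\<close>, carries it to the free
    algebra.\<close>
  have dY: "?T (dl (ops P (length C)) Y, C) = U \<oplus>\<^bsub>?F\<^esub> (\<Oplus>\<^bsub>?F\<^esub>i\<in>{..<?k}. sgn_mod ?F (a i) (A i))"
  proof -
    let ?O = "gpart (ops P (sum_list J)) (fst Y - 1)"
    let ?L = "\<lambda>u. ?T ((fst Y - 1, u), C)"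
    note O = op_module[of "sum_list J" "fst Y - 1"]
    have L: "?L \<in> lin R ?O ?F"
      using balanced_op[OF B syms_dl_op[OF YC]] by (simp add: CJ dl_def)
    let ?z = "\<lambda>i. snd (?yx i)"
    have z: "?z i \<in> carrier ?O" "?yx i = (fst Y - 1, ?z i)" if i: "i < ?k" for i
    proof -
      have "fst (?yx i) = fst Y - 1"
        using AE[OF i] YC by (simp add: syms_iff)
      then show "?z i \<in> carrier ?O" "?yx i = (fst Y - 1, ?z i)"
        using AE[OF i] by (auto simp: syms_iff El_iff CJ prod_eq_iff)
    qed
    have u: "snd ?y \<in> carrier ?O"
      "?y = (fst Y - 1, snd ?y)"
    proof -
      have "fst ?y = fst Y - 1"
        using UE YC by (simp add: syms_iff)
      then show "snd ?y \<in> carrier ?O"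
        "?y = (fst Y - 1, snd ?y)"
        using UE by (auto simp: syms_iff El_iff CJ prod_eq_iff)
    qed
    have "dif (ops P (sum_list J)) (fst Y) (snd Y) = snd ?y \<oplus>\<^bsub>?O\<^esub>
        (\<Oplus>\<^bsub>?O\<^esub>i\<in>{..<?k}. snd (sg (gpart (ops P (sum_list J))) (a i) (ocomp P J y (xs[i := dl (map (ops P) J ! i) (xs ! i)]))))"
      using ocomp_dif[OF yJ o(1)] lens by (simp add: Ydeg Y_def[symmetric] a_def)
    also have "(\<Oplus>\<^bsub>?O\<^esub>i\<in>{..<?k}. snd (sg (gpart (ops P (sum_list J))) (a i) (ocomp P J y (xs[i := dl (map (ops P) J ! i) (xs ! i)])))) =
        (\<Oplus>\<^bsub>?O\<^esub>i\<in>{..<?k}. sgn_mod ?O (a i) (?z i))"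
    proof (rule module_finsum_cong[OF O])
      fix i assume "i \<in> {..<?k}"
      then have i: "i < ?k" by simp
      show "snd (sg (gpart (ops P (sum_list J))) (a i) (ocomp P J y (xs[i := dl (map (ops P) J ! i) (xs ! i)]))) = sgn_mod ?O (a i) (?z i)"
        using i lens arg_cong[OF z(2)[OF i], of fst] by (simp add: sg_def)
      show "sgn_mod ?O (a i) (?z i) \<in> carrier ?O" by (rule module_sgn_closed[OF O z(1)[OF i]])
    qed
    finally have d: "dl (ops P (length C)) Y = (fst Y - 1, snd ?y \<oplus>\<^bsub>?O\<^esub>
        (\<Oplus>\<^bsub>?O\<^esub>i\<in>{..<?k}. sgn_mod ?O (a i) (?z i)))"
      by (simp add: dl_def CJ)
    have "?L (snd ?y \<oplus>\<^bsub>?O\<^esub> (\<Oplus>\<^bsub>?O\<^esub>i\<in>{..<?k}. sgn_mod ?O (a i) (?z i))) =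
        ?L (snd ?y) \<oplus>\<^bsub>?F\<^esub> ?L (\<Oplus>\<^bsub>?O\<^esub>i\<in>{..<?k}. sgn_mod ?O (a i) (?z i))"
      by (rule lin_add[OF L u(1)]) (rule module_finsum_closed[OF O module_sgn_closed[OF O z(1)]], simp)
    also have "?L (\<Oplus>\<^bsub>?O\<^esub>i\<in>{..<?k}. sgn_mod ?O (a i) (?z i)) = (\<Oplus>\<^bsub>?F\<^esub>i\<in>{..<?k}. ?L (sgn_mod ?O (a i) (?z i)))"
      by (rule lin_finsum[OF L O F]) (use module_sgn_closed[OF O z(1)] in auto)
    also have "\<dots> = (\<Oplus>\<^bsub>?F\<^esub>i\<in>{..<?k}. sgn_mod ?F (a i) (A i))"
    proof (rule module_finsum_cong[OF F])
      fix i assume "i \<in> {..<?k}"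
      then have i: "i < ?k" by simp
      show "?L (sgn_mod ?O (a i) (?z i)) = sgn_mod ?F (a i) (A i)"
        unfolding lin_sgn[OF L O F z(1)[OF i]] A_def z(2)[OF i, symmetric] ..
      show "sgn_mod ?F (a i) (A i) \<in> carrier ?F" by (rule sc[OF Ac[OF i]])
    qed
    finally show ?thesis unfolding d U_def u(2)[symmetric] .
  qed
  have sl: "(\<lambda>v. sgn_mod ?F e v) \<in> lin R ?F ?F" by (rule lin_sgn_mod[OF lin_id F])
  let ?SA = "\<Oplus>\<^bsub>?F\<^esub>i\<in>{..<?k}. sgn_mod ?F (a i) (A i)"
  let ?SD = "\<Oplus>\<^bsub>?F\<^esub>m\<in>{..<length C}. sgn_mod ?F (c m) (D m)"
  have SAc: "?SA \<in> carrier ?F" and SDc: "?SD \<in> carrier ?F"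
    by (rule fc, rule sc, use Ac Dc in auto)+
  have "Fdif n (snd (Sev ?V y ss)) = sgn_mod ?F e (sym_dif R P W n (Y, C))"
    unfolding sym_comp(2)[OF W y ss n, folded xs_def J_def C_def ps_def ds_def, folded Y_def e_def]
      lin_sgn[OF free_dif_lin F F sym_class_closed[OF W YC]] free_dif_class[OF YC] ..
  also have "\<dots> = sgn_mod ?F e ((U \<oplus>\<^bsub>?F\<^esub> ?SA) \<oplus>\<^bsub>?F\<^esub> ?SD)"
    unfolding sym_dif_eq[OF YC] dY D_def c_def ..
  also have "\<dots> = sgn_mod ?F e U \<oplus>\<^bsub>?F\<^esub> (sgn_mod ?F e ?SA \<oplus>\<^bsub>?F\<^esub> sgn_mod ?F e ?SD)"
    unfolding lin_add[OF sl module_add_closed[OF F Uc SAc] SDc] lin_add[OF sl Uc SAc]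
    by (rule F.a_assoc[OF sc[OF Uc] sc[OF SAc] sc[OF SDc]])
  also have "sgn_mod ?F e ?SA \<oplus>\<^bsub>?F\<^esub> sgn_mod ?F e ?SD = (\<Oplus>\<^bsub>?F\<^esub>i\<in>{..<?k}. sgn_mod ?F (e + a i) (A i) \<oplus>\<^bsub>?F\<^esub>
      (\<Oplus>\<^bsub>?F\<^esub>m\<in>{..<?l i}. ?Dc i m))"
  proof -
    \<comment> \<open>Extended by zero beyond the end of the word, since
      \<open>finsum_concat\<close> asks for values in the module at every position.\<close>
    define h where "h m = (if m < length C then sgn_mod ?F (e + c m) (D m) else \<zero>\<^bsub>?F\<^esub>)" for m
    have h: "h m \<in> carrier ?F" for m unfolding h_def by (cases "m < length C") (simp_all only: if_True if_False F.zero_closed sc[OF Dc])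
    have om: "offset J i + m < length C" if "i < ?k" "m < ?l i" for i m
      using off[OF that(1)] that by (simp add: C_def)
    have "sgn_mod ?F e ?SD = (\<Oplus>\<^bsub>?F\<^esub>m\<in>{..<length C}. sgn_mod ?F e (sgn_mod ?F (c m) (D m)))"
      by (rule lin_finsum[OF sl F F finite_lessThan]) (rule sc[OF Dc], simp)
    also have "\<dots> = finsum ?F h {..<length C}"
      by (rule module_finsum_cong[OF F _ h]) (simp only: h_def sgn_mod_sgn_mod[OF F Dc] lessThan_iff if_True)
    also have "\<dots> = finsum ?F (\<lambda>i. finsum ?F (\<lambda>m. h (offset J i + m)) {..<?l i}) {..<?k}"
    proof -
      have "finsum ?F h {..<length C} = finsum ?F (\<lambda>i. finsum ?F (\<lambda>m. h (offset J i + m)) {..<length (map snd ss ! i)}) {..<?k}"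
        using finsum_concat[where wss = "map snd ss", OF F h] len by (simp add: C_def J_def)
      also have "\<dots> = finsum ?F (\<lambda>i. finsum ?F (\<lambda>m. h (offset J i + m)) {..<?l i}) {..<?k}"
        by (rule module_finsum_cong[OF F _ fc[OF h]]) (simp add: len)
      finally show ?thesis .
    qed
    also have "\<dots> = finsum ?F (\<lambda>i. finsum ?F (\<lambda>m. ?Dc i m) {..<?l i}) {..<?k}"
    proof (rule module_finsum_cong[OF F])
      fix i assume "i \<in> {..<?k}"
      then have i: "i < ?k" by simp
      show "finsum ?F (\<lambda>m. h (offset J i + m)) {..<?l i} =
          finsum ?F (\<lambda>m. ?Dc i m) {..<?l i}"
        by (rule module_finsum_cong[OF F _ sc[OF Dc]]) (use om[OF i] in \<open>simp_all only: h_def if_True lessThan_iff\<close>)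
      show "finsum ?F (\<lambda>m. ?Dc i m) {..<?l i} \<in> carrier ?F"
        by (rule fc[OF sc[OF Dc]]) (use om[OF i] in simp)
    qed
    finally have 1: "sgn_mod ?F e ?SD = \<dots>" .
    have "sgn_mod ?F e ?SA = (\<Oplus>\<^bsub>?F\<^esub>i\<in>{..<?k}. sgn_mod ?F e (sgn_mod ?F (a i) (A i)))"
      by (rule lin_finsum[OF sl F F finite_lessThan]) (rule sc[OF Ac], simp)
    also have "\<dots> = (\<Oplus>\<^bsub>?F\<^esub>i\<in>{..<?k}. sgn_mod ?F (e + a i) (A i))"
      by (rule module_finsum_cong[OF F _ sc[OF Ac]]) (simp_all only: sgn_mod_sgn_mod[OF F Ac] lessThan_iff)
    finally have 2: "sgn_mod ?F e ?SA = \<dots>" .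
    show ?thesis unfolding 1 2
    proof (rule F.finsum_addf[symmetric])
      show "(\<lambda>i. sgn_mod ?F (e + a i) (A i)) \<in> {..<?k} \<rightarrow> carrier ?F"
        by (rule Pi_I, rule sc, rule Ac) simp
      show "(\<lambda>i. \<Oplus>\<^bsub>?F\<^esub>m\<in>{..<?l i}. ?Dc i m)
          \<in> {..<?k} \<rightarrow> carrier ?F"
        by (rule Pi_I, rule fc, rule sc, rule Dc, rule om) simp_all
    qed
  qed
  also have "\<dots> = (\<Oplus>\<^bsub>?F\<^esub>i\<in>{..<?k}. sgn_mod ?F (fst y + sum_list (take i qs))
        (snd (Fev ?V y (Xs[i := (qs ! i - 1, sym_dif R P W (qs ! i) (ss ! i))]))))"
    (is "finsum _ ?l _ = finsum _ ?r _")
  proof (rule module_finsum_cong[OF F])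
    fix i assume "i \<in> {..<?k}"
    then have i: "i < ?k" by simp
    let ?x = "fst (ss ! i)" and ?w = "snd (ss ! i)"
    let ?q = "qs ! i - 1"
    let ?G = "Fr ?V ?q"
    let ?t = "\<lambda>m. fst ?x + sum_list (degs (take m ?w))"
    let ?Dt = "\<lambda>m. sgn_mod ?F (?t m) (sgn_mod ?F (?eD i) (D (offset J i + m)))"
    have XsE: "set Xs \<subseteq> El (Fr ?V)" "degs Xs = qs" "length Xs = ?k"
      using sym_lists_classes[OF W ss] len by (simp_all add: Xs_def)
    let ?g = "\<lambda>u. snd (Fev ?V y (Xs[i := (?q, u)]))"
    have g: "?g \<in> lin R ?G ?F"
    proof -
      have "set (Xs[i := (?q, \<zero>\<^bsub>?G\<^esub>)]) \<subseteq> El (Fr ?V)"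
        by (rule El_update[OF XsE(1)]) (simp add: module_zero_closed[OF F])
      from multilin_lin[OF free_ev_multilin[OF W yk nA[OF i]] this, of i] i XsE show ?thesis
        by (simp add: map_update)
    qed
    have gT: "?g (Cl ?V ?q s) = snd (Sev ?V y (ss[i := s]))" if s: "s \<in> syms P ?V ?q" for s
    proof -
      have "tens R P ?V (fst s) (snd s) = (?q, Cl ?V ?q s)" using tens_eq[of "fst s" "snd s" P ?V ?q R] s by simp
      then show ?thesis
        using free_ev_tens[OF W yk slA[OF s i]] by (simp add: map_update Xs_def)
    qed
    have sxw: "(?x, ?w) \<in> syms P ?V (qs ! i)" using si[OF i] by simp
    have "?g (sym_dif R P W (qs ! i) (?x, ?w)) = ?g (Cl ?V ?q (dl (ops P (length ?w)) ?x, ?w)) \<oplus>\<^bsub>?F\<^esub>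
        ?g (\<Oplus>\<^bsub>?G\<^esub>m\<in>{..<length ?w}. sgn_mod ?G (?t m) (Cl ?V ?q (?x, dslot ?w m)))"
      unfolding sym_dif_eq[OF sxw]
      by (rule lin_add[OF g sym_class_closed[OF W sA[OF i]] module_finsum_closed[OF F module_sgn_closed[OF F sym_class_closed[OF W sD[OF i]]]]]) simp
    also have "?g (\<Oplus>\<^bsub>?G\<^esub>m\<in>{..<length ?w}. sgn_mod ?G (?t m) (Cl ?V ?q (?x, dslot ?w m))) =
        (\<Oplus>\<^bsub>?F\<^esub>m\<in>{..<length ?w}. ?g (sgn_mod ?G (?t m) (Cl ?V ?q (?x, dslot ?w m))))"
      by (rule lin_finsum[OF g F F finite_lessThan module_sgn_closed[OF F sym_class_closed[OF W sD[OF i]]]]) simp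
    also have "\<dots> = (\<Oplus>\<^bsub>?F\<^esub>m\<in>{..<length ?w}. ?Dt m)"
    proof (rule module_finsum_cong[OF F])
      fix m assume "m \<in> {..<length ?w}"
      then have m: "m < length ?w" by simp
      have "offset J i + m < length C" using off[OF i] m by (simp add: C_def)
      then show "?Dt m \<in> carrier ?F"
        by (intro sc Dc)
      show "?g (sgn_mod ?G (?t m) (Cl ?V ?q (?x, dslot ?w m))) =
          ?Dt m"
        unfolding lin_sgn[OF g F F sym_class_closed[OF W sD[OF i m]]] gT[OF sD[OF i m]] D[OF i m] ..
    qed
    also have "?g (Cl ?V ?q (dl (ops P (length ?w)) ?x, ?w)) = ?At i"
      unfolding gT[OF sA[OF i]] A[OF i] ..
    finally have gs: "?g (sym_dif R P W (qs ! i) (ss ! i)) = ?At i \<oplus>\<^bsub>?F\<^esub>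
      (\<Oplus>\<^bsub>?F\<^esub>m\<in>{..<length ?w}. ?Dt m)"
      by simp
    let ?z = "fst y + sum_list (take i qs)"
    have zl: "(\<lambda>v. sgn_mod ?F ?z v) \<in> lin R ?F ?F" by (rule lin_sgn_mod[OF lin_id F])
    have om: "offset J i + m < length C" if "m < length ?w" for m using off[OF i] that by (simp add: C_def)
    \<comment> \<open>Argument \<open>l\<close> has degree \<open>ps ! l + ds ! l\<close>, so the
      sign for moving the differential past the first \<open>i\<close> arguments has an operation
      part and a word part. The word part is what the interleaving exponent loses when operation
      \<open>i\<close> is differentiated.\<close>
    have tk: "sum_list (take i qs) = (\<Sum>l<i. ps ! l) + (\<Sum>l<i. ds ! l)"
      using i qi by (simp add: sum_list_sum_nth atLeast0LessThan sum.distrib)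
    have ta: "sum_list (degs (take i xs)) = (\<Sum>l<i. ps ! l)"
      using i len by (simp add: sum_list_sum_nth atLeast0LessThan xs_def ps_def)
    have tp: "sum_list (degs xs) = (\<Sum>l<i. ps ! l) + (ps ! i + (\<Sum>j\<in>{Suc i..<length ps}. ps ! j))"
    proof -
      have "sum_list (degs xs) = (\<Sum>j\<in>{0..<length ps}. ps ! j)"
        using len by (simp add: sum_list_sum_nth xs_def ps_def)
      also have "\<dots> = (\<Sum>j\<in>{0..<i}. ps ! j) + (\<Sum>j\<in>{i..<length ps}. ps ! j)"
        using i lens by (simp add: sum.atLeastLessThan_concat)
      finally show ?thesis using i lens by (simp add: sum.atLeast_Suc_lessThan atLeast0LessThan)
    qed
    have td: "sum_list (degs (take (offset J i + m) C)) = (\<Sum>l<i. ds ! l) + sum_list (degs (take m ?w))" if m: "m < length ?w" for m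
    proof -
      have "take (offset J i + m) C = concat (take i (map snd ss)) @ take m ?w"
        using off[OF i] m by (simp add: C_def)
      moreover have "sum_list (degs (concat (take i (map snd ss)))) = sum_list (take i ds)"
        by (simp add: ds_def take_map sum_list_degs_concat comp_def)
      moreover have "sum_list (take i ds) = (\<Sum>l<i. ds ! l)"
        using i lens by (simp add: sum_list_sum_nth atLeast0LessThan)
      ultimately show ?thesis by simp
    qed
    have parA: "even ((?z + ?eA i) + (e + a i))"
      using i lens by (simp add: interleave_exp_dec_left e_def a_def tk ta)
    \<comment> \<open>The exponent loses the degrees of the operations after \<open>i\<close>.
      Together with the operation \<open>i\<close> itself, counted in \<open>?t m\<close>, and those
      before it, they add up to the degree of all inner operations that is contained in
      \<open>c\<close>.\<close>
    have parD: "even ((?z + (?t m + ?eD i)) + (e + c (offset J i + m)))" if "m < length ?w" for m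
      using i lens len td[OF that] by (simp add: interleave_exp_dec_right e_def c_def Ydeg tk tp) (simp add: ps_def)
    show "?l i = ?r i"
    proof -
      have "?r i = sgn_mod ?F ?z (?At i) \<oplus>\<^bsub>?F\<^esub>
        sgn_mod ?F ?z (\<Oplus>\<^bsub>?F\<^esub>m\<in>{..<length ?w}. ?Dt m)"
        unfolding gs by (rule lin_add[OF zl sc[OF Ac[OF i]] fc[OF sc[OF sc[OF Dc]]]]) (use om in simp)
      also have "sgn_mod ?F ?z (\<Oplus>\<^bsub>?F\<^esub>m\<in>{..<length ?w}. ?Dt m) =
          (\<Oplus>\<^bsub>?F\<^esub>m\<in>{..<length ?w}. sgn_mod ?F ?z (?Dt m))"
        by (rule lin_finsum[OF zl F F finite_lessThan sc[OF sc[OF Dc]]]) (use om in simp)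
      also have "\<dots> = (\<Oplus>\<^bsub>?F\<^esub>m\<in>{..<length ?w}. ?Dc i m)"
      proof (rule module_finsum_cong[OF F])
        fix m assume "m \<in> {..<length ?w}"
        then have m: "m < length ?w" by simp
        show "sgn_mod ?F ?z (?Dt m) =
            ?Dc i m"
          unfolding sgn_mod_sgn_mod[OF F Dc[OF om[OF m]]] by (rule sgn_mod_cong[OF parD[OF m]])
        show "?Dc i m \<in> carrier ?F"
          by (rule sc[OF Dc[OF om[OF m]]])
      qed
      also have "sgn_mod ?F ?z (?At i) = sgn_mod ?F (e + a i) (A i)"
        unfolding sgn_mod_sgn_mod[OF F Ac[OF i]] by (rule sgn_mod_cong[OF parA])
      finally show ?thesis by simp
    qed
    show "?r i \<in> carrier ?F"
      unfolding gs by (intro sc module_add_closed[OF F] fc Ac[OF i] Dc om) simp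
  qed
  finally show ?thesis unfolding U Xs_def .
qed

text \<open>Both sides are multilinear and the symbol classes span, so the identity on symbols
  suffices.\<close>

lemma free_leibniz:
  assumes y: "y \<in> OEl P (length Xs)" and Xs: "set Xs \<subseteq> El (Fr (gpart W))"
    and n: "n = fst y + sum_list (degs Xs)"
  shows "Fdif n (snd (Fev (gpart W) y Xs)) = snd (Fev (gpart W) (dl (ops P (length Xs)) y) Xs)
    \<oplus>\<^bsub>Fr (gpart W) (n - 1)\<^esub> (\<Oplus>\<^bsub>Fr (gpart W) (n - 1)\<^esub>i\<in>{..<length Xs}.
      sgn_mod (Fr (gpart W) (n - 1)) (fst y + sum_list (take i (degs Xs)))
        (snd (Fev (gpart W) y (Xs[i := dl (free_alg R P W) (Xs ! i)]))))"
proof -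
  let ?V = "gpart W" and ?qs = "degs Xs"
  let ?F = "Fr ?V (n - 1)"
  let ?f = "\<lambda>Xs. Fdif n (snd (Fev ?V y Xs))"
  \<comment> \<open>Degrees are read from the fixed list and not from the arguments, so that the
    right-hand side is multilinear for the degrees \<open>?qs\<close>. On \<open>Xs\<close> itself
    this is \<open>dl\<close>.\<close>
  let ?d = "\<lambda>i Xs. Xs[i := (?qs ! i - 1, Fdif (?qs ! i) (snd (Xs ! i)))]"
  let ?g = "\<lambda>Xs. snd (Fev ?V (dl (ops P (length ?qs)) y) Xs) \<oplus>\<^bsub>?F\<^esub>
    (\<Oplus>\<^bsub>?F\<^esub>i\<in>{..<length ?qs}. sgn_mod ?F (fst y + sum_list (take i ?qs)) (snd (Fev ?V y (?d i Xs))))"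
  note F = free_part_module[OF W]
  have yq: "y \<in> OEl P (length ?qs)" using y by simp
  have dy: "dl (ops P (length ?qs)) y \<in> OEl P (length ?qs)"
    using yq lin_closed[OF op_dif] by (auto simp: El_iff dl_def)
  have "?f Xs = ?g Xs"
  proof (rule multilin_eq[OF _ _ F F, where qs = ?qs and f = ?f and g = ?g and as = Xs and G = "\<lambda>i. Cl ?V (?qs ! i) ` syms P ?V (?qs ! i)"])
    show "multilin R (Fr ?V) ?F ?qs ?f"
      by (rule multilin_comp[OF free_ev_multilin[OF W yq n] free_dif_lin])
    show "multilin R (Fr ?V) ?F ?qs ?g"
    proof (intro multilin_add[OF _ _ F] multilin_sum[OF F F finite_lessThan] multilin_sgn[OF _ F])
      show "multilin R (Fr ?V) ?F ?qs (\<lambda>Xs. snd (Fev ?V (dl (ops P (length ?qs)) y) Xs))"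
        by (rule free_ev_multilin[OF W dy]) (simp add: n dl_def)
      fix i assume "i \<in> {..<length ?qs}"
      then have i: "i < length ?qs" by simp
      show "multilin R (Fr ?V) ?F ?qs (\<lambda>Xs. snd (Fev ?V y (?d i Xs)))"
      proof (rule multilin_slot_map[OF free_ev_multilin[OF W] F i free_dif_lin])
        show "y \<in> OEl P (length (?qs[i := ?qs ! i - 1]))" using yq by simp
        show "n - 1 = fst y + sum_list (?qs[i := ?qs ! i - 1])"
          by (simp add: sum_list_update_int[OF i] n)
      qed
    qed
    show "set Xs \<subseteq> El (Fr ?V)" "degs Xs = ?qs" by (rule Xs, rule refl)
    fix i assume i: "i < length ?qs"
    show "Cl ?V (?qs ! i) ` syms P ?V (?qs ! i) \<subseteq> carrier (Fr ?V (?qs ! i))"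
      using sym_class_closed[OF W] by blast
    show "snd (Xs ! i) \<in> gen_sub R (Fr ?V (?qs ! i)) (Cl ?V (?qs ! i) ` syms P ?V (?qs ! i))"
      using El_nth[OF Xs, of i] i free_part_gen[OF W] by auto
  next
    fix As assume As: "set As \<subseteq> El (Fr ?V)" "degs As = ?qs"
      and G: "\<And>i. i < length ?qs \<Longrightarrow> snd (As ! i) \<in> Cl ?V (?qs ! i) ` syms P ?V (?qs ! i)"
    have "\<forall>i. \<exists>s. i < length ?qs \<longrightarrow> s \<in> syms P ?V (?qs ! i) \<and> snd (As ! i) = Cl ?V (?qs ! i) s"
      using G by blast
    then obtain t where t: "\<And>i. i < length ?qs \<Longrightarrow> t i \<in> syms P ?V (?qs ! i)"
      "\<And>i. i < length ?qs \<Longrightarrow> snd (As ! i) = Cl ?V (?qs ! i) (t i)" by metis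
    define ss where "ss = map t [0..<length ?qs]"
    have ss: "sym_lists P ?V ?qs ss" using t by (simp add: ss_def list_all2_conv_all_nth)
    have lA: "length As = length ?qs" using degs_length[OF As(2)] .
    have AsE: "As = map (\<lambda>s. tens R P ?V (fst s) (snd s)) ss"
      unfolding sym_lists_classes(1)[OF W ss]
    proof (rule nth_equalityI)
      fix i assume "i < length As"
      then have i: "i < length ?qs" using lA by simp
      show "As ! i = map2 (\<lambda>q s. (q, Cl ?V q s)) ?qs ss ! i"
        using i t(2)[OF i] degs_nth[OF As(2), of i] lA by (simp add: ss_def prod_eq_iff)
    qed (simp add: lA ss_def)
    have d: "(\<Oplus>\<^bsub>?F\<^esub>i\<in>{..<length ?qs}. sgn_mod ?F (fst y + sum_list (take i ?qs)) (snd (Fev ?V y (?d i As)))) =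
      (\<Oplus>\<^bsub>?F\<^esub>i\<in>{..<length ?qs}. sgn_mod ?F (fst y + sum_list (take i ?qs)) (snd (Fev ?V y
        (As[i := (?qs ! i - 1, sym_dif R P W (?qs ! i) (ss ! i))]))))"
    proof (rule module_finsum_cong[OF F])
      fix i assume "i \<in> {..<length ?qs}"
      then have i: "i < length ?qs" by simp
      have e: "Fdif (?qs ! i) (snd (As ! i)) = sym_dif R P W (?qs ! i) (ss ! i)"
        using free_dif_class[OF t(1)[OF i]] t(2)[OF i] i by (simp add: ss_def)
      show "sgn_mod ?F (fst y + sum_list (take i ?qs)) (snd (Fev ?V y (?d i As))) =
        sgn_mod ?F (fst y + sum_list (take i ?qs)) (snd (Fev ?V y
        (As[i := (?qs ! i - 1, sym_dif R P W (?qs ! i) (ss ! i))])))" unfolding e ..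
      have "snd (Fev ?V y (?d i As)) \<in> carrier ?F"
      proof (rule multilin_closed[OF free_ev_multilin[OF W]])
        show "y \<in> OEl P (length (?qs[i := ?qs ! i - 1]))" using yq by simp
        show "n - 1 = fst y + sum_list (?qs[i := ?qs ! i - 1])" by (simp add: sum_list_update_int[OF i] n)
        show "set (?d i As) \<subseteq> El (Fr ?V)"
          using El_update[OF As(1)] lin_closed[OF free_dif_lin] El_nth[OF As(1), of i] degs_nth[OF As(2), of i] i lA by simp
        show "degs (?d i As) = ?qs[i := ?qs ! i - 1]" using As(2) by (simp add: map_update)
      qed
      then show "sgn_mod ?F (fst y + sum_list (take i ?qs)) (snd (Fev ?V y
        (As[i := (?qs ! i - 1, sym_dif R P W (?qs ! i) (ss ! i))]))) \<in> carrier ?F"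
        unfolding e by (rule module_sgn_closed[OF F])
    qed
    show "?f As = ?g As"
      unfolding d using free_leibniz_syms[OF yq ss n, folded AsE] free_ev_tens[OF W yq ss, folded AsE]
        free_ev_tens[OF W dy ss, folded AsE]
      by simp
  qed
  moreover have "?d i Xs = Xs[i := dl (free_alg R P W) (Xs ! i)]" if "i < length Xs" for i
    using that by (simp add: dl_def)
  ultimately show ?thesis
  proof -
    assume e: "?f Xs = ?g Xs"
    have "(\<Oplus>\<^bsub>?F\<^esub>i\<in>{..<length Xs}. sgn_mod ?F (fst y + sum_list (take i ?qs)) (snd (Fev ?V y (?d i Xs)))) =
      (\<Oplus>\<^bsub>?F\<^esub>i\<in>{..<length Xs}. sgn_mod ?F (fst y + sum_list (take i ?qs)) (snd (Fev ?V y
        (Xs[i := dl (free_alg R P W) (Xs ! i)]))))"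
    proof (rule module_finsum_cong[OF F])
      fix i assume "i \<in> {..<length Xs}"
      then have i: "i < length ?qs" by simp
      have e: "?d i Xs = Xs[i := dl (free_alg R P W) (Xs ! i)]" using i by (simp add: dl_def)
      show "sgn_mod ?F (fst y + sum_list (take i ?qs)) (snd (Fev ?V y (?d i Xs))) =
        sgn_mod ?F (fst y + sum_list (take i ?qs)) (snd (Fev ?V y (Xs[i := dl (free_alg R P W) (Xs ! i)])))"
        unfolding e ..
      have "snd (Fev ?V y (?d i Xs)) \<in> carrier ?F"
      proof (rule multilin_closed[OF free_ev_multilin[OF W]])
        show "y \<in> OEl P (length (?qs[i := ?qs ! i - 1]))" using yq by simp
        show "n - 1 = fst y + sum_list (?qs[i := ?qs ! i - 1])" by (simp add: sum_list_update_int[OF i] n)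
        show "set (?d i Xs) \<subseteq> El (Fr ?V)"
          using El_update[OF Xs] lin_closed[OF free_dif_lin] El_nth[OF Xs, of i] i by simp
        show "degs (?d i Xs) = ?qs[i := ?qs ! i - 1]" by (simp add: map_update)
      qed
      then show "sgn_mod ?F (fst y + sum_list (take i ?qs)) (snd (Fev ?V y
        (Xs[i := dl (free_alg R P W) (Xs ! i)]))) \<in> carrier ?F"
        unfolding e by (rule module_sgn_closed[OF F])
    qed
    then show ?thesis using e by simp
  qed
qed

end

end

section \<open>Functoriality of free algebras\<close>

definition free_map :: "'r ring \<Rightarrow> ('r, 'o) operad \<Rightarrow> ('r, 'v) grmod \<Rightarrow> ('r, 'w) grmod \<Rightarrow> (int \<Rightarrow> 'v \<Rightarrow> 'w)
    \<Rightarrow> int \<Rightarrow> ('r, 'o, 'v) free_el \<Rightarrow> ('r, 'o, 'w) free_el"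
  where "free_map R P V V' \<psi> n = induced (lin_ext R (syms P V n) (free_part R P V' n)
    (\<lambda>(x, vs). sym_class R P V' n (x, map (gmap \<psi>) vs)))"

context dg_operad_ctx
begin

context
  fixes V :: "('r, 'v) grmod" and V' :: "('r, 'w) grmod" and \<psi> :: "int \<Rightarrow> 'v \<Rightarrow> 'w"
  assumes V: "gr_module R V" and V': "gr_module R V'" and \<psi>: "\<And>q. \<psi> q \<in> lin R (V q) (V' q)"
begin

lemma syms_map: "(x, vs) \<in> syms P V n \<Longrightarrow> (x, map (gmap \<psi>) vs) \<in> syms P V' n"
  using lin_closed[OF \<psi>] by (auto simp: syms_iff El_iff subset_iff comp_def)

lemma free_map_balanced:
  "balanced R P V n (Fr V' n) (\<lambda>(x, vs). Cl V' n (x, map (gmap \<psi>) vs))"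
proof (rule balancedI)
  let ?F = "Fr V' n"
  let ?T = "Cl V' n"
  note B = sym_class_balanced[OF V', of n]
  fix x vs assume s: "(x, vs) \<in> syms P V n"
  note s' = syms_map[OF s]
  show "(case (x, vs) of (x, vs) \<Rightarrow> ?T (x, map (gmap \<psi>) vs)) \<in> carrier ?F"
    using sym_class_closed[OF V' s'] by simp
  show "(\<lambda>u. case ((fst x, u), vs) of (x, vs) \<Rightarrow> ?T (x, map (gmap \<psi>) vs)) \<in> lin R (gpart (ops P (length vs)) (fst x)) ?F"
    using balanced_op[OF B s'] by simp
  show "(\<lambda>u. case (x, vs[i := (fst (vs ! i), u)]) of (x, vs) \<Rightarrow> ?T (x, map (gmap \<psi>) vs)) \<in> lin R (V (fst (vs ! i))) ?F"
    if i: "i < length vs" for i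
  proof -
    have "(\<lambda>u. ?T (x, (map (gmap \<psi>) vs)[i := (fst (vs ! i), u)])) \<in> lin R (V' (fst (vs ! i))) ?F"
      using balanced_slot[OF B s', of i] i by simp
    from lin_comp[OF \<psi> this] show ?thesis by (simp add: map_update)
  qed
  fix \<sigma> assume \<sigma>: "\<sigma> permutes {..<length vs}"
  have "degs (map (gmap \<psi>) vs) = degs vs" by simp
  then show "(case (gmap (oact P (length vs) \<sigma>) x, vs) of (x, vs) \<Rightarrow> ?T (x, map (gmap \<psi>) vs)) =
      sgn_mod ?F (koszul_exp \<sigma> (degs vs)) (case (x, perminv \<sigma> vs) of (x, vs) \<Rightarrow> ?T (x, map (gmap \<psi>) vs))"
    using balanced_perm[OF B s', of \<sigma>] \<sigma> permute_list_map[OF permutes_inv[OF \<sigma>], of "gmap \<psi>"]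
    by (simp only: length_map prod.case)
qed

lemma free_map_lin: "free_map R P V V' \<psi> n \<in> lin R (Fr V n) (Fr V' n)"
  unfolding free_map_def by (rule lift_lin[OF V free_map_balanced free_part_module[OF V']])

lemma free_map_class: "(x, vs) \<in> syms P V n \<Longrightarrow>
    free_map R P V V' \<psi> n (Cl V n (x, vs)) = Cl V' n (x, map (gmap \<psi>) vs)"
  unfolding free_map_def using lift_class[OF V free_map_balanced free_part_module[OF V']] by simp

lemma free_map_tens: "(x, vs) \<in> syms P V n \<Longrightarrow>
    gmap (free_map R P V V' \<psi>) (tens R P V x vs) = tens R P V' x (map (gmap \<psi>) vs)"
  by (simp add: tens_eq[of x vs] tens_eq[OF syms_map] free_map_class)

text \<open>It suffices to compare symbols. There the product does not look inside the letters, and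
  its sign depends only on degrees, which \<open>\<psi>\<close> preserves.\<close>

lemma free_map_ev:
  assumes y: "y \<in> OEl P (length Xs)" and Xs: "set Xs \<subseteq> El (Fr V)"
  shows "gmap (free_map R P V V' \<psi>) (Fev V y Xs) = Fev V' y (map (gmap (free_map R P V V' \<psi>)) Xs)"
proof -
  let ?qs = "degs Xs"
  let ?n = "fst y + sum_list ?qs"
  let ?\<Phi> = "free_map R P V V' \<psi>"
  have yq: "y \<in> OEl P (length ?qs)" using y by simp
  have d: "degs (map (gmap ?\<Phi>) Xs) = ?qs" by simp
  have "?\<Phi> ?n (snd (Fev V y Xs)) = snd (Fev V' y (map (gmap ?\<Phi>) Xs))"
  proof (rule multilin_eq[OF _ _ free_part_module[OF V] free_part_module[OF V'], where qs = ?qs and as = Xs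
        and f = "\<lambda>Xs. ?\<Phi> ?n (snd (Fev V y Xs))" and g = "\<lambda>Xs. snd (Fev V' y (map (gmap ?\<Phi>) Xs))"
        and G = "\<lambda>i. Cl V (?qs ! i) ` syms P V (?qs ! i)"])
    show "multilin R (Fr V) (Fr V' ?n) ?qs (\<lambda>Xs. ?\<Phi> ?n (snd (Fev V y Xs)))"
      by (rule multilin_comp[OF free_ev_multilin[OF V yq refl] free_map_lin])
    show "multilin R (Fr V) (Fr V' ?n) ?qs (\<lambda>Xs. snd (Fev V' y (map (gmap ?\<Phi>) Xs)))"
      by (rule multilin_map[OF free_ev_multilin[OF V' yq refl] free_map_lin])
    show "set Xs \<subseteq> El (Fr V)" "degs Xs = ?qs" by (rule Xs, rule refl)
    fix i assume i: "i < length ?qs"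
    show "Cl V (?qs ! i) ` syms P V (?qs ! i) \<subseteq> carrier (Fr V (?qs ! i))"
      using sym_class_closed[OF V] by blast
    show "snd (Xs ! i) \<in> gen_sub R (Fr V (?qs ! i)) (Cl V (?qs ! i) ` syms P V (?qs ! i))"
      using El_nth[OF Xs, of i] i free_part_gen[OF V] by auto
  next
    fix As assume As: "set As \<subseteq> El (Fr V)" "degs As = ?qs"
      and G: "\<And>i. i < length ?qs \<Longrightarrow> snd (As ! i) \<in> Cl V (?qs ! i) ` syms P V (?qs ! i)"
    have "\<forall>i. \<exists>s. i < length ?qs \<longrightarrow> s \<in> syms P V (?qs ! i) \<and> snd (As ! i) = Cl V (?qs ! i) s"
      using G by blast
    then obtain t where t: "\<And>i. i < length ?qs \<Longrightarrow> t i \<in> syms P V (?qs ! i)"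
      "\<And>i. i < length ?qs \<Longrightarrow> snd (As ! i) = Cl V (?qs ! i) (t i)" by metis
    define ss where "ss = map t [0..<length ?qs]"
    have ss: "sym_lists P V ?qs ss" using t by (simp add: ss_def list_all2_conv_all_nth)
    have lA: "length As = length ?qs" using degs_length[OF As(2)] .
    have AsE: "As = map (\<lambda>s. tens R P V (fst s) (snd s)) ss"
      unfolding sym_lists_classes(1)[OF V ss]
    proof (rule nth_equalityI)
      fix i assume "i < length As"
      then have i: "i < length ?qs" using lA by simp
      show "As ! i = map2 (\<lambda>q s. (q, Cl V q s)) ?qs ss ! i"
        using i t(2)[OF i] degs_nth[OF As(2), of i] lA by (simp add: ss_def prod_eq_iff)
    qed (simp add: lA ss_def)
    let ?m = "\<lambda>s. (fst s, map (gmap \<psi>) (snd s))"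
    have ss': "sym_lists P V' ?qs (map ?m ss)"
    proof -
      have "?m (ss ! i) \<in> syms P V' (?qs ! i)" if "i < length ss" for i
      proof (rule syms_map)
        show "(fst (ss ! i), snd (ss ! i)) \<in> syms P V (?qs ! i)"
          using list_all2_nthD[OF ss that] by simp
      qed
      then show ?thesis using ss by (simp add: list_all2_conv_all_nth)
    qed
    have AsE': "map (gmap ?\<Phi>) As = map (\<lambda>s. tens R P V' (fst s) (snd s)) (map ?m ss)"
    proof (rule nth_equalityI)
      fix i assume "i < length (map (gmap ?\<Phi>) As)"
      then have i: "i < length ss" "i < length ?qs" using lA by (simp_all add: ss_def)
      have "(fst (ss ! i), snd (ss ! i)) \<in> syms P V (?qs ! i)" using list_all2_nthD[OF ss i(1)] by simp
      from free_map_tens[OF this] show "map (gmap ?\<Phi>) As ! i = map (\<lambda>s. tens R P V' (fst s) (snd s)) (map ?m ss) ! i"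
        using i by (simp add: AsE)
    qed (simp add: AsE)
    have c: "(ocomp P (map (length \<circ> snd) ss) y (map fst ss), concat (map snd ss)) \<in> syms P V ?n"
      by (rule sym_comp(1)[OF V yq ss refl])
    have u: "map (length \<circ> snd) (map ?m ss) = map (length \<circ> snd) ss" "map fst (map ?m ss) = map fst ss"
      "concat (map snd (map ?m ss)) = map (gmap \<psi>) (concat (map snd ss))"
      "map (fst \<circ> fst) (map ?m ss) = map (fst \<circ> fst) ss"
      "map (sum_list \<circ> degs \<circ> snd) (map ?m ss) = map (sum_list \<circ> degs \<circ> snd) ss"
      by (simp_all add: map_concat comp_def)
    show "?\<Phi> ?n (snd (Fev V y As)) = snd (Fev V' y (map (gmap ?\<Phi>) As))"
      unfolding AsE' free_ev_tens[OF V' yq ss'] unfolding AsE free_ev_tens[OF V yq ss]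
        sym_comp(2)[OF V yq ss refl] sym_comp(2)[OF V' yq ss' refl] u
        lin_sgn[OF free_map_lin free_part_module[OF V] free_part_module[OF V'] sym_class_closed[OF V c]]
        free_map_class[OF c] ..
  qed
  then show ?thesis by (simp add: free_ev_deg[OF V] free_ev_deg[OF V'] prod_eq_iff comp_def)
qed

end

end

section \<open>Quotient algebras and graded ideals\<close>

text \<open>What enters is multilinearity of the product, its degree, and closure of
  \<open>I\<close> for arguments of the given degrees. In this form the statement serves both the
  free algebra on the copies of \<open>A\<close> and the total complex.\<close>

lemma quot_alg_ev:
  fixes A :: "('r, 'o, 'a) dgalg"
  assumes M: "\<And>q. module R (gpart A q)" and I: "\<And>q. submodule (I q) R (gpart A q)"
    and ev: "multilin R (gpart A) (gpart A n) (degs as) (\<lambda>as. snd (ev A x as))"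
    and deg: "\<And>bs. degs bs = degs as \<Longrightarrow> set bs \<subseteq> El (gpart A) \<Longrightarrow> fst (ev A x bs) = n"
    and ideal: "\<And>bs i. degs bs = degs as \<Longrightarrow> set bs \<subseteq> El (gpart A) \<Longrightarrow> i < length bs \<Longrightarrow>
      snd (bs ! i) \<in> I (degs as ! i) \<Longrightarrow> snd (ev A x bs) \<in> I n"
    and as: "set as \<subseteq> El (gpart A)"
  shows "ev (quot_alg A I) x (map (gmap (proj A I)) as) = gmap (proj A I) (ev A x as)"
proof -
  let ?Xs = "map (gmap (proj A I)) as"
  have eq: "gmap (proj A I) (ev A x bs) = gmap (proj A I) (ev A x as)"
    if b: "list_all2 (\<lambda>a X. fst a = fst X \<and> snd a \<in> snd X) bs ?Xs" for bs
  proof -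
    have bd: "degs bs = degs as" using b by (auto simp: list_all2_conv_all_nth intro!: nth_equalityI)
    have lb: "length bs = length as" using bd by (metis length_map)
    have mem: "snd (bs ! i) \<in> carrier (gpart A (fst (bs ! i))) \<and>
        snd (bs ! i) \<ominus>\<^bsub>gpart A (degs as ! i)\<^esub> snd (as ! i) \<in> I (degs as ! i)"
      if i: "i < length as" for i
      using b coset_mem_iff[OF M I El_nth[OF as i], of "snd (bs ! i)"] i
      by (auto simp: list_all2_conv_all_nth proj_def)
    have bE: "set bs \<subseteq> El (gpart A)"
      by (rule El_listI) (use mem lb in auto)
    have "snd (ev A x bs) \<ominus>\<^bsub>gpart A n\<^esub> snd (ev A x as) \<in> I n"
    proof (rule multilin_cong[OF ev M M I _ bE bd as refl])
      show "snd (bs ! i) \<ominus>\<^bsub>gpart A (degs as ! i)\<^esub> snd (as ! i) \<in> I (degs as ! i)"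
        if "i < length (degs as)" for i using mem that by simp
    qed (use ideal degs_length in metis)
    then show ?thesis
      using coset_eq_iff[OF M I multilin_closed[OF ev bE bd] multilin_closed[OF ev as refl]]
      by (simp add: deg[OF bd bE] deg[OF refl as] proj_def)
  qed
  have self: "list_all2 (\<lambda>a X. fst a = fst X \<and> snd a \<in> snd X) as ?Xs"
    using coset_self[OF M I] as by (auto simp: list_all2_conv_all_nth El_iff subset_iff proj_def)
  have "{gmap (proj A I) (ev A x bs) | bs. list_all2 (\<lambda>a X. fst a = fst X \<and> snd a \<in> snd X) bs ?Xs} =
      {gmap (proj A I) (ev A x as)}"
    using eq self by blast
  then show ?thesis by (simp add: quot_alg_def)
qed

text \<open>Ideals of the underlying graded algebra. They can be pulled back along multiplicative
  maps that do not commute with the differential, such as those built from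
  \<open>kill\<close>.\<close>

definition graded_ideal :: "'r ring \<Rightarrow> ('r, 'o) operad \<Rightarrow> ('r, 'o, 'a) dgalg \<Rightarrow> (int \<Rightarrow> 'a set) \<Rightarrow> bool"
  where "graded_ideal R P A I \<longleftrightarrow> gr_sub R A I \<and>
    (\<forall>x as. x \<in> OEl P (length as) \<and> set as \<subseteq> El (gpart A) \<and> (\<exists>a\<in>set as. snd a \<in> I (fst a)) \<longrightarrow>
      snd (ev A x as) \<in> I (fst (ev A x as)))"

lemma alg_ideal_iff: "alg_ideal R P A I \<longleftrightarrow> graded_ideal R P A I \<and> (\<forall>q. dif A q ` I q \<subseteq> I (q - 1))"
  by (auto simp: alg_ideal_def graded_ideal_def subcomplex_def)

lemma graded_ideal_submodule: "graded_ideal R P A I \<Longrightarrow> submodule (I q) R (gpart A q)"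
  by (simp add: graded_ideal_def gr_sub_def)

lemma graded_ideal_ev: "graded_ideal R P A I \<Longrightarrow> x \<in> OEl P (length as) \<Longrightarrow> set as \<subseteq> El (gpart A) \<Longrightarrow>
    i < length as \<Longrightarrow> snd (as ! i) \<in> I (fst (as ! i)) \<Longrightarrow> snd (ev A x as) \<in> I (fst (ev A x as))"
  unfolding graded_ideal_def using nth_mem by blast

lemma graded_ideal_Inter:
  fixes A :: "('r, 'o, 'a) dgalg"
  assumes "\<And>q. module R (gpart A q)" "\<I> \<noteq> {}" "\<And>I. I \<in> \<I> \<Longrightarrow> graded_ideal R P A I"
  shows "graded_ideal R P A (\<lambda>q. \<Inter>I\<in>\<I>. I q)"
  unfolding graded_ideal_def gr_sub_def
proof (intro conjI allI impI)
  show "submodule (\<Inter>I\<in>\<I>. I q) R (gpart A q)" for q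
    by (rule submodule_Inter[OF assms(1)]) (use assms(2) graded_ideal_submodule[OF assms(3)] in auto)
  show "snd (ev A x as) \<in> (\<Inter>I\<in>\<I>. I (fst (ev A x as)))"
    if "x \<in> OEl P (length as) \<and> set as \<subseteq> El (gpart A) \<and> (\<exists>a\<in>set as. snd a \<in> (\<Inter>I\<in>\<I>. I (fst a)))" for x as
    using that assms(3) unfolding graded_ideal_def by blast
qed

section \<open>Algebras over an operad\<close>

locale dg_algebra_ctx = dg_operad_ctx R P
  for R :: "'r ring" and P :: "('r, 'o) operad" +
  fixes A :: "('r, 'o, 'a) dgalg"
  assumes A: "operad_algebra R P A"
begin

lemma A_module: "module R (gpart A q)"
  using A by (simp add: operad_algebra_def dg_module_def gr_module_def)

lemma A_gr: "gr_module R (gpart A)"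
  using A by (simp add: operad_algebra_def dg_module_def)

lemma A_dif: "dif A q \<in> lin R (gpart A q) (gpart A (q - 1))"
  using A by (simp add: operad_algebra_def dg_module_def)

lemma A_chain_op: "chain_op R (ops P k) (replicate k A) A (ev A)"
  using A by (simp add: operad_algebra_def)

lemma A_dl: "a \<in> El (gpart A) \<Longrightarrow> dl A a \<in> El (gpart A)"
  using lin_closed[OF A_dif] by (auto simp: El_iff dl_def)

lemma
  assumes x: "x \<in> OEl P (length as)" and as: "set as \<subseteq> El (gpart A)"
  shows A_ev_El: "ev A x as \<in> El (gpart A)"
    and A_ev_deg: "fst (ev A x as) = fst x + sum_list (degs as)"
    and A_leibniz: "dif A (fst x + sum_list (degs as)) (snd (ev A x as)) =
      snd (ev A (dl (ops P (length as)) x) as)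
      \<oplus>\<^bsub>gpart A (fst x + sum_list (degs as) - 1)\<^esub> (\<Oplus>\<^bsub>gpart A (fst x + sum_list (degs as) - 1)\<^esub>i\<in>{..<length as}.
        sgn_mod (gpart A (fst x + sum_list (degs as) - 1)) (fst x + sum_list (degs (take i as)))
          (snd (ev A x (as[i := dl A (as ! i)]))))"
proof -
  let ?k = "length as"
  let ?n = "fst x + sum_list (degs as)"
  have all: "list_all2 (\<lambda>y Y. y \<in> El (gpart Y)) bs (replicate ?k A)" if "set bs \<subseteq> El (gpart A)" "length bs = ?k" for bs
    using that El_nth[OF that(1)] by (auto simp: list_all2_conv_all_nth El_iff)
  note * = A_chain_op[of ?k, unfolded chain_op_def Let_def, rule_format, OF conjI, OF x]
  show El: "ev A x as \<in> El (gpart A)" and dg: "fst (ev A x as) = ?n"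
    using *[OF all[OF as refl]] by auto
  have d: "fst (ev A x (as[i := dl A (as ! i)])) = ?n - 1 \<and> ev A x (as[i := dl A (as ! i)]) \<in> El (gpart A)" if i: "i < ?k" for i
  proof -
    have "set (as[i := dl A (as ! i)]) \<subseteq> El (gpart A)"
      by (rule El_update[OF as]) (use A_dl[of "as ! i"] El_nth[OF as i] in \<open>simp add: El_iff\<close>)
    moreover have "sum_list (degs (as[i := dl A (as ! i)])) = sum_list (degs as) - 1"
      using i by (simp add: map_update sum_list_update_int) (simp add: dl_def)
    ultimately show ?thesis using *[OF all[of "as[i := dl A (as ! i)]"]] by simp
  qed
  have "dif A ?n (snd (ev A x as)) = snd (ev A (dl (ops P ?k) x) as)
      \<oplus>\<^bsub>gpart A (?n - 1)\<^esub> (\<Oplus>\<^bsub>gpart A (?n - 1)\<^esub>i\<in>{..<?k}.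
        snd (sg (gpart A) (fst x + sum_list (degs (take i as))) (ev A x (as[i := dl (replicate ?k A ! i) (as ! i)]))))"
    using *[OF all[OF as refl]] by auto
  also have "(\<Oplus>\<^bsub>gpart A (?n - 1)\<^esub>i\<in>{..<?k}.
        snd (sg (gpart A) (fst x + sum_list (degs (take i as))) (ev A x (as[i := dl (replicate ?k A ! i) (as ! i)])))) =
      (\<Oplus>\<^bsub>gpart A (?n - 1)\<^esub>i\<in>{..<?k}.
        sgn_mod (gpart A (?n - 1)) (fst x + sum_list (degs (take i as))) (snd (ev A x (as[i := dl A (as ! i)]))))"
  proof (rule module_finsum_cong[OF A_module])
    fix i assume "i \<in> {..<?k}"
    then have i: "i < ?k" by simp
    show "snd (sg (gpart A) (fst x + sum_list (degs (take i as))) (ev A x (as[i := dl (replicate ?k A ! i) (as ! i)]))) =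
        sgn_mod (gpart A (?n - 1)) (fst x + sum_list (degs (take i as))) (snd (ev A x (as[i := dl A (as ! i)])))"
      using i d[OF i] by (simp add: sg_def)
    show "sgn_mod (gpart A (?n - 1)) (fst x + sum_list (degs (take i as))) (snd (ev A x (as[i := dl A (as ! i)]))) \<in> carrier (gpart A (?n - 1))"
      by (rule module_sgn_closed[OF A_module]) (use d[OF i] in \<open>auto simp: El_iff\<close>)
  qed
  finally show "dif A ?n (snd (ev A x as)) = snd (ev A (dl (ops P ?k) x) as)
      \<oplus>\<^bsub>gpart A (?n - 1)\<^esub> (\<Oplus>\<^bsub>gpart A (?n - 1)\<^esub>i\<in>{..<?k}.
        sgn_mod (gpart A (?n - 1)) (fst x + sum_list (degs (take i as))) (snd (ev A x (as[i := dl A (as ! i)]))))" .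
qed

lemma syms_A: "(x, as) \<in> syms P (gpart A) n \<Longrightarrow> ev A x as \<in> El (gpart A) \<and> fst (ev A x as) = n"
  using A_ev_El A_ev_deg by (auto simp: syms_iff)

section \<open>Direct sums of copies of an algebra\<close>

abbreviation "C m \<equiv> copies A m"
abbreviation "CM m \<equiv> gpart (copies A m)"

lemma CM_eq: "CM m q = direct_sum {..<m} (\<lambda>_. gpart A q)"
  by (simp add: copies_def)

lemma C_module: "module R (CM m q)"
  unfolding CM_eq by (rule direct_sum_module[OF R A_module])

lemma C_gr: "gr_module R (CM m)"
  using C_module by (simp add: gr_module_def)

lemma C_carrier: "w \<in> carrier (CM m q) \<longleftrightarrow> w \<in> (\<Pi>\<^sub>E i\<in>{..<m}. carrier (gpart A q))"
  by (simp add: CM_eq direct_sum_carrier)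

lemma C_dif: "dif (C m) q \<in> lin R (CM m q) (CM m (q - 1))"
proof (rule linI)
  note d = lin_closed[OF A_dif] lin_add[OF A_dif] lin_smult[OF A_dif]
  fix w assume w: "w \<in> carrier (CM m q)"
  show "dif (C m) q w \<in> carrier (CM m (q - 1))"
    using w d unfolding C_carrier by (auto simp: copies_def)
  show "dif (C m) q (w \<oplus>\<^bsub>CM m q\<^esub> w') = dif (C m) q w \<oplus>\<^bsub>CM m (q - 1)\<^esub> dif (C m) q w'" if "w' \<in> carrier (CM m q)" for w'
    using w that d unfolding C_carrier by (auto simp: copies_def direct_sum_def fun_eq_iff restrict_def PiE_def Pi_def)
  show "dif (C m) q (r \<odot>\<^bsub>CM m q\<^esub> w) = r \<odot>\<^bsub>CM m (q - 1)\<^esub> dif (C m) q w" if "r \<in> carrier R" for r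
    using w that d unfolding C_carrier by (auto simp: copies_def direct_sum_def fun_eq_iff restrict_def PiE_def Pi_def)
qed

abbreviation "\<iota> m i q \<equiv> single {..<m} (\<lambda>_. gpart A q) i"

lemma \<iota>_lin: "i < m \<Longrightarrow> \<iota> m i q \<in> lin R (gpart A q) (CM m q)"
  unfolding CM_eq by (rule single_lin[OF A_module]) simp

lemma copy_in_eq: "copy_in A m i a = (fst a, \<iota> m i (fst a) (snd a))"
  by (simp add: copy_in_def)

lemma fst_copy_in [simp]: "fst (copy_in A m i a) = fst a"
  by (simp add: copy_in_def)

lemma copy_in_El: "i < m \<Longrightarrow> a \<in> El (gpart A) \<Longrightarrow> copy_in A m i a \<in> El (CM m)"
  using lin_closed[OF \<iota>_lin] by (simp add: El_iff copy_in_def)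

lemma dl_copy_in: "a \<in> El (gpart A) \<Longrightarrow> dl (C m) (copy_in A m i a) = copy_in A m i (dl A a)"
  using lin_zero[OF A_dif A_module A_module]
  by (auto simp: dl_def copy_in_def copies_def single_def restrict_def fun_eq_iff)

lemma CM_gen: "carrier (CM m q) \<subseteq> gen_sub R (CM m q) {\<iota> m i q a | i a. i < m \<and> a \<in> carrier (gpart A q)}"
proof
  fix w assume w: "w \<in> carrier (CM m q)"
  let ?G = "{\<iota> m i q a | i a. i < m \<and> a \<in> carrier (gpart A q)}"
  have G: "?G \<subseteq> carrier (CM m q)" using lin_closed[OF \<iota>_lin] by auto
  have "submodule (gen_sub R (CM m q) ?G) R (direct_sum {..<m} (\<lambda>_. gpart A q))"
    using gen_sub_submodule[OF C_module G] unfolding CM_eq .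
  then show "w \<in> gen_sub R (CM m q) ?G"
  proof (rule direct_sum_single_mem[OF R A_module])
    show "w \<in> carrier (direct_sum {..<m} (\<lambda>_. gpart A q))" using w unfolding CM_eq .
    fix i assume i: "i \<in> {..<m}"
    then have "w i \<in> carrier (gpart A q)" using w unfolding C_carrier by auto
    then show "\<iota> m i q (w i) \<in> gen_sub R (CM m q) ?G"
      using i by (intro subsetD[OF gen_sub_incl]) blast
  qed
qed

section \<open>The ideal defining the coproduct\<close>

abbreviation "FC m \<equiv> free_on_copies R P A m"
abbreviation "FP m \<equiv> Fr (CM m)"

lemma FC_simps [simp]: "gpart (FC m) = FP m" "ev (FC m) = Fev (CM m)"
  by (simp_all add: free_alg_def)

lemma FP_module: "module R (FP m q)"
  by (rule free_part_module[OF C_gr])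

lemma FC_dif: "dif (FC m) q \<in> lin R (FP m q) (FP m (q - 1))"
  by (rule free_dif_lin[OF C_gr C_dif])

lemma syms_copy:
  assumes "(x, map snd ias) \<in> syms P (gpart A) n" "fst ` set ias \<subseteq> {..<m}"
  shows "(x, map (\<lambda>(i, a). copy_in A m i a) ias) \<in> syms P (CM m) n"
proof -
  have d: "degs (map (\<lambda>(i, a). copy_in A m i a) ias) = degs (map snd ias)" by auto
  have "copy_in A m i a \<in> El (CM m)" if "(i, a) \<in> set ias" for i a
  proof (rule copy_in_El)
    show "i < m" using that assms(2) by force
    show "a \<in> El (gpart A)" using that assms(1) unfolding syms_iff by force
  qed
  then have "set (map (\<lambda>(i, a). copy_in A m i a) ias) \<subseteq> El (CM m)" by auto
  then show ?thesis using assms(1) unfolding syms_iff d by simp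
qed

lemma syms_copies: "(x, as) \<in> syms P (gpart A) n \<Longrightarrow> i < m \<Longrightarrow> (x, map (copy_in A m i) as) \<in> syms P (CM m) n"
proof -
  assume s: "(x, as) \<in> syms P (gpart A) n" and i: "i < m"
  have "(x, map snd (map (Pair i) as)) \<in> syms P (gpart A) n" using s by (simp add: comp_def)
  moreover have "fst ` set (map (Pair i) as) \<subseteq> {..<m}" using i by auto
  ultimately show ?thesis using syms_copy[of x "map (Pair i) as" n m] by (simp add: comp_def)
qed

lemma syms_copy1: "a \<in> El (gpart A) \<Longrightarrow> i < m \<Longrightarrow> (oid P, [copy_in A m i a]) \<in> syms P (CM m) (fst a)"
  using copy_in_El oid_el(1) by (simp add: syms_iff)

definition rel :: "nat \<Rightarrow> nat \<Rightarrow> 'o gel \<Rightarrow> 'a gel list \<Rightarrow> int \<Rightarrow> ('r, 'o, nat \<Rightarrow> 'a) free_el"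
  where "rel m i y as q = snd (tens R P (CM m) y (map (copy_in A m i) as)) \<ominus>\<^bsub>FP m q\<^esub>
    snd (tens R P (CM m) (oid P) [copy_in A m i (ev A y as)])"

lemma cop_rels_eq: "cop_rels R P A m q = {rel m i y as q | i y as. i < m \<and> (y, as) \<in> syms P (gpart A) q}"
  by (simp add: cop_rels_def rel_def)

lemma
  assumes "(y, as) \<in> syms P (gpart A) q" "i < m"
  shows rel_eq: "rel m i y as q = Cl (CM m) q (y, map (copy_in A m i) as) \<ominus>\<^bsub>FP m q\<^esub>
      Cl (CM m) q (oid P, [copy_in A m i (ev A y as)])"
    and rel_syms: "(y, map (copy_in A m i) as) \<in> syms P (CM m) q"
      "(oid P, [copy_in A m i (ev A y as)]) \<in> syms P (CM m) q"
    and rel_closed: "rel m i y as q \<in> carrier (FP m q)"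
proof -
  show s: "(y, map (copy_in A m i) as) \<in> syms P (CM m) q" "(oid P, [copy_in A m i (ev A y as)]) \<in> syms P (CM m) q"
    using syms_copies[OF assms] syms_copy1[OF _ assms(2), of "ev A y as"] syms_A[OF assms(1)] by auto
  then show e: "rel m i y as q = Cl (CM m) q (y, map (copy_in A m i) as) \<ominus>\<^bsub>FP m q\<^esub>
      Cl (CM m) q (oid P, [copy_in A m i (ev A y as)])"
    by (simp add: rel_def tens_eq)
  show "rel m i y as q \<in> carrier (FP m q)"
    unfolding e by (rule module_minus_closed[OF FP_module sym_class_closed[OF C_gr s(1)] sym_class_closed[OF C_gr s(2)]])
qed

text \<open>Makes the families of ideals intersected in \<open>gr_ideal_gen\<close> and
  \<open>cop_ideal\<close> nonempty; an empty intersection would be the whole type and not a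
  submodule.\<close>

lemma FC_full_ideal: "alg_ideal R P (FC m) (\<lambda>q. carrier (FP m q))"
  unfolding alg_ideal_def subcomplex_def gr_sub_def
proof (intro conjI allI impI)
  show "submodule (carrier (FP m q)) R (gpart (FC m) q)" for q
    using module.carrier_is_submodule[OF FP_module] by simp
  show "dif (FC m) q ` carrier (FP m q) \<subseteq> carrier (FP m (q - 1))" for q
    using lin_closed[OF FC_dif] by blast
  show "snd (ev (FC m) x as) \<in> carrier (FP m (fst (ev (FC m) x as)))"
    if "x \<in> OEl P (length as) \<and> set as \<subseteq> El (gpart (FC m)) \<and> (\<exists>a\<in>set as. snd a \<in> carrier (FP m (fst a)))" for x as
    using multilin_closed[OF free_ev_multilin[OF C_gr, of x "degs as"]] that by (simp add: free_ev_deg[OF C_gr])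
qed

text \<open>Closure under the differential is not required here, but holds by \<open>gr_ideal_gen_dif\<close>; this
  identifies \<^const>\<open>cop_ideal\<close>.\<close>

definition gr_ideal_gen :: "nat \<Rightarrow> int \<Rightarrow> ('r, 'o, nat \<Rightarrow> 'a) free_el set"
  where "gr_ideal_gen m q = (\<Inter>I\<in>{I. graded_ideal R P (FC m) I \<and> (\<forall>n. cop_rels R P A m n \<subseteq> I n)}. I q)"

lemma cop_rels_carrier: "cop_rels R P A m q \<subseteq> carrier (FP m q)"
  using rel_closed by (auto simp: cop_rels_eq)

lemma gr_ideal_gen_ideal: "graded_ideal R P (FC m) (gr_ideal_gen m)"
  unfolding gr_ideal_gen_def[abs_def]
proof (rule graded_ideal_Inter)
  have "(\<lambda>q. carrier (FP m q)) \<in> {I. graded_ideal R P (FC m) I \<and> (\<forall>n. cop_rels R P A m n \<subseteq> I n)}"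
    using FC_full_ideal[unfolded alg_ideal_iff] cop_rels_carrier by blast
  then show "{I. graded_ideal R P (FC m) I \<and> (\<forall>n. cop_rels R P A m n \<subseteq> I n)} \<noteq> {}" by blast
qed (use FP_module in auto)

lemma gr_ideal_gen_rels: "cop_rels R P A m q \<subseteq> gr_ideal_gen m q"
  by (auto simp: gr_ideal_gen_def)

lemma gr_ideal_gen_least: "graded_ideal R P (FC m) I \<Longrightarrow> (\<And>n. cop_rels R P A m n \<subseteq> I n) \<Longrightarrow> gr_ideal_gen m q \<subseteq> I q"
  by (auto simp: gr_ideal_gen_def)

lemma cop_ideal_ideal: "alg_ideal R P (FC m) (cop_ideal R P A m)"
proof -
  let ?\<I> = "{I. alg_ideal R P (FC m) I \<and> (\<forall>n. cop_rels R P A m n \<subseteq> I n)}"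
  have eq: "cop_ideal R P A m = (\<lambda>q. \<Inter>I\<in>?\<I>. I q)"
    unfolding cop_ideal_def ideal_gen_def by (rule ext) auto
  have "graded_ideal R P (FC m) (\<lambda>q. \<Inter>I\<in>?\<I>. I q)"
  proof (rule graded_ideal_Inter)
    have "(\<lambda>q. carrier (FP m q)) \<in> ?\<I>" using FC_full_ideal cop_rels_carrier by blast
    then show "?\<I> \<noteq> {}" by blast
  qed (use FP_module in \<open>auto simp: alg_ideal_iff\<close>)
  moreover have "dif (FC m) q ` (\<Inter>I\<in>?\<I>. I q) \<subseteq> (\<Inter>I\<in>?\<I>. I (q - 1))" for q
    unfolding alg_ideal_iff by blast
  ultimately show ?thesis unfolding eq alg_ideal_iff by blast
qed

lemma cop_ideal_rels: "cop_rels R P A m q \<subseteq> cop_ideal R P A m q"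
  by (auto simp: cop_ideal_def ideal_gen_def)

text \<open>The Leibniz rules in the free algebra and in \<open>A\<close> carry the same signs, and
  the operad unit is a cycle. So the two halves of a relation are differentiated in parallel, and
  the terms pair up to relations again.\<close>

lemma rel_dif:
  assumes s: "(y, as) \<in> syms P (gpart A) q" and i: "i < m"
  shows "dif (FC m) q (rel m i y as q) = rel m i (dl (ops P (length as)) y) as (q - 1) \<oplus>\<^bsub>FP m (q - 1)\<^esub>
    (\<Oplus>\<^bsub>FP m (q - 1)\<^esub>j\<in>{..<length as}. sgn_mod (FP m (q - 1)) (fst y + sum_list (degs (take j as)))
      (rel m i y (as[j := dl A (as ! j)]) (q - 1)))"
proof -
  let ?F = "FP m (q - 1)"
  let ?T = "Cl (CM m) (q - 1)"
  let ?c = "copy_in A m i"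
  note F = FP_module[of m "q - 1"]
  interpret F: module R ?F by (rule F)
  have y: "y \<in> OEl P (length as)" and as: "set as \<subseteq> El (gpart A)" and q: "q = fst y + sum_list (degs as)"
    using s by (auto simp: syms_iff)
  have sdy: "(dl (ops P (length as)) y, as) \<in> syms P (gpart A) (q - 1)"
    by (rule syms_dl_op[where W = "\<lparr>gpart = gpart A, dif = dif A\<rparr>", simplified, OF A_gr A_dif s])
  have sdj: "(y, as[j := dl A (as ! j)]) \<in> syms P (gpart A) (q - 1)" if "j < length as" for j
    using syms_dslot[where W = "\<lparr>gpart = gpart A, dif = dif A\<rparr>", simplified, OF A_gr A_dif s that]
    by (simp add: dl_def)
  \<comment> \<open>The linear map that regards an element of \<open>A\<close> as a single letter in
    copy \<open>i\<close>. It transports the Leibniz expansion in \<open>A\<close> to the free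
    algebra.\<close>
  define L where "L u = ?T (oid P, [(q - 1, \<iota> m i (q - 1) u)])" for u
  have L: "L \<in> lin R (gpart A (q - 1)) ?F"
  proof -
    have z: "(oid P, [(q - 1, \<zero>\<^bsub>CM m (q - 1)\<^esub>)]) \<in> syms P (CM m) (q - 1)"
      using oid_el(1) module_zero_closed[OF C_module] by (simp add: syms_iff El_iff)
    have "(\<lambda>u. ?T (oid P, [(q - 1, u)])) \<in> lin R (CM m (q - 1)) ?F"
      using balanced_slot[OF sym_class_balanced[OF C_gr] z, of 0] by simp
    from lin_comp[OF \<iota>_lin[OF i] this] show ?thesis unfolding L_def .
  qed
  have Lc: "?T (oid P, [?c a]) = L (snd a)" if "fst a = q - 1" for a
    unfolding L_def copy_in_eq that ..
  define a0 where "a0 = snd (ev A (dl (ops P (length as)) y) as)"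
  define a1 where "a1 j = snd (ev A y (as[j := dl A (as ! j)]))" for j
  define t0 where "t0 = ?T (dl (ops P (length as)) y, map ?c as)"
  define t1 where "t1 j = ?T (y, map ?c (as[j := dl A (as ! j)]))" for j
  define z where "z j = fst y + sum_list (degs (take j as))" for j
  have a0c: "a0 \<in> carrier (gpart A (q - 1))" using syms_A[OF sdy] by (auto simp: El_iff a0_def)
  have a1c: "a1 j \<in> carrier (gpart A (q - 1))" if "j < length as" for j using syms_A[OF sdj[OF that]] by (auto simp: El_iff a1_def)
  have t0c: "t0 \<in> carrier ?F" unfolding t0_def by (rule sym_class_closed[OF C_gr rel_syms(1)[OF sdy i]])
  have t1c: "t1 j \<in> carrier ?F" if "j < length as" for j
    unfolding t1_def by (rule sym_class_closed[OF C_gr rel_syms(1)[OF sdj[OF that] i]])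
  have r0: "rel m i (dl (ops P (length as)) y) as (q - 1) = t0 \<ominus>\<^bsub>?F\<^esub> L a0"
    unfolding rel_eq[OF sdy i] t0_def a0_def using Lc syms_A[OF sdy] by simp
  have r1: "rel m i y (as[j := dl A (as ! j)]) (q - 1) = t1 j \<ominus>\<^bsub>?F\<^esub> L (a1 j)" if "j < length as" for j
    unfolding rel_eq[OF sdj[OF that] i] t1_def a1_def using Lc syms_A[OF sdj[OF that]] by simp
  have d1: "dif (FC m) q (Cl (CM m) q (y, map ?c as)) =
      t0 \<oplus>\<^bsub>?F\<^esub> (\<Oplus>\<^bsub>?F\<^esub>j\<in>{..<length as}. sgn_mod ?F (z j) (t1 j))"
  proof -
    have e: "?T (y, (map ?c as)[j := dl (C m) (map ?c as ! j)]) = t1 j"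
      "degs (take j (map ?c as)) = degs (take j as)" if "j < length as" for j
    proof -
      have "as ! j \<in> El (gpart A)" using as nth_mem[OF that] by blast
      from dl_copy_in[OF this, of m i]
      show "?T (y, (map ?c as)[j := dl (C m) (map ?c as ! j)]) = t1 j" using that by (simp add: t1_def map_update)
      show "degs (take j (map ?c as)) = degs (take j as)" by (simp add: take_map comp_def)
    qed
    have "(\<Oplus>\<^bsub>?F\<^esub>j\<in>{..<length as}. sgn_mod ?F (fst y + sum_list (degs (take j (map ?c as))))
        (?T (y, (map ?c as)[j := dl (C m) (map ?c as ! j)]))) = (\<Oplus>\<^bsub>?F\<^esub>j\<in>{..<length as}. sgn_mod ?F (z j) (t1 j))"
      by (rule module_finsum_cong[OF F _ module_sgn_closed[OF F t1c]]) (simp_all only: e lessThan_iff z_def)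
    then show ?thesis
      unfolding free_dif_class[OF C_gr C_dif rel_syms(1)[OF s i]] sym_dif_eq[OF C_gr C_dif rel_syms(1)[OF s i]]
      by (simp add: t0_def)
  qed
  have d2: "dif (FC m) q (Cl (CM m) q (oid P, [?c (ev A y as)])) =
      L a0 \<oplus>\<^bsub>?F\<^esub> (\<Oplus>\<^bsub>?F\<^esub>j\<in>{..<length as}. sgn_mod ?F (z j) (L (a1 j)))"
  proof -
    have s2: "(oid P, [?c (ev A y as)]) \<in> syms P (CM m) q" by (rule rel_syms(2)[OF s i])
    have evE: "ev A y as \<in> El (gpart A)" "fst (ev A y as) = q" using syms_A[OF s] by auto
    have dev: "dl (C m) (?c (ev A y as)) = (q - 1, \<iota> m i (q - 1) (dif A q (snd (ev A y as))))"
      unfolding dl_copy_in[OF evE(1)] by (simp add: copy_in_eq dl_def evE(2))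
    have z0: "?T (dl (ops P 1) (oid P), [?c (ev A y as)]) = \<zero>\<^bsub>?F\<^esub>"
    proof -
      have "((\<lambda>u. ?T ((fst (dl (ops P 1) (oid P)), u), [?c (ev A y as)])) \<zero>\<^bsub>gpart (ops P 1) (fst (dl (ops P 1) (oid P)))\<^esub>) = \<zero>\<^bsub>?F\<^esub>"
        by (rule lin_zero[OF _ op_module F])
          (use balanced_op[OF sym_class_balanced[OF C_gr] syms_dl_op[OF C_gr C_dif s2]] in simp)
      then show ?thesis using oid_el(3) by (simp add: dl_def)
    qed
    have Ldif: "?T (oid P, [dl (C m) (?c (ev A y as))]) = L (dif A q (snd (ev A y as)))"
      unfolding dev L_def ..
    have Lc': "L (dif A q (snd (ev A y as))) \<in> carrier ?F"
      by (rule lin_closed[OF L lin_closed[OF A_dif]]) (use evE in \<open>auto simp: El_iff\<close>)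
    have "dif (FC m) q (Cl (CM m) q (oid P, [?c (ev A y as)])) = L (dif A q (snd (ev A y as)))"
      unfolding free_dif_class[OF C_gr C_dif s2] sym_dif_eq[OF C_gr C_dif s2]
      using z0 Ldif Lc' by (simp add: lessThan_Suc)
    also have "\<dots> = L (a0 \<oplus>\<^bsub>gpart A (q - 1)\<^esub> (\<Oplus>\<^bsub>gpart A (q - 1)\<^esub>j\<in>{..<length as}. sgn_mod (gpart A (q - 1)) (z j) (a1 j)))"
      using A_leibniz[OF y as] by (simp only: q[symmetric] a0_def a1_def z_def)
    also have "\<dots> = L a0 \<oplus>\<^bsub>?F\<^esub> L (\<Oplus>\<^bsub>gpart A (q - 1)\<^esub>j\<in>{..<length as}. sgn_mod (gpart A (q - 1)) (z j) (a1 j))"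
      by (rule lin_add[OF L a0c]) (rule module_finsum_closed[OF A_module module_sgn_closed[OF A_module a1c]], simp)
    also have "L (\<Oplus>\<^bsub>gpart A (q - 1)\<^esub>j\<in>{..<length as}. sgn_mod (gpart A (q - 1)) (z j) (a1 j)) =
        (\<Oplus>\<^bsub>?F\<^esub>j\<in>{..<length as}. L (sgn_mod (gpart A (q - 1)) (z j) (a1 j)))"
      by (rule lin_finsum[OF L A_module F finite_lessThan module_sgn_closed[OF A_module a1c]]) simp
    also have "\<dots> = (\<Oplus>\<^bsub>?F\<^esub>j\<in>{..<length as}. sgn_mod ?F (z j) (L (a1 j)))"
      by (rule module_finsum_cong[OF F _ module_sgn_closed[OF F lin_closed[OF L a1c]]])
        (simp_all only: lin_sgn[OF L A_module F a1c] lessThan_iff)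
    finally show ?thesis .
  qed
  let ?S1 = "\<Oplus>\<^bsub>?F\<^esub>j\<in>{..<length as}. sgn_mod ?F (z j) (t1 j)"
  let ?S2 = "\<Oplus>\<^bsub>?F\<^esub>j\<in>{..<length as}. sgn_mod ?F (z j) (L (a1 j))"
  have sc: "sgn_mod ?F e v \<in> carrier ?F" if "v \<in> carrier ?F" for e v by (rule module_sgn_closed[OF F that])
  have S1: "?S1 \<in> carrier ?F" and S2: "?S2 \<in> carrier ?F"
    by (rule module_finsum_closed[OF F], rule sc, rule t1c, simp,
        rule module_finsum_closed[OF F], rule sc, rule lin_closed[OF L a1c], simp)
  have La0: "L a0 \<in> carrier ?F" by (rule lin_closed[OF L a0c])
  have "dif (FC m) q (rel m i y as q) = (t0 \<oplus>\<^bsub>?F\<^esub> ?S1) \<ominus>\<^bsub>?F\<^esub> (L a0 \<oplus>\<^bsub>?F\<^esub> ?S2)"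
    unfolding rel_eq[OF s i] lin_minus[OF FC_dif FP_module F sym_class_closed[OF C_gr rel_syms(1)[OF s i]] sym_class_closed[OF C_gr rel_syms(2)[OF s i]]]
      d1 d2 ..
  also have "\<dots> = (t0 \<ominus>\<^bsub>?F\<^esub> L a0) \<oplus>\<^bsub>?F\<^esub> (?S1 \<ominus>\<^bsub>?F\<^esub> ?S2)"
    using t0c S1 S2 La0 by (simp add: F.minus_eq F.minus_add F.a_ac)
  also have "?S1 \<ominus>\<^bsub>?F\<^esub> ?S2 = (\<Oplus>\<^bsub>?F\<^esub>j\<in>{..<length as}. sgn_mod ?F (z j) (t1 j \<ominus>\<^bsub>?F\<^esub> L (a1 j)))"
  proof -
    have ul: "(\<lambda>v. \<ominus>\<^bsub>?F\<^esub> v) \<in> lin R ?F ?F" by (rule lin_uminus[OF lin_id F])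
    have "\<ominus>\<^bsub>?F\<^esub> ?S2 = (\<Oplus>\<^bsub>?F\<^esub>j\<in>{..<length as}. \<ominus>\<^bsub>?F\<^esub> sgn_mod ?F (z j) (L (a1 j)))"
      by (rule lin_finsum[OF ul F F finite_lessThan]) (rule sc[OF lin_closed[OF L a1c]], simp)
    then have "?S1 \<ominus>\<^bsub>?F\<^esub> ?S2 = ?S1 \<oplus>\<^bsub>?F\<^esub> (\<Oplus>\<^bsub>?F\<^esub>j\<in>{..<length as}. \<ominus>\<^bsub>?F\<^esub> sgn_mod ?F (z j) (L (a1 j)))"
      by (simp only: F.minus_eq)
    also have "\<dots> = (\<Oplus>\<^bsub>?F\<^esub>j\<in>{..<length as}. sgn_mod ?F (z j) (t1 j) \<oplus>\<^bsub>?F\<^esub> \<ominus>\<^bsub>?F\<^esub> sgn_mod ?F (z j) (L (a1 j)))"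
      by (rule F.finsum_addf[symmetric]) (rule Pi_I, (rule sc t1c module_neg_closed[OF F] lin_closed[OF L a1c] | simp only: lessThan_iff)+)+
    also have "\<dots> = (\<Oplus>\<^bsub>?F\<^esub>j\<in>{..<length as}. sgn_mod ?F (z j) (t1 j \<ominus>\<^bsub>?F\<^esub> L (a1 j)))"
    proof (rule module_finsum_cong[OF F])
      fix j assume "j \<in> {..<length as}"
      then have j: "t1 j \<in> carrier ?F" "L (a1 j) \<in> carrier ?F" using t1c lin_closed[OF L a1c] by auto
      show "sgn_mod ?F (z j) (t1 j) \<oplus>\<^bsub>?F\<^esub> \<ominus>\<^bsub>?F\<^esub> sgn_mod ?F (z j) (L (a1 j)) = sgn_mod ?F (z j) (t1 j \<ominus>\<^bsub>?F\<^esub> L (a1 j))"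
        using j by (simp add: F.minus_eq F.minus_add)
      show "sgn_mod ?F (z j) (t1 j \<ominus>\<^bsub>?F\<^esub> L (a1 j)) \<in> carrier ?F"
        by (rule sc[OF module_minus_closed[OF F j]])
    qed
    finally show ?thesis .
  qed
  also have "\<dots> = (\<Oplus>\<^bsub>?F\<^esub>j\<in>{..<length as}. sgn_mod ?F (z j) (rel m i y (as[j := dl A (as ! j)]) (q - 1)))"
    by (rule module_finsum_cong[OF F _ sc[OF rel_closed[OF sdj i]]]) (simp_all only: r1 lessThan_iff)
  finally show ?thesis unfolding r0 z_def .
qed

text \<open>Those elements of the ideal whose differential stays in it again form a graded ideal, by
  the Leibniz rule, and include the relations, by \<open>rel_dif\<close>. Minimality then gives the
  whole ideal.\<close>

lemma gr_ideal_gen_dif: "dif (FC m) q ` gr_ideal_gen m q \<subseteq> gr_ideal_gen m (q - 1)"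
proof -
  let ?J = "gr_ideal_gen m"
  let ?K = "\<lambda>q. {z \<in> ?J q. dif (FC m) q z \<in> ?J (q - 1)}"
  note J = graded_ideal_submodule[OF gr_ideal_gen_ideal, unfolded FC_simps]
  have Jc: "?J q \<subseteq> carrier (FP m q)" for q by (rule submodule_subset[OF FP_module J])
  have "graded_ideal R P (FC m) ?K"
    unfolding graded_ideal_def gr_sub_def
  proof (intro conjI allI impI)
    fix q
    have "?K q = ?J q \<inter> {z \<in> carrier (FP m q). dif (FC m) q z \<in> ?J (q - 1)}" using Jc by auto
    then show "submodule (?K q) R (gpart (FC m) q)"
      using submodule_Int[OF FP_module J submodule_preimage[OF FC_dif FP_module FP_module J]] by simp
  next
    fix x as assume H: "x \<in> OEl P (length as) \<and> set as \<subseteq> El (gpart (FC m)) \<and> (\<exists>a\<in>set as. snd a \<in> ?K (fst a))"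
    then obtain j where j: "j < length as" "snd (as ! j) \<in> ?J (fst (as ! j))" "dif (FC m) (fst (as ! j)) (snd (as ! j)) \<in> ?J (fst (as ! j) - 1)"
      by (auto simp: in_set_conv_nth)
    have x: "x \<in> OEl P (length as)" and as: "set as \<subseteq> El (FP m)" using H by auto
    let ?e = "Fev (CM m)"
    let ?n = "fst x + sum_list (degs as)"
    have evJ: "snd (?e y bs) \<in> ?J (fst y + sum_list (degs bs))"
      if "y \<in> OEl P (length bs)" "set bs \<subseteq> El (FP m)" "l < length bs" "snd (bs ! l) \<in> ?J (fst (bs ! l))" for y bs l
      using graded_ideal_ev[OF gr_ideal_gen_ideal, of y bs m l] that by (simp add: free_ev_deg[OF C_gr])
    have 1: "snd (?e x as) \<in> ?J ?n" by (rule evJ[OF x as j(1,2)])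
    have "dif (FC m) ?n (snd (?e x as)) \<in> ?J (?n - 1)"
      unfolding free_leibniz[OF C_gr C_dif x as refl]
    proof (rule submodule_add[OF FP_module J _ submodule_finsum[OF FP_module J submodule_sgn[OF FP_module J]]])
      have "dl (ops P (length as)) x \<in> OEl P (length as)" using x lin_closed[OF op_dif] by (auto simp: El_iff dl_def)
      from evJ[OF this as j(1,2)] show "snd (?e (dl (ops P (length as)) x) as) \<in> ?J (?n - 1)"
        by (simp add: dl_def algebra_simps)
      fix i assume "i \<in> {..<length as}"
      then have i: "i < length as" by simp
      let ?bs = "as[i := dl (FC m) (as ! i)]"
      have "sum_list (degs ?bs) = sum_list (degs as) - 1"
        using i by (simp add: map_update sum_list_update_int) (simp add: dl_def)
      then have dg: "fst x + sum_list (degs ?bs) = ?n - 1" by simp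
      have "set ?bs \<subseteq> El (FP m)"
        by (rule El_update[OF as]) (use lin_closed[OF FC_dif El_nth[OF as i]] in \<open>simp add: dl_def\<close>)
      \<comment> \<open>If the differentiated slot is the one that lies in the ideal,
        \<open>?K\<close> supplies its differential; otherwise the entry in the ideal is
        untouched.\<close>
      moreover have "snd (?bs ! j) \<in> ?J (fst (?bs ! j))"
        using j i by (cases "i = j") (auto simp: dl_def)
      ultimately show "snd (?e x ?bs) \<in> ?J (?n - 1)"
        using evJ[of x ?bs j] x j(1) unfolding dg by simp
    qed
    then show "snd (ev (FC m) x as) \<in> ?K (fst (ev (FC m) x as))"
      using 1 by (simp add: free_ev_deg[OF C_gr])
  qed
  moreover have "cop_rels R P A m n \<subseteq> ?K n" for n
  proof
    fix z assume z: "z \<in> cop_rels R P A m n"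
    then obtain i y as where s: "z = rel m i y as n" "i < m" "(y, as) \<in> syms P (gpart A) n" by (auto simp: cop_rels_eq)
    have rJ: "rel m i y' as' (n - 1) \<in> ?J (n - 1)" if "(y', as') \<in> syms P (gpart A) (n - 1)" for y' as'
      using gr_ideal_gen_rels[of m "n - 1"] s(2) that unfolding cop_rels_eq by blast
    have "dif (FC m) n z \<in> ?J (n - 1)"
      unfolding s(1) rel_dif[OF s(3,2)]
    proof (rule submodule_add[OF FP_module J rJ submodule_finsum[OF FP_module J submodule_sgn[OF FP_module J rJ]]])
      show "(dl (ops P (length as)) y, as) \<in> syms P (gpart A) (n - 1)"
        by (rule syms_dl_op[where W = "\<lparr>gpart = gpart A, dif = dif A\<rparr>", simplified, OF A_gr A_dif s(3)])
      show "(y, as[j := dl A (as ! j)]) \<in> syms P (gpart A) (n - 1)" if "j \<in> {..<length as}" for j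
        using syms_dslot[where W = "\<lparr>gpart = gpart A, dif = dif A\<rparr>", simplified, OF A_gr A_dif s(3)] that
        by (simp add: dl_def)
    qed
    then show "z \<in> ?K n" using gr_ideal_gen_rels z by auto
  qed
  ultimately have "gr_ideal_gen m q \<subseteq> ?K q" by (rule gr_ideal_gen_least)
  then show ?thesis by auto
qed

lemma cop_ideal_least:
  assumes "graded_ideal R P (FC m) I" "\<And>n. cop_rels R P A m n \<subseteq> I n"
  shows "cop_ideal R P A m q \<subseteq> I q"
proof -
  have "alg_ideal R P (FC m) (gr_ideal_gen m)"
    unfolding alg_ideal_iff using gr_ideal_gen_ideal gr_ideal_gen_dif by blast
  then have "cop_ideal R P A m q \<subseteq> gr_ideal_gen m q"
    unfolding cop_ideal_def ideal_gen_def using gr_ideal_gen_rels by blast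
  then show ?thesis using gr_ideal_gen_least[OF assms] by blast
qed

end

section \<open>Coproducts of copies of an algebra\<close>

lemma quot_alg_multilin:
  fixes A :: "('r, 'o, 'a) dgalg"
  assumes M: "\<And>q. module R (gpart A q)" and I: "\<And>q. submodule (I q) R (gpart A q)"
    and ev: "multilin R (gpart A) (gpart A n) qs (\<lambda>as. snd (ev A x as))"
    and deg: "\<And>bs. degs bs = qs \<Longrightarrow> set bs \<subseteq> El (gpart A) \<Longrightarrow> fst (ev A x bs) = n"
    and ideal: "\<And>bs i. degs bs = qs \<Longrightarrow> set bs \<subseteq> El (gpart A) \<Longrightarrow> i < length bs \<Longrightarrow>
      snd (bs ! i) \<in> I (qs ! i) \<Longrightarrow> snd (ev A x bs) \<in> I n"
  shows "multilin R (\<lambda>q. quot_mod (gpart A q) (I q)) (quot_mod (gpart A n) (I n)) qs (\<lambda>Xs. snd (ev (quot_alg A I) x Xs))"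
proof -
  let ?p = "gmap (proj A I)"
  let ?Q = "\<lambda>q. quot_mod (gpart A q) (I q)"
  have p: "proj A I q a = I q +>\<^bsub>gpart A q\<^esub> a" for q a by (simp add: proj_def)
  have pl: "proj A I q \<in> lin R (gpart A q) (?Q q)" for q
    using coset_lin[OF M I] by (simp add: proj_def[abs_def])
  have evq: "ev (quot_alg A I) x (map ?p as) = ?p (ev A x as)" if "set as \<subseteq> El (gpart A)" "degs as = qs" for as
    by (rule quot_alg_ev[OF M I, where n = n]) (use ev deg ideal that in auto)
  have reps: "\<exists>as. set as \<subseteq> El (gpart A) \<and> Xs = map ?p as" if "set Xs \<subseteq> El ?Q" for Xs
    using that
  proof (induction Xs)
    case (Cons X Xs)
    then obtain as where as: "set as \<subseteq> El (gpart A)" "Xs = map ?p as" by auto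
    obtain a where a: "a \<in> carrier (gpart A (fst X))" "snd X = proj A I (fst X) a"
      using Cons.prems by (auto simp: El_iff quot_carrier[OF M I] p)
    show ?case by (rule exI[of _ "(fst X, a) # as"]) (use a as in \<open>auto simp: El_iff prod_eq_iff\<close>)
  qed auto
  show "multilin R ?Q (?Q n) qs (\<lambda>Xs. snd (ev (quot_alg A I) x Xs))"
  proof (rule multilinI)
    fix Xs assume Xs: "set Xs \<subseteq> El ?Q" "degs Xs = qs"
    obtain as where as: "set as \<subseteq> El (gpart A)" "Xs = map ?p as" using reps[OF Xs(1)] by blast
    have ad: "degs as = qs" using as Xs by (simp add: comp_def)
    have val: "snd (ev (quot_alg A I) x (map ?p bs)) = proj A I n (snd (ev A x bs))"
      if "set bs \<subseteq> El (gpart A)" "degs bs = qs" for bs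
      using evq[OF that] deg[OF that(2,1)] by simp
    show "snd (ev (quot_alg A I) x Xs) \<in> carrier (?Q n)"
      unfolding as(2) val[OF as(1) ad] by (rule lin_closed[OF pl multilin_closed[OF ev as(1) ad]])
    fix i assume "i < length Xs"
    then have i: "i < length as" using as by simp
    let ?q = "fst (as ! i)"
    let ?L = "\<lambda>u. proj A I n (snd (ev A x (as[i := (?q, u)])))"
    have L: "?L \<in> lin R (gpart A ?q) (?Q n)" by (rule lin_comp[OF multilin_lin[OF ev as(1) ad i] pl])
    have eq: "snd (ev (quot_alg A I) x (Xs[i := (?q, proj A I ?q u)])) = ?L u" if u: "u \<in> carrier (gpart A ?q)" for u
    proof -
      have "Xs[i := (?q, proj A I ?q u)] = map ?p (as[i := (?q, u)])" unfolding as(2) by (simp add: map_update)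
      then show ?thesis using val[OF El_update[OF as(1)], of "(?q, u)" i] u degs_update[of as i u] ad by simp
    qed
    have "(\<lambda>u. snd (ev (quot_alg A I) x (Xs[i := (?q, u)]))) \<in> lin R (?Q ?q) (?Q n)"
    proof (rule linI)
      note qa = lin_add[OF pl, symmetric] and qs = lin_smult[OF pl, symmetric]
      fix u assume "u \<in> carrier (?Q ?q)"
      then obtain f where f: "f \<in> carrier (gpart A ?q)" "u = proj A I ?q f" by (auto simp: quot_carrier[OF M I] p)
      show "snd (ev (quot_alg A I) x (Xs[i := (?q, u)])) \<in> carrier (?Q n)"
        unfolding f(2) eq[OF f(1)] by (rule lin_closed[OF L f(1)])
      {
        fix v assume "v \<in> carrier (?Q ?q)"
        then obtain g where g: "g \<in> carrier (gpart A ?q)" "v = proj A I ?q g" by (auto simp: quot_carrier[OF M I] p)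
        show "snd (ev (quot_alg A I) x (Xs[i := (?q, u \<oplus>\<^bsub>?Q ?q\<^esub> v)])) =
            snd (ev (quot_alg A I) x (Xs[i := (?q, u)])) \<oplus>\<^bsub>?Q n\<^esub> snd (ev (quot_alg A I) x (Xs[i := (?q, v)]))"
          unfolding f(2) g(2) qa[OF f(1) g(1)] eq[OF f(1)] eq[OF g(1)] eq[OF module_add_closed[OF M f(1) g(1)]]
          by (rule lin_add[OF L f(1) g(1)])
      }
      fix r assume r: "r \<in> carrier R"
      show "snd (ev (quot_alg A I) x (Xs[i := (?q, r \<odot>\<^bsub>?Q ?q\<^esub> u)])) =
          r \<odot>\<^bsub>?Q n\<^esub> snd (ev (quot_alg A I) x (Xs[i := (?q, u)]))"
        unfolding f(2) qs[OF r f(1)] eq[OF f(1)] eq[OF module.smult_closed[OF M r f(1)]]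
        by (rule lin_smult[OF L r f(1)])
    qed
    then show "(\<lambda>u. snd (ev (quot_alg A I) x (Xs[i := (fst (Xs ! i), u)]))) \<in> lin R (?Q (fst (Xs ! i))) (?Q n)"
      unfolding as(2) using i by simp
  qed
qed

lemma balanced_lin:
  assumes h: "balanced R P V n M h" and T: "T \<in> lin R M M'" "module R M" "module R M'" and ctx: "dg_operad_ctx R P"
  shows "balanced R P V n M' (\<lambda>s. T (h s))"
proof -
  interpret dg_operad_ctx R P by fact
  show ?thesis
  proof (rule balancedI)
    fix x vs assume s: "(x, vs) \<in> syms P V n"
    show "T (h (x, vs)) \<in> carrier M'" by (rule lin_closed[OF T(1) balanced_closed[OF h s]])
    show "(\<lambda>u. T (h ((fst x, u), vs))) \<in> lin R (gpart (ops P (length vs)) (fst x)) M'"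
      by (rule lin_comp[OF balanced_op[OF h s] T(1)])
    show "(\<lambda>u. T (h (x, vs[i := (fst (vs ! i), u)]))) \<in> lin R (V (fst (vs ! i))) M'" if "i < length vs" for i
      by (rule lin_comp[OF balanced_slot[OF h s that] T(1)])
    show "T (h (gmap (oact P (length vs) \<sigma>) x, vs)) =
        sgn_mod M' (koszul_exp \<sigma> (degs vs)) (T (h (x, permute_list (inv_into UNIV \<sigma>) vs)))"
      if "\<sigma> permutes {..<length vs}" for \<sigma>
      unfolding balanced_perm[OF h s that] by (rule lin_sgn[OF T balanced_closed[OF h syms_permute[OF s that]]])
  qed
qed

context dg_operad_ctx
begin

text \<open>Composition with units changes nothing, and the interleaving sign is trivial because
  units have degree zero. A symbol is thus an operation applied to single letters, which is how maps
  into other algebras are computed on it.\<close>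

lemma free_ev_letters:
  assumes V: "gr_module R V" and s: "(x, vs) \<in> syms P V n"
  shows "Fev V x (map (\<lambda>v. tens R P V (oid P) [v]) vs) = tens R P V x vs"
proof -
  let ?ss = "map (\<lambda>v. (oid P, [v])) vs"
  have x: "x \<in> OEl P (length vs)" and n: "n = fst x + sum_list (degs vs)" using s by (auto simp: syms_iff)
  have ss: "sym_lists P V (degs vs) ?ss"
    using s oid_el(1) El_nth[of vs V] by (auto simp: list_all2_conv_all_nth syms_iff El_iff)
  have "Fev V x (map (\<lambda>v. tens R P V (oid P) [v]) vs) = Sev V x ?ss"
    using free_ev_tens[OF V _ ss, of x] x by (simp add: comp_def)
  also have "\<dots> = tens R P V x vs"
  proof -
    have m: "map (length \<circ> snd) ?ss = replicate (length vs) 1" "map fst ?ss = replicate (length vs) (oid P)"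
      "concat (map snd ?ss) = vs" "map (fst \<circ> fst) ?ss = replicate (length vs) 0"
      by (simp_all add: map_replicate_const comp_def)
    have e: "interleave_exp (replicate (length vs) 0) qs = 0" for qs
      by (rule interleave_exp_zero) auto
    show ?thesis unfolding sym_ev_def m e ocomp_oids[OF x] by (simp add: sg_def)
  qed
  finally show ?thesis .
qed

lemma sym_class_multilin:
  assumes V: "gr_module R V" and x: "x \<in> OEl P (length qs)" and n: "n = fst x + sum_list qs"
  shows "multilin R V (Fr V n) qs (\<lambda>vs. Cl V n (x, vs))"
proof (rule multilinI)
  fix vs assume vs: "set vs \<subseteq> El V" "degs vs = qs"
  have s: "(x, vs) \<in> syms P V n" using vs x n degs_length[OF vs(2)] by (simp add: syms_iff)
  show "Cl V n (x, vs) \<in> carrier (Fr V n)" by (rule sym_class_closed[OF V s])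
  show "(\<lambda>u. Cl V n (x, vs[i := (fst (vs ! i), u)])) \<in> lin R (V (fst (vs ! i))) (Fr V n)"
    if "i < length vs" for i
    by (rule balanced_slot[OF sym_class_balanced[OF V] s that])
qed

end

section \<open>The coproduct as a quotient of the free algebra on the copies\<close>

context dg_algebra_ctx
begin

abbreviation "B m \<equiv> copower R P A m"
abbreviation "BP m \<equiv> gpart (copower R P A m)"
abbreviation "pr m \<equiv> proj (FC m) (cop_ideal R P A m)"

lemma cop_ideal_submodule: "submodule (cop_ideal R P A m q) R (FP m q)"
  using graded_ideal_submodule cop_ideal_ideal unfolding alg_ideal_iff by fastforce

lemma BP_eq: "BP m q = quot_mod (FP m q) (cop_ideal R P A m q)"
  by (simp add: copower_def quot_alg_def)

lemma B_module: "module R (BP m q)"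
  unfolding BP_eq by (rule quot_module[OF FP_module cop_ideal_submodule])

lemma pr_eq: "pr m q X = cop_ideal R P A m q +>\<^bsub>FP m q\<^esub> X"
  by (simp add: proj_def)

lemma pr_lin: "pr m q \<in> lin R (FP m q) (BP m q)"
  using coset_lin[OF FP_module cop_ideal_submodule] by (simp add: BP_eq pr_eq[abs_def])

lemma pr_surj: "X \<in> carrier (BP m q) \<Longrightarrow> \<exists>Y\<in>carrier (FP m q). X = pr m q Y"
  by (auto simp: BP_eq quot_carrier[OF FP_module cop_ideal_submodule] pr_eq)

lemma pr_zero: "X \<in> cop_ideal R P A m q \<Longrightarrow> pr m q X = \<zero>\<^bsub>BP m q\<^esub>"
  unfolding BP_eq pr_eq
  using coset_eq_zero_iff[OF FP_module cop_ideal_submodule subsetD[OF submodule_subset[OF FP_module cop_ideal_submodule]]]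
  by blast

lemma induced_pr:
  assumes "f \<in> lin R (FP m q) N" "module R N" "\<And>X. X \<in> cop_ideal R P A m q \<Longrightarrow> f X = \<zero>\<^bsub>N\<^esub>"
  shows "X \<in> carrier (FP m q) \<Longrightarrow> induced f (pr m q X) = f X"
    and "induced f \<in> lin R (BP m q) N"
  unfolding pr_eq BP_eq
  using induced_coset[OF FP_module cop_ideal_submodule assms] induced_lin[OF FP_module cop_ideal_submodule assms] by auto

lemma
  shows B_dif_pr: "X \<in> carrier (FP m q) \<Longrightarrow> dif (B m) q (pr m q X) = pr m (q - 1) (dif (FC m) q X)"
    and B_dif: "dif (B m) q \<in> lin R (BP m q) (BP m (q - 1))"
proof -
  have d: "dif (B m) q = induced (pr m (q - 1) \<circ> dif (FC m) q)" by (simp add: copower_def quot_alg_def)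
  have l: "(pr m (q - 1) \<circ> dif (FC m) q) \<in> lin R (FP m q) (BP m (q - 1))"
    unfolding comp_def by (rule lin_comp[OF FC_dif pr_lin])
  have z: "(pr m (q - 1) \<circ> dif (FC m) q) X = \<zero>\<^bsub>BP m (q - 1)\<^esub>" if "X \<in> cop_ideal R P A m q" for X
  proof -
    have "dif (FC m) q X \<in> cop_ideal R P A m (q - 1)"
      using cop_ideal_ideal[of m] that unfolding alg_ideal_iff by blast
    then show ?thesis by (simp add: pr_zero)
  qed
  show "dif (B m) q (pr m q X) = pr m (q - 1) (dif (FC m) q X)" if "X \<in> carrier (FP m q)"
  proof -
    have "induced (pr m (q - 1) \<circ> dif (FC m) q) (pr m q X) = (pr m (q - 1) \<circ> dif (FC m) q) X"
      by (rule induced_pr(1)[OF l B_module z that])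
    then show ?thesis unfolding d by (simp add: comp_def)
  qed
  show "dif (B m) q \<in> lin R (BP m q) (BP m (q - 1))"
    unfolding d by (rule induced_pr(2)[OF l B_module z])
qed

lemma FC_ev_ideal:
  assumes "x \<in> OEl P (length qs)" "degs bs = qs" "set bs \<subseteq> El (FP m)" "i < length bs" "snd (bs ! i) \<in> cop_ideal R P A m (qs ! i)"
  shows "snd (Fev (CM m) x bs) \<in> cop_ideal R P A m (fst x + sum_list qs)"
  using graded_ideal_ev[of R P "FC m" "cop_ideal R P A m" x bs i] cop_ideal_ideal[of m] assms degs_length[OF assms(2)]
    degs_nth[OF assms(2,4)]
  unfolding alg_ideal_iff by (simp add: free_ev_deg[OF C_gr])

lemma
  assumes x: "x \<in> OEl P (length qs)"
  shows B_ev_pr: "set Xs \<subseteq> El (FP m) \<Longrightarrow> degs Xs = qs \<Longrightarrow>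
      ev (B m) x (map (gmap (pr m)) Xs) = gmap (pr m) (Fev (CM m) x Xs)"
    and B_ev_multilin: "n = fst x + sum_list qs \<Longrightarrow> multilin R (BP m) (BP m n) qs (\<lambda>Xs. snd (ev (B m) x Xs))"
proof -
  let ?n = "fst x + sum_list qs"
  have M: "module R (gpart (FC m) q)" and I: "submodule (cop_ideal R P A m q) R (gpart (FC m) q)" for q
    using FP_module cop_ideal_submodule by auto
  have e: "multilin R (gpart (FC m)) (gpart (FC m) ?n) qs (\<lambda>as. snd (ev (FC m) x as))"
    using free_ev_multilin[OF C_gr x refl] by simp
  have d: "fst (ev (FC m) x bs) = ?n" if "degs bs = qs" "set bs \<subseteq> El (gpart (FC m))" for bs
    using that by (simp add: free_ev_deg[OF C_gr])
  have i: "snd (ev (FC m) x bs) \<in> cop_ideal R P A m ?n"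
    if "degs bs = qs" "set bs \<subseteq> El (gpart (FC m))" "i < length bs" "snd (bs ! i) \<in> cop_ideal R P A m (qs ! i)" for bs i
    using FC_ev_ideal[OF x] that by simp
  show "ev (B m) x (map (gmap (pr m)) Xs) = gmap (pr m) (Fev (CM m) x Xs)"
    if "set Xs \<subseteq> El (FP m)" "degs Xs = qs"
    using quot_alg_ev[OF M I, where n = ?n and as = Xs] e d i that unfolding copower_def by simp
  have qq: "(\<lambda>q. quot_mod (gpart (FC m) q) (cop_ideal R P A m q)) = BP m"
    by (rule ext) (simp add: BP_eq)
  show "multilin R (BP m) (BP m n) qs (\<lambda>Xs. snd (ev (B m) x Xs))" if "n = fst x + sum_list qs"
  proof -
    have "multilin R (\<lambda>q. quot_mod (gpart (FC m) q) (cop_ideal R P A m q))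
        (quot_mod (gpart (FC m) ?n) (cop_ideal R P A m ?n)) qs (\<lambda>Xs. snd (ev (quot_alg (FC m) (cop_ideal R P A m)) x Xs))"
      by (rule quot_alg_multilin[OF M I e]) (use d i in auto)
    then show ?thesis unfolding qq copower_def[symmetric] that by (simp add: BP_eq)
  qed
qed

subsection \<open>Monomials\<close>

text \<open>A letter is a pair of a copy index and an element of \<open>A\<close>. Keeping the two
  apart lets faces and degeneracies act on the indices alone.\<close>

definition mono :: "nat \<Rightarrow> 'o gel \<Rightarrow> (nat \<times> 'a gel) list \<Rightarrow> ('r, 'o, 'a) cop_el gel"
  where "mono m x ias = gmap (pr m) (tens R P (CM m) x (map (\<lambda>(i, a). copy_in A m i a) ias))"

definition valid :: "nat \<Rightarrow> int \<Rightarrow> 'o gel \<Rightarrow> (nat \<times> 'a gel) list \<Rightarrow> bool"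
  where "valid m n x ias \<longleftrightarrow> (x, map snd ias) \<in> syms P (gpart A) n \<and> fst ` set ias \<subseteq> {..<m}"

abbreviation "cps m ias \<equiv> map (\<lambda>(i, a). copy_in A m i a) ias"

lemma valid_syms: "valid m n x ias \<Longrightarrow> (x, cps m ias) \<in> syms P (CM m) n"
  unfolding valid_def by (rule syms_copy) auto

lemma mono_eq: "valid m n x ias \<Longrightarrow> mono m x ias = (n, pr m n (Cl (CM m) n (x, cps m ias)))"
  by (simp add: mono_def tens_eq[OF valid_syms])

lemma mono_closed: "valid m n x ias \<Longrightarrow> snd (mono m x ias) \<in> carrier (BP m n)"
  by (simp add: mono_eq lin_closed[OF pr_lin sym_class_closed[OF C_gr valid_syms]])

lemma mono_El: "valid m n x ias \<Longrightarrow> mono m x ias \<in> El (BP m) \<and> fst (mono m x ias) = n"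
  using mono_closed by (auto simp: El_iff mono_eq)

lemma mono_multilin:
  assumes x: "x \<in> OEl P (length qs)" and n: "n = fst x + sum_list qs"
    and js: "length js = length qs" "set js \<subseteq> {..<m}"
  shows "multilin R (gpart A) (BP m n) qs (\<lambda>as. snd (mono m x (zip js as)))"
proof -
  have ism: "js ! i < m" if "i < length qs" for i using js that nth_mem[of i js] by (auto simp: subset_iff)
  have "multilin R (gpart A) (BP m n) qs (\<lambda>as. pr m n (Cl (CM m) n
      (x, map (\<lambda>i. (qs ! i, \<iota> m (js ! i) (qs ! i) (snd (as ! i)))) [0..<length qs])))"
    by (rule multilin_precomp[OF multilin_comp[OF sym_class_multilin[OF C_gr x n] pr_lin] refl]) (rule \<iota>_lin[OF ism])
  then show ?thesis
  proof (rule multilin_transfer[OF _ A_module])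
    fix as assume as: "set as \<subseteq> El (gpart A)" "degs as = qs"
    have len: "length as = length qs" using degs_length[OF as(2)] .
    have "fst ` set (zip js as) \<subseteq> {..<m}" using js set_zip_leftD by fastforce
    then have v: "valid m n x (zip js as)" using as x n js len by (simp add: valid_def syms_iff)
    have "cps m (zip js as) = map (\<lambda>i. (qs ! i, \<iota> m (js ! i) (qs ! i) (snd (as ! i)))) [0..<length qs]"
      by (rule nth_equalityI) (use len js degs_nth[OF as(2)] in \<open>auto simp: copy_in_eq\<close>)
    then show "snd (mono m x (zip js as)) = pr m n (Cl (CM m) n
      (x, map (\<lambda>i. (qs ! i, \<iota> m (js ! i) (qs ! i) (snd (as ! i)))) [0..<length qs]))"
      by (simp add: mono_eq[OF v])
  qed
qed

lemma mono_perm: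
  assumes v: "valid m n x ias" and \<sigma>: "\<sigma> permutes {..<length ias}"
  shows "snd (mono m (gmap (oact P (length ias) \<sigma>) x) ias) =
      sgn_mod (BP m n) (koszul_exp \<sigma> (degs (map snd ias))) (snd (mono m x (perminv \<sigma> ias)))"
    and "valid m n (gmap (oact P (length ias) \<sigma>) x) ias" "valid m n x (perminv \<sigma> ias)"
proof -
  have i\<sigma>: "inv_into UNIV \<sigma> permutes {..<length ias}" by (rule permutes_inv[OF \<sigma>])
  have s: "(x, map snd ias) \<in> syms P (gpart A) n" using v by (simp add: valid_def)
  show v1: "valid m n (gmap (oact P (length ias) \<sigma>) x) ias"
    using syms_act[OF s, of \<sigma>] \<sigma> v by (simp add: valid_def)
  show v2: "valid m n x (perminv \<sigma> ias)"
    using syms_permute[OF s, of \<sigma>] \<sigma> v permute_list_map[OF i\<sigma>, of snd] set_permute_list[OF i\<sigma>] by (simp add: valid_def)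
  have d: "degs (cps m ias) = degs (map snd ias)" by auto
  have p: "perminv \<sigma> (cps m ias) = cps m (perminv \<sigma> ias)"
    by (rule permute_list_map[OF i\<sigma>])
  have \<sigma>': "\<sigma> permutes {..<length (cps m ias)}" using \<sigma> by simp
  have "Cl (CM m) n (gmap (oact P (length ias) \<sigma>) x, cps m ias) =
      sgn_mod (FP m n) (koszul_exp \<sigma> (degs (map snd ias))) (Cl (CM m) n (x, cps m (perminv \<sigma> ias)))"
    using balanced_perm[OF sym_class_balanced[OF C_gr] valid_syms[OF v] \<sigma>'] unfolding d p by simp
  then show "snd (mono m (gmap (oact P (length ias) \<sigma>) x) ias) =
      sgn_mod (BP m n) (koszul_exp \<sigma> (degs (map snd ias))) (snd (mono m x (perminv \<sigma> ias)))"
    using lin_sgn[OF pr_lin FP_module B_module sym_class_closed[OF C_gr valid_syms[OF v2]]]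
    unfolding mono_eq[OF v1] mono_eq[OF v2] by simp
qed

text \<open>Products multiply out by the formula for symbols, with operations composed and words
  concatenated. What matters later is that the copies occurring in the product are the union of
  those occurring in the factors.\<close>

lemma mono_ev:
  assumes y: "y \<in> OEl P (length qs)" and ss: "list_all2 (\<lambda>s q. valid m q (fst s) (snd s)) ss qs" and n: "n = fst y + sum_list qs"
  shows "valid m n (ocomp P (map (length \<circ> snd) ss) y (map fst ss)) (concat (map snd ss))"
    and "snd (ev (B m) y (map (\<lambda>s. mono m (fst s) (snd s)) ss)) =
      sgn_mod (BP m n) (interleave_exp (map (fst \<circ> fst) ss) (map (sum_list \<circ> degs \<circ> map snd \<circ> snd) ss))
        (snd (mono m (ocomp P (map (length \<circ> snd) ss) y (map fst ss)) (concat (map snd ss))))"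
    and "fst (ev (B m) y (map (\<lambda>s. mono m (fst s) (snd s)) ss)) = n"
proof -
  let ?ts = "map (\<lambda>s. (fst s, map snd (snd s))) ss"
  let ?us = "map (\<lambda>s. (fst s, cps m (snd s))) ss"
  have ts: "sym_lists P (gpart A) qs ?ts" using ss by (simp add: list_all2_map1 valid_def list_all2_conv_all_nth)
  have us: "sym_lists P (CM m) qs ?us" using ss valid_syms by (auto simp: list_all2_conv_all_nth)
  have m1: "map (length \<circ> snd) ?ts = map (length \<circ> snd) ss" "map fst ?ts = map fst ss"
    "concat (map snd ?ts) = map snd (concat (map snd ss))"
    by (simp_all add: comp_def map_concat)
  have dd: "degs (cps m z) = degs (map snd z)" for z by auto
  have m2: "map (length \<circ> snd) ?us = map (length \<circ> snd) ss" "map fst ?us = map fst ss"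
    "concat (map snd ?us) = cps m (concat (map snd ss))" "map (fst \<circ> fst) ?us = map (fst \<circ> fst) ss"
    "map (sum_list \<circ> degs \<circ> snd) ?us = map (sum_list \<circ> degs \<circ> map snd \<circ> snd) ss"
    using dd by (simp_all add: comp_def map_concat) (metis (no_types, lifting) comp_apply map_eq_conv)
  have f: "fst ` set (concat (map snd ss)) \<subseteq> {..<m}"
  proof -
    have "fst ` set (snd s) \<subseteq> {..<m}" if "s \<in> set ss" for s
      using ss that unfolding list_all2_conv_all_nth in_set_conv_nth valid_def by metis
    then show ?thesis by (fastforce simp: set_concat)
  qed
  show v: "valid m n (ocomp P (map (length \<circ> snd) ss) y (map fst ss)) (concat (map snd ss))"
    using sym_comp(1)[OF A_gr y ts n] f unfolding m1 valid_def by blast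
  have mo: "map (\<lambda>s. mono m (fst s) (snd s)) ss = map (gmap (pr m)) (map (\<lambda>s. tens R P (CM m) (fst s) (snd s)) ?us)"
    by (simp add: mono_def comp_def)
  have evs: "ev (B m) y (map (\<lambda>s. mono m (fst s) (snd s)) ss) = gmap (pr m) (Sev (CM m) y ?us)"
    unfolding mo B_ev_pr[OF y sym_lists_classes(2,3)[OF C_gr us]] free_ev_tens[OF C_gr y us] ..
  show "fst (ev (B m) y (map (\<lambda>s. mono m (fst s) (snd s)) ss)) = n"
    unfolding evs using sym_comp(3)[OF C_gr y us n] by simp
  show "snd (ev (B m) y (map (\<lambda>s. mono m (fst s) (snd s)) ss)) =
      sgn_mod (BP m n) (interleave_exp (map (fst \<circ> fst) ss) (map (sum_list \<circ> degs \<circ> map snd \<circ> snd) ss))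
        (snd (mono m (ocomp P (map (length \<circ> snd) ss) y (map fst ss)) (concat (map snd ss))))"
    unfolding evs using sym_comp(2,3)[OF C_gr y us n] lin_sgn[OF pr_lin FP_module B_module sym_class_closed[OF C_gr valid_syms[OF v]]]
    unfolding m2 mono_eq[OF v] by simp
qed

lemma coinj_mono: "coinj R P A m i a = mono m (oid P) [(i, a)]"
  by (simp add: coinj_def mono_def)

lemma ev_coinj:
  assumes v: "valid m n x ias"
  shows "ev (B m) x (map (\<lambda>(i, a). coinj R P A m i a) ias) = mono m x ias"
proof -
  let ?Xs = "map (\<lambda>w. tens R P (CM m) (oid P) [w]) (cps m ias)"
  note s = valid_syms[OF v]
  have x: "x \<in> OEl P (length (degs (cps m ias)))" using s by (simp add: syms_iff)
  have ss: "sym_lists P (CM m) (degs (cps m ias)) (map (\<lambda>v. (oid P, [v])) (cps m ias))"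
    using s oid_el(1) El_nth[of "cps m ias" "CM m"] by (auto simp: list_all2_conv_all_nth syms_iff El_iff)
  have Xs: "set ?Xs \<subseteq> El (FP m)" "degs ?Xs = degs (cps m ias)"
    using sym_lists_classes(2,3)[OF C_gr ss] by (simp_all add: comp_def)
  have eq: "map (\<lambda>(i, a). coinj R P A m i a) ias = map (gmap (pr m)) ?Xs"
    by (auto simp: coinj_def)
  show ?thesis
    unfolding eq B_ev_pr[OF x Xs] free_ev_letters[OF C_gr s] mono_def ..
qed

text \<open>A letter that is itself a product in \<open>A\<close> can be opened up within its copy:
  this is the defining relation of the coproduct, read as an equality of cosets.\<close>

lemma mono_rel:
  assumes s: "(y, as) \<in> syms P (gpart A) q" and i: "i < m"
  shows "mono m (oid P) [(i, ev A y as)] = mono m y (map (Pair i) as)"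
    and "valid m q y (map (Pair i) as)" "valid m q (oid P) [(i, ev A y as)]"
proof -
  show v1: "valid m q y (map (Pair i) as)" using s i by (auto simp: valid_def comp_def)
  show v2: "valid m q (oid P) [(i, ev A y as)]" using syms_A[OF s] i oid_el(1) by (simp add: valid_def syms_iff)
  let ?a = "Cl (CM m) q (y, map (copy_in A m i) as)"
  let ?b = "Cl (CM m) q (oid P, [copy_in A m i (ev A y as)])"
  have r: "rel m i y as q \<in> cop_ideal R P A m q"
    using cop_ideal_rels[of m q] s i unfolding cop_rels_eq by blast
  have "pr m q ?a = pr m q ?b"
    unfolding pr_eq
    using coset_eq_iff[OF FP_module cop_ideal_submodule sym_class_closed[OF C_gr rel_syms(1)[OF s i]] sym_class_closed[OF C_gr rel_syms(2)[OF s i]]]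
      r unfolding rel_eq[OF s i] by simp
  then show "mono m (oid P) [(i, ev A y as)] = mono m y (map (Pair i) as)"
    unfolding mono_eq[OF v1] mono_eq[OF v2] by (simp add: comp_def)
qed

text \<open>All letters are opened up at once: the monomial is the operation applied to its letters,
  each letter is rewritten by \<open>mono_rel\<close>, and \<open>mono_ev\<close> multiplies out.
  The sign is left existential, since only membership in submodules is drawn from it.\<close>

lemma mono_expand:
  assumes x: "x \<in> OEl P (length L)" and L: "\<And>i y as. (i, y, as) \<in> set L \<Longrightarrow> i < m \<and> y \<in> OEl P (length as) \<and> set as \<subseteq> El (gpart A)"
    and n: "n = fst x + sum_list (map (\<lambda>(i, y, as). fst y + sum_list (degs as)) L)"
  shows "\<exists>e. snd (mono m x (map (\<lambda>(i, y, as). (i, ev A y as)) L)) =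
    sgn_mod (BP m n) e (snd (mono m (ocomp P (map (\<lambda>(i, y, as). length as) L) x (map (fst \<circ> snd) L))
      (concat (map (\<lambda>(i, y, as). map (Pair i) as) L))))"
    and "valid m n (ocomp P (map (\<lambda>(i, y, as). length as) L) x (map (fst \<circ> snd) L))
      (concat (map (\<lambda>(i, y, as). map (Pair i) as) L))"
proof -
  let ?qs = "map (\<lambda>(i, y, as). fst y + sum_list (degs as)) L"
  let ?ss = "map (\<lambda>(i, y, as). (y, map (Pair i) as)) L"
  let ?ias = "map (\<lambda>(i, y, as). (i, ev A y as)) L"
  have sy: "(y, as) \<in> syms P (gpart A) (fst y + sum_list (degs as))" "i < m" if "(i, y, as) \<in> set L" for i y as
    using L[OF that] by (auto simp: syms_iff)
  have ss: "list_all2 (\<lambda>s q. valid m q (fst s) (snd s)) ?ss ?qs"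
    unfolding list_all2_map1 list_all2_map2 using mono_rel(2)[OF sy] by (auto simp: list_all2_same)
  have x': "x \<in> OEl P (length ?qs)" using x by simp
  note * = mono_ev[OF x' ss n]
  have m1: "map (length \<circ> snd) ?ss = map (\<lambda>(i, y, as). length as) L" "map fst ?ss = map (fst \<circ> snd) L"
    "concat (map snd ?ss) = concat (map (\<lambda>(i, y, as). map (Pair i) as) L)"
    by (auto intro!: arg_cong[of _ _ concat])
  have vi: "valid m n x ?ias"
  proof -
    have "degs (map snd ?ias) = ?qs" using syms_A[OF sy(1)] by auto
    then have "fst x + sum_list (degs (map snd ?ias)) = n" using n by presburger
    moreover have "set (map snd ?ias) \<subseteq> El (gpart A)" using syms_A[OF sy(1)] by auto
    moreover have "fst ` set ?ias \<subseteq> {..<m}" using sy(2) by auto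
    ultimately show ?thesis using x by (simp add: valid_def syms_iff)
  qed
  have eq: "map (\<lambda>(i, a). coinj R P A m i a) ?ias = map (\<lambda>s. mono m (fst s) (snd s)) ?ss"
    using mono_rel(1)[OF sy] by (auto simp: coinj_mono)
  have "mono m x ?ias = ev (B m) x (map (\<lambda>s. mono m (fst s) (snd s)) ?ss)"
    unfolding ev_coinj[OF vi, symmetric] eq ..
  then show "\<exists>e. snd (mono m x (map (\<lambda>(i, y, as). (i, ev A y as)) L)) =
    sgn_mod (BP m n) e (snd (mono m (ocomp P (map (\<lambda>(i, y, as). length as) L) x (map (fst \<circ> snd) L))
      (concat (map (\<lambda>(i, y, as). map (Pair i) as) L))))"
    using *(2) unfolding m1 by auto
  show "valid m n (ocomp P (map (\<lambda>(i, y, as). length as) L) x (map (fst \<circ> snd) L))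
      (concat (map (\<lambda>(i, y, as). map (Pair i) as) L))"
    using *(1) unfolding m1 .
qed

lemma mono_dif:
  assumes v: "valid m n x ias"
  shows "dif (B m) n (snd (mono m x ias)) = snd (mono m (dl (ops P (length ias)) x) ias) \<oplus>\<^bsub>BP m (n - 1)\<^esub>
    (\<Oplus>\<^bsub>BP m (n - 1)\<^esub>j\<in>{..<length ias}. sgn_mod (BP m (n - 1)) (fst x + sum_list (degs (take j (map snd ias))))
      (snd (mono m x (ias[j := (fst (ias ! j), dl A (snd (ias ! j)))]))))"
    and "valid m (n - 1) (dl (ops P (length ias)) x) ias"
    and "\<And>j. j < length ias \<Longrightarrow> valid m (n - 1) x (ias[j := (fst (ias ! j), dl A (snd (ias ! j)))])"
proof -
  let ?F = "FP m (n - 1)"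
  let ?T = "Cl (CM m) (n - 1)"
  note s = valid_syms[OF v]
  have sA: "(x, map snd ias) \<in> syms P (gpart A) n" and f: "fst ` set ias \<subseteq> {..<m}" using v by (auto simp: valid_def)
  show v0: "valid m (n - 1) (dl (ops P (length ias)) x) ias"
    using syms_dl_op[where W = "\<lparr>gpart = gpart A, dif = dif A\<rparr>", simplified, OF A_gr A_dif sA] f by (simp add: valid_def)
  show v1: "valid m (n - 1) x (ias[j := (fst (ias ! j), dl A (snd (ias ! j)))])" if j: "j < length ias" for j
  proof -
    have "fst ` set (ias[j := (fst (ias ! j), dl A (snd (ias ! j)))]) \<subseteq> {..<m}"
      using f j set_update_subset_insert[of ias j] nth_mem[OF j] by fastforce
    then show ?thesis
      using syms_dslot[where W = "\<lparr>gpart = gpart A, dif = dif A\<rparr>", simplified, OF A_gr A_dif sA, of j] j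
      by (simp add: valid_def map_update dl_def)
  qed
  have e: "(cps m ias)[j := dl (C m) (cps m ias ! j)] = cps m (ias[j := (fst (ias ! j), dl A (snd (ias ! j)))])"
    if j: "j < length ias" for j
  proof -
    have "snd (ias ! j) \<in> El (gpart A)" using sA nth_mem[OF j] by (auto simp: syms_iff)
    from dl_copy_in[OF this] show ?thesis using j by (simp add: map_update case_prod_beta)
  qed
  have dg: "degs (take j (cps m ias)) = degs (take j (map snd ias))" for j
    by (auto simp: take_map)
  note Tc = sym_class_closed[OF C_gr]
  have c0: "?T (dl (ops P (length ias)) x, cps m ias) \<in> carrier ?F" by (rule Tc[OF valid_syms[OF v0]])
  have c1: "sgn_mod ?F z (?T (x, cps m (ias[j := (fst (ias ! j), dl A (snd (ias ! j)))]))) \<in> carrier ?F" if "j < length ias" for j z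
    by (rule module_sgn_closed[OF FP_module Tc[OF valid_syms[OF v1[OF that]]]])
  have "dif (FC m) n (Cl (CM m) n (x, cps m ias)) = ?T (dl (ops P (length ias)) x, cps m ias) \<oplus>\<^bsub>?F\<^esub>
    (\<Oplus>\<^bsub>?F\<^esub>j\<in>{..<length ias}. sgn_mod ?F (fst x + sum_list (degs (take j (map snd ias))))
      (?T (x, cps m (ias[j := (fst (ias ! j), dl A (snd (ias ! j)))]))))"
    unfolding free_dif_class[OF C_gr C_dif s] sym_dif_eq[OF C_gr C_dif s] dg length_map
    by (intro arg_cong2[of _ _ _ _ "add ?F"] refl module_finsum_cong[OF FP_module _ c1]) (simp_all only: e lessThan_iff)
  then have "dif (B m) n (snd (mono m x ias)) = pr m (n - 1) (?T (dl (ops P (length ias)) x, cps m ias) \<oplus>\<^bsub>?F\<^esub>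
    (\<Oplus>\<^bsub>?F\<^esub>j\<in>{..<length ias}. sgn_mod ?F (fst x + sum_list (degs (take j (map snd ias))))
      (?T (x, cps m (ias[j := (fst (ias ! j), dl A (snd (ias ! j)))])))))"
    using B_dif_pr[OF Tc[OF s]] by (simp add: mono_eq[OF v])
  also have "\<dots> = pr m (n - 1) (?T (dl (ops P (length ias)) x, cps m ias)) \<oplus>\<^bsub>BP m (n - 1)\<^esub>
    pr m (n - 1) (\<Oplus>\<^bsub>?F\<^esub>j\<in>{..<length ias}. sgn_mod ?F (fst x + sum_list (degs (take j (map snd ias))))
      (?T (x, cps m (ias[j := (fst (ias ! j), dl A (snd (ias ! j)))]))))"
    by (rule lin_add[OF pr_lin c0 module_finsum_closed[OF FP_module c1]]) simp
  also have "pr m (n - 1) (\<Oplus>\<^bsub>?F\<^esub>j\<in>{..<length ias}. sgn_mod ?F (fst x + sum_list (degs (take j (map snd ias))))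
      (?T (x, cps m (ias[j := (fst (ias ! j), dl A (snd (ias ! j)))])))) =
    (\<Oplus>\<^bsub>BP m (n - 1)\<^esub>j\<in>{..<length ias}. pr m (n - 1) (sgn_mod ?F (fst x + sum_list (degs (take j (map snd ias))))
      (?T (x, cps m (ias[j := (fst (ias ! j), dl A (snd (ias ! j)))])))))"
    by (rule lin_finsum[OF pr_lin FP_module B_module finite_lessThan c1]) simp
  also have "\<dots> = (\<Oplus>\<^bsub>BP m (n - 1)\<^esub>j\<in>{..<length ias}. sgn_mod (BP m (n - 1)) (fst x + sum_list (degs (take j (map snd ias))))
      (snd (mono m x (ias[j := (fst (ias ! j), dl A (snd (ias ! j)))]))))"
  proof (rule module_finsum_cong[OF B_module])
    fix j assume "j \<in> {..<length ias}"
    then have j: "j < length ias" by simp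
    show "pr m (n - 1) (sgn_mod ?F (fst x + sum_list (degs (take j (map snd ias))))
        (?T (x, cps m (ias[j := (fst (ias ! j), dl A (snd (ias ! j)))])))) =
      sgn_mod (BP m (n - 1)) (fst x + sum_list (degs (take j (map snd ias))))
        (snd (mono m x (ias[j := (fst (ias ! j), dl A (snd (ias ! j)))])))"
      unfolding lin_sgn[OF pr_lin FP_module B_module Tc[OF valid_syms[OF v1[OF j]]]] mono_eq[OF v1[OF j]] snd_conv ..
    show "sgn_mod (BP m (n - 1)) (fst x + sum_list (degs (take j (map snd ias))))
        (snd (mono m x (ias[j := (fst (ias ! j), dl A (snd (ias ! j)))]))) \<in> carrier (BP m (n - 1))"
      by (rule module_sgn_closed[OF B_module mono_closed[OF v1[OF j]]])
  qed
  finally show "dif (B m) n (snd (mono m x ias)) = snd (mono m (dl (ops P (length ias)) x) ias) \<oplus>\<^bsub>BP m (n - 1)\<^esub>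
    (\<Oplus>\<^bsub>BP m (n - 1)\<^esub>j\<in>{..<length ias}. sgn_mod (BP m (n - 1)) (fst x + sum_list (degs (take j (map snd ias))))
      (snd (mono m x (ias[j := (fst (ias ! j), dl A (snd (ias ! j)))]))))"
    by (simp add: mono_eq[OF v0])
qed

text \<open>A letter of the free algebra on copies is a vector with an entry for each copy.
  Multilinearity splits it into vectors concentrated in one copy.\<close>

lemma B_gen: "carrier (BP m n) \<subseteq> gen_sub R (BP m n) {snd (mono m x ias) | x ias. valid m n x ias}"
  (is "_ \<subseteq> gen_sub _ _ ?G")
proof -
  have Gc: "?G \<subseteq> carrier (BP m n)" using mono_closed by auto
  note GS = gen_sub_submodule[OF B_module Gc]
  have "pr m n ` Cl (CM m) n ` syms P (CM m) n \<subseteq> gen_sub R (BP m n) ?G"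
  proof clarify
    fix p y ws assume s: "((p, y), ws) \<in> syms P (CM m) n"
    let ?x = "(p, y)" and ?qs = "degs ws"
    have x: "?x \<in> OEl P (length ?qs)" and n: "n = fst ?x + sum_list ?qs" and ws: "set ws \<subseteq> El (CM m)"
      using s by (auto simp: syms_iff)
    show "pr m n (Cl (CM m) n (?x, ws)) \<in> gen_sub R (BP m n) ?G"
    proof (rule multilin_gen_sub[OF multilin_comp[OF sym_class_multilin[OF C_gr x n] pr_lin] C_module B_module GS,
          where as = ws and G = "\<lambda>i. {\<iota> m j (?qs ! i) a | j a. j < m \<and> a \<in> carrier (gpart A (?qs ! i))}"])
      fix i assume i: "i < length ?qs"
      show "{\<iota> m j (?qs ! i) a | j a. j < m \<and> a \<in> carrier (gpart A (?qs ! i))} \<subseteq> carrier (CM m (?qs ! i))"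
        using lin_closed[OF \<iota>_lin] by auto
      show "snd (ws ! i) \<in> gen_sub R (CM m (?qs ! i)) {\<iota> m j (?qs ! i) a | j a. j < m \<and> a \<in> carrier (gpart A (?qs ! i))}"
        using El_nth[OF ws, of i] i CM_gen by auto
    next
      fix us assume us: "set us \<subseteq> El (CM m)" "degs us = ?qs"
        and G: "\<And>i. i < length ?qs \<Longrightarrow> snd (us ! i) \<in> {\<iota> m j (?qs ! i) a | j a. j < m \<and> a \<in> carrier (gpart A (?qs ! i))}"
      have lu: "length us = length ?qs" using degs_length[OF us(2)] .
      have "\<forall>i. \<exists>j a. i < length ?qs \<longrightarrow> snd (us ! i) = \<iota> m j (?qs ! i) a \<and> j < m \<and> a \<in> carrier (gpart A (?qs ! i))"
        using G by blast
      then obtain J a where Ja: "\<And>i. i < length ?qs \<Longrightarrow> snd (us ! i) = \<iota> m (J i) (?qs ! i) (a i) \<and> J i < m \<and> a i \<in> carrier (gpart A (?qs ! i))"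
        by metis
      define ias where "ias = map (\<lambda>i. (J i, (?qs ! i, a i))) [0..<length ?qs]"
      have uc: "us = cps m ias"
      proof (rule nth_equalityI)
        fix i assume "i < length us"
        then have i: "i < length ?qs" using lu by simp
        show "us ! i = cps m ias ! i"
          using Ja[OF i] i lu degs_nth[OF us(2), of i] by (simp add: ias_def copy_in_eq prod_eq_iff)
      qed (simp add: lu ias_def)
      have "degs (map snd ias) = ?qs" unfolding ias_def by (auto intro!: nth_equalityI)
      then have "fst ?x + sum_list (degs (map snd ias)) = n" using n by presburger
      moreover have "set (map snd ias) \<subseteq> El (gpart A)" using Ja by (auto simp: ias_def El_iff)
      moreover have "fst ` set ias \<subseteq> {..<m}" using Ja by (auto simp: ias_def)
      ultimately have v: "valid m n ?x ias" using x by (simp add: valid_def syms_iff ias_def)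
      have "pr m n (Cl (CM m) n (?x, us)) = snd (mono m ?x ias)" by (simp add: mono_eq[OF v] uc)
      moreover have "snd (mono m ?x ias) \<in> gen_sub R (BP m n) ?G"
        by (rule subsetD[OF gen_sub_incl]) (use v in blast)
      ultimately show "pr m n (Cl (CM m) n (?x, us)) \<in> gen_sub R (BP m n) ?G" by simp
    qed (rule refl)
  qed
  from gen_sub_least[OF GS this]
  have 1: "gen_sub R (BP m n) (pr m n ` Cl (CM m) n ` syms P (CM m) n) \<subseteq> gen_sub R (BP m n) ?G" .
  have 2: "carrier (BP m n) \<subseteq> gen_sub R (BP m n) (pr m n ` Cl (CM m) n ` syms P (CM m) n)"
  proof -
    have "Cl (CM m) n ` syms P (CM m) n \<subseteq> carrier (FP m n)" using sym_class_closed[OF C_gr] by blast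
    from quot_gen_sub[OF FP_module cop_ideal_submodule this free_part_gen[OF C_gr]]
    show ?thesis unfolding BP_eq pr_eq[abs_def] .
  qed
  show ?thesis by (rule order_trans[OF 2 1])
qed

end

section \<open>Maps between coproducts\<close>

context dg_algebra_ctx
begin

definition cmap :: "nat \<Rightarrow> nat \<Rightarrow> (nat \<Rightarrow> nat) \<Rightarrow> (nat \<Rightarrow> int \<Rightarrow> 'a \<Rightarrow> 'a) \<Rightarrow> int \<Rightarrow> (nat \<Rightarrow> 'a) \<Rightarrow> nat \<Rightarrow> 'a"
  where "cmap M N \<theta> \<alpha> q w = (\<Oplus>\<^bsub>CM N q\<^esub>j\<in>{..<M}. \<iota> N (\<theta> j) q (\<alpha> j q (w j)))"

text \<open>The maps \<open>\<alpha> j\<close> are not required to commute with the differential of \<open>A\<close>.\<close>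

definition bmap :: "nat \<Rightarrow> nat \<Rightarrow> (nat \<Rightarrow> nat) \<Rightarrow> (nat \<Rightarrow> int \<Rightarrow> 'a \<Rightarrow> 'a) \<Rightarrow> int \<Rightarrow> ('r, 'o, 'a) cop_el \<Rightarrow> ('r, 'o, 'a) cop_el"
  where "bmap M N \<theta> \<alpha> q = induced (\<lambda>X. pr N q (free_map R P (CM M) (CM N) (cmap M N \<theta> \<alpha>) q X))"

context
  fixes M N :: nat and \<theta> :: "nat \<Rightarrow> nat" and \<alpha> :: "nat \<Rightarrow> int \<Rightarrow> 'a \<Rightarrow> 'a"
  assumes \<theta>: "\<And>j. j < M \<Longrightarrow> \<theta> j < N"
    and \<alpha>_lin: "\<And>j q. j < M \<Longrightarrow> \<alpha> j q \<in> lin R (gpart A q) (gpart A q)"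
    and \<alpha>_ev: "\<And>j y as. j < M \<Longrightarrow> y \<in> OEl P (length as) \<Longrightarrow> set as \<subseteq> El (gpart A) \<Longrightarrow>
      gmap (\<alpha> j) (ev A y as) = ev A y (map (gmap (\<alpha> j)) as)"
begin

lemma cmap_lin: "cmap M N \<theta> \<alpha> q \<in> lin R (CM M q) (CM N q)"
proof -
  have "(\<lambda>w. \<iota> N (\<theta> j) q (\<alpha> j q (w j))) \<in> lin R (CM M q) (CM N q)" if j: "j < M" for j
  proof -
    have "(\<lambda>w. w j) \<in> lin R (CM M q) (gpart A q)"
      unfolding CM_eq by (rule direct_sum_eval_lin) (use j in simp)
    from lin_comp[OF lin_comp[OF this \<alpha>_lin[OF j]] \<iota>_lin[OF \<theta>[OF j]]] show ?thesis .
  qed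
  then show ?thesis
    unfolding cmap_def[abs_def] by (intro lin_sum[OF C_module C_module finite_lessThan]) simp
qed

lemma cmap_\<iota>:
  assumes i: "i < M" and a: "a \<in> carrier (gpart A q)"
  shows "cmap M N \<theta> \<alpha> q (\<iota> M i q a) = \<iota> N (\<theta> i) q (\<alpha> i q a)"
proof -
  interpret CN: module R "CM N q" by (rule C_module)
  have z: "\<iota> N (\<theta> j) q (\<alpha> j q (\<iota> M i q a j)) = \<zero>\<^bsub>CM N q\<^esub>" if "j < M" "j \<noteq> i" for j
    using that lin_zero[OF \<alpha>_lin[OF that(1)] A_module A_module] lin_zero[OF \<iota>_lin[OF \<theta>[OF that(1)]] A_module C_module]
    by (simp add: single_apply)
  have c: "\<iota> N (\<theta> i) q (\<alpha> i q a) \<in> carrier (CM N q)"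
    by (rule lin_closed[OF \<iota>_lin[OF \<theta>[OF i]] lin_closed[OF \<alpha>_lin[OF i] a]])
  have "cmap M N \<theta> \<alpha> q (\<iota> M i q a) = (\<Oplus>\<^bsub>CM N q\<^esub>j\<in>{..<M}. if i = j then \<iota> N (\<theta> i) q (\<alpha> i q a) else \<zero>\<^bsub>CM N q\<^esub>)"
    unfolding cmap_def
    by (rule module_finsum_cong[OF C_module]) (use z c in \<open>auto simp: single_apply\<close>)
  also have "\<dots> = \<iota> N (\<theta> i) q (\<alpha> i q a)"
    by (rule CN.finsum_singleton[of i "{..<M}" "\<lambda>_. \<iota> N (\<theta> i) q (\<alpha> i q a)"]) (use i c in auto)
  finally show ?thesis .
qed

lemma cmap_copy_in:
  "i < M \<Longrightarrow> a \<in> El (gpart A) \<Longrightarrow> gmap (cmap M N \<theta> \<alpha>) (copy_in A M i a) = copy_in A N (\<theta> i) (gmap (\<alpha> i) a)"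
  using cmap_\<iota> by (simp add: copy_in_eq El_iff)

abbreviation "fm \<equiv> free_map R P (CM M) (CM N) (cmap M N \<theta> \<alpha>)"

lemma fm_lin: "fm q \<in> lin R (FP M q) (FP N q)"
  by (rule free_map_lin[OF C_gr C_gr cmap_lin])

lemma \<alpha>_syms: "i < M \<Longrightarrow> (y, as) \<in> syms P (gpart A) q \<Longrightarrow> (y, map (gmap (\<alpha> i)) as) \<in> syms P (gpart A) q"
  by (rule syms_map[OF A_gr A_gr \<alpha>_lin])

lemma fm_rel:
  assumes i: "i < M" and s: "(y, as) \<in> syms P (gpart A) q"
  shows "fm q (rel M i y as q) = rel N (\<theta> i) y (map (gmap (\<alpha> i)) as) q"
proof -
  have y: "y \<in> OEl P (length as)" and as: "set as \<subseteq> El (gpart A)" using s by (auto simp: syms_iff)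
  note s' = \<alpha>_syms[OF i s]
  have 1: "map (gmap (cmap M N \<theta> \<alpha>)) (map (copy_in A M i) as) = map (copy_in A N (\<theta> i)) (map (gmap (\<alpha> i)) as)"
    unfolding map_map comp_def by (rule map_cong[OF refl]) (rule cmap_copy_in[OF i], use as in blast)
  have 2: "map (gmap (cmap M N \<theta> \<alpha>)) [copy_in A M i (ev A y as)] = [copy_in A N (\<theta> i) (ev A y (map (gmap (\<alpha> i)) as))]"
    using cmap_copy_in[OF i, of "ev A y as"] syms_A[OF s] \<alpha>_ev[OF i y as] by simp
  show ?thesis
    unfolding rel_eq[OF s i] rel_eq[OF s' \<theta>[OF i]]
      lin_minus[OF fm_lin FP_module FP_module sym_class_closed[OF C_gr rel_syms(1)[OF s i]] sym_class_closed[OF C_gr rel_syms(2)[OF s i]]]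
      free_map_class[OF C_gr C_gr cmap_lin rel_syms(1)[OF s i]] free_map_class[OF C_gr C_gr cmap_lin rel_syms(2)[OF s i]] 1 2 ..
qed

text \<open>The preimage of the target ideal is a graded ideal, and it contains the relations
  because the maps \<open>\<alpha> j\<close> are multiplicative. Through
  \<open>cop_ideal_least\<close> this already bounds \<open>cop_ideal\<close>, although
  \<open>\<alpha> j\<close> may ignore the differential.\<close>

lemma fm_ideal: "X \<in> cop_ideal R P A M q \<Longrightarrow> fm q X \<in> cop_ideal R P A N q"
proof -
  let ?K = "\<lambda>q. {X \<in> carrier (FP M q). fm q X \<in> cop_ideal R P A N q}"
  have "graded_ideal R P (FC M) ?K"
    unfolding graded_ideal_def gr_sub_def
  proof (intro conjI allI impI)
    show "submodule (?K q) R (gpart (FC M) q)" for q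
      using submodule_preimage[OF fm_lin FP_module FP_module cop_ideal_submodule] by simp
    fix x as assume H: "x \<in> OEl P (length as) \<and> set as \<subseteq> El (gpart (FC M)) \<and> (\<exists>a\<in>set as. snd a \<in> ?K (fst a))"
    then obtain j where j: "j < length as" "fm (fst (as ! j)) (snd (as ! j)) \<in> cop_ideal R P A N (fst (as ! j))"
      by (auto simp: in_set_conv_nth)
    have x: "x \<in> OEl P (length as)" and as: "set as \<subseteq> El (FP M)" using H by auto
    have xd: "x \<in> OEl P (length (degs as))" using x by simp
    note fe = free_map_ev[OF C_gr C_gr cmap_lin x as]
    have E: "set (map (gmap fm) as) \<subseteq> El (FP N)"
      using as lin_closed[OF fm_lin] by (auto simp: El_iff subset_iff)
    have "snd (Fev (CM N) x (map (gmap fm) as)) \<in> cop_ideal R P A N (fst x + sum_list (degs as))"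
      by (rule FC_ev_ideal[OF xd _ E, of j]) (use j in auto)
    then have "fm (fst x + sum_list (degs as)) (snd (Fev (CM M) x as)) \<in> cop_ideal R P A N (fst x + sum_list (degs as))"
      unfolding fe[symmetric] by (simp add: free_ev_deg[OF C_gr])
    moreover have "snd (Fev (CM M) x as) \<in> carrier (FP M (fst x + sum_list (degs as)))"
      by (rule multilin_closed[OF free_ev_multilin[OF C_gr xd refl] as refl])
    ultimately show "snd (ev (FC M) x as) \<in> ?K (fst (ev (FC M) x as))"
      by (simp add: free_ev_deg[OF C_gr])
  qed
  moreover have "cop_rels R P A M n \<subseteq> ?K n" for n
  proof
    fix z assume "z \<in> cop_rels R P A M n"
    then obtain i y as where s: "z = rel M i y as n" "i < M" "(y, as) \<in> syms P (gpart A) n" by (auto simp: cop_rels_eq)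
    have "rel N (\<theta> i) y (map (gmap (\<alpha> i)) as) n \<in> cop_ideal R P A N n"
      by (rule subsetD[OF cop_ideal_rels]) (unfold cop_rels_eq, use \<alpha>_syms[OF s(2,3)] \<theta>[OF s(2)] in blast)
    then show "z \<in> ?K n" using rel_closed[OF s(3,2)] fm_rel[OF s(2,3)] s(1) by simp
  qed
  ultimately have "cop_ideal R P A M q \<subseteq> ?K q" by (rule cop_ideal_least)
  moreover assume "X \<in> cop_ideal R P A M q"
  ultimately show ?thesis by blast
qed

lemma
  shows bmap_pr: "X \<in> carrier (FP M q) \<Longrightarrow> bmap M N \<theta> \<alpha> q (pr M q X) = pr N q (fm q X)"
    and bmap_lin: "bmap M N \<theta> \<alpha> q \<in> lin R (BP M q) (BP N q)"
proof -
  have l: "(\<lambda>X. pr N q (fm q X)) \<in> lin R (FP M q) (BP N q)" by (rule lin_comp[OF fm_lin pr_lin])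
  have z: "pr N q (fm q X) = \<zero>\<^bsub>BP N q\<^esub>" if "X \<in> cop_ideal R P A M q" for X
    by (rule pr_zero[OF fm_ideal[OF that]])
  show "bmap M N \<theta> \<alpha> q (pr M q X) = pr N q (fm q X)" if "X \<in> carrier (FP M q)"
    unfolding bmap_def by (rule induced_pr(1)[OF l B_module z that])
  show "bmap M N \<theta> \<alpha> q \<in> lin R (BP M q) (BP N q)"
    unfolding bmap_def by (rule induced_pr(2)[OF l B_module z])
qed

lemma bmap_mono:
  assumes v: "valid M n x ias"
  shows "bmap M N \<theta> \<alpha> n (snd (mono M x ias)) = snd (mono N x (map (\<lambda>(i, a). (\<theta> i, gmap (\<alpha> i) a)) ias))"
    and "valid N n x (map (\<lambda>(i, a). (\<theta> i, gmap (\<alpha> i) a)) ias)"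
proof -
  let ?ias = "map (\<lambda>(i, a). (\<theta> i, gmap (\<alpha> i) a)) ias"
  have ia: "i < M" "a \<in> El (gpart A)" if "(i, a) \<in> set ias" for i a
    using v that by (force simp: valid_def syms_iff)+
  have E: "set (map snd ?ias) \<subseteq> El (gpart A)"
    using ia lin_closed[OF \<alpha>_lin] by (fastforce simp: El_iff)
  have d: "degs (map snd ?ias) = degs (map snd ias)" by auto
  have f: "fst ` set ?ias \<subseteq> {..<N}" using ia(1) \<theta> by auto
  show v': "valid N n x ?ias" using v E f unfolding valid_def syms_iff d by simp
  have c: "map (gmap (cmap M N \<theta> \<alpha>)) (cps M ias) = cps N ?ias"
    using cmap_copy_in ia by auto
  note s = valid_syms[OF v]
  show "bmap M N \<theta> \<alpha> n (snd (mono M x ias)) = snd (mono N x ?ias)"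
    unfolding mono_eq[OF v] mono_eq[OF v'] snd_conv bmap_pr[OF sym_class_closed[OF C_gr s]]
      free_map_class[OF C_gr C_gr cmap_lin s] c ..
qed

end

text \<open>\<open>reindex\<close> evaluates a symbol in the target coproduct letter by letter,
  whereas \<open>bmap\<close> comes from a map of free algebras. On a symbol both give the class of
  the symbol whose letters are moved by \<open>cmap\<close>, thanks to
  \<open>free_ev_letters\<close>, and symbol classes span.\<close>

lemma reindex_eq_bmap:
  assumes \<theta>: "\<And>j. j \<le> m \<Longrightarrow> \<theta> j \<le> n" and X: "X \<in> carrier (BP (Suc m) q)"
  shows "reindex R P A m n \<theta> q X = bmap (Suc m) (Suc n) \<theta> (\<lambda>_ _ a. a) q X"
proof -
  let ?M = "Suc m" and ?N = "Suc n"
  let ?\<alpha> = "\<lambda>_ _ a. a"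
  let ?cm = "cmap ?M ?N \<theta> ?\<alpha>"
  have \<theta>': "\<theta> j < ?N" if "j < ?M" for j using \<theta> that by (simp add: less_Suc_eq_le)
  note al = lin_id
  have ae: "gmap (?\<alpha> j) (ev A y as) = ev A y (map (gmap (?\<alpha> j)) as)" for j y as by simp
  have cml: "?cm q \<in> lin R (CM ?M q) (CM ?N q)" for q by (rule cmap_lin[OF \<theta>' al ae])
  let ?fm = "free_map R P (CM ?M) (CM ?N) ?cm"
  define h where "h = (\<lambda>(x :: 'o gel, ws). snd (ev (B ?N) x
    (map (\<lambda>w. (fst w, \<Oplus>\<^bsub>BP ?N (fst w)\<^esub>j\<in>{..<?M}. snd (coinj R P A ?N (\<theta> j) (fst w, snd w j)))) ws)))"
  have letter: "(fst w, \<Oplus>\<^bsub>BP ?N (fst w)\<^esub>j\<in>{..<?M}. snd (coinj R P A ?N (\<theta> j) (fst w, snd w j))) =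
      gmap (pr ?N) (tens R P (CM ?N) (oid P) [gmap ?cm w])" if w: "w \<in> El (CM ?M)" for w
  proof -
    let ?q = "fst w"
    let ?L = "\<lambda>u. pr ?N ?q (Cl (CM ?N) ?q (oid P, [(?q, u)]))"
    have s: "(oid P, [(?q, u)]) \<in> syms P (CM ?N) ?q" if "u \<in> carrier (CM ?N ?q)" for u
      using oid_el(1) that by (simp add: syms_iff El_iff)
    have L: "?L \<in> lin R (CM ?N ?q) (BP ?N ?q)"
    proof -
      have "(\<lambda>u. Cl (CM ?N) ?q (oid P, [(?q, u)])) \<in> lin R (CM ?N ?q) (FP ?N ?q)"
        using balanced_slot[OF sym_class_balanced[OF C_gr] s[OF module_zero_closed[OF C_module]], of 0] by simp
      from lin_comp[OF this pr_lin] show ?thesis .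
    qed
    have wc: "snd w j \<in> carrier (gpart A ?q)" if "j < ?M" for j
      using w that by (auto simp: El_iff C_carrier)
    have ic: "\<iota> ?N (\<theta> j) ?q (snd w j) \<in> carrier (CM ?N ?q)" if "j < ?M" for j
      by (rule lin_closed[OF \<iota>_lin[OF \<theta>'[OF that]] wc[OF that]])
    have co: "snd (coinj R P A ?N (\<theta> j) (?q, snd w j)) = ?L (\<iota> ?N (\<theta> j) ?q (snd w j))" if "j < ?M" for j
      using s[OF ic[OF that]] by (simp add: coinj_def copy_in_eq tens_eq)
    have "(\<Oplus>\<^bsub>BP ?N ?q\<^esub>j\<in>{..<?M}. snd (coinj R P A ?N (\<theta> j) (?q, snd w j))) =
        (\<Oplus>\<^bsub>BP ?N ?q\<^esub>j\<in>{..<?M}. ?L (\<iota> ?N (\<theta> j) ?q (snd w j)))"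
      by (rule module_finsum_cong[OF B_module co lin_closed[OF L ic]]) simp_all
    also have "\<dots> = ?L (\<Oplus>\<^bsub>CM ?N ?q\<^esub>j\<in>{..<?M}. \<iota> ?N (\<theta> j) ?q (snd w j))"
      by (rule lin_finsum[OF L C_module B_module finite_lessThan ic, symmetric]) simp
    also have "\<dots> = ?L (?cm ?q (snd w))" by (simp add: cmap_def)
    finally have e: "(\<Oplus>\<^bsub>BP ?N ?q\<^esub>j\<in>{..<?M}. snd (coinj R P A ?N (\<theta> j) (?q, snd w j))) = ?L (?cm ?q (snd w))" .
    have "snd w \<in> carrier (CM ?M ?q)" using w by (simp add: El_iff)
    from tens_eq[OF s[OF lin_closed[OF cml this]]] show ?thesis unfolding e by simp
  qed
  have hv: "h s = pr ?N q (?fm q (Cl (CM ?M) q s))" if "s \<in> syms P (CM ?M) q" for s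
  proof -
    obtain x ws where s: "s = (x, ws)" by (cases s)
    have sx: "(x, ws) \<in> syms P (CM ?M) q" using that s by simp
    note sx' = syms_map[OF C_gr C_gr cml sx]
    have x: "x \<in> OEl P (length (degs (map (gmap ?cm) ws)))" and wsE: "set ws \<subseteq> El (CM ?M)" using sx by (auto simp: syms_iff)
    let ?Ts = "map (\<lambda>w. tens R P (CM ?N) (oid P) [w]) (map (gmap ?cm) ws)"
    have ss: "sym_lists P (CM ?N) (degs (map (gmap ?cm) ws)) (map (\<lambda>v. (oid P, [v])) (map (gmap ?cm) ws))"
      using sx' oid_el(1) El_nth[of "map (gmap ?cm) ws" "CM ?N"] by (auto simp: list_all2_conv_all_nth syms_iff El_iff)
    have Ts: "set ?Ts \<subseteq> El (FP ?N)" "degs ?Ts = degs (map (gmap ?cm) ws)"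
      using sym_lists_classes(2,3)[OF C_gr ss] by (simp_all add: comp_def)
    have "map (\<lambda>w. (fst w, \<Oplus>\<^bsub>BP ?N (fst w)\<^esub>j\<in>{..<?M}. snd (coinj R P A ?N (\<theta> j) (fst w, snd w j)))) ws =
        map (\<lambda>w. gmap (pr ?N) (tens R P (CM ?N) (oid P) [gmap ?cm w])) ws"
      by (rule map_cong[OF refl]) (rule letter, use wsE in blast)
    also have "\<dots> = map (gmap (pr ?N)) ?Ts" by (simp add: comp_def)
    finally have hx: "map (\<lambda>w. (fst w, \<Oplus>\<^bsub>BP ?N (fst w)\<^esub>j\<in>{..<?M}. snd (coinj R P A ?N (\<theta> j) (fst w, snd w j)))) ws =
        map (gmap (pr ?N)) ?Ts" .
    have "h s = snd (ev (B ?N) x (map (gmap (pr ?N)) ?Ts))" unfolding h_def s prod.case hx ..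
    also have "\<dots> = snd (gmap (pr ?N) (tens R P (CM ?N) x (map (gmap ?cm) ws)))"
      unfolding B_ev_pr[OF x Ts] free_ev_letters[OF C_gr sx'] ..
    also have "\<dots> = pr ?N q (?fm q (Cl (CM ?M) q s))"
      unfolding tens_eq[OF sx'] s free_map_class[OF C_gr C_gr cml sx] by simp
    finally show ?thesis .
  qed
  have l: "(\<lambda>X. pr ?N q (?fm q X)) \<in> lin R (FP ?M q) (BP ?N q)"
    by (rule lin_comp[OF fm_lin[OF \<theta>' al ae] pr_lin])
  \<comment> \<open>Balancedness of \<open>h\<close> is inherited through \<open>hv\<close> from the
    symbol classes, rather than derived from algebra axioms for the coproduct.\<close>
  have hb: "balanced R P (CM ?M) q (BP ?N q) h"
    by (rule balanced_cong[OF balanced_lin[OF sym_class_balanced[OF C_gr] l FP_module B_module dg_operad_ctx_axioms]])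
      (use hv dg_operad_ctx_axioms C_gr in auto)
  let ?in = "induced (lin_ext R (syms P (CM ?M) q) (BP ?N q) h)"
  have inl: "?in \<in> lin R (FP ?M q) (BP ?N q)" by (rule lift_lin[OF C_gr hb B_module])
  have inv: "?in Y = pr ?N q (?fm q Y)" if Y: "Y \<in> carrier (FP ?M q)" for Y
  proof (rule gen_sub_lin_eq[OF inl l FP_module B_module])
    show "Cl (CM ?M) q ` syms P (CM ?M) q \<subseteq> carrier (FP ?M q)" using sym_class_closed[OF C_gr] by blast
    show "Y \<in> gen_sub R (FP ?M q) (Cl (CM ?M) q ` syms P (CM ?M) q)" using free_part_gen[OF C_gr] Y by blast
    show "?in Z = pr ?N q (?fm q Z)" if "Z \<in> Cl (CM ?M) q ` syms P (CM ?M) q" for Z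
      using that lift_class[OF C_gr hb B_module] hv by auto
  qed
  have inz: "?in Y = \<zero>\<^bsub>BP ?N q\<^esub>" if "Y \<in> cop_ideal R P A ?M q" for Y
    using inv[of Y] submodule_subset[OF FP_module cop_ideal_submodule] that pr_zero[OF fm_ideal[OF \<theta>' al ae that]] by auto
  obtain Y where Y: "Y \<in> carrier (FP ?M q)" "X = pr ?M q Y" using pr_surj[OF X] by blast
  have "reindex R P A m n \<theta> q X = induced ?in X"
    by (simp add: reindex_def copair_def cyc_def h_def)
  also have "\<dots> = ?in Y" unfolding Y(2) by (rule induced_pr(1)[OF inl B_module inz Y(1)])
  also have "\<dots> = bmap ?M ?N \<theta> ?\<alpha> q X" unfolding inv[OF Y(1)] Y(2)
    by (rule bmap_pr[where \<theta> = \<theta> and \<alpha> = ?\<alpha> and M = ?M and N = ?N, OF \<theta>' al ae Y(1), symmetric])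
  finally show ?thesis .
qed

lemma
  assumes \<theta>: "\<And>j. j \<le> m \<Longrightarrow> \<theta> j \<le> n"
  shows reindex_lin: "reindex R P A m n \<theta> q \<in> lin R (BP (Suc m) q) (BP (Suc n) q)"
    and reindex_mono: "valid (Suc m) q x ias \<Longrightarrow> reindex R P A m n \<theta> q (snd (mono (Suc m) x ias)) =
      snd (mono (Suc n) x (map (apfst \<theta>) ias))"
proof -
  have \<theta>': "\<theta> j < Suc n" if "j < Suc m" for j using \<theta> that by (simp add: less_Suc_eq_le)
  have ae: "gmap (\<lambda>_ a. a) (ev A y as) = ev A y (map (gmap (\<lambda>_ a. a)) as)" for y as by simp
  show "reindex R P A m n \<theta> q \<in> lin R (BP (Suc m) q) (BP (Suc n) q)"
    by (rule lin_cong[OF bmap_lin[where \<theta> = \<theta> and \<alpha> = "\<lambda>_ _ a. a" and M = "Suc m" and N = "Suc n", OF \<theta>' lin_id ae] B_module])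
      (assumption | rule reindex_eq_bmap[OF \<theta>])+
  have eq: "map (\<lambda>(i, a). (\<theta> i, gmap (\<lambda>_ a. a) a)) ias = map (apfst \<theta>) ias" by auto
  assume v: "valid (Suc m) q x ias"
  note * = bmap_mono[where \<theta> = \<theta> and \<alpha> = "\<lambda>_ _ a. a" and M = "Suc m" and N = "Suc n", OF \<theta>' lin_id ae v]
  show "reindex R P A m n \<theta> q (snd (mono (Suc m) x ias)) = snd (mono (Suc n) x (map (apfst \<theta>) ias))"
    using reindex_eq_bmap[OF \<theta> mono_closed[OF v]] * unfolding eq by simp
qed

end

section \<open>Almost free algebras\<close>

locale almost_free_ctx = dg_algebra_ctx R P A
  for R :: "'r ring" and P :: "('r, 'o) operad" and A :: "('r, 'o, 'a) dgalg" +
  fixes V :: "('r, 'v) grmod" and \<phi> :: "int \<Rightarrow> ('r, 'o, 'v) free_el \<Rightarrow> 'a"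
  assumes af: "almost_free R P A V \<phi>"
begin

lemma V_gr: "gr_module R V"
  using af by (simp add: almost_free_def)

lemma
  shows \<phi>_lin: "\<phi> q \<in> lin R (Fr V q) (gpart A q)"
    and \<phi>_bij: "bij_betw (\<phi> q) (carrier (Fr V q)) (carrier (gpart A q))"
    and \<phi>_ev: "x \<in> OEl P (length Xs) \<Longrightarrow> set Xs \<subseteq> El (Fr V) \<Longrightarrow>
      gmap \<phi> (Fev V x Xs) = ev A x (map (gmap \<phi>) Xs)"
proof -
  have "\<phi> \<in> gr_alg_iso R P (free_alg R P \<lparr>gpart = V, dif = (\<lambda>q _. \<zero>\<^bsub>V (q - 1)\<^esub>)\<rparr>) A"
    using af by (simp add: almost_free_def)
  then have *: "(\<forall>q. \<phi> q \<in> lin R (Fr V q) (gpart A q) \<and>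
      bij_betw (\<phi> q) (carrier (Fr V q)) (carrier (gpart A q)))"
    "preserves_ev P (free_alg R P \<lparr>gpart = V, dif = (\<lambda>q _. \<zero>\<^bsub>V (q - 1)\<^esub>)\<rparr>) A \<phi>"
    by (simp_all add: gr_alg_iso_def gr_iso_def free_alg_def)
  show "\<phi> q \<in> lin R (Fr V q) (gpart A q)"
    "bij_betw (\<phi> q) (carrier (Fr V q)) (carrier (gpart A q))"
    using *(1) by blast+
  assume "x \<in> OEl P (length Xs)" "set Xs \<subseteq> El (Fr V)"
  then show "gmap \<phi> (Fev V x Xs) = ev A x (map (gmap \<phi>) Xs)"
    using *(2) unfolding preserves_ev_def free_alg_def dgalg.simps dgmod.simps by blast
qed

abbreviation "gn \<equiv> gen R P V \<phi>"

lemma letter_syms: "v \<in> El V \<Longrightarrow> (oid P, [v]) \<in> syms P V (fst v)"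
  using oid_el(1) by (simp add: syms_iff)

lemma gn_eq: "v \<in> El V \<Longrightarrow> gn v = (fst v, \<phi> (fst v) (Cl V (fst v) (oid P, [v])))"
  by (simp add: gen_def tens_eq[OF letter_syms])

lemma gn_El: "v \<in> El V \<Longrightarrow> gn v \<in> El (gpart A) \<and> fst (gn v) = fst v"
  using lin_closed[OF \<phi>_lin sym_class_closed[OF V_gr letter_syms]] by (simp add: gn_eq El_iff)

lemma degs_gn: "set vs \<subseteq> El V \<Longrightarrow> degs (map gn vs) = degs vs"
  using gn_El by auto

lemma syms_gn: "(x, vs) \<in> syms P V n \<Longrightarrow> (x, map gn vs) \<in> syms P (gpart A) n"
  using gn_El degs_gn by (auto simp: syms_iff simp del: map_map)

text \<open>\<open>free_ev_letters\<close> writes a symbol as its operation applied to letters, and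
  \<open>\<phi>\<close> preserves products; so \<open>\<phi>\<close> of a symbol class is a product
  of generators.\<close>

lemma ev_gn:
  assumes s: "(x, vs) \<in> syms P V n"
  shows "ev A x (map gn vs) = (n, \<phi> n (Cl V n (x, vs)))"
proof -
  let ?Ts = "map (\<lambda>v. tens R P V (oid P) [v]) vs"
  have x: "x \<in> OEl P (length ?Ts)" and vs: "set vs \<subseteq> El V" using s by (auto simp: syms_iff)
  have "set ?Ts \<subseteq> El (Fr V)"
    using vs sym_class_closed[OF V_gr letter_syms] by (auto simp: El_iff tens_eq[OF letter_syms] subset_iff)
  from \<phi>_ev[OF x this] have "ev A x (map gn vs) = gmap \<phi> (Fev V x ?Ts)"
    by (simp add: gen_def[abs_def] comp_def)
  then show ?thesis unfolding free_ev_letters[OF V_gr s] tens_eq[OF s] by simp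
qed

lemma A_gen: "carrier (gpart A q) \<subseteq> gen_sub R (gpart A q) {snd (ev A x (map gn vs)) | x vs. (x, vs) \<in> syms P V q}"
  (is "_ \<subseteq> gen_sub _ _ ?G")
proof
  fix a assume "a \<in> carrier (gpart A q)"
  then obtain X where X: "X \<in> carrier (Fr V q)" "a = \<phi> q X"
    using \<phi>_bij[of q] by (auto simp: bij_betw_def)
  have Gc: "?G \<subseteq> carrier (gpart A q)"
    using lin_closed[OF \<phi>_lin sym_class_closed[OF V_gr]] by (auto simp: ev_gn)
  show "a \<in> gen_sub R (gpart A q) ?G"
    unfolding X(2)
  proof (rule gen_sub_lin[OF \<phi>_lin free_part_module[OF V_gr] A_module gen_sub_submodule[OF A_module Gc]])
    show "X \<in> gen_sub R (Fr V q) (Cl V q ` syms P V q)" using free_part_gen[OF V_gr] X by blast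
    fix Y assume "Y \<in> Cl V q ` syms P V q"
    then obtain x vs where s: "(x, vs) \<in> syms P V q" "Y = Cl V q (x, vs)" by auto
    show "Y \<in> carrier (Fr V q)" unfolding s(2) by (rule sym_class_closed[OF V_gr s(1)])
    have "\<phi> q Y = snd (ev A x (map gn vs))" unfolding ev_gn[OF s(1)] s(2) by simp
    then have "\<phi> q Y \<in> ?G" using s(1) by blast
    then show "\<phi> q Y \<in> gen_sub R (gpart A q) ?G" by (rule subsetD[OF gen_sub_incl])
  qed
qed

subsection \<open>Killing one copy of the generators\<close>

text \<open>The endomorphism of \<open>F(\<O>, V)\<close> induced by \<open>0 : V \<rightarrow> V\<close>.\<close>

definition kill :: "int \<Rightarrow> 'a \<Rightarrow> 'a"
  where "kill q a = \<phi> q (free_map R P V V (\<lambda>q _. \<zero>\<^bsub>V q\<^esub>) q (inv_into (carrier (Fr V q)) (\<phi> q) a))"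

abbreviation "z0 \<equiv> (\<lambda>q _. \<zero>\<^bsub>V q\<^esub>)"

lemma z0_lin: "z0 q \<in> lin R (V q) (V q)"
  by (rule lin_const_zero[OF V_module[OF V_gr]])

lemma zm_lin: "free_map R P V V z0 q \<in> lin R (Fr V q) (Fr V q)"
  by (rule free_map_lin[OF V_gr V_gr z0_lin])

lemma kill_\<phi>: "X \<in> carrier (Fr V q) \<Longrightarrow> kill q (\<phi> q X) = \<phi> q (free_map R P V V z0 q X)"
  using \<phi>_bij[of q] by (simp add: kill_def bij_betw_def inv_into_f_f)

lemma \<phi>_rep: "a \<in> carrier (gpart A q) \<Longrightarrow> \<exists>X\<in>carrier (Fr V q). a = \<phi> q X"
  using \<phi>_bij[of q] by (auto simp: bij_betw_def)

lemma kill_lin: "kill q \<in> lin R (gpart A q) (gpart A q)"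
proof (rule linI)
  note F = free_part_module[OF V_gr]
  fix a assume "a \<in> carrier (gpart A q)"
  then obtain X where X: "X \<in> carrier (Fr V q)" "a = \<phi> q X" using \<phi>_rep by blast
  show "kill q a \<in> carrier (gpart A q)"
    unfolding X(2) kill_\<phi>[OF X(1)] by (rule lin_closed[OF \<phi>_lin lin_closed[OF zm_lin X(1)]])
  {
    fix b assume "b \<in> carrier (gpart A q)"
    then obtain Y where Y: "Y \<in> carrier (Fr V q)" "b = \<phi> q Y" using \<phi>_rep by blast
    show "kill q (a \<oplus>\<^bsub>gpart A q\<^esub> b) = kill q a \<oplus>\<^bsub>gpart A q\<^esub> kill q b"
      unfolding X(2) Y(2) lin_add[OF \<phi>_lin X(1) Y(1), symmetric] kill_\<phi>[OF module_add_closed[OF F X(1) Y(1)]]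
        lin_add[OF zm_lin X(1) Y(1)] kill_\<phi>[OF X(1)] kill_\<phi>[OF Y(1)]
      by (rule lin_add[OF \<phi>_lin lin_closed[OF zm_lin X(1)] lin_closed[OF zm_lin Y(1)]])
  }
  fix r assume r: "r \<in> carrier R"
  show "kill q (r \<odot>\<^bsub>gpart A q\<^esub> a) = r \<odot>\<^bsub>gpart A q\<^esub> kill q a"
    unfolding X(2) lin_smult[OF \<phi>_lin r X(1), symmetric] kill_\<phi>[OF module.smult_closed[OF F r X(1)]]
      lin_smult[OF zm_lin r X(1)] kill_\<phi>[OF X(1)]
    by (rule lin_smult[OF \<phi>_lin r lin_closed[OF zm_lin X(1)]])
qed

text \<open>\<open>kill\<close> is conjugate under the multiplicative bijection
  \<open>\<phi>\<close> to a map of free algebras induced by a map of generators, and such maps are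
  multiplicative. Constants from \<open>O(0)\<close> survive it.\<close>

lemma kill_ev:
  assumes y: "y \<in> OEl P (length as)" and as: "set as \<subseteq> El (gpart A)"
  shows "gmap kill (ev A y as) = ev A y (map (gmap kill) as)"
proof -
  have "\<exists>Xs. set Xs \<subseteq> El (Fr V) \<and> as = map (gmap \<phi>) Xs"
    using as
  proof (induction as)
    case (Cons a as)
    then obtain Xs where Xs: "set Xs \<subseteq> El (Fr V)" "as = map (gmap \<phi>) Xs" by auto
    have "snd a \<in> carrier (gpart A (fst a))" using Cons.prems by (simp add: El_iff)
    from \<phi>_rep[OF this] obtain X where X: "X \<in> carrier (Fr V (fst a))" "snd a = \<phi> (fst a) X" by blast
    show ?case by (rule exI[of _ "(fst a, X) # Xs"]) (use X Xs in \<open>auto simp: El_iff prod_eq_iff\<close>)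
  qed auto
  then obtain Xs where Xs: "set Xs \<subseteq> El (Fr V)" "as = map (gmap \<phi>) Xs" by blast
  have yX: "y \<in> OEl P (length Xs)" using y Xs by simp
  have yd: "y \<in> OEl P (length (degs Xs))" using yX by simp
  let ?zm = "free_map R P V V z0"
  have zX: "set (map (gmap ?zm) Xs) \<subseteq> El (Fr V)"
    using Xs(1) lin_closed[OF zm_lin] by (auto simp: El_iff subset_iff)
  have yz: "y \<in> OEl P (length (map (gmap ?zm) Xs))" using yX by simp
  let ?E = "Fev V y Xs"
  have Ec: "snd ?E \<in> carrier (Fr V (fst ?E))"
    using multilin_closed[OF free_ev_multilin[OF V_gr yd refl] Xs(1) refl] by (simp add: free_ev_deg[OF V_gr])
  have "ev A y as = gmap \<phi> ?E" unfolding Xs(2) by (rule \<phi>_ev[OF yX Xs(1), symmetric])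
  then have "gmap kill (ev A y as) = gmap \<phi> (gmap ?zm ?E)"
    using kill_\<phi>[OF Ec] by simp
  also have "\<dots> = gmap \<phi> (Fev V y (map (gmap ?zm) Xs))"
    unfolding free_map_ev[OF V_gr V_gr z0_lin yX Xs(1)] ..
  also have "\<dots> = ev A y (map (gmap \<phi>) (map (gmap ?zm) Xs))"
    by (rule \<phi>_ev[OF yz zX])
  also have "map (gmap \<phi>) (map (gmap ?zm) Xs) = map (gmap kill) as"
    using Xs(1) kill_\<phi> by (auto simp: Xs(2) El_iff subset_iff)
  finally show ?thesis .
qed

lemma kill_gn: "v \<in> El V \<Longrightarrow> gmap kill (gn v) = (fst v, \<zero>\<^bsub>gpart A (fst v)\<^esub>)"
proof -
  assume v: "v \<in> El V"
  note F = free_part_module[OF V_gr]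
  have s: "(oid P, [v]) \<in> syms P V (fst v)" by (rule letter_syms[OF v])
  have s0: "(oid P, [(fst v, \<zero>\<^bsub>V (fst v)\<^esub>)]) \<in> syms P V (fst v)"
    using oid_el(1) module_zero_closed[OF V_module[OF V_gr]] by (simp add: syms_iff El_iff)
  have "(\<lambda>u. Cl V (fst v) (oid P, [(fst v, u)])) \<in> lin R (V (fst v)) (Fr V (fst v))"
    using balanced_slot[OF sym_class_balanced[OF V_gr] s0, of 0] by simp
  from lin_zero[OF this V_module[OF V_gr] F]
  have "free_map R P V V z0 (fst v) (Cl V (fst v) (oid P, [v])) = \<zero>\<^bsub>Fr V (fst v)\<^esub>"
    using free_map_class[OF V_gr V_gr z0_lin s] by simp
  then show ?thesis
    using kill_\<phi>[OF sym_class_closed[OF V_gr s]] lin_zero[OF \<phi>_lin F A_module] by (simp add: gn_eq[OF v])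
qed

subsection \<open>Monomials in the generators\<close>

definition vmono :: "nat \<Rightarrow> 'o gel \<Rightarrow> (nat \<times> 'v gel) list \<Rightarrow> ('r, 'o, 'a) cop_el gel"
  where "vmono m x ivs = mono m x (map (apsnd gn) ivs)"

definition vvalid :: "nat \<Rightarrow> int \<Rightarrow> 'o gel \<Rightarrow> (nat \<times> 'v gel) list \<Rightarrow> bool"
  where "vvalid m n x ivs \<longleftrightarrow> (x, map snd ivs) \<in> syms P V n \<and> fst ` set ivs \<subseteq> {..<m}"

lemma vvalid_valid: "vvalid m n x ivs \<Longrightarrow> valid m n x (map (apsnd gn) ivs)"
  using syms_gn[of x "map snd ivs" n] by (auto simp: vvalid_def valid_def comp_def)

lemma vmono_closed: "vvalid m n x ivs \<Longrightarrow> snd (vmono m x ivs) \<in> carrier (BP m n)"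
  unfolding vmono_def by (rule mono_closed[OF vvalid_valid])

text \<open>Each letter is expanded in words in the generators, multilinearity reduces the monomial
  to those in which every letter is one such word, and \<open>mono_expand\<close> opens them up. The
  predicate \<open>ok\<close> records which words may replace which letter, so that control over
  empty words survives the expansion.\<close>

lemma mono_span:
  assumes v: "valid m n x ias" and H: "submodule H R (BP m n)"
    and gens: "\<And>j. j < length ias \<Longrightarrow> snd (snd (ias ! j)) \<in> gen_sub R (gpart A (fst (snd (ias ! j))))
      {snd (ev A y (map gn vs)) | y vs. (y, vs) \<in> syms P V (fst (snd (ias ! j))) \<and> ok j vs}"
    and inH: "\<And>x' vs. (\<And>j. j < length ias \<Longrightarrow> ok j (vs j)) \<Longrightarrow>
      vvalid m n x' (concat (map (\<lambda>j. map (Pair (fst (ias ! j))) (vs j)) [0..<length ias])) \<Longrightarrow>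
      snd (vmono m x' (concat (map (\<lambda>j. map (Pair (fst (ias ! j))) (vs j)) [0..<length ias]))) \<in> H"
  shows "snd (mono m x ias) \<in> H"
proof -
  let ?k = "length ias"
  let ?as = "map snd ias" and ?js = "map fst ias"
  let ?qs = "degs ?as"
  have x: "x \<in> OEl P (length ?qs)" and n: "n = fst x + sum_list ?qs" and asE: "set ?as \<subseteq> El (gpart A)"
    and f: "fst ` set ias \<subseteq> {..<m}" using v by (auto simp: valid_def syms_iff)
  have js: "length ?js = length ?qs" "set ?js \<subseteq> {..<m}" using f by auto
  let ?G = "\<lambda>j. {snd (ev A y (map gn vs)) | y vs. (y, vs) \<in> syms P V (?qs ! j) \<and> ok j vs}"
  have "snd (mono m x (zip ?js ?as)) \<in> H"
  proof (rule multilin_gen_sub[OF mono_multilin[OF x n js] A_module B_module H, where G = ?G and as = ?as])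
    fix j assume j: "j < length ?qs"
    show "?G j \<subseteq> carrier (gpart A (?qs ! j))"
      using syms_A[OF syms_gn] by (fastforce simp: El_iff)
    show "snd (?as ! j) \<in> gen_sub R (gpart A (?qs ! j)) (?G j)" using gens[of j] j by simp
  next
    fix As assume As: "set As \<subseteq> El (gpart A)" "degs As = ?qs"
      and G: "\<And>j. j < length ?qs \<Longrightarrow> snd (As ! j) \<in> ?G j"
    have lA: "length As = ?k" using degs_length[OF As(2)] by simp
    have "\<forall>j. \<exists>y vs. j < ?k \<longrightarrow> snd (As ! j) = snd (ev A y (map gn vs)) \<and> (y, vs) \<in> syms P V (?qs ! j) \<and> ok j vs"
      using G by fastforce
    then obtain y vs where yv: "\<And>j. j < ?k \<Longrightarrow> snd (As ! j) = snd (ev A (y j) (map gn (vs j))) \<and>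
        (y j, vs j) \<in> syms P V (?qs ! j) \<and> ok j (vs j)" by metis
    have Aj: "As ! j = ev A (y j) (map gn (vs j))" if j: "j < ?k" for j
      using yv[OF j] syms_A[OF syms_gn[of "y j" "vs j" "?qs ! j"]] degs_nth[OF As(2), of j] j lA by (simp add: prod_eq_iff)
    define L where "L = map (\<lambda>j. (fst (ias ! j), y j, map gn (vs j))) [0..<?k]"
    let ?ivs = "concat (map (\<lambda>j. map (Pair (fst (ias ! j))) (vs j)) [0..<?k])"
    have zip: "zip ?js As = map (\<lambda>(i, y, as). (i, ev A y as)) L"
      by (rule nth_equalityI) (use lA Aj in \<open>auto simp: L_def\<close>)
    have cc: "concat (map (\<lambda>(i, y, as). map (Pair i) as) L) = map (apsnd gn) ?ivs"
      by (simp add: L_def map_concat comp_def)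
    have Lp: "i < m \<and> z \<in> OEl P (length as) \<and> set as \<subseteq> El (gpart A)" if iL: "(i, z, as) \<in> set L" for i z as
    proof -
      obtain j where j: "j < ?k" "i = fst (ias ! j)" "z = y j" "as = map gn (vs j)" using iL by (auto simp: L_def)
      have "(z, as) \<in> syms P (gpart A) (?qs ! j)" using syms_gn yv[OF j(1)] j by blast
      moreover have "i < m" using f nth_mem[OF j(1)] j(2) by auto
      ultimately show ?thesis by (simp add: syms_iff)
    qed
    have xL: "x \<in> OEl P (length L)" using x by (simp add: L_def)
    have nL: "n = fst x + sum_list (map (\<lambda>(i, y, as). fst y + sum_list (degs as)) L)"
    proof -
      have "map (\<lambda>(i, y, as). fst y + sum_list (degs as)) L = ?qs"
      proof (rule nth_equalityI)
        fix j assume "j < length (map (\<lambda>(i, y, as). fst y + sum_list (degs as)) L)"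
        then have j: "j < ?k" by (simp add: L_def)
        have "(y j, map gn (vs j)) \<in> syms P (gpart A) (?qs ! j)" using syms_gn yv[OF j] by blast
        then show "map (\<lambda>(i, y, as). fst y + sum_list (degs as)) L ! j = ?qs ! j"
          using j by (simp add: L_def syms_iff)
      qed (simp add: L_def)
      then show ?thesis using n by simp
    qed
    obtain e x' where ex: "snd (mono m x (zip ?js As)) = sgn_mod (BP m n) e (snd (mono m x' (map (apsnd gn) ?ivs)))"
      and vx: "valid m n x' (map (apsnd gn) ?ivs)"
      using mono_expand[OF xL Lp nL] unfolding zip cc by blast
    have ivE: "set (map snd ?ivs) \<subseteq> El V"
    proof -
      have "set (vs j) \<subseteq> El V" if "j < ?k" for j using yv[OF that] by (simp add: syms_iff)
      then show ?thesis by fastforce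
    qed
    have dd: "degs (map snd (map (apsnd gn) ?ivs)) = degs (map snd ?ivs)"
      using degs_gn[OF ivE] by (simp add: comp_def)
    have fi: "fst ` set (map (apsnd gn) ?ivs) = fst ` set ?ivs" by (simp add: image_image)
    have "vvalid m n x' ?ivs"
      using vx ivE unfolding valid_def vvalid_def syms_iff dd fi by simp
    from inH[OF _ this] have "snd (vmono m x' ?ivs) \<in> H" using yv by blast
    then show "snd (mono m x (zip ?js As)) \<in> H"
      unfolding ex vmono_def by (rule submodule_sgn[OF B_module H])
  qed simp
  then show ?thesis by (simp add: zip_map_fst_snd)
qed

lemma vmono_gen: "carrier (BP m n) \<subseteq> gen_sub R (BP m n) {snd (vmono m x ivs) | x ivs. vvalid m n x ivs}"
  (is "_ \<subseteq> gen_sub _ _ ?G")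
proof -
  have Gc: "?G \<subseteq> carrier (BP m n)" using vmono_closed by auto
  note GS = gen_sub_submodule[OF B_module Gc]
  have "{snd (mono m x ias) | x ias. valid m n x ias} \<subseteq> gen_sub R (BP m n) ?G"
  proof clarify
    fix p x ias assume v: "valid m n (p, x) ias"
    show "snd (mono m (p, x) ias) \<in> gen_sub R (BP m n) ?G"
    proof (rule mono_span[OF v GS, where ok = "\<lambda>_ _. True"])
      fix j assume j: "j < length ias"
      have "snd (ias ! j) \<in> El (gpart A)" using v nth_mem[OF j] by (auto simp: valid_def syms_iff)
      then show "snd (snd (ias ! j)) \<in> gen_sub R (gpart A (fst (snd (ias ! j))))
          {snd (ev A y (map gn vs)) | y vs. (y, vs) \<in> syms P V (fst (snd (ias ! j))) \<and> True}"
        using A_gen[of "fst (snd (ias ! j))"] by (auto simp: El_iff)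
    next
      fix x' vs assume "vvalid m n x' (concat (map (\<lambda>j. map (Pair (fst (ias ! j))) (vs j)) [0..<length ias]))"
      then show "snd (vmono m x' (concat (map (\<lambda>j. map (Pair (fst (ias ! j))) (vs j)) [0..<length ias]))) \<in> gen_sub R (BP m n) ?G"
        by (intro subsetD[OF gen_sub_incl]) blast
    qed
  qed
  from order_trans[OF B_gen gen_sub_least[OF GS this]] show ?thesis .
qed

lemma vmono_reindex:
  assumes "\<And>j. j \<le> m \<Longrightarrow> \<theta> j \<le> n" and v: "vvalid (Suc m) q x ivs"
  shows "reindex R P A m n \<theta> q (snd (vmono (Suc m) x ivs)) = snd (vmono (Suc n) x (map (apfst \<theta>) ivs))"
    and "vvalid (Suc n) q x (map (apfst \<theta>) ivs)"
proof -
  have c: "map (apfst \<theta>) (map (apsnd gn) ivs) = map (apsnd gn) (map (apfst \<theta>) ivs)" by simp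
  show "reindex R P A m n \<theta> q (snd (vmono (Suc m) x ivs)) = snd (vmono (Suc n) x (map (apfst \<theta>) ivs))"
    using reindex_mono[where \<theta> = \<theta>, OF assms(1) vvalid_valid[OF v]] unfolding vmono_def c by simp
  have "fst ` set (map (apfst \<theta>) ivs) = \<theta> ` fst ` set ivs" by (simp add: image_image)
  then show "vvalid (Suc n) q x (map (apfst \<theta>) ivs)"
    using v assms(1) by (force simp: vvalid_def comp_def less_Suc_eq_le)
qed

text \<open>The operator \<open>\<kappa>\<^sub>i\<close> on the \<open>m\<close>-fold
  coproduct.\<close>

definition kcopy :: "nat \<Rightarrow> nat \<Rightarrow> int \<Rightarrow> ('r, 'o, 'a) cop_el \<Rightarrow> ('r, 'o, 'a) cop_el"
  where "kcopy m i = bmap m m (\<lambda>j. j) (\<lambda>j. if j = i then kill else (\<lambda>_ a. a))"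

lemma
  shows kcopy_lin: "kcopy m i q \<in> lin R (BP m q) (BP m q)"
    and kcopy_vmono: "vvalid m q x ivs \<Longrightarrow> kcopy m i q (snd (vmono m x ivs)) =
      (if i \<in> fst ` set ivs then \<zero>\<^bsub>BP m q\<^esub> else snd (vmono m x ivs))"
proof -
  let ?\<alpha> = "\<lambda>j. if j = i then kill else (\<lambda>_ a. a)"
  have al: "?\<alpha> j q \<in> lin R (gpart A q) (gpart A q)" for j q by (simp add: kill_lin lin_id)
  have th: "j < m \<Longrightarrow> j < m" for j .
  have ae: "gmap (?\<alpha> j) (ev A y as) = ev A y (map (gmap (?\<alpha> j)) as)"
    if "y \<in> OEl P (length as)" "set as \<subseteq> El (gpart A)" for j y as
    using kill_ev[OF that] by auto
  show "kcopy m i q \<in> lin R (BP m q) (BP m q)"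
    unfolding kcopy_def by (rule bmap_lin[where \<theta> = "\<lambda>j. j" and \<alpha> = ?\<alpha>, OF th al ae])
  assume v: "vvalid m q x ivs"
  let ?ias = "map (\<lambda>(j, a). (j, gmap (?\<alpha> j) a)) (map (apsnd gn) ivs)"
  have k: "kcopy m i q (snd (vmono m x ivs)) = snd (mono m x ?ias)" and vk: "valid m q x ?ias"
    unfolding kcopy_def vmono_def
    using bmap_mono[where \<theta> = "\<lambda>j. j" and \<alpha> = ?\<alpha>, OF th al ae vvalid_valid[OF v]] by blast+
  show "kcopy m i q (snd (vmono m x ivs)) = (if i \<in> fst ` set ivs then \<zero>\<^bsub>BP m q\<^esub> else snd (vmono m x ivs))"
  proof (cases "i \<in> fst ` set ivs")
    case False
    have e: "?ias = map (apsnd gn) ivs"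
      unfolding map_map
    proof (rule map_cong[OF refl])
      fix iv assume "iv \<in> set ivs"
      then have "fst iv \<noteq> i" using False by blast
      then show "((\<lambda>(j, a). (j, gmap (?\<alpha> j) a)) \<circ> apsnd gn) iv = apsnd gn iv" by (cases iv) simp
    qed
    show ?thesis using k False unfolding e vmono_def by (simp only: if_False)
  next
    case True
    then obtain j where j: "j < length ivs" "fst (ivs ! j) = i" by (auto simp: in_set_conv_nth image_iff)
    let ?as = "map snd ?ias"
    have vE: "snd (ivs ! j) \<in> El V" using v nth_mem[OF j(1)] by (auto simp: vvalid_def syms_iff)
    have sa: "x \<in> OEl P (length (degs ?as))" "q = fst x + sum_list (degs ?as)" "set ?as \<subseteq> El (gpart A)"
      "set (map fst ?ias) \<subseteq> {..<m}" using vk by (auto simp: valid_def syms_iff)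
    have aj: "?as ! j = (fst (snd (ivs ! j)), \<zero>\<^bsub>gpart A (fst (snd (ivs ! j)))\<^esub>)"
    proof -
      have "kill (fst (snd (ivs ! j))) (snd (gn (snd (ivs ! j)))) = \<zero>\<^bsub>gpart A (fst (snd (ivs ! j)))\<^esub>"
        using kill_gn[OF vE] unfolding prod.inject conjunct2[OF gn_El[OF vE]] by blast
      then show ?thesis using j gn_El[OF vE] by (simp add: case_prod_beta)
    qed
    \<comment> \<open>A letter of copy \<open>i\<close> has become zero, and a monomial with a zero
      letter vanishes by multilinearity.\<close>
    have "snd (mono m x (zip (map fst ?ias) ?as)) = \<zero>\<^bsub>BP m q\<^esub>"
      by (rule multilin_zero[OF mono_multilin[OF sa(1,2) _ sa(4)] A_module B_module sa(3) refl, of j])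
        (use aj j in auto)
    then show ?thesis unfolding k using True by (simp only: zip_map_fst_snd if_True)
  qed
qed

text \<open>The product of the operators \<open>1 - \<kappa>\<^sub>j\<close> for
  \<open>1 \<le> j \<le> k\<close>. Copy 0 is excluded, because no degeneracy leaves it out.\<close>

primrec split :: "nat \<Rightarrow> int \<Rightarrow> nat \<Rightarrow> ('r, 'o, 'a) cop_el \<Rightarrow> ('r, 'o, 'a) cop_el"
  where "split m q 0 X = X"
  | "split m q (Suc k) X = split m q k (X \<ominus>\<^bsub>BP m q\<^esub> kcopy m (Suc k) q X)"

lemma split_lin: "split m q k \<in> lin R (BP m q) (BP m q)"
proof (induction k)
  case 0
  have "split m q 0 = (\<lambda>X. X)" by (rule ext) simp
  then show ?case using lin_id by simp
next
  case (Suc k)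
  from lin_comp[OF lin_diff[OF lin_id kcopy_lin B_module] Suc]
  show ?case by simp
qed

lemma split_vmono:
  assumes v: "vvalid m q x ivs"
  shows "split m q k (snd (vmono m x ivs)) = (if {1..k} \<subseteq> fst ` set ivs then snd (vmono m x ivs) else \<zero>\<^bsub>BP m q\<^esub>)"
proof (induction k)
  case (Suc k)
  interpret B: module R "BP m q" by (rule B_module)
  have c: "snd (vmono m x ivs) \<in> carrier (BP m q)" by (rule vmono_closed[OF v])
  have s: "{1..Suc k} \<subseteq> fst ` set ivs \<longleftrightarrow> Suc k \<in> fst ` set ivs \<and> {1..k} \<subseteq> fst ` set ivs"
    by (auto simp: atLeastAtMostSuc_conv)
  show ?case
  proof (cases "Suc k \<in> fst ` set ivs")
    case True
    have "snd (vmono m x ivs) \<ominus>\<^bsub>BP m q\<^esub> kcopy m (Suc k) q (snd (vmono m x ivs)) = snd (vmono m x ivs)"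
      using True c kcopy_vmono[OF v, of "Suc k"] by (simp add: B.minus_eq module_neg_zero[OF B_module])
    then show ?thesis using Suc True s by simp
  next
    case False
    have "snd (vmono m x ivs) \<ominus>\<^bsub>BP m q\<^esub> kcopy m (Suc k) q (snd (vmono m x ivs)) = \<zero>\<^bsub>BP m q\<^esub>"
      using False c kcopy_vmono[OF v, of "Suc k"] by (simp add: module_diff_eq_zero[OF B_module])
    then show ?thesis using lin_zero[OF split_lin B_module B_module] False s by simp
  qed
qed simp

subsection \<open>Nondegenerate and degenerate elements\<close>

text \<open>The span \<open>N\<^sub>p\<close> in internal degree \<open>q\<close>. The letters of a
  monomial may come in any order here, unlike in \<open>plus_sub\<close>; \<open>plus_sub_eq\<close>
  reconciles the two.\<close>

definition nondeg :: "nat \<Rightarrow> int \<Rightarrow> ('r, 'o, 'a) cop_el set"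
  where "nondeg p q = gen_sub R (BP (Suc p) q)
    {snd (vmono (Suc p) x ivs) | x ivs. vvalid (Suc p) q x ivs \<and> {1..p} \<subseteq> fst ` set ivs}"

definition deg_sub :: "nat \<Rightarrow> int \<Rightarrow> ('r, 'o, 'a) cop_el set"
  where "deg_sub p q = gen_sub R (BP (Suc p) q)
    {snd (vmono (Suc p) x ivs) | x ivs. vvalid (Suc p) q x ivs \<and> \<not> {1..p} \<subseteq> fst ` set ivs}"

lemma nondeg_submodule: "submodule (nondeg p q) R (BP (Suc p) q)"
  unfolding nondeg_def by (rule gen_sub_submodule[OF B_module]) (use vmono_closed in auto)

lemma deg_sub_submodule: "submodule (deg_sub p q) R (BP (Suc p) q)"
  unfolding deg_sub_def by (rule gen_sub_submodule[OF B_module]) (use vmono_closed in auto)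

lemma nondegI: "vvalid (Suc p) q x ivs \<Longrightarrow> {1..p} \<subseteq> fst ` set ivs \<Longrightarrow> snd (vmono (Suc p) x ivs) \<in> nondeg p q"
  unfolding nondeg_def by (rule subsetD[OF gen_sub_incl]) blast

lemma deg_subI: "vvalid (Suc p) q x ivs \<Longrightarrow> \<not> {1..p} \<subseteq> fst ` set ivs \<Longrightarrow> snd (vmono (Suc p) x ivs) \<in> deg_sub p q"
  unfolding deg_sub_def by (rule subsetD[OF gen_sub_incl]) blast

lemma split_nondeg: "X \<in> nondeg p q \<Longrightarrow> split (Suc p) q p X = X"
  unfolding nondeg_def
proof (rule gen_sub_lin_eq[OF split_lin lin_id B_module B_module])
  let ?G = "{snd (vmono (Suc p) x ivs) | x ivs. vvalid (Suc p) q x ivs \<and> {1..p} \<subseteq> fst ` set ivs}"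
  show "?G \<subseteq> carrier (BP (Suc p) q)" using vmono_closed by blast
  fix Y assume "Y \<in> ?G"
  then obtain x ivs where *: "Y = snd (vmono (Suc p) x ivs)" "vvalid (Suc p) q x ivs" "{1..p} \<subseteq> fst ` set ivs" by blast
  show "split (Suc p) q p Y = Y" using split_vmono[OF *(2), of p] *(3) unfolding *(1) by (simp only: if_True)
qed

lemma split_deg: "X \<in> deg_sub p q \<Longrightarrow> split (Suc p) q p X = \<zero>\<^bsub>BP (Suc p) q\<^esub>"
  unfolding deg_sub_def
proof (rule gen_sub_lin_eq[OF split_lin lin_const_zero[OF B_module] B_module B_module])
  let ?G = "{snd (vmono (Suc p) x ivs) | x ivs. vvalid (Suc p) q x ivs \<and> \<not> {1..p} \<subseteq> fst ` set ivs}"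
  show "?G \<subseteq> carrier (BP (Suc p) q)" using vmono_closed by blast
  fix Y assume "Y \<in> ?G"
  then obtain x ivs where *: "Y = snd (vmono (Suc p) x ivs)" "vvalid (Suc p) q x ivs" "\<not> {1..p} \<subseteq> fst ` set ivs" by blast
  show "split (Suc p) q p Y = \<zero>\<^bsub>BP (Suc p) q\<^esub>" using split_vmono[OF *(2), of p] *(3) unfolding *(1) by (simp only: if_False)
qed

lemma split_mem_nondeg:
  assumes "X \<in> carrier (BP (Suc p) q)"
  shows "split (Suc p) q p X \<in> nondeg p q"
proof (rule gen_sub_lin[OF split_lin B_module B_module nondeg_submodule])
  let ?G = "{snd (vmono (Suc p) x ivs) | x ivs. vvalid (Suc p) q x ivs}"
  show "X \<in> gen_sub R (BP (Suc p) q) ?G" using vmono_gen assms by blast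
  fix Y assume "Y \<in> ?G"
  then obtain x ivs where *: "Y = snd (vmono (Suc p) x ivs)" "vvalid (Suc p) q x ivs" by blast
  show "Y \<in> carrier (BP (Suc p) q)" unfolding *(1) by (rule vmono_closed[OF *(2)])
  show "split (Suc p) q p Y \<in> nondeg p q"
  proof (cases "{1..p} \<subseteq> fst ` set ivs")
    case True
    then show ?thesis using nondegI[OF *(2) True] split_vmono[OF *(2), of p] unfolding *(1) by (simp only: if_True)
  next
    case False
    then show ?thesis using submodule_zero[OF B_module nondeg_submodule] split_vmono[OF *(2), of p] unfolding *(1) by (simp only: if_False)
  qed
qed

lemma split_diff_deg: "X \<in> carrier (BP (Suc p) q) \<Longrightarrow> X \<ominus>\<^bsub>BP (Suc p) q\<^esub> split (Suc p) q p X \<in> deg_sub p q"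
proof (rule gen_sub_lin[OF lin_diff[OF lin_id split_lin B_module] B_module B_module deg_sub_submodule _ _ subsetD[OF vmono_gen]])
  interpret B: module R "BP (Suc p) q" by (rule B_module)
  fix X assume "X \<in> {snd (vmono (Suc p) x ivs) | x ivs. vvalid (Suc p) q x ivs}"
  then obtain x ivs where v: "X = snd (vmono (Suc p) x ivs)" "vvalid (Suc p) q x ivs" by auto
  show c: "X \<in> carrier (BP (Suc p) q)" unfolding v(1) by (rule vmono_closed[OF v(2)])
  show "X \<ominus>\<^bsub>BP (Suc p) q\<^esub> split (Suc p) q p X \<in> deg_sub p q"
  proof (cases "{1..p} \<subseteq> fst ` set ivs")
    case True
    then have "split (Suc p) q p X = X" using split_vmono[OF v(2), of p] v(1) by simp
    then show ?thesis using submodule_zero[OF B_module deg_sub_submodule] module_diff_eq_zero[OF B_module c c] by simp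
  next
    case False
    then have "X \<ominus>\<^bsub>BP (Suc p) q\<^esub> split (Suc p) q p X = X"
      using split_vmono[OF v(2), of p] v(1) c by (simp add: B.minus_eq module_neg_zero[OF B_module])
    then show ?thesis using deg_subI[OF v(2) False] v(1) by simp
  qed
qed

lemma mset_blocks: "mset (concat (map (\<lambda>i. filter (\<lambda>x. fst x = i) xs) [0..<m])) = mset (filter (\<lambda>x. fst x < m) xs)"
proof (induction m)
  case (Suc m)
  have "mset (filter (\<lambda>x. fst x < m) xs) + mset (filter (\<lambda>x. fst x = m) xs) = mset (filter (\<lambda>x. fst x < Suc m) xs)"
    by (induction xs) auto
  then show ?case using Suc by simp
qed simp

text \<open>Sorting the letters of a monomial by copies is a permutation. It can be absorbed into
  the operation at the cost of a sign, so sorted and unsorted monomials span the same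
  submodule.\<close>

lemma plus_sub_eq: "plus_sub R P A V \<phi> p q = nondeg p q"
proof -
  let ?m = "Suc p"
  let ?ev = "\<lambda>x vss. snd (ev (cyc R P A p) x (concat (map (\<lambda>i. map (coinj R P A (Suc p) i \<circ> gn) (vss ! i)) [0..<Suc p])))"
  let ?G = "{?ev x vss | x vss. length vss = Suc p \<and> (\<forall>i\<in>{1..p}. vss ! i \<noteq> []) \<and> (x, concat vss) \<in> syms P V q}"
  let ?ivs = "\<lambda>vss. concat (map (\<lambda>i. map (Pair i) (vss ! i)) [0..<Suc p])"
  have snd_ivs: "map snd (?ivs vss) = concat vss" if "length vss = Suc p" for vss :: "'v gel list list"
  proof -
    have "map snd (?ivs vss) = concat (map (\<lambda>i. vss ! i) [0..<Suc p])" by (simp add: map_concat comp_def del: upt_Suc)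
    also have "map (\<lambda>i. vss ! i) [0..<Suc p] = vss" using that map_nth[of vss] by (simp only:)
    finally show ?thesis .
  qed
  have fst_ivs: "fst ` set (?ivs vss) = {i. i \<le> p \<and> vss ! i \<noteq> []}" for vss :: "'v gel list list"
  proof -
    have "fst ` set (?ivs vss) = (\<Union>i\<in>{0..<Suc p}. fst ` set (map (Pair i) (vss ! i)))"
      by (simp add: image_UN del: upt_Suc)
    also have "\<dots> = (\<Union>i\<in>{0..<Suc p}. if vss ! i = [] then {} else {i})"
      by (rule SUP_cong[OF refl]) (simp add: image_image image_constant_conv)
    finally show ?thesis by (auto simp: less_Suc_eq_le split: if_splits)
  qed
  have g: "?ev x vss = snd (vmono ?m x (?ivs vss)) \<and> vvalid ?m q x (?ivs vss) \<and> {1..p} \<subseteq> fst ` set (?ivs vss)"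
    if l: "length vss = Suc p" and ne: "\<forall>i\<in>{1..p}. vss ! i \<noteq> []" and s: "(x, concat vss) \<in> syms P V q" for x vss
  proof -
    have v: "vvalid ?m q x (?ivs vss)" using snd_ivs[OF l] s fst_ivs[of vss] by (auto simp: vvalid_def simp del: upt_Suc)
    have "concat (map (\<lambda>i. map (coinj R P A (Suc p) i \<circ> gn) (vss ! i)) [0..<Suc p]) =
        map (\<lambda>(i, a). coinj R P A ?m i a) (map (apsnd gn) (?ivs vss))"
      by (simp add: map_concat comp_def del: upt_Suc)
    then have "?ev x vss = snd (vmono ?m x (?ivs vss))"
      using arg_cong[OF ev_coinj[OF vvalid_valid[OF v]], of snd] unfolding vmono_def cyc_def by (simp only:)
    then show ?thesis using v ne fst_ivs[of vss] by auto
  qed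
  have Gc: "?G \<subseteq> carrier (BP ?m q)" using g vmono_closed by fastforce
  note GS = gen_sub_submodule[OF B_module Gc]
  have 1: "?G \<subseteq> nondeg p q" using g nondegI by fastforce
  have "{snd (vmono ?m x ivs) | x ivs. vvalid ?m q x ivs \<and> {1..p} \<subseteq> fst ` set ivs} \<subseteq> gen_sub R (BP ?m q) ?G"
  proof clarify
    fix e x ivs assume v: "vvalid ?m q (e, x) ivs" and ne: "{1..p} \<subseteq> fst ` set ivs"
    define vss where "vss = map (\<lambda>i. map snd (filter (\<lambda>iv. fst iv = i) ivs)) [0..<?m]"
    have lv: "length vss = Suc p" by (simp add: vss_def)
    have iv: "?ivs vss = concat (map (\<lambda>i. filter (\<lambda>iv. fst iv = i) ivs) [0..<?m])"
    proof (rule arg_cong[of _ _ concat], rule map_cong[OF refl])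
      fix i assume "i \<in> set [0..<?m]"
      then have "vss ! i = map snd (filter (\<lambda>iv. fst iv = i) ivs)" by (simp add: vss_def del: upt_Suc)
      moreover have "map (Pair i) (map snd (filter (\<lambda>iv. fst iv = i) ivs)) = filter (\<lambda>iv. fst iv = i) ivs"
        by (induction ivs) auto
      ultimately show "map (Pair i) (vss ! i) = filter (\<lambda>iv. fst iv = i) ivs" by simp
    qed
    have "filter (\<lambda>iv. fst iv < ?m) ivs = ivs" using v by (auto simp: vvalid_def intro!: filter_True)
    then have ms: "mset (?ivs vss) = mset ivs" unfolding iv mset_blocks by simp
    obtain \<rho> where \<rho>: "\<rho> permutes {..<length (?ivs vss)}" "permute_list \<rho> (?ivs vss) = ivs"
      using mset_eq_permutation[OF ms[symmetric]] by blast
    \<comment> \<open>\<open>mono_perm\<close> rearranges the letters by the inverse of the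
      permutation that acts on the operation; hence the inverse of \<open>\<rho>\<close> is
      needed.\<close>
    define \<sigma> where "\<sigma> = inv_into UNIV \<rho>"
    have \<sigma>: "\<sigma> permutes {..<length (?ivs vss)}" unfolding \<sigma>_def by (rule permutes_inv[OF \<rho>(1)])
    have inv\<sigma>: "inv_into UNIV \<sigma> = \<rho>" unfolding \<sigma>_def by (rule permutes_inv_inv[OF \<rho>(1)])
    let ?x = "(e, x)"
    let ?y = "gmap (oact P (length (?ivs vss)) \<sigma>) ?x"
    have v': "vvalid ?m q ?x (?ivs vss)"
    proof -
      have m1: "mset (map snd (?ivs vss)) = mset (map snd ivs)" by (simp only: mset_map ms)
      have m2: "mset (degs (map snd (?ivs vss))) = mset (degs (map snd ivs))" by (simp only: mset_map ms)
      have "set (map snd (?ivs vss)) = set (map snd ivs)" by (rule mset_eq_setD[OF m1])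
      moreover have "length (map snd (?ivs vss)) = length (map snd ivs)" by (rule mset_eq_length[OF m1])
      moreover have "sum_list (degs (map snd (?ivs vss))) = sum_list (degs (map snd ivs))"
        by (simp only: sum_mset_sum_list[symmetric] m2)
      moreover have "set (?ivs vss) = set ivs" using ms by (rule mset_eq_setD)
      ultimately show ?thesis using v unfolding vvalid_def syms_iff by (simp only:)
    qed
    have \<sigma>': "\<sigma> permutes {..<length (map (apsnd gn) (?ivs vss))}" using \<sigma> by simp
    have pm: "permute_list \<rho> (map (apsnd gn) (?ivs vss)) = map (apsnd gn) ivs"
      using permute_list_map[OF \<rho>(1), of "apsnd gn"] \<rho>(2) by simp
    have mp: "snd (vmono ?m ?y (?ivs vss)) = sgn_mod (BP ?m q) (koszul_exp \<sigma> (degs (map snd (map (apsnd gn) (?ivs vss))))) (snd (vmono ?m ?x ivs))"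
      using mono_perm(1)[OF vvalid_valid[OF v'] \<sigma>'] unfolding inv\<sigma> pm vmono_def by simp
    have vy: "vvalid ?m q ?y (?ivs vss)"
      using syms_act[of ?x "map snd (?ivs vss)" V q \<sigma>] v' \<sigma> by (simp add: vvalid_def)
    have neb: "\<forall>i\<in>{1..p}. vss ! i \<noteq> []"
    proof
      fix i assume i: "i \<in> {1..p}"
      then obtain w where "w \<in> set ivs" "fst w = i" using ne by auto
      then show "vss ! i \<noteq> []" using i by (auto simp: vss_def filter_empty_conv simp del: upt_Suc)
    qed
    have "(?y, concat vss) \<in> syms P V q" using vy snd_ivs[OF lv] by (simp add: vvalid_def)
    from g[OF lv neb this] have "snd (vmono ?m ?y (?ivs vss)) \<in> ?G" using lv neb \<open>(?y, concat vss) \<in> syms P V q\<close> by fastforce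
    then have "snd (vmono ?m ?y (?ivs vss)) \<in> gen_sub R (BP ?m q) ?G" by (rule subsetD[OF gen_sub_incl])
    then show "snd (vmono ?m ?x ivs) \<in> gen_sub R (BP ?m q) ?G"
      unfolding mp submodule_sgn_iff[OF B_module GS vmono_closed[OF v]] .
  qed
  from gen_sub_least[OF GS this] gen_sub_least[OF nondeg_submodule 1]
  show ?thesis unfolding plus_sub_def nondeg_def cyc_def by blast
qed

end

section \<open>Faces, degeneracies and the internal differential\<close>

text \<open>For the alternating sum of faces on a monomial with a missing copy: \<open>a\<close> and
  \<open>b\<close> are the two faces around that copy, which need not lie in \<open>H\<close>
  individually.\<close>

lemma finsum_cancel_mem:
  fixes M :: "('r, 'a) module"
  assumes M: "module R M" and H: "submodule H R M" and I: "finite I" "a \<in> I" "b \<in> I" "a \<noteq> b"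
    and f: "f a \<in> carrier M" "f b \<in> carrier M" "f a \<oplus>\<^bsub>M\<^esub> f b = \<zero>\<^bsub>M\<^esub>"
    and rest: "\<And>i. i \<in> I \<Longrightarrow> i \<noteq> a \<Longrightarrow> i \<noteq> b \<Longrightarrow> f i \<in> H"
  shows "finsum M f I \<in> H"
proof -
  interpret M: module R M by fact
  let ?J = "I - {a, b}"
  have J: "I = insert a (insert b ?J)" using I by blast
  have r: "finsum M f ?J \<in> H" by (rule submodule_finsum[OF M H]) (use rest in blast)
  have fc: "f \<in> ?J \<rightarrow> carrier M" using rest submodule_subset[OF M H] by blast
  note rc = M.finsum_closed[OF fc]
  have "finsum M f I = f a \<oplus>\<^bsub>M\<^esub> (f b \<oplus>\<^bsub>M\<^esub> finsum M f ?J)"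
    by (subst J) (use I f fc in simp)
  also have "\<dots> = finsum M f ?J" using f rc by (simp add: M.a_assoc[symmetric])
  finally show ?thesis using r by simp
qed

context almost_free_ctx
begin

lemma gn_unit: "v \<in> El V \<Longrightarrow> ev A (oid P) [gn v] = gn v"
  using A gn_El by (simp add: operad_algebra_def)

text \<open>The differential hits the operation, which leaves the letters alone, or one generator,
  whose image is expanded in words in generators of the same copy. So no new copy appears, and a
  copy can disappear only if an empty word replaces its last letter, which
  \<open>no_constant_terms\<close> excludes.\<close>

lemma dif_vmono_mem:
  assumes v: "vvalid m q x ivs" and H: "submodule H R (BP m (q - 1))"
    and inH: "\<And>x' ivs'. vvalid m (q - 1) x' ivs' \<Longrightarrow> fst ` set ivs' \<subseteq> fst ` set ivs \<Longrightarrow>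
      (no_constant_terms R P A V \<phi> \<Longrightarrow> fst ` set ivs' = fst ` set ivs) \<Longrightarrow> snd (vmono m x' ivs') \<in> H"
  shows "dif (B m) q (snd (vmono m x ivs)) \<in> H"
proof -
  let ?nct = "no_constant_terms R P A V \<phi>"
  let ?ias = "map (apsnd gn) ivs"
  let ?k = "length ivs"
  note va = vvalid_valid[OF v]
  note d = mono_dif[OF va]
  have lk: "length ?ias = ?k" by simp
  have ivE: "snd (ivs ! l) \<in> El V" if "l < ?k" for l
    using v nth_mem[OF that] by (auto simp: vvalid_def syms_iff)
  have vm: "valid m q' y ?ias \<Longrightarrow> vvalid m q' y ivs" for q' y
  proof -
    assume a: "valid m q' y ?ias"
    have E: "set (map snd ivs) \<subseteq> El V" and f: "fst ` set ivs \<subseteq> {..<m}" using v by (auto simp: vvalid_def syms_iff)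
    have dd: "degs (map snd ?ias) = degs (map snd ivs)" using degs_gn[OF E] by (simp add: comp_def)
    show ?thesis using a E f unfolding valid_def vvalid_def syms_iff dd by simp
  qed
  have 1: "snd (mono m (dl (ops P ?k) x) ?ias) \<in> H"
    using inH[OF vm[OF d(2)[unfolded lk]]] by (simp add: vmono_def)
  \<comment> \<open>Only the differentiated letter \<open>j\<close> may turn into the empty word,
    and only when constant terms are possible. Any other generator is expanded as the unit applied
    to itself, a word of length one.\<close>
  have 2: "snd (mono m x (?ias[j := (fst (?ias ! j), dl A (snd (?ias ! j)))])) \<in> H" if j: "j < ?k" for j
  proof (rule mono_span[OF d(3)[unfolded lk, OF j] H, where ok = "\<lambda>l vs. vs \<noteq> [] \<or> l = j \<and> \<not> ?nct"])
    let ?jas = "?ias[j := (fst (?ias ! j), dl A (snd (?ias ! j)))]"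
    fix l assume "l < length ?jas"
    then have l: "l < ?k" by simp
    show "snd (snd (?jas ! l)) \<in> gen_sub R (gpart A (fst (snd (?jas ! l))))
      {snd (ev A y (map gn vs)) | y vs. (y, vs) \<in> syms P V (fst (snd (?jas ! l))) \<and> (vs \<noteq> [] \<or> l = j \<and> \<not> ?nct)}"
    proof (cases "l = j")
      case False
      let ?w = "snd (ivs ! l)"
      have e: "snd (?jas ! l) = gn ?w" using False l by simp
      have "snd (gn ?w) = snd (ev A (oid P) (map gn [?w])) \<and> (oid P, [?w]) \<in> syms P V (fst (gn ?w)) \<and> ([?w] \<noteq> [] \<or> l = j \<and> \<not> ?nct)"
        using gn_unit[OF ivE[OF l]] letter_syms[OF ivE[OF l]] gn_El[OF ivE[OF l]] by simp
      then show ?thesis unfolding e by (intro subsetD[OF gen_sub_incl]) blast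
    next
      case True
      let ?w = "snd (ivs ! j)"
      have e: "snd (?jas ! l) = dl A (gn ?w)" and e1: "fst (dl A (gn ?w)) = fst ?w - 1"
        using True j gn_El[OF ivE[OF j]] by (auto simp: dl_def)
      show ?thesis
      proof (cases ?nct)
        case nct: True
        have "snd (dl A (gn ?w)) \<in> gen_sub R (gpart A (fst ?w - 1))
            {snd (ev A x (map gn vs)) | x vs. vs \<noteq> [] \<and> (x, vs) \<in> syms P V (fst ?w - 1)}"
          using nct ivE[OF j] unfolding no_constant_terms_def by blast
        then show ?thesis unfolding e e1 by (rule subsetD[OF gen_sub_mono, rotated]) blast
      next
        case nct: False
        have "snd (dl A (gn ?w)) \<in> carrier (gpart A (fst ?w - 1))"
          using A_dl[OF conjunct1[OF gn_El[OF ivE[OF j]]]] unfolding El_iff e1 .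
        then have "snd (dl A (gn ?w)) \<in> gen_sub R (gpart A (fst ?w - 1)) {snd (ev A x (map gn vs)) | x vs. (x, vs) \<in> syms P V (fst ?w - 1)}"
          using A_gen by blast
        then show ?thesis unfolding e e1 by (rule subsetD[OF gen_sub_mono, rotated]) (use nct True in blast)
      qed
    qed
  next
    let ?jas = "?ias[j := (fst (?ias ! j), dl A (snd (?ias ! j)))]"
    have f: "fst (?jas ! l) = fst (ivs ! l)" if "l < ?k" for l using that j by (cases "l = j") auto
    fix x' and vs :: "nat \<Rightarrow> 'v gel list"
    let ?ivs = "concat (map (\<lambda>l. map (Pair (fst (?jas ! l))) (vs l)) [0..<length ?jas])"
    assume ok: "\<And>l. l < length ?jas \<Longrightarrow> vs l \<noteq> [] \<or> l = j \<and> \<not> ?nct" and v': "vvalid m (q - 1) x' ?ivs"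
    have "fst ` set ?ivs = (\<Union>l\<in>{..<?k}. if vs l = [] then {} else {fst (ivs ! l)})"
    proof -
      have "fst ` set ?ivs = (\<Union>l\<in>{..<?k}. fst ` set (map (Pair (fst (?jas ! l))) (vs l)))"
        by (simp add: image_UN atLeast0LessThan)
      also have "\<dots> = (\<Union>l\<in>{..<?k}. if vs l = [] then {} else {fst (ivs ! l)})"
        by (rule SUP_cong[OF refl]) (use f in \<open>simp add: image_image image_constant_conv\<close>)
      finally show ?thesis .
    qed
    moreover have "fst ` set ivs = (\<Union>l\<in>{..<?k}. {fst (ivs ! l)})" by (auto simp: set_conv_nth)
    ultimately show "snd (vmono m x' ?ivs) \<in> H"
      by (intro inH[OF v']) (use ok in \<open>auto split: if_splits\<close>)
  qed
  show ?thesis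
    unfolding vmono_def d(1) lk
    by (rule submodule_add[OF B_module H 1 submodule_finsum[OF B_module H submodule_sgn[OF B_module H]]]) (use 2 in simp)
qed

lemma dif_deg:
  assumes "X \<in> deg_sub p q"
  shows "dif (B (Suc p)) q X \<in> deg_sub p (q - 1)"
proof (rule gen_sub_lin[OF B_dif B_module B_module deg_sub_submodule])
  let ?G = "{snd (vmono (Suc p) x ivs) | x ivs. vvalid (Suc p) q x ivs \<and> \<not> {1..p} \<subseteq> fst ` set ivs}"
  show "X \<in> gen_sub R (BP (Suc p) q) ?G" using assms by (simp only: deg_sub_def)
  fix Y assume "Y \<in> ?G"
  then obtain x ivs where *: "Y = snd (vmono (Suc p) x ivs)" "vvalid (Suc p) q x ivs" "\<not> {1..p} \<subseteq> fst ` set ivs" by blast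
  show "Y \<in> carrier (BP (Suc p) q)" unfolding *(1) by (rule vmono_closed[OF *(2)])
  show "dif (B (Suc p)) q Y \<in> deg_sub p (q - 1)"
    unfolding *(1)
  proof (rule dif_vmono_mem[OF *(2) deg_sub_submodule])
    fix x' ivs'
    assume v: "vvalid (Suc p) (q - 1) x' ivs'" and "fst ` set ivs' \<subseteq> fst ` set ivs"
    then have "\<not> {1..p} \<subseteq> fst ` set ivs'" using *(3) by (meson order_trans)
    then show "snd (vmono (Suc p) x' ivs') \<in> deg_sub p (q - 1)" by (rule deg_subI[OF v])
  qed
qed

lemma dif_nondeg:
  assumes "no_constant_terms R P A V \<phi>" "X \<in> nondeg p q"
  shows "dif (B (Suc p)) q X \<in> nondeg p (q - 1)"
proof (rule gen_sub_lin[OF B_dif B_module B_module nondeg_submodule])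
  let ?G = "{snd (vmono (Suc p) x ivs) | x ivs. vvalid (Suc p) q x ivs \<and> {1..p} \<subseteq> fst ` set ivs}"
  show "X \<in> gen_sub R (BP (Suc p) q) ?G" using assms by (simp only: nondeg_def)
  fix Y assume "Y \<in> ?G"
  then obtain x ivs where *: "Y = snd (vmono (Suc p) x ivs)" "vvalid (Suc p) q x ivs" "{1..p} \<subseteq> fst ` set ivs" by blast
  show "Y \<in> carrier (BP (Suc p) q)" unfolding *(1) by (rule vmono_closed[OF *(2)])
  show "dif (B (Suc p)) q Y \<in> nondeg p (q - 1)"
    unfolding *(1)
  proof (rule dif_vmono_mem[OF *(2) nondeg_submodule])
    fix x' ivs'
    assume "vvalid (Suc p) (q - 1) x' ivs'" "no_constant_terms R P A V \<phi> \<Longrightarrow> fst ` set ivs' = fst ` set ivs"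
    then show "snd (vmono (Suc p) x' ivs') \<in> nondeg p (q - 1)" using *(3) assms(1) by (intro nondegI) simp_all
  qed
qed

text \<open>The last face is the composite of the rotation, which sends the last copy to 0 and
  raises all others by one, with the merging of copies 0 and 1, which lowers them again. In effect
  only the last index moves, to 0.\<close>

definition face_index :: "nat \<Rightarrow> nat \<Rightarrow> nat \<Rightarrow> nat"
  where "face_index p i j = (if i \<le> p then (if j \<le> i then j else j - 1) else if j = Suc p then 0 else j)"

lemma
  assumes i: "i \<le> Suc p"
  shows face_lin: "face R P A (Suc p) i q \<in> lin R (BP (Suc (Suc p)) q) (BP (Suc p) q)"
    and face_vmono: "vvalid (Suc (Suc p)) q x ivs \<Longrightarrow> face R P A (Suc p) i q (snd (vmono (Suc (Suc p)) x ivs)) =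
      snd (vmono (Suc p) x (map (apfst (face_index p i)) ivs))"
    and face_vvalid: "vvalid (Suc (Suc p)) q x ivs \<Longrightarrow> vvalid (Suc p) q x (map (apfst (face_index p i)) ivs)"
proof -
  let ?m = "\<lambda>i j. if j \<le> i then j else j - 1" and ?r = "\<lambda>j. if j = Suc p then 0 else j + 1"
  have m: "?m i j \<le> p" if "j \<le> Suc p" "i \<le> p" for i j :: nat using that by auto
  have r: "?r j \<le> Suc p" if "j \<le> Suc p" for j using that by auto
  have mr: "merge R P A (Suc p) i = reindex R P A (Suc p) p (?m i)" for i by (simp add: merge_def)
  have rr: "rot R P A (Suc p) = reindex R P A (Suc p) (Suc p) ?r" by (simp add: rot_def)
  have l1: "merge R P A (Suc p) i q \<in> lin R (BP (Suc (Suc p)) q) (BP (Suc p) q)" if "i \<le> p" for i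
    unfolding mr by (rule reindex_lin[OF m]) (use that in auto)
  have l2: "rot R P A (Suc p) q \<in> lin R (BP (Suc (Suc p)) q) (BP (Suc (Suc p)) q)"
    unfolding rr by (rule reindex_lin[OF r])
  have v1: "merge R P A (Suc p) i q (snd (vmono (Suc (Suc p)) x ivs)) = snd (vmono (Suc p) x (map (apfst (?m i)) ivs)) \<and>
      vvalid (Suc p) q x (map (apfst (?m i)) ivs)"
    if "i \<le> p" "vvalid (Suc (Suc p)) q x ivs" for i x ivs
    unfolding mr by (rule conjI[OF vmono_reindex(1)[where \<theta> = "?m i", OF m[OF _ that(1)] that(2)] vmono_reindex(2)[where \<theta> = "?m i", OF m[OF _ that(1)] that(2)]])
  have v2: "rot R P A (Suc p) q (snd (vmono (Suc (Suc p)) x ivs)) = snd (vmono (Suc (Suc p)) x (map (apfst ?r) ivs)) \<and>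
      vvalid (Suc (Suc p)) q x (map (apfst ?r) ivs)"
    if "vvalid (Suc (Suc p)) q x ivs" for x ivs
    unfolding rr by (rule conjI[OF vmono_reindex(1)[where \<theta> = ?r, OF r that] vmono_reindex(2)[where \<theta> = ?r, OF r that]])
  have f1: "face_index p i = ?m i" if "i \<le> p" using that by (auto simp: face_index_def fun_eq_iff)
  have f2: "map (apfst (?m 0)) (map (apfst ?r) ivs) = map (apfst (face_index p i)) ivs" if "i = Suc p" for ivs :: "(nat \<times> 'v gel) list"
    using that by (auto simp: face_index_def)
  show "face R P A (Suc p) i q \<in> lin R (BP (Suc (Suc p)) q) (BP (Suc p) q)"
  proof (cases "i \<le> p")
    case True
    then have "face R P A (Suc p) i q = merge R P A (Suc p) i q" by (auto simp: face_def fun_eq_iff)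
    then show ?thesis using l1[OF True] by simp
  next
    case False
    then have "face R P A (Suc p) i q = (\<lambda>X. merge R P A (Suc p) 0 q (rot R P A (Suc p) q X))" using i by (auto simp: face_def fun_eq_iff)
    then show ?thesis using lin_comp[OF l2 l1[of 0]] by simp
  qed
  assume v: "vvalid (Suc (Suc p)) q x ivs"
  have "face R P A (Suc p) i q (snd (vmono (Suc (Suc p)) x ivs)) = snd (vmono (Suc p) x (map (apfst (face_index p i)) ivs)) \<and>
    vvalid (Suc p) q x (map (apfst (face_index p i)) ivs)"
  proof (cases "i \<le> p")
    case True
    have "face R P A (Suc p) i q X = merge R P A (Suc p) i q X" for X using True by (simp add: face_def)
    then show ?thesis using v1[OF True v] unfolding f1[OF True] by (simp only:)
  next
    case False
    have "face R P A (Suc p) i q X = merge R P A (Suc p) 0 q (rot R P A (Suc p) q X)" for X using False i by (simp add: face_def)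
    moreover have "i = Suc p" using False i by simp
    ultimately show ?thesis using v1[of 0, OF _ conjunct2[OF v2[OF v]]] conjunct1[OF v2[OF v]] unfolding f2[OF \<open>i = Suc p\<close>] by (simp only: zero_le)
  qed
  then show "face R P A (Suc p) i q (snd (vmono (Suc (Suc p)) x ivs)) = snd (vmono (Suc p) x (map (apfst (face_index p i)) ivs))"
    "vvalid (Suc p) q x (map (apfst (face_index p i)) ivs)" by blast+
qed

section \<open>Stability of both spans under the alternating sum of faces\<close>

definition face_sum :: "nat \<Rightarrow> int \<Rightarrow> ('r, 'o, 'a) cop_el \<Rightarrow> ('r, 'o, 'a) cop_el"
  where "face_sum p q X = (\<Oplus>\<^bsub>BP (Suc p) q\<^esub>i\<in>{..Suc p}. sgn_mod (BP (Suc p) q) (int i) (face R P A (Suc p) i q X))"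

lemma face_sum_lin: "face_sum p q \<in> lin R (BP (Suc (Suc p)) q) (BP (Suc p) q)"
  unfolding face_sum_def[abs_def]
  by (rule lin_sum[OF B_module B_module finite_atMost lin_sgn_mod[OF face_lin B_module]]) simp

lemma set_apfst: "fst ` set (map (apfst f) ivs) = f ` fst ` set ivs"
  by (simp add: image_image)

lemma face_sum_nondeg:
  assumes "X \<in> nondeg (Suc p) q"
  shows "face_sum p q X \<in> nondeg p q"
proof (rule gen_sub_lin[OF face_sum_lin B_module B_module nondeg_submodule])
  let ?G = "{snd (vmono (Suc (Suc p)) x ivs) | x ivs. vvalid (Suc (Suc p)) q x ivs \<and> {1..Suc p} \<subseteq> fst ` set ivs}"
  show "X \<in> gen_sub R (BP (Suc (Suc p)) q) ?G" using assms by (simp only: nondeg_def)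
  fix Y assume "Y \<in> ?G"
  then obtain x ivs where *: "Y = snd (vmono (Suc (Suc p)) x ivs)" "vvalid (Suc (Suc p)) q x ivs" "{1..Suc p} \<subseteq> fst ` set ivs" by blast
  show "Y \<in> carrier (BP (Suc (Suc p)) q)" unfolding *(1) by (rule vmono_closed[OF *(2)])
  show "face_sum p q Y \<in> nondeg p q"
    unfolding face_sum_def
  proof (rule submodule_finsum[OF B_module nondeg_submodule submodule_sgn[OF B_module nondeg_submodule]])
    fix i assume "i \<in> {..Suc p}"
    then have i: "i \<le> Suc p" by simp
    have "{1..p} \<subseteq> face_index p i ` fst ` set ivs"
    proof
      fix k assume k: "k \<in> {1..p}"
      \<comment> \<open>A preimage of \<open>k\<close>: merging \<open>i\<close> and
        \<open>i + 1\<close> lowers the indices above \<open>i\<close> by one, whereas the last face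
        changes only the last index.\<close>
      let ?j = "if i \<le> p \<and> i < k then Suc k else k"
      have "?j \<in> {1..Suc p}" using k by auto
      then have "?j \<in> fst ` set ivs" by (rule subsetD[OF *(3)])
      moreover have "face_index p i ?j = k" using k by (auto simp: face_index_def)
      ultimately show "k \<in> face_index p i ` fst ` set ivs" by (metis imageI)
    qed
    then show "face R P A (Suc p) i q Y \<in> nondeg p q"
      unfolding *(1) face_vmono[OF i *(2)] by (intro nondegI[OF face_vvalid[OF i *(2)]]) (simp only: set_apfst)
  qed
qed

lemma face_sum_deg:
  assumes "X \<in> deg_sub (Suc p) q"
  shows "face_sum p q X \<in> deg_sub p q"
proof (rule gen_sub_lin[OF face_sum_lin B_module B_module deg_sub_submodule])
  let ?G = "{snd (vmono (Suc (Suc p)) x ivs) | x ivs. vvalid (Suc (Suc p)) q x ivs \<and> \<not> {1..Suc p} \<subseteq> fst ` set ivs}"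
  show "X \<in> gen_sub R (BP (Suc (Suc p)) q) ?G" using assms by (simp only: deg_sub_def)
  fix Y assume "Y \<in> ?G"
  then obtain x ivs where *: "Y = snd (vmono (Suc (Suc p)) x ivs)" "vvalid (Suc (Suc p)) q x ivs" "\<not> {1..Suc p} \<subseteq> fst ` set ivs" by blast
  show Yc: "Y \<in> carrier (BP (Suc (Suc p)) q)" unfolding *(1) by (rule vmono_closed[OF *(2)])
  obtain b where b: "1 \<le> b" "b \<le> Suc p" "b \<notin> fst ` set ivs" using *(3) by (auto simp only: subset_iff atLeastAtMost_iff)
  have le: "j \<le> Suc p" "j \<noteq> b" if "j \<in> fst ` set ivs" for j using that *(2) b(3) by (fastforce simp: vvalid_def less_Suc_eq_le)+
  have f: "face R P A (Suc p) i q Y = snd (vmono (Suc p) x (map (apfst (face_index p i)) ivs))" if "i \<le> Suc p" for i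
    unfolding *(1) by (rule face_vmono[OF that *(2)])
  have fc: "face R P A (Suc p) i q Y \<in> carrier (BP (Suc p) q)" if "i \<le> Suc p" for i
    by (rule lin_closed[OF face_lin[OF that] Yc])
  show "face_sum p q Y \<in> deg_sub p q"
    unfolding face_sum_def
  proof (rule finsum_cancel_mem[OF B_module deg_sub_submodule, where a = "b - 1" and b = b])
    \<comment> \<open>The two index maps differ only at \<open>b\<close>, which does not occur. For
      \<open>b = p + 1\<close> the second one is the cyclic face.\<close>
    have "face_index p (b - 1) j = face_index p b j" if "j \<in> fst ` set ivs" for j
      using b le[OF that] by (auto simp: face_index_def)
    then have "map (apfst (face_index p (b - 1))) ivs = map (apfst (face_index p b)) ivs"
      by (intro map_cong[OF refl] prod_eqI) (simp_all del: One_nat_def)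
    then have "face R P A (Suc p) (b - 1) q Y = face R P A (Suc p) b q Y"
      using f[of "b - 1"] f[of b] b(2) by (simp only: diff_le_self le_trans[OF diff_le_self b(2)])
    moreover have "even (int b) \<longleftrightarrow> odd (int (b - 1))" using b by auto
    ultimately show "sgn_mod (BP (Suc p) q) (int (b - 1)) (face R P A (Suc p) (b - 1) q Y) \<oplus>\<^bsub>BP (Suc p) q\<^esub>
        sgn_mod (BP (Suc p) q) (int b) (face R P A (Suc p) b q Y) = \<zero>\<^bsub>BP (Suc p) q\<^esub>"
    proof -
      interpret B: module R "BP (Suc p) q" by (rule B_module)
      note c = fc[OF b(2)]
      show ?thesis
        using b(1) c \<open>face R P A (Suc p) (b - 1) q Y = _\<close> \<open>even (int b) \<longleftrightarrow> _\<close> by (simp add: B.l_neg B.r_neg)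
    qed
    fix i assume i': "i \<in> {..Suc p}" "i \<noteq> b - 1" "i \<noteq> b"
    then have i: "i \<le> Suc p" by simp
    \<comment> \<open>The copy that is still missing: merging two copies below \<open>b\<close>
      shifts the gap to \<open>b - 1\<close>, any later face leaves it at \<open>b\<close>. It stays
      within \<open>{1..p}\<close> because \<open>i\<close> is neither \<open>b - 1\<close> nor
      \<open>b\<close>.\<close>
    let ?k = "if i < b then b - 1 else b"
    have "?k \<in> {1..p}" using i' b by auto
    moreover have "?k \<notin> face_index p i ` fst ` set ivs"
    proof
      assume "?k \<in> face_index p i ` fst ` set ivs"
      then obtain j where j: "j \<in> fst ` set ivs" "?k = face_index p i j" by blast
      show False using j(2) le[OF j(1)] i' b by (auto simp: face_index_def split: if_splits)
    qed
    ultimately have "\<not> {1..p} \<subseteq> fst ` set (map (apfst (face_index p i)) ivs)" unfolding set_apfst by blast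
    from deg_subI[OF face_vvalid[OF i *(2)] this]
    show "sgn_mod (BP (Suc p) q) (int i) (face R P A (Suc p) i q Y) \<in> deg_sub p q"
      unfolding f[OF i] by (rule submodule_sgn[OF B_module deg_sub_submodule])
  next
    show "sgn_mod (BP (Suc p) q) (int (b - 1)) (face R P A (Suc p) (b - 1) q Y) \<in> carrier (BP (Suc p) q)"
      by (rule module_sgn_closed[OF B_module fc]) (use b in linarith)
    show "sgn_mod (BP (Suc p) q) (int b) (face R P A (Suc p) b q Y) \<in> carrier (BP (Suc p) q)"
      by (rule module_sgn_closed[OF B_module fc[OF b(2)]])
  qed (use b in simp_all)
qed

section \<open>Degeneracies and the submodule that they generate\<close>

lemma
  assumes i: "i \<le> p"
  shows degen_lin: "degen R P A p i q \<in> lin R (BP (Suc p) q) (BP (Suc (Suc p)) q)"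
    and degen_vmono: "vvalid (Suc p) q x ivs \<Longrightarrow> degen R P A p i q (snd (vmono (Suc p) x ivs)) =
      snd (vmono (Suc (Suc p)) x (map (apfst (\<lambda>j. if j \<le> i then j else j + 1)) ivs))"
    and degen_vvalid: "vvalid (Suc p) q x ivs \<Longrightarrow> vvalid (Suc (Suc p)) q x (map (apfst (\<lambda>j. if j \<le> i then j else j + 1)) ivs)"
proof -
  let ?s = "\<lambda>j. if j \<le> i then j else j + 1"
  have s: "?s j \<le> Suc p" if "j \<le> p" for j using that by auto
  show "degen R P A p i q \<in> lin R (BP (Suc p) q) (BP (Suc (Suc p)) q)"
    unfolding degen_def by (rule reindex_lin[OF s])
  assume v: "vvalid (Suc p) q x ivs"
  show "degen R P A p i q (snd (vmono (Suc p) x ivs)) = snd (vmono (Suc (Suc p)) x (map (apfst ?s) ivs))"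
    and "vvalid (Suc (Suc p)) q x (map (apfst ?s) ivs)"
    using vmono_reindex[where \<theta> = ?s, OF s v] unfolding degen_def by blast+
qed

lemma degen_deg:
  assumes i: "i \<le> p" and X: "X \<in> carrier (BP (Suc p) q)"
  shows "degen R P A p i q X \<in> deg_sub (Suc p) q"
proof (rule gen_sub_lin[OF degen_lin[OF i] B_module B_module deg_sub_submodule])
  let ?G = "{snd (vmono (Suc p) x ivs) | x ivs. vvalid (Suc p) q x ivs}"
  show "X \<in> gen_sub R (BP (Suc p) q) ?G" using vmono_gen X by blast
  fix Y assume "Y \<in> ?G"
  then obtain x ivs where *: "Y = snd (vmono (Suc p) x ivs)" "vvalid (Suc p) q x ivs" by blast
  show "Y \<in> carrier (BP (Suc p) q)" unfolding *(1) by (rule vmono_closed[OF *(2)])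
  have "Suc i \<notin> (\<lambda>j. if j \<le> i then j else j + 1) ` fst ` set ivs" by (auto split: if_splits)
  moreover have "Suc i \<in> {1..Suc p}" using i by simp
  ultimately have "\<not> {1..Suc p} \<subseteq> fst ` set (map (apfst (\<lambda>j. if j \<le> i then j else j + 1)) ivs)"
    unfolding set_apfst using \<open>Suc i \<in> {1..Suc p}\<close> by blast
  then show "degen R P A p i q Y \<in> deg_sub (Suc p) q"
    unfolding *(1) degen_vmono[OF i *(2)] by (rule deg_subI[OF degen_vvalid[OF i *(2)]])
qed

lemma deg_sub_0: "deg_sub 0 q = {\<zero>\<^bsub>BP (Suc 0) q\<^esub>}"
proof -
  have "deg_sub 0 q \<subseteq> {\<zero>\<^bsub>BP (Suc 0) q\<^esub>}"
    unfolding deg_sub_def by (rule gen_sub_least[OF submodule_zero_sub[OF B_module]]) auto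
  then show ?thesis using submodule_zero[OF B_module deg_sub_submodule] by blast
qed

text \<open>A monomial in which copy \<open>b\<close> is missing is the degeneracy with index
  \<open>b - 1\<close> of the monomial obtained by lowering all indices above \<open>b\<close> by
  one.\<close>

lemma deg_sub_Suc_least:
  assumes H: "submodule H R (BP (Suc (Suc p)) q)"
    and degen: "\<And>i X. i \<le> p \<Longrightarrow> X \<in> carrier (BP (Suc p) q) \<Longrightarrow> degen R P A p i q X \<in> H"
  shows "deg_sub (Suc p) q \<subseteq> H"
  unfolding deg_sub_def
proof (rule gen_sub_least[OF H], rule subsetI)
  fix Y assume "Y \<in> {snd (vmono (Suc (Suc p)) x ivs) | x ivs. vvalid (Suc (Suc p)) q x ivs \<and> \<not> {1..Suc p} \<subseteq> fst ` set ivs}"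
  then obtain x ivs where *: "Y = snd (vmono (Suc (Suc p)) x ivs)" "vvalid (Suc (Suc p)) q x ivs" "\<not> {1..Suc p} \<subseteq> fst ` set ivs" by blast
  obtain b where b: "1 \<le> b" "b \<le> Suc p" "b \<notin> fst ` set ivs" using *(3) by (auto simp only: subset_iff atLeastAtMost_iff)
  have le: "fst iv \<le> Suc p" "fst iv \<noteq> b" if "iv \<in> set ivs" for iv
    using *(2) b(3) that by (fastforce simp: vvalid_def less_Suc_eq_le)+
  let ?l = "\<lambda>j. if j < b then j else j - 1" and ?s = "\<lambda>j. if j \<le> b - 1 then j else j + 1"
  let ?jvs = "map (apfst ?l) ivs"
  have "fst ` set ?jvs \<subseteq> {..<Suc p}"
    unfolding set_apfst using le b by (fastforce simp: less_Suc_eq_le)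
  then have v: "vvalid (Suc p) q x ?jvs" using *(2) by (simp add: vvalid_def comp_def)
  have "map (apfst ?s) ?jvs = ivs"
    unfolding map_map
  proof (rule map_idI)
    fix iv assume "iv \<in> set ivs"
    from le[OF this] show "(apfst ?s \<circ> apfst ?l) iv = iv" using b by (cases iv) auto
  qed
  then have "Y = degen R P A p (b - 1) q (snd (vmono (Suc p) x ?jvs))"
    using degen_vmono[OF _ v, of "b - 1"] b *(1) by simp
  then show "Y \<in> H" using degen[of "b - 1"] vmono_closed[OF v] b by simp
qed

end

section \<open>Shuffles\<close>

lemma count_list_filter: "count_list c i = length (filter (\<lambda>m. c ! m = i) [0..<length c])"
proof -
  have "count_list c i = length (filter (\<lambda>x. i = x) c)" by (rule count_list_eq_length_filter)
  also have "\<dots> = length (filter (\<lambda>x. i = x) (map (\<lambda>m. c ! m) [0..<length c]))" by (simp only: map_nth)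
  also have "\<dots> = length (filter (\<lambda>m. c ! m = i) [0..<length c])" by (simp add: filter_map comp_def eq_commute[of i])
  finally show ?thesis .
qed

lemma length_filter_split: "length (filter Q xs) + length (filter (\<lambda>x. \<not> Q x) xs) = length xs"
  by (rule sum_length_filter_compl)

lemma length_filter_upt_mono: "t \<le> n \<Longrightarrow> length (filter Q [0..<t]) \<le> length (filter Q [0..<n])"
proof -
  assume "t \<le> n"
  then have "[0..<n] = [0..<t] @ [t..<n]" by (metis le_add_diff_inverse upt_add_eq_append zero_le)
  then show ?thesis by simp
qed

lemma sum_count_list: "set c \<subseteq> {..<k} \<Longrightarrow> (\<Sum>i\<leftarrow>[0..<k]. int (count_list c i)) = int (length c)"
proof (induction c)
  case (Cons a c)
  have "(\<Sum>i\<leftarrow>[0..<k]. if a = i then 1 else 0 :: int) = 1"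
    using Cons.prems by (simp add: interv_sum_list_conv_sum_set_nat)
  moreover have "(\<Sum>i\<leftarrow>[0..<k]. int (count_list (a # c) i)) =
      (\<Sum>i\<leftarrow>[0..<k]. if a = i then 1 else 0) + (\<Sum>i\<leftarrow>[0..<k]. int (count_list c i))"
    unfolding sum_list_addf[symmetric] by (rule arg_cong[of _ _ sum_list]) (rule map_cong[OF refl], simp)
  ultimately show ?case using Cons by simp
qed simp

context almost_free_ctx
begin

text \<open>The map \<open>\<Theta>\<close> is the effect of the first degeneracies on the indices of the copies. At the end, the
  indices left out are the \<open>\<nu> + 1\<close> where \<open>\<nu>\<close> runs through the positions of letters other than \<open>i\<close>.\<close>

lemma shuffle_prefix:
  assumes "t \<le> length c"
  shows "\<exists>\<Theta>. inj \<Theta> \<and> \<Theta> 0 = (0::nat) \<and>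
    \<Theta> ` {..count_list c i} = {k. k \<le> count_list c i + length (filter (\<lambda>m. c ! m \<noteq> i) [0..<t]) \<and>
      \<not> (1 \<le> k \<and> k \<le> t \<and> c ! (k - 1) \<noteq> i)} \<and>
    (\<forall>X. fst (fold (\<lambda>\<nu> (n, Y). (Suc n, degen R P A n \<nu> q Y)) (filter (\<lambda>m. c ! m \<noteq> i) [0..<t])
      (count_list c i, X)) = count_list c i + length (filter (\<lambda>m. c ! m \<noteq> i) [0..<t])) \<and>
    (\<lambda>X. snd (fold (\<lambda>\<nu> (n, Y). (Suc n, degen R P A n \<nu> q Y)) (filter (\<lambda>m. c ! m \<noteq> i) [0..<t])
      (count_list c i, X))) \<in> lin R (BP (Suc (count_list c i)) q)
        (BP (Suc (count_list c i + length (filter (\<lambda>m. c ! m \<noteq> i) [0..<t]))) q) \<and>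
    (\<forall>x ivs. vvalid (Suc (count_list c i)) q x ivs \<longrightarrow>
      snd (fold (\<lambda>\<nu> (n, Y). (Suc n, degen R P A n \<nu> q Y)) (filter (\<lambda>m. c ! m \<noteq> i) [0..<t])
        (count_list c i, snd (vmono (Suc (count_list c i)) x ivs))) =
      snd (vmono (Suc (count_list c i + length (filter (\<lambda>m. c ! m \<noteq> i) [0..<t]))) x (map (apfst \<Theta>) ivs)) \<and>
      vvalid (Suc (count_list c i + length (filter (\<lambda>m. c ! m \<noteq> i) [0..<t]))) q x (map (apfst \<Theta>) ivs))"
  using assms
proof (induction t)
  case 0
  have m: "map (apfst (\<lambda>j. j)) ivs = ivs" for ivs :: "(nat \<times> 'v gel) list" by (rule map_idI) (simp add: prod_eq_iff)
  show ?case
    by (rule exI[of _ "\<lambda>j. j"]) (simp add: m lin_id atMost_def)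
next
  case (Suc t)
  let ?p = "count_list c i" and ?g = "\<lambda>\<nu> (n, Y). (Suc n, degen R P A n \<nu> q Y)"
  let ?F = "\<lambda>t. filter (\<lambda>m. c ! m \<noteq> i) [0..<t]"
  let ?f = "\<lambda>t X. fold ?g (?F t) (?p, X)"
  define r where "r = length (?F t)"
  obtain \<Theta> where \<Theta>: "inj \<Theta>" "\<Theta> 0 = 0"
    "\<Theta> ` {..?p} = {k. k \<le> ?p + r \<and> \<not> (1 \<le> k \<and> k \<le> t \<and> c ! (k - 1) \<noteq> i)}"
    and f1: "\<And>X. fst (?f t X) = ?p + r"
    and f2: "(\<lambda>X. snd (?f t X)) \<in> lin R (BP (Suc ?p) q) (BP (Suc (?p + r)) q)"
    and f3: "\<And>x ivs. vvalid (Suc ?p) q x ivs \<Longrightarrow> snd (?f t (snd (vmono (Suc ?p) x ivs))) =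
      snd (vmono (Suc (?p + r)) x (map (apfst \<Theta>) ivs)) \<and> vvalid (Suc (?p + r)) q x (map (apfst \<Theta>) ivs)"
    using Suc.IH[OF Suc_leD[OF Suc.prems]] unfolding r_def by (elim exE conjE) blast
  show ?case
  proof (cases "c ! t = i")
    case True
    have F: "?F (Suc t) = ?F t" using True by simp
    have im: "\<Theta> ` {..?p} = {k. k \<le> ?p + r \<and> \<not> (1 \<le> k \<and> k \<le> Suc t \<and> c ! (k - 1) \<noteq> i)}"
      unfolding \<Theta>(3) using True by (auto simp: le_Suc_eq)
    show ?thesis unfolding F r_def[symmetric]
      by (rule exI[of _ \<Theta>]) (intro conjI \<Theta>(1,2) im allI f1 f2 impI f3[THEN conjunct1] f3[THEN conjunct2])
  next
    case False
    have F: "?F (Suc t) = ?F t @ [t]" using False by simp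
    have fS: "?f (Suc t) X = (Suc (?p + r), degen R P A (?p + r) t q (snd (?f t X)))" for X
      using f1[of X] unfolding F by (simp add: case_prod_beta)
    have lS: "length (?F (Suc t)) = Suc r" unfolding F r_def by simp
    \<comment> \<open>The next degeneracy has index \<open>t\<close> and is applied in simplicial
      degree \<open>?p + r\<close>. Of the \<open>t\<close> positions before it, \<open>r\<close>
      carry other letters and at most \<open>?p\<close> carry \<open>i\<close>, so the index is in
      range.\<close>
    have t: "t \<le> ?p + r"
      using length_filter_split[of "\<lambda>m. c ! m = i" "[0..<t]"] length_filter_upt_mono[OF Suc_leD[OF Suc.prems], of "\<lambda>m. c ! m = i"]
      unfolding count_list_filter r_def by simp
    let ?s = "\<lambda>j. if j \<le> t then j else j + 1"
    let ?\<Theta> = "\<lambda>j. ?s (\<Theta> j)"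
    have inj: "inj ?\<Theta>"
    proof (rule injI)
      fix a b assume "?s (\<Theta> a) = ?s (\<Theta> b)"
      then have "\<Theta> a = \<Theta> b" by (auto split: if_splits)
      then show "a = b" using \<Theta>(1) by (simp add: inj_eq)
    qed
    have "?\<Theta> ` {..?p} = ?s ` (\<Theta> ` {..?p})" by (simp only: image_image)
    also have "\<dots> = {k. k \<le> ?p + Suc r \<and> \<not> (1 \<le> k \<and> k \<le> Suc t \<and> c ! (k - 1) \<noteq> i)}" (is "_ = ?K")
    proof (rule Set.set_eqI)
      fix k
      show "k \<in> ?s ` (\<Theta> ` {..?p}) \<longleftrightarrow> k \<in> ?K"
      proof
        assume "k \<in> ?s ` (\<Theta> ` {..?p})"
        then show "k \<in> ?K" unfolding \<Theta>(3) using t False by (auto split: if_splits simp: le_Suc_eq)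
      next
        assume k: "k \<in> ?K"
        show "k \<in> ?s ` (\<Theta> ` {..?p})"
        proof (cases "k \<le> t")
          case True
          then have "k \<in> \<Theta> ` {..?p}" unfolding \<Theta>(3) using k t by auto
          then show ?thesis using True by force
        next
          case f: False
          \<comment> \<open>The index \<open>t + 1\<close> is excluded from \<open>?K\<close>
            because \<open>c ! t\<close> is not \<open>i\<close>; it is the one that the new
            degeneracy skips.\<close>
          then have k2: "Suc t < k" using k False by (cases "k = Suc t") auto
          then have "k - 1 \<in> \<Theta> ` {..?p}" unfolding \<Theta>(3) using k by auto
          moreover have "k = ?s (k - 1)" using k2 by auto
          ultimately show ?thesis by blast
        qed
      qed
    qed
    finally have im: "?\<Theta> ` {..?p} = ?K" .
    have l: "(\<lambda>X. snd (?f (Suc t) X)) \<in> lin R (BP (Suc ?p) q) (BP (Suc (?p + Suc r)) q)"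
      unfolding fS snd_conv add_Suc_right by (rule lin_comp[OF f2 degen_lin[OF t]])
    have v: "snd (?f (Suc t) (snd (vmono (Suc ?p) x ivs))) = snd (vmono (Suc (?p + Suc r)) x (map (apfst ?\<Theta>) ivs)) \<and>
        vvalid (Suc (?p + Suc r)) q x (map (apfst ?\<Theta>) ivs)" if v: "vvalid (Suc ?p) q x ivs" for x ivs
    proof -
      have c: "map (apfst ?s) (map (apfst \<Theta>) ivs) = map (apfst ?\<Theta>) ivs" by auto
      note f3' = f3[OF v]
      show ?thesis
        unfolding fS snd_conv conjunct1[OF f3'] degen_vmono[OF t conjunct2[OF f3']] c add_Suc_right
        using degen_vvalid[OF t conjunct2[OF f3']] unfolding c by (rule conjI[OF refl])
    qed
    have f1': "fst (?f (Suc t) X) = ?p + Suc r" for X unfolding fS by simp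
    show ?thesis unfolding lS
      by (rule exI[of _ ?\<Theta>]) (intro conjI inj im allI f1' l impI v[THEN conjunct1] v[THEN conjunct2], use \<Theta>(2) in simp)
  qed
qed

lemma shuffle_degen_index:
  obtains \<Theta> where "inj \<Theta>" "\<Theta> 0 = (0::nat)"
    "\<Theta> ` {..count_list c i} = {k. k \<le> length c \<and> \<not> (1 \<le> k \<and> c ! (k - 1) \<noteq> i)}"
    "shuffle_degen R P A c i q \<in> lin R (BP (Suc (count_list c i)) q) (BP (Suc (length c)) q)"
    "\<And>x ivs. vvalid (Suc (count_list c i)) q x ivs \<Longrightarrow> shuffle_degen R P A c i q (snd (vmono (Suc (count_list c i)) x ivs)) =
      snd (vmono (Suc (length c)) x (map (apfst \<Theta>) ivs))"
    "\<And>x ivs. vvalid (Suc (count_list c i)) q x ivs \<Longrightarrow> vvalid (Suc (length c)) q x (map (apfst \<Theta>) ivs)"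
proof -
  have e: "count_list c i + length (filter (\<lambda>m. c ! m \<noteq> i) [0..<length c]) = length c"
    unfolding count_list_filter using length_filter_split[of "\<lambda>m. c ! m = i" "[0..<length c]"] by simp
  have s: "shuffle_degen R P A c i q = (\<lambda>X. snd (fold (\<lambda>\<nu> (n, Y). (Suc n, degen R P A n \<nu> q Y)) (filter (\<lambda>m. c ! m \<noteq> i) [0..<length c])
      (count_list c i, X)))" by (rule ext) (simp add: shuffle_degen_def)
  obtain \<Theta> where \<Theta>: "inj \<Theta>" "\<Theta> 0 = (0::nat)"
    "\<Theta> ` {..count_list c i} = {k. k \<le> length c \<and> \<not> (1 \<le> k \<and> k \<le> length c \<and> c ! (k - 1) \<noteq> i)}"
    "shuffle_degen R P A c i q \<in> lin R (BP (Suc (count_list c i)) q) (BP (Suc (length c)) q)"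
    "\<forall>x ivs. vvalid (Suc (count_list c i)) q x ivs \<longrightarrow> shuffle_degen R P A c i q (snd (vmono (Suc (count_list c i)) x ivs)) =
      snd (vmono (Suc (length c)) x (map (apfst \<Theta>) ivs)) \<and> vvalid (Suc (length c)) q x (map (apfst \<Theta>) ivs)"
    using shuffle_prefix[OF order.refl, of c i q] unfolding e s by (elim exE conjE) blast
  have "\<Theta> ` {..count_list c i} = {k. k \<le> length c \<and> \<not> (1 \<le> k \<and> c ! (k - 1) \<noteq> i)}" unfolding \<Theta>(3) by auto
  from that[OF \<Theta>(1,2) this \<Theta>(4)] \<Theta>(5) show ?thesis by blast
qed

lemma shuffle_degen_lin: "shuffle_degen R P A c i q \<in> lin R (BP (Suc (count_list c i)) q) (BP (Suc (length c)) q)"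
  by (rule shuffle_degen_index[of c i q])

text \<open>A general condition on the set of copies of a monomial is needed: after degeneracies,
  the factors of a shuffle term satisfy neither the condition of \<open>nondeg\<close> nor merely
  that of \<open>deg_sub\<close>, but conditions on which positions they occupy.\<close>

definition span :: "nat \<Rightarrow> int \<Rightarrow> (nat set \<Rightarrow> bool) \<Rightarrow> ('r, 'o, 'a) cop_el set"
  where "span m q Q = gen_sub R (BP m q) {snd (vmono m x ivs) | x ivs. vvalid m q x ivs \<and> Q (fst ` set ivs)}"

lemma nondeg_span: "nondeg p q = span (Suc p) q (\<lambda>J. {1..p} \<subseteq> J)"
  and deg_sub_span: "deg_sub p q = span (Suc p) q (\<lambda>J. \<not> {1..p} \<subseteq> J)"
  by (simp_all only: nondeg_def deg_sub_def span_def)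

lemma carrier_span: "carrier (BP m q) \<subseteq> span m q (\<lambda>_. True)"
  using vmono_gen by (simp only: span_def simp_thms)

lemma span_submodule: "submodule (span m q Q) R (BP m q)"
  unfolding span_def by (rule gen_sub_submodule[OF B_module]) (use vmono_closed in blast)

text \<open>Degeneracies act on the set of copies through an index map \<open>\<Theta>\<close>. Only
  its injectivity, its value at 0 and its image are passed on.\<close>

lemma shuffle_degen_span:
  assumes Y: "Y \<in> span (Suc (count_list c i)) q Q"
    and Q: "\<And>\<Theta> J. inj \<Theta> \<Longrightarrow> \<Theta> 0 = (0::nat) \<Longrightarrow>
      \<Theta> ` {..count_list c i} = {k. k \<le> length c \<and> \<not> (1 \<le> k \<and> c ! (k - 1) \<noteq> i)} \<Longrightarrow>
      J \<subseteq> {..count_list c i} \<Longrightarrow> Q J \<Longrightarrow> Q' (\<Theta> ` J)"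
  shows "shuffle_degen R P A c i q Y \<in> span (Suc (length c)) q Q'"
proof (rule shuffle_degen_index[of c i q])
  fix \<Theta> assume \<Theta>: "inj \<Theta>" "\<Theta> 0 = (0::nat)" "\<Theta> ` {..count_list c i} = {k. k \<le> length c \<and> \<not> (1 \<le> k \<and> c ! (k - 1) \<noteq> i)}"
    and l: "shuffle_degen R P A c i q \<in> lin R (BP (Suc (count_list c i)) q) (BP (Suc (length c)) q)"
    and v: "\<And>x ivs. vvalid (Suc (count_list c i)) q x ivs \<Longrightarrow> shuffle_degen R P A c i q (snd (vmono (Suc (count_list c i)) x ivs)) =
      snd (vmono (Suc (length c)) x (map (apfst \<Theta>) ivs))"
    "\<And>x ivs. vvalid (Suc (count_list c i)) q x ivs \<Longrightarrow> vvalid (Suc (length c)) q x (map (apfst \<Theta>) ivs)"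
  show ?thesis
  proof (rule gen_sub_lin[OF l B_module B_module span_submodule _ _ Y[unfolded span_def]])
    fix Z assume "Z \<in> {snd (vmono (Suc (count_list c i)) x ivs) | x ivs. vvalid (Suc (count_list c i)) q x ivs \<and> Q (fst ` set ivs)}"
    then obtain x ivs where *: "Z = snd (vmono (Suc (count_list c i)) x ivs)" "vvalid (Suc (count_list c i)) q x ivs" "Q (fst ` set ivs)" by blast
    show "Z \<in> carrier (BP (Suc (count_list c i)) q)" unfolding *(1) by (rule vmono_closed[OF *(2)])
    have "fst ` set ivs \<subseteq> {..count_list c i}" using *(2) by (auto simp: vvalid_def less_Suc_eq_le)
    from Q[OF \<Theta> this *(3)] have "Q' (fst ` set (map (apfst \<Theta>) ivs))" unfolding set_apfst .
    then show "shuffle_degen R P A c i q Z \<in> span (Suc (length c)) q Q'"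
      unfolding *(1) v(1)[OF *(2)] span_def by (intro subsetD[OF gen_sub_incl]) (use v(2)[OF *(2)] in blast)
  qed
qed

text \<open>The copies of a product are the union of the copies of its factors, so conditions on the
  factors transfer as soon as they force \<open>Q'\<close> on unions.\<close>

lemma ev_span:
  assumes x: "x \<in> OEl P (length qs)" and n: "n = fst x + sum_list qs"
    and Ys: "degs Ys = qs" "\<And>i. i < length qs \<Longrightarrow> snd (Ys ! i) \<in> span m (qs ! i) (Q i)"
    and Q': "\<And>J. (\<And>i. i < length qs \<Longrightarrow> Q i (J i)) \<Longrightarrow> Q' (\<Union>i\<in>{..<length qs}. J i)"
  shows "snd (ev (B m) x Ys) \<in> span m n Q'"
proof (rule multilin_gen_sub[OF B_ev_multilin[OF x n] B_module B_module span_submodule])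
  let ?k = "length qs"
  let ?G = "\<lambda>i. {snd (vmono m y ivs) | y ivs. vvalid m (qs ! i) y ivs \<and> Q i (fst ` set ivs)}"
  show "degs Ys = qs" by fact
  fix i assume i: "i < ?k"
  show "?G i \<subseteq> carrier (BP m (qs ! i))" using vmono_closed by blast
  show "snd (Ys ! i) \<in> gen_sub R (BP m (qs ! i)) (?G i)" using Ys(2)[OF i] by (simp only: span_def)
next
  let ?k = "length qs"
  let ?G = "\<lambda>i. {snd (vmono m y ivs) | y ivs. vvalid m (qs ! i) y ivs \<and> Q i (fst ` set ivs)}"
  fix Zs assume Zs: "set Zs \<subseteq> El (BP m)" "degs Zs = qs" and G: "\<And>i. i < ?k \<Longrightarrow> snd (Zs ! i) \<in> ?G i"
  have lZ: "length Zs = ?k" by (rule degs_length[OF Zs(2)])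
  have "\<forall>i. \<exists>y ivs. i < ?k \<longrightarrow> snd (Zs ! i) = snd (vmono m y ivs) \<and> vvalid m (qs ! i) y ivs \<and> Q i (fst ` set ivs)"
    using G by blast
  then obtain y ivs where yi: "\<And>i. i < ?k \<Longrightarrow> snd (Zs ! i) = snd (vmono m (y i) (ivs i)) \<and>
      vvalid m (qs ! i) (y i) (ivs i) \<and> Q i (fst ` set (ivs i))" by metis
  define ss where "ss = map (\<lambda>i. (y i, map (apsnd gn) (ivs i))) [0..<?k]"
  have ss: "list_all2 (\<lambda>s q. valid m q (fst s) (snd s)) ss qs"
    using yi vvalid_valid by (simp add: ss_def list_all2_conv_all_nth)
  have Ze: "Zs = map (\<lambda>s. mono m (fst s) (snd s)) ss"
  proof (rule nth_equalityI)
    fix i assume "i < length Zs"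
    then have i: "i < ?k" using lZ by simp
    have "fst (Zs ! i) = fst (vmono m (y i) (ivs i))"
      using degs_nth[OF Zs(2)] i lZ conjunct2[OF mono_El[OF vvalid_valid[OF yi[OF i, THEN conjunct2, THEN conjunct1]]]]
      by (simp add: vmono_def)
    then show "Zs ! i = map (\<lambda>s. mono m (fst s) (snd s)) ss ! i"
      using yi[OF i] i by (simp add: ss_def prod_eq_iff vmono_def)
  qed (simp add: lZ ss_def)
  let ?ivs = "concat (map ivs [0..<?k])"
  have cc: "concat (map snd ss) = map (apsnd gn) ?ivs" by (simp add: ss_def map_concat comp_def)
  let ?z = "ocomp P (map (length \<circ> snd) ss) x (map fst ss)"
  note me = mono_ev[OF x ss n, unfolded cc]
  have E: "set (map snd ?ivs) \<subseteq> El V"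
  proof -
    have "set (map snd (ivs i)) \<subseteq> El V" if "i < ?k" for i using yi[OF that] by (simp add: vvalid_def syms_iff)
    then show ?thesis by fastforce
  qed
  have dd: "degs (map snd (map (apsnd gn) ?ivs)) = degs (map snd ?ivs)" using degs_gn[OF E] by (simp add: comp_def)
  have fi: "fst ` set (map (apsnd gn) ?ivs) = fst ` set ?ivs" by (simp add: image_image)
  have v: "vvalid m n ?z ?ivs"
    using me(1) E unfolding valid_def vvalid_def syms_iff dd fi by simp
  have "fst ` set ?ivs = (\<Union>i\<in>{..<?k}. fst ` set (ivs i))" by (simp add: image_UN atLeast0LessThan)
  then have "Q' (fst ` set ?ivs)" using Q'[of "\<lambda>i. fst ` set (ivs i)"] yi by simp
  then have "snd (vmono m ?z ?ivs) \<in> span m n Q'"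
    unfolding span_def by (intro subsetD[OF gen_sub_incl]) (use v in blast)
  then show "snd (ev (B m) x Zs) \<in> span m n Q'"
    unfolding Ze me(2) vmono_def by (rule submodule_sgn[OF B_module span_submodule])
qed

text \<open>The summand of the shuffle product that belongs to the word \<open>c\<close>, without
  its sign. The total degrees \<open>qs\<close> form a separate argument, so that multilinearity in
  \<open>ts\<close> can be stated.\<close>

definition shuffle_term :: "'o gel \<Rightarrow> int list \<Rightarrow> nat list \<Rightarrow> ('r, 'o, 'a) tot_el gel list \<Rightarrow> ('r, 'o, 'a) cop_el"
  where "shuffle_term x qs c ts = snd (ev (B (Suc (length c))) x (map (\<lambda>i. (qs ! i - int (count_list c i),
    shuffle_degen R P A c i (qs ! i - int (count_list c i)) (snd (ts ! i) (count_list c i)))) [0..<length qs]))"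

text \<open>Internal degree is total degree minus simplicial degree, and the simplicial degrees of
  the factors add up to the length of \<open>c\<close>, because each position carries exactly one
  letter.\<close>

lemma shuffle_term_degree:
  assumes "set c \<subseteq> {..<length qs}"
  shows "fst x + sum_list qs - int (length c) = fst x + sum_list (map (\<lambda>i. qs ! i - int (count_list c i)) [0..<length qs])"
proof -
  have "(\<Sum>i\<leftarrow>[0..<length qs]. qs ! i - int (count_list c i)) = sum_list (map (\<lambda>i. qs ! i) [0..<length qs]) - (\<Sum>i\<leftarrow>[0..<length qs]. int (count_list c i))"
    by (rule sum_list_subtractf)
  then show ?thesis unfolding sum_count_list[OF assms] map_nth by simp
qed

lemma shuffle_term_span:
  assumes x: "x \<in> OEl P (length qs)" and c: "set c \<subseteq> {..<length qs}"
    and ts: "\<And>i. i < length qs \<Longrightarrow> shuffle_degen R P A c i (qs ! i - int (count_list c i)) (snd (ts ! i) (count_list c i))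
      \<in> span (Suc (length c)) (qs ! i - int (count_list c i)) (Q i)"
    and Q': "\<And>J. (\<And>i. i < length qs \<Longrightarrow> Q i (J i)) \<Longrightarrow> Q' (\<Union>i\<in>{..<length qs}. J i)"
  shows "shuffle_term x qs c ts \<in> span (Suc (length c)) (fst x + sum_list qs - int (length c)) Q'"
  unfolding shuffle_term_def
proof (rule ev_span[OF _ shuffle_term_degree[OF c]])
  let ?qs = "map (\<lambda>i. qs ! i - int (count_list c i)) [0..<length qs]"
  show "x \<in> OEl P (length ?qs)" using x by simp
  show "Q' (\<Union>i\<in>{..<length ?qs}. J i)" if "\<And>i. i < length ?qs \<Longrightarrow> Q i (J i)" for J
    using Q'[of J] that by simp
qed (use ts in \<open>simp_all add: comp_def\<close>)

text \<open>The condition \<open>Q i\<close> says that factor \<open>i\<close> covers the positions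
  of its own letter, shifted by one since position \<open>m\<close> of \<open>c\<close> belongs to
  copy \<open>m + 1\<close>. Every position carries a letter, so together the factors cover all
  copies from 1 on.\<close>

lemma shuffle_term_nondeg:
  assumes x: "x \<in> OEl P (length qs)" and c: "set c \<subseteq> {..<length qs}"
    and ts: "\<And>i. i < length qs \<Longrightarrow> snd (ts ! i) (count_list c i) \<in> nondeg (count_list c i) (qs ! i - int (count_list c i))"
  shows "shuffle_term x qs c ts \<in> nondeg (length c) (fst x + sum_list qs - int (length c))"
  unfolding nondeg_span
proof (rule shuffle_term_span[OF x c, where Q = "\<lambda>i J. {k. 1 \<le> k \<and> k \<le> length c \<and> c ! (k - 1) = i} \<subseteq> J"])
  fix i assume i: "i < length qs"
  show "shuffle_degen R P A c i (qs ! i - int (count_list c i)) (snd (ts ! i) (count_list c i))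
      \<in> span (Suc (length c)) (qs ! i - int (count_list c i)) (\<lambda>J. {k. 1 \<le> k \<and> k \<le> length c \<and> c ! (k - 1) = i} \<subseteq> J)"
  proof (rule shuffle_degen_span[OF ts[OF i, unfolded nondeg_span]])
    fix \<Theta> J assume \<Theta>: "inj \<Theta>" "\<Theta> 0 = (0::nat)" "\<Theta> ` {..count_list c i} = {k. k \<le> length c \<and> \<not> (1 \<le> k \<and> c ! (k - 1) \<noteq> i)}"
      and J: "{1..count_list c i} \<subseteq> J"
    show "{k. 1 \<le> k \<and> k \<le> length c \<and> c ! (k - 1) = i} \<subseteq> \<Theta> ` J"
    proof
      fix k assume "k \<in> {k. 1 \<le> k \<and> k \<le> length c \<and> c ! (k - 1) = i}"
      then have k: "1 \<le> k" "k \<in> \<Theta> ` {..count_list c i}" unfolding \<Theta>(3) by auto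
      then obtain j where j: "k = \<Theta> j" "j \<le> count_list c i" by blast
      \<comment> \<open>Copy 0 is sent to copy 0, so a copy \<open>k\<close> with
        \<open>1 \<le> k\<close> comes from one of the copies that are known to occur.\<close>
      have "j \<noteq> 0" using j(1) k(1) \<Theta>(2) by (metis not_one_le_zero)
      then have "j \<in> {1..count_list c i}" using j(2) by simp
      then show "k \<in> \<Theta> ` J" using J j(1) by blast
    qed
  qed
next
  fix J assume J: "\<And>i. i < length qs \<Longrightarrow> {k. 1 \<le> k \<and> k \<le> length c \<and> c ! (k - 1) = i} \<subseteq> J i"
  show "{1..length c} \<subseteq> (\<Union>i\<in>{..<length qs}. J i)"
  proof
    fix k assume "k \<in> {1..length c}"
    then have k: "1 \<le> k" "k \<le> length c" by auto
    then have "c ! (k - 1) < length qs" using c nth_mem[of "k - 1" c] by (auto simp: subset_iff)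
    then show "k \<in> (\<Union>i\<in>{..<length qs}. J i)" using J[of "c ! (k - 1)"] k by blast
  qed
qed

text \<open>A missing copy of factor \<open>j\<close> leaves a gap at a position of letter
  \<open>j\<close>. The other factors cannot fill it, since apart from copy 0 they reach only the
  positions of their own letters; for this reason \<open>Q i\<close> also bounds the copies of every
  factor from above.\<close>

lemma shuffle_term_deg:
  assumes x: "x \<in> OEl P (length qs)" and c: "set c \<subseteq> {..<length qs}"
    and ts: "\<And>i. i < length qs \<Longrightarrow> snd (ts ! i) (count_list c i) \<in> carrier (BP (Suc (count_list c i)) (qs ! i - int (count_list c i)))"
    and j: "j < length qs" "snd (ts ! j) (count_list c j) \<in> deg_sub (count_list c j) (qs ! j - int (count_list c j))"
  shows "shuffle_term x qs c ts \<in> deg_sub (length c) (fst x + sum_list qs - int (length c))"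
  unfolding deg_sub_span
proof (rule shuffle_term_span[OF x c, where Q = "\<lambda>i J. J \<subseteq> {k. k \<le> length c \<and> \<not> (1 \<le> k \<and> c ! (k - 1) \<noteq> i)} \<and>
    (i = j \<longrightarrow> (\<exists>k. 1 \<le> k \<and> k \<le> length c \<and> c ! (k - 1) = j \<and> k \<notin> J))"])
  fix i assume i: "i < length qs"
  let ?Q = "\<lambda>J. J \<subseteq> {k. k \<le> length c \<and> \<not> (1 \<le> k \<and> c ! (k - 1) \<noteq> i)} \<and>
    (i = j \<longrightarrow> (\<exists>k. 1 \<le> k \<and> k \<le> length c \<and> c ! (k - 1) = j \<and> k \<notin> J))"
  show "shuffle_degen R P A c i (qs ! i - int (count_list c i)) (snd (ts ! i) (count_list c i))
      \<in> span (Suc (length c)) (qs ! i - int (count_list c i)) ?Q"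
  proof (cases "i = j")
    case False
    show ?thesis
      by (rule shuffle_degen_span[OF subsetD[OF carrier_span ts[OF i]]]) (use False in blast)
  next
    case True
    show ?thesis
    proof (rule shuffle_degen_span[OF j(2)[folded True, unfolded deg_sub_span]])
      fix \<Theta> J assume \<Theta>: "inj \<Theta>" "\<Theta> 0 = (0::nat)" "\<Theta> ` {..count_list c i} = {k. k \<le> length c \<and> \<not> (1 \<le> k \<and> c ! (k - 1) \<noteq> i)}"
        and J: "J \<subseteq> {..count_list c i}" "\<not> {1..count_list c i} \<subseteq> J"
      obtain b where b: "b \<in> {1..count_list c i}" "b \<notin> J" using J(2) by blast
      have b0: "b \<noteq> 0" using b(1) by simp
      \<comment> \<open>Injectivity keeps the gap away from copy 0, whose absence would not make the
        product degenerate.\<close>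
      have "\<Theta> b \<noteq> \<Theta> 0" using b0 \<Theta>(1) by (simp add: inj_eq)
      then have k1: "1 \<le> \<Theta> b" unfolding \<Theta>(2) by simp
      have "\<Theta> b \<in> \<Theta> ` {..count_list c i}" using b(1) by (intro imageI) simp
      then have "\<Theta> b \<le> length c \<and> c ! (\<Theta> b - 1) = i" unfolding \<Theta>(3) using k1 by blast
      moreover have "\<Theta> b \<notin> \<Theta> ` J" using b(2) \<Theta>(1) by (simp add: inj_image_mem_iff)
      moreover have "\<Theta> ` J \<subseteq> {k. k \<le> length c \<and> \<not> (1 \<le> k \<and> c ! (k - 1) \<noteq> i)}"
        unfolding \<Theta>(3)[symmetric] using J(1) by (rule image_mono)
      ultimately show "?Q (\<Theta> ` J)" using k1 True by blast
    qed
  qed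
next
  fix J assume J: "\<And>i. i < length qs \<Longrightarrow> J i \<subseteq> {k. k \<le> length c \<and> \<not> (1 \<le> k \<and> c ! (k - 1) \<noteq> i)} \<and>
    (i = j \<longrightarrow> (\<exists>k. 1 \<le> k \<and> k \<le> length c \<and> c ! (k - 1) = j \<and> k \<notin> J i))"
  obtain k where k: "1 \<le> k" "k \<le> length c" "c ! (k - 1) = j" "k \<notin> J j" using J[OF j(1)] by blast
  have "k \<notin> J i" if "i < length qs" for i using J[OF that] k by (cases "i = j") blast+
  moreover have "k \<in> {1..length c}" using k by simp
  ultimately show "\<not> {1..length c} \<subseteq> (\<Union>i\<in>{..<length qs}. J i)" by blast
qed

lemma shuffle_term_multilin:
  assumes x: "x \<in> OEl P (length qs)" and c: "set c \<subseteq> {..<length qs}"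
  shows "multilin R (tot_part R P A) (BP (Suc (length c)) (fst x + sum_list qs - int (length c))) qs (shuffle_term x qs c)"
proof -
  let ?qs = "map (\<lambda>i. qs ! i - int (count_list c i)) [0..<length qs]"
  let ?h = "\<lambda>i f. shuffle_degen R P A c i (qs ! i - int (count_list c i)) (f (count_list c i))"
  have x': "x \<in> OEl P (length ?qs)" using x by simp
  have h: "?h i \<in> lin R (tot_part R P A (qs ! i)) (BP (Suc (length c)) (?qs ! i))" if i: "i < length ?qs" for i
  proof -
    have "(\<lambda>f. f (count_list c i)) \<in> lin R (tot_part R P A (qs ! i)) (BP (Suc (count_list c i)) (qs ! i - int (count_list c i)))"
      using direct_sum_eval_lin[where I = UNIV and M = "bidegree R P A (qs ! i)" and i = "count_list c i" and R = R]
      by (simp add: tot_part_def bidegree_def cyc_def)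
    from lin_comp[OF this shuffle_degen_lin] show ?thesis using i by simp
  qed
  have "multilin R (tot_part R P A) (BP (Suc (length c)) (fst x + sum_list qs - int (length c))) qs
      (\<lambda>as. snd (ev (B (Suc (length c))) x (map (\<lambda>i. (?qs ! i, ?h i (snd (as ! i)))) [0..<length ?qs])))"
    by (rule multilin_precomp[OF B_ev_multilin[OF x' shuffle_term_degree[OF c]] _ h]) simp_all
  moreover have "map (\<lambda>i. (?qs ! i, ?h i (snd (as ! i)))) [0..<length ?qs] =
      map (\<lambda>i. (qs ! i - int (count_list c i), ?h i (snd (as ! i)))) [0..<length qs]" for as :: "('r, 'o, 'a) tot_el gel list"
    by (intro map_cong) simp_all
  ultimately show ?thesis unfolding shuffle_term_def[abs_def] by (simp only:)
qed

lemma shuffle_term_zero: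
  assumes x: "x \<in> OEl P (length qs)" and c: "set c \<subseteq> {..<length qs}"
    and ts: "\<And>i. i < length qs \<Longrightarrow> snd (ts ! i) (count_list c i) \<in> carrier (BP (Suc (count_list c i)) (qs ! i - int (count_list c i)))"
    and j: "j < length qs" "snd (ts ! j) (count_list c j) = \<zero>\<^bsub>BP (Suc (count_list c j)) (qs ! j - int (count_list c j))\<^esub>"
  shows "shuffle_term x qs c ts = \<zero>\<^bsub>BP (Suc (length c)) (fst x + sum_list qs - int (length c))\<^esub>"
  unfolding shuffle_term_def
proof (rule multilin_zero[OF B_ev_multilin[OF _ shuffle_term_degree[OF c]] B_module B_module])
  let ?qs = "map (\<lambda>i. qs ! i - int (count_list c i)) [0..<length qs]"
  let ?Y = "map (\<lambda>i. (qs ! i - int (count_list c i),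
    shuffle_degen R P A c i (qs ! i - int (count_list c i)) (snd (ts ! i) (count_list c i)))) [0..<length qs]"
  show "x \<in> OEl P (length ?qs)" using x by simp
  show "set ?Y \<subseteq> El (BP (Suc (length c)))" using lin_closed[OF shuffle_degen_lin ts] by (auto simp: El_iff)
  show "degs ?Y = ?qs" by simp
  show "j < length ?Y" using j(1) by simp
  show "snd (?Y ! j) = \<zero>\<^bsub>BP (Suc (length c)) (fst (?Y ! j))\<^esub>"
    using j lin_zero[OF shuffle_degen_lin B_module B_module] by simp
qed

end

section \<open>The total complex\<close>

lemma direct_sum_linI:
  assumes f: "\<And>x. x \<in> carrier N \<Longrightarrow> f x \<in> carrier (direct_sum I M)"
    and l: "\<And>i. i \<in> I \<Longrightarrow> (\<lambda>x. f x i) \<in> lin R N (M i)"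
    and N: "module R N" and M: "\<And>i. i \<in> I \<Longrightarrow> module R (M i)" and R: "cring R"
  shows "f \<in> lin R N (direct_sum I M)"
proof (rule linI)
  interpret N: module R N by fact
  interpret D: module R "direct_sum I M" by (rule direct_sum_module[OF R M])
  show "f x \<in> carrier (direct_sum I M)" if "x \<in> carrier N" for x by (rule f[OF that])
  show "f (x \<oplus>\<^bsub>N\<^esub> y) = f x \<oplus>\<^bsub>direct_sum I M\<^esub> f y" if x: "x \<in> carrier N" and y: "y \<in> carrier N" for x y
    by (rule direct_sum_ext[OF f[OF N.a_closed[OF x y]] D.a_closed[OF f[OF x] f[OF y]]])
      (simp add: direct_sum_add lin_add[OF l x y])
  show "f (r \<odot>\<^bsub>N\<^esub> x) = r \<odot>\<^bsub>direct_sum I M\<^esub> f x" if r: "r \<in> carrier R" and x: "x \<in> carrier N" for r x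
    by (rule direct_sum_ext[OF f[OF N.smult_closed[OF r x]] D.smult_closed[OF r f[OF x]]])
      (simp add: direct_sum_smult lin_smult[OF l r x])
qed

context almost_free_ctx
begin

abbreviation "T \<equiv> tot_part R P A"

lemma bidegree_eq: "bidegree R P A n p = BP (Suc p) (n - int p)"
  by (simp add: bidegree_def cyc_def)

lemma T_module: "module R (T n)"
  unfolding tot_part_def by (rule direct_sum_module[OF R]) (simp add: bidegree_eq B_module)

lemma T_carrier: "f \<in> carrier (T n) \<longleftrightarrow> (\<forall>p. f p \<in> carrier (BP (Suc p) (n - int p))) \<and>
    finite {p. f p \<noteq> \<zero>\<^bsub>BP (Suc p) (n - int p)\<^esub>}"
  by (simp add: tot_part_def direct_sum_carrier bidegree_eq PiE_iff)

lemma T_eval: "(\<lambda>f. f p) \<in> lin R (T n) (BP (Suc p) (n - int p))"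
  using direct_sum_eval_lin[where I = UNIV and M = "bidegree R P A n" and i = p and R = R]
  by (simp add: tot_part_def bidegree_eq)

lemma T_minus: "f \<in> carrier (T n) \<Longrightarrow> g \<in> carrier (T n) \<Longrightarrow> (f \<ominus>\<^bsub>T n\<^esub> g) p = f p \<ominus>\<^bsub>BP (Suc p) (n - int p)\<^esub> g p"
  by (rule lin_minus[OF T_eval T_module B_module])

lemma T_linI:
  assumes "\<And>x. x \<in> carrier N \<Longrightarrow> finite {p. f x p \<noteq> \<zero>\<^bsub>BP (Suc p) (n - int p)\<^esub>}"
    and l: "\<And>p. (\<lambda>x. f x p) \<in> lin R N (BP (Suc p) (n - int p))" and "module R N"
  shows "f \<in> lin R N (T n)"
proof -
  have "f x \<in> carrier (T n)" if "x \<in> carrier N" for x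
    unfolding T_carrier using assms(1)[OF that] lin_closed[OF l that] by blast
  then show ?thesis
    unfolding tot_part_def by (intro direct_sum_linI) (simp_all add: bidegree_eq l B_module assms(3) R)
qed

definition tot_sub :: "(nat \<Rightarrow> int \<Rightarrow> ('r, 'o, 'a) cop_el set) \<Rightarrow> int \<Rightarrow> ('r, 'o, 'a) tot_el set"
  where "tot_sub S n = {f \<in> carrier (T n). \<forall>p. f p \<in> S p (n - int p)}"

lemma tot_sub_submodule:
  assumes S: "\<And>p q. submodule (S p q) R (BP (Suc p) q)"
  shows "submodule (tot_sub S n) R (T n)"
proof -
  have "tot_sub S n = (\<Inter>p. {f \<in> carrier (T n). f p \<in> S p (n - int p)})" by (auto simp: tot_sub_def)
  then show ?thesis
    by (simp only:) (rule submodule_Inter[OF T_module], use submodule_preimage[OF T_eval T_module B_module S] in auto)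
qed

lemma tot_plus_eq: "tot_plus R P A V \<phi> n = tot_sub nondeg n"
  by (simp add: tot_plus_def tot_sub_def Tot_def plus_sub_eq)

lemma tot_dif_apply: "tot_dif R P A n f p = face_sum p (n - 1 - int p) (f (Suc p))
    \<oplus>\<^bsub>BP (Suc p) (n - 1 - int p)\<^esub> sgn_mod (BP (Suc p) (n - 1 - int p)) (int p) (dif (B (Suc p)) (n - int p) (f p))"
proof -
  have "n - int (Suc p) = n - 1 - int p" by simp
  then show ?thesis unfolding tot_dif_def face_sum_def bidegree_eq cyc_def by (simp only:)
qed

lemma tot_dif_lin: "tot_dif R P A n \<in> lin R (T n) (T (n - 1))"
proof (rule T_linI[OF _ _ T_module])
  have e: "n - int (Suc p) = n - 1 - int p" "n - int p - 1 = n - 1 - int p" for p by simp_all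
  have fs: "(\<lambda>f. face_sum p (n - 1 - int p) (f (Suc p))) \<in> lin R (T n) (BP (Suc p) (n - 1 - int p))" for p
    using lin_comp[OF T_eval[of "Suc p" n, unfolded e] face_sum_lin] .
  have ds: "(\<lambda>f. dif (B (Suc p)) (n - int p) (f p)) \<in> lin R (T n) (BP (Suc p) (n - 1 - int p))" for p
    using lin_comp[OF T_eval B_dif, of p n] unfolding e .
  show "(\<lambda>f. tot_dif R P A n f p) \<in> lin R (T n) (BP (Suc p) (n - 1 - int p))" for p
    unfolding tot_dif_apply by (rule lin_plus[OF fs lin_sgn_mod[OF ds B_module] B_module])
  fix f assume f: "f \<in> carrier (T n)"
  let ?Z = "{p. f p \<noteq> \<zero>\<^bsub>BP (Suc p) (n - int p)\<^esub>}"
  have "tot_dif R P A n f p = \<zero>\<^bsub>BP (Suc p) (n - 1 - int p)\<^esub>" if "p \<notin> ?Z" "Suc p \<notin> ?Z" for p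
  proof -
    interpret module R "BP (Suc p) (n - 1 - int p)" by (rule B_module)
    have "face_sum p (n - 1 - int p) (f (Suc p)) = \<zero>\<^bsub>BP (Suc p) (n - 1 - int p)\<^esub>"
      using that(2) lin_zero[OF face_sum_lin B_module B_module, of p "n - 1 - int p"] unfolding mem_Collect_eq e by simp
    moreover have "dif (B (Suc p)) (n - int p) (f p) = \<zero>\<^bsub>BP (Suc p) (n - 1 - int p)\<^esub>"
      using that(1) lin_zero[OF B_dif B_module B_module, of "Suc p" "n - int p"] unfolding mem_Collect_eq e by simp
    ultimately show ?thesis unfolding tot_dif_apply by simp
  qed
  \<comment> \<open>Component \<open>p\<close> of the differential depends only on the components
    \<open>p\<close> and \<open>p + 1\<close>, so the support grows at most by a shift.\<close>
  then have "{p. tot_dif R P A n f p \<noteq> \<zero>\<^bsub>BP (Suc p) (n - 1 - int p)\<^esub>} \<subseteq> ?Z \<union> Suc -` ?Z" by blast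
  moreover have fZ: "finite ?Z" using f by (simp add: T_carrier)
  then have "finite (?Z \<union> Suc -` ?Z)" using finite_vimageI[OF fZ inj_Suc] by blast
  ultimately show "finite {p. tot_dif R P A n f p \<noteq> \<zero>\<^bsub>BP (Suc p) (n - 1 - int p)\<^esub>}" by (rule finite_subset)
qed

lemma tot_dif_sub:
  assumes S: "\<And>p q. submodule (S p q) R (BP (Suc p) q)"
    and face: "\<And>p q X. X \<in> S (Suc p) q \<Longrightarrow> face_sum p q X \<in> S p q"
    and dif: "\<And>p q X. X \<in> S p q \<Longrightarrow> dif (B (Suc p)) q X \<in> S p (q - 1)"
    and f: "f \<in> tot_sub S n"
  shows "tot_dif R P A n f \<in> tot_sub S (n - 1)"
proof -
  have e: "n - int (Suc p) = n - 1 - int p" "n - int p - 1 = n - 1 - int p" for p by simp_all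
  have fp: "f p \<in> S p (n - int p)" for p using f by (simp add: tot_sub_def)
  have "tot_dif R P A n f p \<in> S p (n - 1 - int p)" for p
    unfolding tot_dif_apply
    by (rule submodule_add[OF B_module S face[OF fp[of "Suc p", unfolded e]] submodule_sgn[OF B_module S dif[OF fp, unfolded e]]])
  moreover have "tot_dif R P A n f \<in> carrier (T (n - 1))"
    by (rule lin_closed[OF tot_dif_lin]) (use f in \<open>simp add: tot_sub_def\<close>)
  ultimately show ?thesis by (simp add: tot_sub_def)
qed

lemma Tot_sel: "gpart (Tot R P A) = T" "dif (Tot R P A) = tot_dif R P A" "ev (Tot R P A) = tot_ev R P A"
  by (simp_all add: Tot_def)

lemma single_T: "single UNIV (bidegree R P A n) p \<in> lin R (BP (Suc p) (n - int p)) (T n)"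
  using single_lin[where I = UNIV and M = "bidegree R P A n" and i = p and R = R] B_module
  by (simp add: tot_part_def bidegree_eq)

text \<open>Stability of \<open>deg_sub\<close> under faces and the internal differential makes the
  right-hand side a subcomplex that contains the degenerate elements. Conversely, each component of
  a chain in it is generated by degenerate elements, and a chain is the finite sum of its
  components.\<close>

lemma degenerate_sub_eq: "degenerate_sub R P A n = tot_sub deg_sub n"
proof
  have sub: "subcomplex R (Tot R P A) (tot_sub deg_sub)"
    unfolding subcomplex_def gr_sub_def Tot_sel
    using tot_sub_submodule[OF deg_sub_submodule] tot_dif_sub[OF deg_sub_submodule face_sum_deg dif_deg] by blast
  have "single UNIV (bidegree R P A (q + int (Suc p))) (Suc p) (degen R P A p i q X) \<in> tot_sub deg_sub (q + int (Suc p))"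
    if X: "X \<in> carrier (gpart (cyc R P A p) q)" and i: "i \<le> p" for p q i X
  proof -
    have d: "degen R P A p i q X \<in> deg_sub (Suc p) q" using degen_deg[OF i] X by (simp add: cyc_def)
    have e: "q + int (Suc p) - int (Suc p) = q" by simp
    have c: "degen R P A p i q X \<in> carrier (BP (Suc (Suc p)) (q + int (Suc p) - int (Suc p)))"
      unfolding e using d submodule_subset[OF B_module deg_sub_submodule] by blast
    have "single UNIV (bidegree R P A (q + int (Suc p))) (Suc p) (degen R P A p i q X) k \<in> deg_sub k (q + int (Suc p) - int k)" for k
      using d submodule_zero[OF B_module deg_sub_submodule] by (simp add: single_apply bidegree_eq)
    then show ?thesis using lin_closed[OF single_T c] by (simp add: tot_sub_def)
  qed
  with sub show "degenerate_sub R P A n \<subseteq> tot_sub deg_sub n" unfolding degenerate_sub_def by blast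
  show "tot_sub deg_sub n \<subseteq> degenerate_sub R P A n"
  proof
    fix f assume f: "f \<in> tot_sub deg_sub n"
    show "f \<in> degenerate_sub R P A n"
      unfolding degenerate_sub_def
    proof clarify
      fix S assume S: "subcomplex R (Tot R P A) S" and deg: "\<forall>p q i. \<forall>X\<in>carrier (gpart (cyc R P A p) q). i \<le> p \<longrightarrow>
        single UNIV (bidegree R P A (q + int (Suc p))) (Suc p) (degen R P A p i q X) \<in> S (q + int (Suc p))"
      have Sm: "submodule (S n) R (T n)" for n using S by (simp add: subcomplex_def gr_sub_def Tot_sel)
      have "single UNIV (bidegree R P A n) p (f p) \<in> S n" for p
      proof (cases p)
        case 0
        have "f 0 \<in> deg_sub 0 (n - int 0)" using f unfolding tot_sub_def by blast
        then have "f p = \<zero>\<^bsub>BP (Suc p) (n - int p)\<^esub>" unfolding 0 by (simp add: deg_sub_0)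
        then show ?thesis using lin_zero[OF single_T B_module T_module] submodule_zero[OF T_module Sm] by simp
      next
        case (Suc p')
        define q where "q = n - int p"
        have n: "n = q + int (Suc p')" by (simp add: q_def Suc)
        have fp: "f p \<in> deg_sub (Suc p') q" using f unfolding tot_sub_def q_def Suc by blast
        \<comment> \<open>The elements whose placement in simplicial degree \<open>p\<close> lies in
          the given subcomplex; being a submodule, it is a candidate for
          \<open>deg_sub_Suc_least\<close>.\<close>
        let ?H = "{X \<in> carrier (BP (Suc p) q). single UNIV (bidegree R P A n) p X \<in> S n}"
        have "submodule ?H R (BP (Suc p) q)"
          unfolding q_def by (rule submodule_preimage[OF single_T B_module T_module Sm])
        then have "deg_sub (Suc p') q \<subseteq> ?H"
          unfolding Suc
        proof (rule deg_sub_Suc_least)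
          fix i X assume i: "i \<le> p'" and X: "X \<in> carrier (BP (Suc p') q)"
          have "single UNIV (bidegree R P A n) (Suc p') (degen R P A p' i q X) \<in> S n"
            using deg i X unfolding n cyc_def by blast
          then show "degen R P A p' i q X \<in> {X \<in> carrier (BP (Suc (Suc p')) q). single UNIV (bidegree R P A n) (Suc p') X \<in> S n}"
            using lin_closed[OF degen_lin[OF i] X] by blast
        qed
        then show ?thesis using fp by blast
      qed
      then show "f \<in> S n"
        using direct_sum_single_mem[OF R, where I = UNIV and M = "bidegree R P A n" and H = "S n" and f = f]
          Sm[of n] f B_module by (simp add: tot_part_def bidegree_eq tot_sub_def)
    qed
  qed
qed

subsection \<open>The evaluation product\<close>

abbreviation words :: "nat \<Rightarrow> nat \<Rightarrow> nat list set"
  where "words N k \<equiv> {c. length c = N \<and> set c \<subseteq> {..<k}}"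

lemma finite_words: "finite (words N k)"
  by (rule finite_subset[OF _ finite_lists_length_eq[OF finite_lessThan, of k N]]) blast

lemma tot_ev_deg: "degs ts = qs \<Longrightarrow> fst (tot_ev R P A x ts) = fst x + sum_list qs"
  by (simp add: tot_ev_def Let_def)

lemma tot_ev_apply:
  assumes x: "x \<in> OEl P (length qs)" and ts: "set ts \<subseteq> El T" and d: "degs ts = qs"
  shows "snd (tot_ev R P A x ts) N = (\<Oplus>\<^bsub>BP (Suc N) (fst x + sum_list qs - int N)\<^esub>c\<in>words N (length qs).
      sgn_mod (BP (Suc N) (fst x + sum_list qs - int N)) (shuffle_exp (fst x) qs c) (shuffle_term x qs c ts))"
proof -
  let ?M = "BP (Suc N) (fst x + sum_list qs - int N)"
  let ?ev = "\<lambda>c. snd (ev (cyc R P A N) x (map (\<lambda>i. let p = count_list c i; q = fst (ts ! i) - int p in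
      (q, shuffle_degen R P A c i q (snd (ts ! i) p))) [0..<length ts]))"
  have l: "length ts = length qs" by (rule degs_length[OF d])
  have t: "?ev c = shuffle_term x qs c ts" if "c \<in> words N (length qs)" for c
  proof -
    have "map (\<lambda>i. let p = count_list c i; q = fst (ts ! i) - int p in
        (q, shuffle_degen R P A c i q (snd (ts ! i) p))) [0..<length ts] =
      map (\<lambda>i. (qs ! i - int (count_list c i),
        shuffle_degen R P A c i (qs ! i - int (count_list c i)) (snd (ts ! i) (count_list c i)))) [0..<length qs]"
      unfolding l by (rule map_cong[OF refl]) (use degs_nth[OF d] l in \<open>simp add: Let_def\<close>)
    then show ?thesis using that unfolding shuffle_term_def cyc_def by simp
  qed
  have c: "shuffle_term x qs c ts \<in> carrier ?M" if "c \<in> words N (length qs)" for c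
    using multilin_closed[OF shuffle_term_multilin[OF x, of c] ts d] that by simp
  have "snd (tot_ev R P A x ts) N = (\<Oplus>\<^bsub>?M\<^esub>c\<in>words N (length qs). sgn_mod ?M (shuffle_exp (fst x) qs c) (?ev c))"
    unfolding tot_ev_def Let_def snd_conv d l bidegree_eq ..
  also have "\<dots> = (\<Oplus>\<^bsub>?M\<^esub>c\<in>words N (length qs). sgn_mod ?M (shuffle_exp (fst x) qs c) (shuffle_term x qs c ts))"
    by (rule module_finsum_cong[OF B_module _ module_sgn_closed[OF B_module c]]) (simp_all only: t)
  finally show ?thesis .
qed

text \<open>Signs and the sum over words are harmless for membership in a submodule, so each shuffle
  term can be treated separately.\<close>

lemma tot_ev_mem:
  assumes x: "x \<in> OEl P (length qs)" and ts: "set ts \<subseteq> El T" and d: "degs ts = qs"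
    and S: "submodule S R (BP (Suc N) (fst x + sum_list qs - int N))"
    and m: "\<And>c. length c = N \<Longrightarrow> set c \<subseteq> {..<length qs} \<Longrightarrow> shuffle_term x qs c ts \<in> S"
  shows "snd (tot_ev R P A x ts) N \<in> S"
  unfolding tot_ev_apply[OF x ts d]
  by (rule submodule_finsum[OF B_module S submodule_sgn[OF B_module S m]]) auto

lemma entry_closed:
  assumes "set ts \<subseteq> El T" "degs ts = qs" "i < length qs"
  shows "snd (ts ! i) p \<in> carrier (BP (Suc p) (qs ! i - int p))"
proof -
  have l: "i < length ts" using degs_length[OF assms(2)] assms(3) by simp
  show ?thesis using El_nth[OF assms(1) l] unfolding degs_nth[OF assms(2) l] T_carrier by blast
qed

text \<open>If all factors vanish above simplicial degree \<open>b\<close> and there are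
  \<open>k\<close> of them, then a word longer than \<open>k * b\<close> repeats some letter more
  than \<open>b\<close> times, and the corresponding term has a zero factor.\<close>

lemma tot_ev_support:
  assumes x: "x \<in> OEl P (length qs)" and ts: "set ts \<subseteq> El T" "degs ts = qs"
  shows "finite {N. snd (tot_ev R P A x ts) N \<noteq> \<zero>\<^bsub>BP (Suc N) (fst x + sum_list qs - int N)\<^esub>}"
proof -
  let ?k = "length qs"
  have l: "length ts = ?k" by (rule degs_length[OF ts(2)])
  let ?Z = "\<lambda>i. {p. snd (ts ! i) p \<noteq> \<zero>\<^bsub>BP (Suc p) (qs ! i - int p)\<^esub>}"
  have "finite (?Z i)" if "i < ?k" for i
    using El_nth[OF ts(1), of i] degs_nth[OF ts(2), of i] that l by (simp add: T_carrier)
  then have "finite (\<Union>i\<in>{..<?k}. ?Z i)" by blast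
  then obtain b where b: "\<forall>p\<in>(\<Union>i\<in>{..<?k}. ?Z i). p \<le> b" unfolding finite_nat_set_iff_bounded_le by blast
  have "snd (tot_ev R P A x ts) N = \<zero>\<^bsub>BP (Suc N) (fst x + sum_list qs - int N)\<^esub>" if N: "?k * b < N" for N
  proof -
    have "snd (tot_ev R P A x ts) N \<in> {\<zero>\<^bsub>BP (Suc N) (fst x + sum_list qs - int N)\<^esub>}"
    proof (rule tot_ev_mem[OF x ts submodule_zero_sub[OF B_module]])
      fix c assume c: "length c = N" "set c \<subseteq> {..<?k}"
      have "\<exists>j<?k. b < count_list c j"
      proof (rule ccontr)
        assume "\<not> (\<exists>j<?k. b < count_list c j)"
        then have "\<forall>j<?k. count_list c j \<le> b" by (meson not_less)
        then have "(\<Sum>i\<leftarrow>[0..<?k]. int (count_list c i)) \<le> (\<Sum>i\<leftarrow>[0..<?k]. int b)"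
          by (intro sum_list_mono) simp
        then have "int N \<le> int ?k * int b" unfolding sum_count_list[OF c(2)] c(1) by (simp add: sum_list_triv)
        then have "N \<le> ?k * b" by (metis of_nat_le_iff of_nat_mult)
        then show False using N by simp
      qed
      then obtain j where j: "j < ?k" "b < count_list c j" by blast
      then have "count_list c j \<notin> ?Z j" using b by (meson UN_I lessThan_iff not_less)
      then have z: "snd (ts ! j) (count_list c j) = \<zero>\<^bsub>BP (Suc (count_list c j)) (qs ! j - int (count_list c j))\<^esub>" by blast
      show "shuffle_term x qs c ts \<in> {\<zero>\<^bsub>BP (Suc N) (fst x + sum_list qs - int N)\<^esub>}"
        using shuffle_term_zero[OF x c(2) entry_closed[OF ts] j(1) z] c(1) by simp
    qed
    then show ?thesis by simp
  qed
  then have "{N. snd (tot_ev R P A x ts) N \<noteq> \<zero>\<^bsub>BP (Suc N) (fst x + sum_list qs - int N)\<^esub>} \<subseteq> {..?k * b}"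
    by (auto simp: not_less[symmetric])
  then show ?thesis by (rule finite_subset) simp
qed

lemma tot_ev_multilin:
  assumes x: "x \<in> OEl P (length qs)"
  shows "multilin R T (T (fst x + sum_list qs)) qs (\<lambda>ts. snd (tot_ev R P A x ts))"
proof -
  let ?n = "fst x + sum_list qs"
  let ?g = "\<lambda>N ts. (\<Oplus>\<^bsub>BP (Suc N) (?n - int N)\<^esub>c\<in>words N (length qs).
      sgn_mod (BP (Suc N) (?n - int N)) (shuffle_exp (fst x) qs c) (shuffle_term x qs c ts))"
  have m: "multilin R T (BP (Suc N) (?n - int N)) qs (?g N)" for N
    by (rule multilin_sum[OF T_module B_module finite_words multilin_sgn[OF _ B_module]])
      (use shuffle_term_multilin[OF x] in auto)
  show ?thesis
  proof (rule multilinI)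
    fix ts assume ts: "set ts \<subseteq> El T" "degs ts = qs"
    show c: "snd (tot_ev R P A x ts) \<in> carrier (T ?n)"
      unfolding T_carrier using tot_ev_support[OF x ts] multilin_closed[OF m ts] unfolding tot_ev_apply[OF x ts] by blast
    fix i assume i: "i < length ts"
    show "(\<lambda>u. snd (tot_ev R P A x (ts[i := (fst (ts ! i), u)]))) \<in> lin R (T (fst (ts ! i))) (T ?n)"
    proof (rule T_linI[OF _ _ T_module])
      fix u assume u: "u \<in> carrier (T (fst (ts ! i)))"
      have "set (ts[i := (fst (ts ! i), u)]) \<subseteq> El T" by (rule El_update[OF ts(1)]) (use u in simp)
      from tot_ev_support[OF x this] show "finite {p. snd (tot_ev R P A x (ts[i := (fst (ts ! i), u)])) p \<noteq> \<zero>\<^bsub>BP (Suc p) (?n - int p)\<^esub>}"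
        unfolding degs_update using ts(2) by blast
    next
      fix N
      have "snd (tot_ev R P A x (ts[i := (fst (ts ! i), u)])) N = ?g N (ts[i := (fst (ts ! i), u)])"
        if u: "u \<in> carrier (T (fst (ts ! i)))" for u
        by (rule tot_ev_apply[OF x El_update[OF ts(1)]]) (use degs_update[of ts i u] ts(2) u in simp_all)
      then show "(\<lambda>u. snd (tot_ev R P A x (ts[i := (fst (ts ! i), u)])) N) \<in> lin R (T (fst (ts ! i))) (BP (Suc N) (?n - int N))"
        by (rule lin_cong[OF multilin_lin[OF m ts i] T_module])
    qed
  qed
qed

lemma tot_ev_nondeg:
  assumes x: "x \<in> OEl P (length ts)" and ts: "\<And>t. t \<in> set ts \<Longrightarrow> snd t \<in> tot_sub nondeg (fst t)"
  shows "snd (tot_ev R P A x ts) \<in> tot_sub nondeg (fst (tot_ev R P A x ts))"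
proof -
  let ?qs = "degs ts"
  have x': "x \<in> OEl P (length ?qs)" using x by simp
  have tE: "set ts \<subseteq> El T" using ts by (auto simp: El_iff tot_sub_def)
  have "snd (tot_ev R P A x ts) N \<in> nondeg N (fst x + sum_list ?qs - int N)" for N
  proof (rule tot_ev_mem[OF x' tE refl nondeg_submodule])
    fix c assume c: "length c = N" "set c \<subseteq> {..<length ?qs}"
    have "snd (ts ! i) (count_list c i) \<in> nondeg (count_list c i) (?qs ! i - int (count_list c i))" if "i < length ?qs" for i
      using ts[OF nth_mem, of i] that by (simp add: tot_sub_def)
    from shuffle_term_nondeg[OF x' c(2) this]
    show "shuffle_term x ?qs c ts \<in> nondeg N (fst x + sum_list ?qs - int N)" unfolding c(1) .
  qed
  then show ?thesis
    using multilin_closed[OF tot_ev_multilin[OF x'] tE refl] by (simp add: tot_sub_def tot_ev_deg[OF refl])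
qed

lemma tot_ev_degenerate:
  assumes x: "x \<in> OEl P (length qs)" and ts: "degs ts = qs" "set ts \<subseteq> El T"
    and j: "j < length ts" "snd (ts ! j) \<in> tot_sub deg_sub (qs ! j)"
  shows "snd (tot_ev R P A x ts) \<in> tot_sub deg_sub (fst x + sum_list qs)"
proof -
  have "snd (tot_ev R P A x ts) N \<in> deg_sub N (fst x + sum_list qs - int N)" for N
  proof (rule tot_ev_mem[OF x ts(2,1) deg_sub_submodule])
    fix c assume c: "length c = N" "set c \<subseteq> {..<length qs}"
    have j': "j < length qs" using j(1) degs_length[OF ts(1)] by simp
    have "snd (ts ! j) (count_list c j) \<in> deg_sub (count_list c j) (qs ! j - int (count_list c j))"
      using j(2) by (simp add: tot_sub_def)
    from shuffle_term_deg[OF x c(2) entry_closed[OF ts(2,1)] j' this]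
    show "shuffle_term x qs c ts \<in> deg_sub N (fst x + sum_list qs - int N)" unfolding c(1) .
  qed
  then show ?thesis
    using multilin_closed[OF tot_ev_multilin[OF x] ts(2,1)] by (simp add: tot_sub_def)
qed

subsection \<open>Normalization\<close>

abbreviation "D \<equiv> tot_sub deg_sub"

lemma D_submodule: "submodule (D n) R (T n)"
  by (rule tot_sub_submodule[OF deg_sub_submodule])

lemma degenerate_sub_eq': "degenerate_sub R P A = D"
  by (rule ext) (rule degenerate_sub_eq)

lemma normalization_eq: "normalization_map R P A n f = D n +>\<^bsub>T n\<^esub> f"
  by (simp add: normalization_map_def proj_def degenerate_sub_eq Tot_sel)

lemma hochschild_gpart: "gpart (hochschild R P A) n = quot_mod (T n) (D n)"
  by (simp add: hochschild_def quot_alg_def degenerate_sub_eq Tot_sel)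

text \<open>Established for all chains of the total complex, hence also for those chains of
  \<open>tot_plus\<close> whose differential leaves \<open>tot_plus\<close>. Stability of
  \<open>D\<close> is what makes the differential on the quotient well defined.\<close>

lemma normalization_dif:
  assumes f: "f \<in> carrier (T n)"
  shows "dif (hochschild R P A) n (normalization_map R P A n f) = normalization_map R P A (n - 1) (tot_dif R P A n f)"
proof -
  let ?F = "\<lambda>f. D (n - 1) +>\<^bsub>T (n - 1)\<^esub> tot_dif R P A n f"
  have l: "?F \<in> lin R (T n) (quot_mod (T (n - 1)) (D (n - 1)))"
    by (rule lin_comp[OF tot_dif_lin coset_lin[OF T_module D_submodule]])
  have z: "?F h = \<zero>\<^bsub>quot_mod (T (n - 1)) (D (n - 1))\<^esub>" if h: "h \<in> D n" for h
  proof -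
    have "tot_dif R P A n h \<in> D (n - 1)" by (rule tot_dif_sub[OF deg_sub_submodule face_sum_deg dif_deg h])
    then show ?thesis
      using coset_eq_zero_iff[OF T_module D_submodule] submodule_subset[OF T_module D_submodule] by blast
  qed
  have "dif (hochschild R P A) n = induced ?F"
    by (simp add: hochschild_def quot_alg_def degenerate_sub_eq' Tot_sel comp_def proj_def)
  then show ?thesis
    using induced_coset[OF T_module D_submodule l quot_module[OF T_module D_submodule] z f] by (simp add: normalization_eq)
qed

lemma normalization_ev:
  assumes x: "x \<in> OEl P (length ts)" and ts: "set ts \<subseteq> El T"
  shows "gmap (normalization_map R P A) (tot_ev R P A x ts) = ev (hochschild R P A) x (map (gmap (normalization_map R P A)) ts)"
proof -
  have x': "x \<in> OEl P (length (degs ts))" using x by simp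
  have "ev (quot_alg (Tot R P A) D) x (map (gmap (proj (Tot R P A) D)) ts) = gmap (proj (Tot R P A) D) (ev (Tot R P A) x ts)"
  proof (rule quot_alg_ev[where n = "fst x + sum_list (degs ts)"])
    show "multilin R (gpart (Tot R P A)) (gpart (Tot R P A) (fst x + sum_list (degs ts))) (degs ts) (\<lambda>as. snd (ev (Tot R P A) x as))"
      unfolding Tot_sel by (rule tot_ev_multilin[OF x'])
    show "fst (ev (Tot R P A) x bs) = fst x + sum_list (degs ts)" if "degs bs = degs ts" for bs
      unfolding Tot_sel by (rule tot_ev_deg[OF that])
    show "snd (ev (Tot R P A) x bs) \<in> D (fst x + sum_list (degs ts))"
      if "degs bs = degs ts" "set bs \<subseteq> El (gpart (Tot R P A))" "i < length bs" "snd (bs ! i) \<in> D (degs ts ! i)" for bs i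
      using tot_ev_degenerate[OF x'] that unfolding Tot_sel by blast
  qed (use ts T_module D_submodule in \<open>simp_all add: Tot_sel\<close>)
  then show ?thesis by (simp add: hochschild_def normalization_map_def degenerate_sub_eq' Tot_sel)
qed

lemma normalization_lin: "normalization_map R P A n \<in> lin R (T n) (quot_mod (T n) (D n))"
  using coset_lin[OF T_module D_submodule, of n] by (simp add: normalization_eq[abs_def])

text \<open>\<open>split\<close> fixes \<open>nondeg\<close> and kills \<open>deg_sub\<close>, so a
  difference of two elements of N that lies in D is zero. Applied in every simplicial degree to an
  arbitrary chain, it yields a representative in N of the same class.\<close>

lemma normalization_bij: "bij_betw (normalization_map R P A n) (tot_sub nondeg n) (carrier (quot_mod (T n) (D n)))"
proof (rule bij_betw_imageI)
  show "inj_on (normalization_map R P A n) (tot_sub nondeg n)"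
  proof (rule inj_onI)
    fix f g assume f: "f \<in> tot_sub nondeg n" and g: "g \<in> tot_sub nondeg n"
      and eq: "normalization_map R P A n f = normalization_map R P A n g"
    have fc: "f \<in> carrier (T n)" and gc: "g \<in> carrier (T n)" using f g by (simp_all add: tot_sub_def)
    have d: "f \<ominus>\<^bsub>T n\<^esub> g \<in> D n" using eq unfolding normalization_eq coset_eq_iff[OF T_module D_submodule fc gc] .
    show "f = g"
    proof (rule ext)
      fix p
      let ?q = "n - int p"
      have fp: "f p \<in> nondeg p ?q" "g p \<in> nondeg p ?q" using f g by (simp_all add: tot_sub_def)
      let ?d = "f p \<ominus>\<^bsub>BP (Suc p) ?q\<^esub> g p"
      have "?d \<in> deg_sub p ?q" using d unfolding tot_sub_def mem_Collect_eq T_minus[OF fc gc] by blast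
      then have "split (Suc p) ?q p ?d = \<zero>\<^bsub>BP (Suc p) ?q\<^esub>" by (rule split_deg)
      moreover have "split (Suc p) ?q p ?d = ?d" by (rule split_nondeg[OF submodule_minus[OF B_module nondeg_submodule fp]])
      ultimately have "?d = \<zero>\<^bsub>BP (Suc p) ?q\<^esub>" by simp
      then show "f p = g p"
        using module_diff_eq_zero[OF B_module] fp submodule_subset[OF B_module nondeg_submodule] by blast
    qed
  qed
  show "normalization_map R P A n ` tot_sub nondeg n = carrier (quot_mod (T n) (D n))"
  proof
    show "normalization_map R P A n ` tot_sub nondeg n \<subseteq> carrier (quot_mod (T n) (D n))"
      using lin_closed[OF normalization_lin] by (auto simp: tot_sub_def)
    show "carrier (quot_mod (T n) (D n)) \<subseteq> normalization_map R P A n ` tot_sub nondeg n"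
    proof
      fix X assume "X \<in> carrier (quot_mod (T n) (D n))"
      then obtain f where f: "f \<in> carrier (T n)" "X = D n +>\<^bsub>T n\<^esub> f" unfolding quot_carrier[OF T_module D_submodule] by blast
      define g where "g = (\<lambda>p. split (Suc p) (n - int p) p (f p))"
      have fp: "f p \<in> carrier (BP (Suc p) (n - int p))" for p using f(1) by (simp add: T_carrier)
      have "{p. g p \<noteq> \<zero>\<^bsub>BP (Suc p) (n - int p)\<^esub>} \<subseteq> {p. f p \<noteq> \<zero>\<^bsub>BP (Suc p) (n - int p)\<^esub>}"
        using lin_zero[OF split_lin B_module B_module] by (auto simp: g_def)
      then have gf: "finite {p. g p \<noteq> \<zero>\<^bsub>BP (Suc p) (n - int p)\<^esub>}"
        by (rule finite_subset) (use f(1) in \<open>simp add: T_carrier\<close>)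
      have gc: "g \<in> carrier (T n)"
        unfolding T_carrier using gf lin_closed[OF split_lin fp] by (simp add: g_def)
      have gn: "g \<in> tot_sub nondeg n" using gc split_mem_nondeg[OF fp] by (simp add: tot_sub_def g_def)
      have "(f \<ominus>\<^bsub>T n\<^esub> g) p \<in> deg_sub p (n - int p)" for p
        unfolding T_minus[OF f(1) gc] unfolding g_def by (rule split_diff_deg[OF fp])
      then have "f \<ominus>\<^bsub>T n\<^esub> g \<in> D n" using module_minus_closed[OF T_module f(1) gc] by (simp add: tot_sub_def)
      then have "X = normalization_map R P A n g"
        unfolding f(2) normalization_eq using coset_eq_iff[OF T_module D_submodule f(1) gc] by blast
      then show "X \<in> normalization_map R P A n ` tot_sub nondeg n" using gn by blast
    qed
  qed
qed

lemma Tot_plus_sel: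
  "gpart (Tot_plus R P A V \<phi>) n = (T n)\<lparr>carrier := tot_sub nondeg n\<rparr>"
  "dif (Tot_plus R P A V \<phi>) = tot_dif R P A" "ev (Tot_plus R P A V \<phi>) = tot_ev R P A"
  by (simp_all add: Tot_plus_def restrict_part_def Tot_sel tot_plus_eq)

lemma normalization_dg_iso: "normalization_map R P A \<in> dg_iso R (Tot_plus R P A V \<phi>) (hochschild R P A)"
proof -
  have sub: "tot_sub nondeg n \<subseteq> carrier (T n)" for n by (auto simp: tot_sub_def)
  have "normalization_map R P A n \<in> lin R ((T n)\<lparr>carrier := tot_sub nondeg n\<rparr>) (quot_mod (T n) (D n))" for n
    using normalization_lin[of n] sub[of n] unfolding lin_def by (auto simp: Pi_iff subset_iff)
  then show ?thesis
    using normalization_bij normalization_dif sub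
    by (auto simp: dg_iso_def gr_iso_def Tot_plus_sel hochschild_gpart subset_iff)
qed

lemma normalization_alg_iso: "normalization_map R P A \<in> alg_iso R P (Tot_plus R P A V \<phi>) (hochschild R P A)"
proof -
  have "El (gpart (Tot_plus R P A V \<phi>)) \<subseteq> El T" by (auto simp: El_iff Tot_plus_sel tot_sub_def)
  then have "preserves_ev P (Tot_plus R P A V \<phi>) (hochschild R P A) (normalization_map R P A)"
    unfolding preserves_ev_def Tot_plus_sel using normalization_ev by blast
  then show ?thesis using normalization_dg_iso by (simp add: alg_iso_def)
qed

end

text \<open>The subcomplex clause is conditional because a constant in the differential of a
  generator may remove the only letter of a copy. The isomorphism clauses use the differential of
  the ambient \<open>Tot\<close>, whose value on an element of \<open>tot_plus\<close> is then
  normalized.\<close>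

theorem theoremB:
  fixes R :: "'r ring" and P :: "('r, 'o) operad" and A :: "('r, 'o, 'a) dgalg"
    and V :: "('r, 'v) grmod" and \<phi> :: "int \<Rightarrow> ('r, 'o, 'v) free_el \<Rightarrow> 'a"
  assumes "cring R" and "dg_operad R P" and "operad_algebra R P A" and "almost_free R P A V \<phi>"
  shows "gr_sub R (Tot R P A) (tot_plus R P A V \<phi>) \<and>
    ev_closed P (Tot R P A) (tot_plus R P A V \<phi>) \<and>
    (no_constant_terms R P A V \<phi> \<longrightarrow> subcomplex R (Tot R P A) (tot_plus R P A V \<phi>)) \<and>
    normalization_map R P A \<in> dg_iso R (Tot_plus R P A V \<phi>) (hochschild R P A) \<and>
    normalization_map R P A \<in> alg_iso R P (Tot_plus R P A V \<phi>) (hochschild R P A)"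
proof -
  interpret almost_free_ctx R P A V \<phi>
    by (intro almost_free_ctx.intro dg_algebra_ctx.intro dg_operad_ctx.intro dg_algebra_ctx_axioms.intro
        almost_free_ctx_axioms.intro assms)
  have p: "tot_plus R P A V \<phi> = tot_sub nondeg" by (rule ext) (rule tot_plus_eq)
  have g: "gr_sub R (Tot R P A) (tot_sub nondeg)"
    unfolding gr_sub_def Tot_sel using tot_sub_submodule[OF nondeg_submodule] by blast
  have e: "ev_closed P (Tot R P A) (tot_sub nondeg)"
    unfolding ev_closed_def Tot_sel using tot_ev_nondeg by blast
  have "subcomplex R (Tot R P A) (tot_sub nondeg)" if "no_constant_terms R P A V \<phi>"
    unfolding subcomplex_def Tot_sel
    using g tot_dif_sub[OF nondeg_submodule face_sum_nondeg dif_nondeg[OF that]] by blast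
  then show ?thesis unfolding p using g e normalization_dg_iso normalization_alg_iso by blast
qed

end
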